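(* Let $1\le m<n$ be integers, $\Omega\subset\mathbb{C}^n$ an open set, $\varphi$ an $m$-subharmonic function on $\Omega$ and $x\in\Omega$. Then $$\imath_x(\varphi)\ge\frac{n}{n-m}.$$ Moreover, if $\nu_\varphi(x)>0$, then $$\imath_x(\varphi)\le\frac{nm}{n-m}.$$
   Context: Conventions: $d=\partial+\overline\partial$, $d^c=\frac{i}{4\pi}(\overline\partial-\partial)$, so $dd^c=\frac{i}{2\pi}\partial\overline\partial$; $\beta=dd^c|z|^2$; $\mathbb{B}(x,r)=\{z\in\mathbb{C}^n: |z-x|<r\}$. A $(1,1)$-form $\alpha$ is $m$-positive if $\alpha^j\wedge\beta^{n-j}\ge 0$ for every $1\le j\le m$. A $(q,q)$-form is strongly $m$-positive if it is of the form $\sum_{k=1}^N a_k\,\alpha_{1,k}\wedge\dots\wedge\alpha_{q,k}$ with $N=\binom nq$, $a_k\ge0$ and all $\alpha_{j,k}$ $m$-positive $(1,1)$-forms. A function $\varphi:\Omega\to\mathbb{R}\cup\{-\infty\}$ is $m$-subharmonic if it is subharmonic (not identically $-\infty$ on any component) and $dd^c\varphi$ is $m$-positive, i.e. $\langle dd^c\varphi\wedge\beta^{n-m},\alpha\rangle\ge0$ for every strongly $m$-positive $(m-1,m-1)$-test form $\alpha$ on $\Omega$. The Lelong number of $\varphi$ at $x$ is $$\nu_\varphi(x)=\lim_{r\to0^+}\frac{1}{r^{\frac{2n}{m}(m-1)}}\int_{\mathbb{B}(x,r)}dd^c\varphi\wedge\beta^{n-1}$$ (the limit exists for $m$-subharmonic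 $\varphi$). The integrability exponent of $\varphi$ at $x$ is $$\imath_x(\varphi)=\sup\{c>0:\ |\varphi|^c\in L^1(U)\text{ for some neighborhood }U\text{ of }x\}.$$ *)

theory Defs
  imports "HOL-Analysis.Analysis"
begin

text \<open>
  An element of the exterior algebra of the real vector space underlying complex n-space, with
  complex coefficients, is a function on lists of
  vectors; its component of degree \<open>k\<close> is the restriction to lists of length \<open>k\<close>. The
  wedge product is the shuffle formula, so that the wedge of two 1-forms is
  \<open>(a \<and> b)[u, v] = a[u] b[v] - a[v] b[u]\<close>.
\<close>

type_synonym 'n covec = "(complex ^ 'n) list \<Rightarrow> complex"

definition alternating_form :: "nat \<Rightarrow> 'n::finite covec \<Rightarrow> bool" where
  "alternating_form k \<alpha> \<longleftrightarrow>
     (\<forall>vs. length vs \<noteq> k \<longrightarrow> \<alpha> vs = 0) \<and>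
     (\<forall>vs i. length vs = k \<longrightarrow> i < k \<longrightarrow> linear (\<lambda>v. \<alpha> (vs[i := v]))) \<and>
     (\<forall>vs. \<not> distinct vs \<longrightarrow> \<alpha> vs = 0)"

definition scalar_form :: "complex \<Rightarrow> 'n::finite covec" where
  "scalar_form c = (\<lambda>vs. if vs = [] then c else 0)"

definition wedge :: "'n::finite covec \<Rightarrow> 'n covec \<Rightarrow> 'n covec" where
  "wedge \<alpha> \<beta> = (\<lambda>vs. \<Sum>S\<in>Pow {..<length vs}.
      (-1) ^ card {(i, j). i \<in> {..<length vs} - S \<and> j \<in> S \<and> i < j}
        * \<alpha> (nths vs S) * \<beta> (nths vs (- S)))"

definition wedge_list :: "'n::finite covec list \<Rightarrow> 'n covec" where
  "wedge_list \<alpha>s = foldr wedge \<alpha>s (scalar_form 1)"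

definition wedge_power :: "'n::finite covec \<Rightarrow> nat \<Rightarrow> 'n covec" where
  "wedge_power \<alpha> k = wedge_list (replicate k \<alpha>)"

text \<open>
  A form of degree 2 with complex coefficients has bidegree (1,1) iff it is invariant under
  multiplication of both arguments by \<open>\<i>\<close> (the (2,0) and (0,2) components change sign).
\<close>

definition real_11_form :: "'n::finite covec \<Rightarrow> bool" where
  "real_11_form \<alpha> \<longleftrightarrow> alternating_form 2 \<alpha> \<and> (\<forall>vs. \<alpha> vs \<in> \<real>) \<and>
     (\<forall>u v. \<alpha> [\<i> *s u, \<i> *s v] = \<alpha> [u, v])"

text \<open>
  Coefficient of the component of top degree with respect to
  \<open>dx\<^sub>1 \<and> dy\<^sub>1 \<and> \<dots> \<and> dx\<^sub>n \<and> dy\<^sub>n\<close>. The chosen enumeration of the coordinates is irrelevant,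
  since permuting the pairs \<open>(dx\<^sub>j, dy\<^sub>j)\<close> does not change the orientation.
\<close>

definition oriented_basis :: "(complex ^ 'n::finite) list" where
  "oriented_basis = concat (map (\<lambda>j. [axis j 1, axis j \<i>])
     (SOME js. distinct js \<and> set js = (UNIV :: 'n set)))"

definition vol_coeff :: "'n::finite covec \<Rightarrow> complex" where
  "vol_coeff \<eta> = \<eta> oriented_basis"

type_synonym 'n dform = "complex ^ 'n \<Rightarrow> 'n covec"

text \<open>Complex-linear and antilinear parts of the differential of a function.\<close>

definition del_dir :: "(complex ^ 'n::finite \<Rightarrow> complex) \<Rightarrow> complex ^ 'n \<Rightarrow> complex ^ 'n \<Rightarrow> complex" where
  "del_dir f z v = (frechet_derivative f (at z) v - \<i> * frechet_derivative f (at z) (\<i> *s v)) / 2"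

definition delbar_dir :: "(complex ^ 'n::finite \<Rightarrow> complex) \<Rightarrow> complex ^ 'n \<Rightarrow> complex ^ 'n \<Rightarrow> complex" where
  "delbar_dir f z v = (frechet_derivative f (at z) v + \<i> * frechet_derivative f (at z) (\<i> *s v)) / 2"

definition remove_nth :: "nat \<Rightarrow> 'a list \<Rightarrow> 'a list" where
  "remove_nth i vs = take i vs @ drop (Suc i) vs"

definition del :: "'n::finite dform \<Rightarrow> 'n dform" where
  "del \<omega> = (\<lambda>z vs. \<Sum>i<length vs.
      (-1) ^ i * del_dir (\<lambda>w. \<omega> w (remove_nth i vs)) z (vs ! i))"

definition delbar :: "'n::finite dform \<Rightarrow> 'n dform" where
  "delbar \<omega> = (\<lambda>z vs. \<Sum>i<length vs.
      (-1) ^ i * delbar_dir (\<lambda>w. \<omega> w (remove_nth i vs)) z (vs ! i))"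

definition ext_d :: "'n::finite dform \<Rightarrow> 'n dform" where
  "ext_d \<omega> = (\<lambda>z vs. del \<omega> z vs + delbar \<omega> z vs)"

definition ext_dc :: "'n::finite dform \<Rightarrow> 'n dform" where
  "ext_dc \<omega> = (\<lambda>z vs. \<i> / (4 * of_real pi) * (delbar \<omega> z vs - del \<omega> z vs))"

definition ddc :: "'n::finite dform \<Rightarrow> 'n dform" where
  "ddc \<omega> = ext_d (ext_dc \<omega>)"

text \<open>The form \<open>dd\<^sup>c|z|\<^sup>2\<close>; it has constant coefficients, so we evaluate it at the origin.\<close>

definition beta :: "'n::finite covec" where
  "beta = ddc (\<lambda>z. scalar_form (of_real ((norm z)\<^sup>2))) 0"

fun iterated_dir_deriv ::
  "'a::real_normed_vector list \<Rightarrow> ('a \<Rightarrow> 'b::real_normed_vector) \<Rightarrow> 'a \<Rightarrow> 'b" where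
  "iterated_dir_deriv [] f = f"
| "iterated_dir_deriv (v # vs) f = iterated_dir_deriv vs (\<lambda>z. frechet_derivative f (at z) v)"

text \<open>
  Differentiability of all iterated directional derivatives implies their continuity, so this is
  \<open>C\<^sup>\<infinity>\<close>-smoothness.
\<close>

definition smooth :: "('a::real_normed_vector \<Rightarrow> 'b::real_normed_vector) \<Rightarrow> bool" where
  "smooth f \<longleftrightarrow> (\<forall>vs z. iterated_dir_deriv vs f differentiable (at z))"

definition test_form :: "(complex ^ 'n::finite) set \<Rightarrow> 'n dform \<Rightarrow> bool" where
  "test_form \<Omega> \<omega> \<longleftrightarrow> (\<forall>vs. smooth (\<lambda>z. \<omega> z vs)) \<and>
     (\<exists>K. compact K \<and> K \<subseteq> \<Omega> \<and> (\<forall>z. z \<notin> K \<longrightarrow> (\<forall>vs. \<omega> z vs = 0)))"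

definition m_positive :: "nat \<Rightarrow> 'n::finite covec \<Rightarrow> bool" where
  "m_positive m \<alpha> \<longleftrightarrow> real_11_form \<alpha> \<and>
     (\<forall>j\<in>{1..m}. vol_coeff (wedge (wedge_power \<alpha> j) (wedge_power beta (CARD('n) - j)))
        \<in> \<real>\<^sub>\<ge>\<^sub>0)"

definition strongly_m_positive :: "nat \<Rightarrow> nat \<Rightarrow> 'n::finite covec \<Rightarrow> bool" where
  "strongly_m_positive m q \<eta> \<longleftrightarrow>
     (\<exists>(a :: nat \<Rightarrow> real) (\<alpha> :: nat \<Rightarrow> nat \<Rightarrow> 'n covec).
        (\<forall>k < CARD('n) choose q. a k \<ge> 0 \<and> (\<forall>j<q. m_positive m (\<alpha> k j))) \<and>
        \<eta> = (\<lambda>vs. \<Sum>k < CARD('n) choose q.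
               of_real (a k) * wedge_list (map (\<alpha> k) [0..<q]) vs))"

text \<open>Lebesgue mean over a ball; it may be \<open>-\<infinity>\<close>, and is meaningful for functions bounded above.\<close>

definition ball_mean :: "('a::euclidean_space \<Rightarrow> ereal) \<Rightarrow> 'a \<Rightarrow> real \<Rightarrow> ereal" where
  "ball_mean \<phi> a r =
     (enn2ereal (\<integral>\<^sup>+z\<in>cball a r. e2ennreal (\<phi> z) \<partial>lborel)
       - enn2ereal (\<integral>\<^sup>+z\<in>cball a r. e2ennreal (- \<phi> z) \<partial>lborel))
     / ereal (measure lborel (cball a r))"

definition subharmonic_on :: "'a::euclidean_space set \<Rightarrow> ('a \<Rightarrow> ereal) \<Rightarrow> bool" where
  "subharmonic_on \<Omega> \<phi> \<longleftrightarrow>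
     (\<forall>z\<in>\<Omega>. \<phi> z \<noteq> \<infinity>) \<and>
     (\<forall>z\<in>\<Omega>. \<forall>t > \<phi> z. \<forall>\<^sub>F w in at z within \<Omega>. \<phi> w < t) \<and>
     (\<forall>a r. r > 0 \<longrightarrow> cball a r \<subseteq> \<Omega> \<longrightarrow> \<phi> a \<le> ball_mean \<phi> a r) \<and>
     (\<forall>C\<in>components \<Omega>. \<exists>z\<in>C. \<phi> z \<noteq> -\<infinity>)"

text \<open>
  The current \<open>dd\<^sup>c\<phi>\<close> and its products with powers of \<open>\<beta>\<close>:
  \<open>\<langle>dd\<^sup>c\<phi> \<and> \<beta>\<^sup>k, \<eta>\<rangle> = \<integral> \<phi> dd\<^sup>c(\<beta>\<^sup>k \<and> \<eta>)\<close> for test forms \<open>\<eta>\<close> of bidegree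
  \<open>(n - 1 - k, n - 1 - k)\<close>. The value 0 which \<open>real_of_ereal\<close> assigns to \<open>-\<infinity>\<close> plays no role,
  as the polar set of a subharmonic function is a null set.
\<close>

definition ddc_current ::
  "(complex ^ 'n::finite) set \<Rightarrow> (complex ^ 'n \<Rightarrow> ereal) \<Rightarrow> nat \<Rightarrow> 'n dform \<Rightarrow> complex" where
  "ddc_current \<Omega> \<phi> k \<eta> =
     (LINT z:\<Omega>|lborel. of_real (real_of_ereal (\<phi> z))
        * vol_coeff (ddc (\<lambda>w. wedge (wedge_power beta k) (\<eta> w)) z))"

definition m_subharmonic ::
  "nat \<Rightarrow> (complex ^ 'n::finite) set \<Rightarrow> (complex ^ 'n \<Rightarrow> ereal) \<Rightarrow> bool" where
  "m_subharmonic m \<Omega> \<phi> \<longleftrightarrow> subharmonic_on \<Omega> \<phi> \<and>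
     (\<forall>\<alpha>. test_form \<Omega> \<alpha> \<and> (\<forall>z. strongly_m_positive m (m - 1) (\<alpha> z)) \<longrightarrow>
        ddc_current \<Omega> \<phi> (CARD('n) - m) \<alpha> \<in> \<real>\<^sub>\<ge>\<^sub>0)"

text \<open>
  The positive current \<open>dd\<^sup>c\<phi> \<and> \<beta>\<^sup>n\<^sup>-\<^sup>1\<close> of top degree, as a Radon measure on \<open>\<Omega>\<close> (extended by 0
  outside of \<open>\<Omega>\<close>). The measure is uniquely determined by these conditions.
\<close>

definition represents_trace ::
  "(complex ^ 'n::finite) set \<Rightarrow> (complex ^ 'n \<Rightarrow> ereal) \<Rightarrow> (complex ^ 'n) measure \<Rightarrow> bool" where
  "represents_trace \<Omega> \<phi> \<mu> \<longleftrightarrow>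
     sets \<mu> = sets borel \<and> emeasure \<mu> (- \<Omega>) = 0 \<and>
     (\<forall>K. compact K \<longrightarrow> K \<subseteq> \<Omega> \<longrightarrow> emeasure \<mu> K < \<infinity>) \<and>
     (\<forall>g :: complex ^ 'n \<Rightarrow> real. test_form \<Omega> (\<lambda>z. scalar_form (of_real (g z))) \<longrightarrow>
        ddc_current \<Omega> \<phi> (CARD('n) - 1) (\<lambda>z. scalar_form (of_real (g z)))
          = of_real (\<integral>z. g z \<partial>\<mu>))"

definition trace_measure ::
  "(complex ^ 'n::finite) set \<Rightarrow> (complex ^ 'n \<Rightarrow> ereal) \<Rightarrow> (complex ^ 'n) measure" where
  "trace_measure \<Omega> \<phi> = (SOME \<mu>. represents_trace \<Omega> \<phi> \<mu>)"

definition lelong_number ::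
  "nat \<Rightarrow> (complex ^ 'n::finite) set \<Rightarrow> (complex ^ 'n \<Rightarrow> ereal) \<Rightarrow> complex ^ 'n \<Rightarrow> real" where
  "lelong_number m \<Omega> \<phi> x =
     Lim (at_right 0) (\<lambda>r. measure (trace_measure \<Omega> \<phi>) (ball x r)
        / r powr (2 * real CARD('n) / real m * (real m - 1)))"

text \<open>
  That \<open>|\<phi>|\<^sup>c\<close> is in \<open>L\<^sup>1(U)\<close> includes that \<open>\<phi>\<close> is finite almost everywhere on \<open>U\<close>.
\<close>

definition integrability_exponent ::
  "(complex ^ 'n::finite) set \<Rightarrow> (complex ^ 'n \<Rightarrow> ereal) \<Rightarrow> complex ^ 'n \<Rightarrow> ereal" where
  "integrability_exponent \<Omega> \<phi> x =
     Sup {ereal c | c. c > 0 \<and> (\<exists>U. open U \<and> x \<in> U \<and> U \<subseteq> \<Omega> \<and>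
        (AE z\<in>U in lborel. \<bar>\<phi> z\<bar> \<noteq> \<infinity>) \<and>
        set_integrable lborel U (\<lambda>z. \<bar>real_of_ereal (\<phi> z)\<bar> powr c))}"

end

theory Submission
  imports Defs
begin

text \<open>
  The lower bound: with \<open>t\<close> the squared distance to the centre and \<open>p = n + 1 - n / m\<close>, testing
  \<^emph>\<open>m\<close>-positivity against radial strongly \<^emph>\<open>m\<close>-positive forms shows that the integral of
  \<open>\<phi>\<close> against \<open>\<tau> powr p / (1 + \<tau> * t) ^ (n + 1)\<close> increases with \<open>\<tau>\<close>, up to an integrable cutoff error.
  Hence the means over balls of radius \<open>r\<close> are at least
  \<open>- C * r powr (2 - 2 * n / m)\<close>, locally uniformly in the centre. Integrating the sub-mean value
  inequality on the set where \<open>\<phi> < - T\<close> against a truncated paraboloid, whose means have a deficit of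
  order \<open>r powr 2\<close>, bounds the volume of this set by \<open>C * T powr (- n / (n - m))\<close>.

  The upper bound: the mass of the trace measure on the ball of radius \<open>r\<close> is at most \<open>C / r powr 2\<close>
  times the integral of \<open>\<bar>\<phi>\<bar>\<close> over the ball of radius \<open>2 * r\<close>. If \<open>\<bar>\<phi>\<bar> powr c\<close> is integrable near
  \<open>x\<close> for some \<open>c > n * m / (n - m)\<close>, then the elementary inequality
  \<open>\<bar>\<phi>\<bar> \<le> \<mu> + \<mu> powr (1 - c) * \<bar>\<phi>\<bar> powr c\<close> with \<open>\<mu>\<close> a suitable power of \<open>r\<close> forces the Lelong
  number to vanish. The trace measure exists by the Riesz representation theorem for positive
  functionals on test functions.
\<close>

subsection \<open>Exterior algebra\<close>

text \<open>Why the integral increases with \<tau>: write E for t d/dt. Pairing the current with the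
  extremal form t h(t) \<gamma>^(m-1) gives, up to a positive constant, the kernel (E + n)(E + p) h.
  For h = (1 + \<tau>t)^-n the factor E + n yields n (1 + \<tau>t)^-(n+1), and on functions of
  \<tau>t the factor E + p acts as \<tau>^(1-p) d/d\<tau> \<tau>^p. Positivity thus becomes the sign
  of a \<tau>-derivative. The cutoff spoils this by O(\<tau>^(p-1-n)), which is integrable at
  infinity because p < n; at \<tau> = r^-2 the weight is comparable to r^(-2p) on the ball of radius
  r.

  The obstacle on the algebraic side is that wedge products are signed sums over subsets of argument
  positions. They are handled through contractions: contraction is an antiderivation
  (\<open>wedge_Cons\<close>), and contractions of alternating forms vanish in top degree
  (\<open>vol_coeff_contr\<close>). Contracting a form of degree 2n + 1 by a suitable vector then
  yields the trace identities for \<beta> and \<open>theta\<close>.\<close>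

definition contr :: "complex ^ 'n::finite \<Rightarrow> 'n covec \<Rightarrow> 'n covec" where
  "contr v \<alpha> = (\<lambda>vs. \<alpha> (v # vs))"

text \<open>The grading involution. No degree is attached to a \<open>covec\<close>, so parity is
  expressed by \<open>sgn_inv \<alpha> = \<alpha>\<close> (even) or
  \<open>sgn_inv \<alpha> = (\<lambda>vs. - \<alpha> vs)\<close> (odd).\<close>

definition sgn_inv :: "'n::finite covec \<Rightarrow> 'n covec" where
  "sgn_inv \<alpha> = (\<lambda>vs. (-1) ^ length vs * \<alpha> vs)"

lemma wedge_Nil [simp]: "wedge \<alpha> \<beta> [] = \<alpha> [] * \<beta> []"
  by (simp add: wedge_def)

text \<open>The subsets S are split by whether they contain the index 0. If 0 lies outside S, it
  forms an inversion with every element of S, and the resulting sign (-1)^card S is absorbed by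
  \<open>sgn_inv \<alpha>\<close>. The associativity, commutation and power rules below follow from
  this antiderivation rule by induction on the argument list.\<close>

lemma wedge_Cons:
  "wedge \<alpha> \<beta> (v # vs) = wedge (contr v \<alpha>) \<beta> vs + wedge (sgn_inv \<alpha>) (contr v \<beta>) vs"
proof -
  define n where "n = length vs"
  define I where "I k S = {(i, j). i \<in> {..<k} - S \<and> j \<in> S \<and> i < j}" for k and S :: "nat set"
  define F where "F S = (-1) ^ card (I (Suc n) S) * \<alpha> (nths (v # vs) S) * \<beta> (nths (v # vs) (- S))" for S
  have pow: "Pow {..<Suc n} = image Suc ` Pow {..<n} \<union> insert 0 ` image Suc ` Pow {..<n}"
    by (simp add: lessThan_Suc_eq_insert_0 Pow_insert image_Pow_surj)
  have inj1: "inj_on (image Suc) (Pow {..<n})"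
    by (meson inj_Suc inj_image_eq_iff inj_onI)
  have inj2: "inj_on (insert 0) (image Suc ` Pow {..<n})"
    by (auto simp: inj_on_def)
  have disj: "image Suc ` Pow {..<n} \<inter> insert 0 ` image Suc ` Pow {..<n} = {}"
    by auto
  have I1: "card (I (Suc n) (insert 0 (Suc ` S))) = card (I n S)" for S
  proof -
    have "I (Suc n) (insert 0 (Suc ` S)) = map_prod Suc Suc ` I n S"
      unfolding I_def
      by (auto simp: image_iff lessThan_Suc_eq_insert_0) 
    then show ?thesis
      by (simp add: card_image prod.inj_map inj_on_subset[OF _ subset_UNIV])
  qed
  have I2: "card (I (Suc n) (Suc ` S)) = card (I n S) + card S" if "S \<subseteq> {..<n}" for S
  proof -
    have fin: "finite (I n S)" "finite S"
      using that by (auto simp: I_def intro: finite_subset[of _ "{..<n} \<times> {..<n}"] finite_subset)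
    have "I (Suc n) (Suc ` S) = map_prod Suc Suc ` I n S \<union> {0} \<times> Suc ` S"
      unfolding I_def
      by (auto simp: image_iff lessThan_Suc_eq_insert_0)
    moreover have "map_prod Suc Suc ` I n S \<inter> {0} \<times> Suc ` S = {}"
      by auto
    ultimately show ?thesis
      using fin
      by (simp add: card_Un_disjoint card_image prod.inj_map inj_on_subset[OF _ subset_UNIV] card_cartesian_product)
  qed
  have n1: "nths (v # vs) (insert 0 (Suc ` S)) = v # nths vs S"
    "nths (v # vs) (- insert 0 (Suc ` S)) = nths vs (- S)"
    "nths (v # vs) (Suc ` S) = nths vs S"
    "nths (v # vs) (- Suc ` S) = v # nths vs (- S)" for S
    proof -
    have "{j. Suc j \<in> insert 0 (Suc ` S)} = S" "{j. Suc j \<in> - insert 0 (Suc ` S)} = - S"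
      "{j. Suc j \<in> Suc ` S} = S" "{j. Suc j \<in> - Suc ` S} = - S"
      by auto
    note sets = this
    show "nths (v # vs) (insert 0 (Suc ` S)) = v # nths vs S"
      "nths (v # vs) (- insert 0 (Suc ` S)) = nths vs (- S)"
      "nths (v # vs) (Suc ` S) = nths vs S"
      "nths (v # vs) (- Suc ` S) = v # nths vs (- S)"
      unfolding nths_Cons sets by simp_all
  qed
  have len: "length (nths vs S) = card S" if "S \<subseteq> {..<n}" for S
  proof -
    have "{i. i < length vs \<and> i \<in> S} = S" using that by (auto simp: n_def)
    then show ?thesis by (simp add: length_nths)
  qed
  have W: "wedge \<gamma> \<delta> vs = (\<Sum>S\<in>Pow {..<n}. (-1) ^ card (I n S) * \<gamma> (nths vs S) * \<delta> (nths vs (- S)))"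
    for \<gamma> \<delta> :: "'a covec"
    by (simp add: wedge_def I_def n_def)
  have "wedge \<alpha> \<beta> (v # vs) = (\<Sum>S\<in>Pow {..<Suc n}. F S)"
    unfolding wedge_def F_def I_def n_def by simp
  also have "\<dots> = (\<Sum>S\<in>Pow {..<n}. F (Suc ` S)) + (\<Sum>S\<in>Pow {..<n}. F (insert 0 (Suc ` S)))"
    unfolding pow using inj1 inj2 disj
    by (subst sum.union_disjoint) (simp_all add: sum.reindex comp_def del: insert_Diff1)
  also have "(\<Sum>S\<in>Pow {..<n}. F (Suc ` S)) = wedge (sgn_inv \<alpha>) (contr v \<beta>) vs"
    unfolding W by (rule sum.cong) (simp_all add: F_def I2 n1 len power_add contr_def sgn_inv_def)
  also have "(\<Sum>S\<in>Pow {..<n}. F (insert 0 (Suc ` S))) = wedge (contr v \<alpha>) \<beta> vs"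
    unfolding W by (rule sum.cong) (simp_all add: F_def I1 n1 contr_def)
  finally show ?thesis by simp
qed

lemma wedge_add_left: "wedge (\<lambda>vs. \<alpha> vs + \<alpha>' vs) \<beta> = (\<lambda>vs. wedge \<alpha> \<beta> vs + wedge \<alpha>' \<beta> vs)"
  by (rule ext) (simp add: wedge_def algebra_simps sum.distrib)

lemma wedge_add_right: "wedge \<alpha> (\<lambda>vs. \<beta> vs + \<beta>' vs) = (\<lambda>vs. wedge \<alpha> \<beta> vs + wedge \<alpha> \<beta>' vs)"
  by (rule ext) (simp add: wedge_def algebra_simps sum.distrib)

lemma wedge_scale_left: "wedge (\<lambda>vs. c * \<alpha> vs) \<beta> = (\<lambda>vs. c * wedge \<alpha> \<beta> vs)"
  by (rule ext) (simp add: wedge_def algebra_simps sum_distrib_left)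

lemma wedge_scale_right: "wedge \<alpha> (\<lambda>vs. c * \<beta> vs) = (\<lambda>vs. c * wedge \<alpha> \<beta> vs)"
  by (rule ext) (simp add: wedge_def algebra_simps sum_distrib_left)

lemma wedge_minus_left: "wedge (\<lambda>vs. - \<alpha> vs) \<beta> = (\<lambda>vs. - wedge \<alpha> \<beta> vs)"
  using wedge_scale_left[of "-1"] by simp

lemma wedge_minus_right: "wedge \<alpha> (\<lambda>vs. - \<beta> vs) = (\<lambda>vs. - wedge \<alpha> \<beta> vs)"
  using wedge_scale_right[of _ "-1"] by simp

lemma wedge_zero_left [simp]: "wedge (\<lambda>vs. 0) \<beta> = (\<lambda>vs. 0)"
  by (simp add: wedge_def)

lemma wedge_zero_right [simp]: "wedge \<alpha> (\<lambda>vs. 0) = (\<lambda>vs. 0)"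
  by (simp add: wedge_def)

lemma wedge_sum_right: "wedge \<alpha> (\<lambda>vs. \<Sum>i\<in>I. \<beta> i vs) = (\<lambda>vs. \<Sum>i\<in>I. wedge \<alpha> (\<beta> i) vs)"
proof (induction I rule: infinite_finite_induct)
  case (insert i I)
  then show ?case using wedge_add_right[of \<alpha> "\<beta> i" "\<lambda>vs. \<Sum>i\<in>I. \<beta> i vs"] by simp
qed simp_all

lemma wedge_sum_left: "wedge (\<lambda>vs. \<Sum>i\<in>I. \<alpha> i vs) \<beta> = (\<lambda>vs. \<Sum>i\<in>I. wedge (\<alpha> i) \<beta> vs)"
proof (induction I rule: infinite_finite_induct)
  case (insert i I)
  then show ?case using wedge_add_left[of "\<alpha> i" "\<lambda>vs. \<Sum>i\<in>I. \<alpha> i vs" \<beta>] by simp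
qed simp_all

lemma contr_wedge:
  "contr v (wedge \<alpha> \<beta>) = (\<lambda>vs. wedge (contr v \<alpha>) \<beta> vs + wedge (sgn_inv \<alpha>) (contr v \<beta>) vs)"
  by (rule ext) (simp add: contr_def[of v "wedge \<alpha> \<beta>"] wedge_Cons)

lemma sgn_inv_sgn_inv [simp]: "sgn_inv (sgn_inv \<alpha>) = \<alpha>"
  by (simp add: sgn_inv_def)

lemma contr_sgn_inv: "contr v (sgn_inv \<alpha>) = (\<lambda>vs. - sgn_inv (contr v \<alpha>) vs)"
  by (auto simp: contr_def sgn_inv_def)

lemma sgn_inv_scale: "sgn_inv (\<lambda>vs. c * \<alpha> vs) = (\<lambda>vs. c * sgn_inv \<alpha> vs)"
  by (auto simp: sgn_inv_def algebra_simps)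

lemma contr_minus: "contr v (\<lambda>vs. - \<alpha> vs) = (\<lambda>vs. - contr v \<alpha> vs)"
  by (auto simp: contr_def)

lemma contr_scale: "contr v (\<lambda>vs. c * \<alpha> vs) = (\<lambda>vs. c * contr v \<alpha> vs)"
  by (auto simp: contr_def)

lemma sgn_inv_wedge: "sgn_inv (wedge \<alpha> \<beta>) = wedge (sgn_inv \<alpha>) (sgn_inv \<beta>)"
proof
  fix vs
  show "sgn_inv (wedge \<alpha> \<beta>) vs = wedge (sgn_inv \<alpha>) (sgn_inv \<beta>) vs"
  proof (induction vs arbitrary: \<alpha> \<beta>)
    case Nil
    then show ?case by (simp add: sgn_inv_def)
  next
    case (Cons v vs)
    have "sgn_inv (wedge \<alpha> \<beta>) (v # vs) =
      - sgn_inv (wedge (contr v \<alpha>) \<beta>) vs - sgn_inv (wedge (sgn_inv \<alpha>) (contr v \<beta>)) vs"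
      by (simp add: sgn_inv_def wedge_Cons algebra_simps)
    then show ?case
      unfolding Cons.IH by (simp add: wedge_Cons contr_sgn_inv wedge_minus_left wedge_minus_right)
  qed
qed

lemma wedge_assoc: "wedge (wedge \<alpha> \<beta>) \<gamma> = wedge \<alpha> (wedge \<beta> \<gamma>)"
proof
  fix vs
  show "wedge (wedge \<alpha> \<beta>) \<gamma> vs = wedge \<alpha> (wedge \<beta> \<gamma>) vs"
    by (induction vs arbitrary: \<alpha> \<beta> \<gamma>)
      (simp_all add: wedge_Cons contr_wedge wedge_add_left wedge_add_right sgn_inv_wedge)
qed

text \<open>Contraction lowers the degree by one and so exchanges the even and the odd case; the
  induction therefore carries both statements at once, for arbitrary forms.\<close>

lemma wedge_commute_aux:
  "(sgn_inv \<alpha> = \<alpha> \<longrightarrow> wedge \<alpha> \<beta> vs = wedge \<beta> \<alpha> vs) \<and>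
   (sgn_inv \<alpha> = (\<lambda>vs. - \<alpha> vs) \<longrightarrow> wedge \<alpha> \<beta> vs = wedge (sgn_inv \<beta>) \<alpha> vs)"
proof (induction vs arbitrary: \<alpha> \<beta>)
  case Nil
  show ?case
  proof (intro conjI impI)
    assume "sgn_inv \<alpha> = (\<lambda>vs. - \<alpha> vs)"
    from fun_cong[OF this, of "[]"] have "\<alpha> [] = - \<alpha> []" by (simp add: sgn_inv_def)
    then have "\<alpha> [] = 0" by simp
    then show "wedge \<alpha> \<beta> [] = wedge (sgn_inv \<beta>) \<alpha> []" by simp
  qed simp
next
  case (Cons v vs)
  show ?case
  proof (intro conjI impI)
    assume a: "sgn_inv \<alpha> = \<alpha>"
    have c: "sgn_inv (contr v \<alpha>) = (\<lambda>vs. - contr v \<alpha> vs)"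
    proof
      fix ws
      have "- sgn_inv (contr v \<alpha>) ws = contr v \<alpha> ws"
        using fun_cong[OF arg_cong[OF a, of "contr v"], of ws] by (simp add: contr_sgn_inv)
      then show "sgn_inv (contr v \<alpha>) ws = - contr v \<alpha> ws" by (metis minus_minus)
    qed
    have "wedge (contr v \<alpha>) \<beta> vs = wedge (sgn_inv \<beta>) (contr v \<alpha>) vs"
      and "wedge \<alpha> (contr v \<beta>) vs = wedge (contr v \<beta>) \<alpha> vs"
      using Cons.IH a c by blast+
    then show "wedge \<alpha> \<beta> (v # vs) = wedge \<beta> \<alpha> (v # vs)"
      unfolding wedge_Cons a by (simp only: add.commute)
  next
    assume a: "sgn_inv \<alpha> = (\<lambda>vs. - \<alpha> vs)"
    have c: "sgn_inv (contr v \<alpha>) = contr v \<alpha>"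
      using arg_cong[OF a, of "contr v"] by (simp add: contr_sgn_inv contr_minus fun_eq_iff)
    have "wedge \<alpha> \<beta> (v # vs) = wedge (contr v \<alpha>) \<beta> vs - wedge \<alpha> (contr v \<beta>) vs"
      by (simp add: wedge_Cons a wedge_minus_left)
    also have "\<dots> = wedge \<beta> (contr v \<alpha>) vs - wedge (sgn_inv (contr v \<beta>)) \<alpha> vs"
      using Cons.IH a c by metis
    also have "\<dots> = wedge (sgn_inv \<beta>) \<alpha> (v # vs)"
      by (simp add: wedge_Cons contr_sgn_inv wedge_minus_left)
    finally show "wedge \<alpha> \<beta> (v # vs) = wedge (sgn_inv \<beta>) \<alpha> (v # vs)" .
  qed
qed

lemma wedge_commute_even: "sgn_inv \<alpha> = \<alpha> \<Longrightarrow> wedge \<alpha> \<beta> = wedge \<beta> \<alpha>"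
  using wedge_commute_aux by blast

lemma wedge_commute_odd: "sgn_inv \<alpha> = (\<lambda>vs. - \<alpha> vs) \<Longrightarrow> wedge \<alpha> \<beta> = wedge (sgn_inv \<beta>) \<alpha>"
  using wedge_commute_aux by blast

section \<open>One-forms, scalar forms and powers of even forms\<close>

definition lform :: "(complex ^ 'n::finite \<Rightarrow> complex) \<Rightarrow> 'n covec" where
  "lform \<xi> = (\<lambda>vs. case vs of [v] \<Rightarrow> \<xi> v | _ \<Rightarrow> 0)"

lemma lform_simps [simp]: "lform \<xi> [] = 0" "lform \<xi> [v] = \<xi> v" "lform \<xi> (v # w # vs) = 0"
  by (simp_all add: lform_def)

lemma sgn_inv_lform: "sgn_inv (lform \<xi>) = (\<lambda>vs. - lform \<xi> vs)"
  by (auto simp: sgn_inv_def lform_def split: list.split)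

lemma contr_lform: "contr v (lform \<xi>) = scalar_form (\<xi> v)"
  by (auto simp: contr_def lform_def scalar_form_def fun_eq_iff split: list.split)

lemma contr_scalar [simp]: "contr v (scalar_form c) = (\<lambda>vs. 0)"
  by (auto simp: contr_def scalar_form_def)

lemma sgn_inv_scalar [simp]: "sgn_inv (scalar_form c) = scalar_form c"
  by (auto simp: sgn_inv_def scalar_form_def)

lemma wedge_scalar_left: "wedge (scalar_form c) \<beta> = (\<lambda>vs. c * \<beta> vs)"
proof
  fix vs show "wedge (scalar_form c) \<beta> vs = c * \<beta> vs"
  proof (induction vs arbitrary: \<beta>)
    case Nil
    then show ?case by (simp add: scalar_form_def)
  next
    case (Cons v vs)
    then show ?case by (simp add: wedge_Cons) (simp add: contr_def)
  qed
qed

lemma wedge_scalar_right: "wedge \<beta> (scalar_form c) = (\<lambda>vs. c * \<beta> vs)"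
  using wedge_commute_even[of "scalar_form c" \<beta>] by (simp add: wedge_scalar_left)

lemma lform_anticommute: "wedge (lform \<xi>) (lform \<zeta>) = (\<lambda>vs. - wedge (lform \<zeta>) (lform \<xi>) vs)"
  by (subst wedge_commute_odd) (simp_all add: sgn_inv_lform wedge_minus_left)

lemma lform_square: "wedge (lform \<xi>) (lform \<xi>) = (\<lambda>vs. 0)"
proof
  fix vs
  have "wedge (lform \<xi>) (lform \<xi>) vs = - wedge (lform \<xi>) (lform \<xi>) vs"
    using fun_cong[OF lform_anticommute[of \<xi> \<xi>], of vs] by simp
  then show "wedge (lform \<xi>) (lform \<xi>) vs = 0" by simp
qed

lemma wedge_power_0: "wedge_power \<alpha> 0 = scalar_form 1"
  by (simp add: wedge_power_def wedge_list_def)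

lemma wedge_power_Suc: "wedge_power \<alpha> (Suc k) = wedge \<alpha> (wedge_power \<alpha> k)"
  by (simp add: wedge_power_def wedge_list_def)

lemma wedge_power_add: "wedge (wedge_power \<alpha> j) (wedge_power \<alpha> k) = wedge_power \<alpha> (j + k)"
  by (induction j) (simp_all add: wedge_power_0 wedge_scalar_left wedge_power_Suc wedge_assoc)

text \<open>An even \<alpha> commutes with every form, in particular with
  \<open>contr v \<alpha>\<close>, so contraction obeys the ordinary power rule. For k = 0 the
  factor k absorbs the truncated k - 1.\<close>

lemma contr_wedge_power:
  assumes "sgn_inv \<alpha> = \<alpha>"
  shows "contr v (wedge_power \<alpha> k) = (\<lambda>vs. of_nat k * wedge (contr v \<alpha>) (wedge_power \<alpha> (k - 1)) vs)"
proof (induction k)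
  case 0
  then show ?case by (simp add: wedge_power_0)
next
  case (Suc k)
  have *: "wedge \<alpha> (wedge (contr v \<alpha>) \<omega>) = wedge (contr v \<alpha>) (wedge \<alpha> \<omega>)" for \<omega>
    by (metis wedge_assoc wedge_commute_even[OF assms])
  have e: "of_nat k * wedge (contr v \<alpha>) (wedge \<alpha> (wedge_power \<alpha> (k - Suc 0))) vs
      = of_nat k * wedge (contr v \<alpha>) (wedge_power \<alpha> k) vs" for vs
    by (cases k) (simp_all add: wedge_power_Suc)
  show ?case
    by (simp add: e wedge_power_Suc[of _ k] contr_wedge assms Suc.IH wedge_scale_right * algebra_simps)
qed

text \<open>Even forms commute, and the binomial expansion stops after the linear term because
  \<theta> squares to zero. This makes powers of \<beta> plus a multiple of \<open>theta v v\<close>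
  computable.\<close>

lemma wedge_power_add_nilpotent:
  assumes ev: "sgn_inv \<alpha> = \<alpha>" "sgn_inv \<theta> = \<theta>" and sq: "wedge \<theta> \<theta> = (\<lambda>vs. 0)"
  shows "wedge_power (\<lambda>vs. \<alpha> vs + s * \<theta> vs) k =
    (\<lambda>vs. wedge_power \<alpha> k vs + of_nat k * s * wedge \<theta> (wedge_power \<alpha> (k - 1)) vs)"
proof (induction k)
  case 0
  then show ?case by (simp add: wedge_power_0)
next
  case (Suc k)
  have *: "wedge \<alpha> (wedge \<theta> \<omega>) = wedge \<theta> (wedge \<alpha> \<omega>)" for \<omega>
    by (metis wedge_assoc wedge_commute_even[OF ev(1)])
  have **: "wedge \<theta> (wedge \<theta> \<omega>) = (\<lambda>vs. 0)" for \<omega>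
    using sq by (simp flip: wedge_assoc)
  have e: "of_nat k * wedge \<theta> (wedge \<alpha> (wedge_power \<alpha> (k - Suc 0))) vs
      = of_nat k * wedge \<theta> (wedge_power \<alpha> k) vs" for vs
    by (cases k) (simp_all add: wedge_power_Suc)
  show ?case
    by (simp add: e wedge_power_Suc[of _ k] Suc.IH wedge_add_left wedge_add_right wedge_scale_left
        wedge_scale_right * ** algebra_simps)
qed

lemma wedge_real:
  assumes "\<And>vs. \<alpha> vs \<in> \<real>" "\<And>vs. \<beta> vs \<in> \<real>"
  shows "wedge \<alpha> \<beta> vs \<in> \<real>"
  unfolding wedge_def by (intro sum_in_Reals Reals_mult assms Reals_power) auto

lemma wedge_lform_vanish:
  assumes "\<And>u. u \<in> set vs \<Longrightarrow> \<xi> u = 0"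
  shows "wedge (lform \<xi>) \<omega> vs = 0"
  using assms
proof (induction vs arbitrary: \<omega>)
  case (Cons v vs)
  then show ?case
    by (simp add: wedge_Cons contr_lform wedge_scalar_left sgn_inv_lform wedge_minus_left)
qed simp

text \<open>A degree-free variant of \<open>alternating_form\<close> that is stable under
  \<open>contr\<close>, as inductions over the argument list require. Vanishing is asked only for
  adjacent equal arguments; \<open>altp_not_distinct\<close> reaches the general case by
  swaps.\<close>

definition altp :: "'n::finite covec \<Rightarrow> bool" where
  "altp \<omega> \<longleftrightarrow> (\<forall>xs u ys. \<omega> (xs @ u # u # ys) = 0) \<and> (\<forall>xs ys. linear (\<lambda>v. \<omega> (xs @ v # ys)))"

lemma altpD:
  assumes "altp \<omega>"
  shows "\<omega> (xs @ u # u # ys) = 0" "linear (\<lambda>v. \<omega> (xs @ v # ys))"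
  using assms unfolding altp_def by blast+

lemma altp_contr:
  assumes "altp \<omega>"
  shows "altp (contr v \<omega>)"
  using altpD[OF assms, of "v # _"] unfolding altp_def contr_def by simp

lemma altp_scale: "altp \<omega> \<Longrightarrow> altp (\<lambda>vs. c * \<omega> vs)"
  unfolding altp_def by (auto simp: linear_iff algebra_simps)

lemma altp_add: "altp \<omega> \<Longrightarrow> altp \<eta> \<Longrightarrow> altp (\<lambda>vs. \<omega> vs + \<eta> vs)"
  unfolding altp_def by (auto simp: linear_iff algebra_simps)

lemma altp_sgn_inv: "altp \<omega> \<Longrightarrow> altp (sgn_inv \<omega>)"
  unfolding altp_def sgn_inv_def by (auto simp: linear_iff algebra_simps)

lemma altp_scalar [simp]: "altp (scalar_form c)"
  unfolding altp_def scalar_form_def by (auto simp: linear_iff)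

lemma altp_contr_contr: "altp \<omega> \<Longrightarrow> contr u (contr u \<omega>) = (\<lambda>vs. 0)"
  using altpD(1)[of \<omega> "[]"] by (simp add: contr_def)

text \<open>For a repeated argument at the head, the two mixed terms of the double contraction
  cancel, because contraction anticommutes with \<open>sgn_inv\<close>. Further inside, the first
  argument is contracted away and the induction applies to the two new pairs of factors.\<close>

lemma altp_wedge:
  fixes \<alpha> \<beta> :: "'n::finite covec"
  assumes "altp \<alpha>" "altp \<beta>"
  shows "altp (wedge \<alpha> \<beta>)"
proof -
  have "wedge \<alpha> \<beta> (xs @ u # u # ys) = 0" if "altp \<alpha>" "altp \<beta>" for xs u ys and \<alpha> \<beta> :: "'n covec"
    using that
  proof (induction xs arbitrary: \<alpha> \<beta>)
    case Nil
    then show ?case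
      by (simp add: wedge_Cons altp_contr_contr contr_sgn_inv wedge_minus_left)
  next
    case (Cons x xs)
    then show ?case by (simp add: wedge_Cons altp_contr altp_sgn_inv)
  qed
  moreover have "linear (\<lambda>v. wedge \<alpha> \<beta> (xs @ v # ys))" if "altp \<alpha>" "altp \<beta>" for xs ys and \<alpha> \<beta> :: "'n covec"
    using that
  proof (induction xs arbitrary: \<alpha> \<beta>)
    case Nil
    have c: "contr (u + v) \<omega> = (\<lambda>vs. contr u \<omega> vs + contr v \<omega> vs)"
            "contr (r *\<^sub>R v) \<omega> = (\<lambda>vs. of_real r * contr v \<omega> vs)" if "altp \<omega>" for u v r and \<omega> :: "'n covec"
    proof -
      have l: "linear (\<lambda>v. \<omega> ([] @ v # vs))" for vs
        by (rule altpD(2)[OF that])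
      show "contr (u + v) \<omega> = (\<lambda>vs. contr u \<omega> vs + contr v \<omega> vs)"
        using linear_add[OF l] by (simp add: contr_def fun_eq_iff)
      show "contr (r *\<^sub>R v) \<omega> = (\<lambda>vs. of_real r * contr v \<omega> vs)"
        using linear_scale[OF l] by (simp add: contr_def fun_eq_iff scaleR_conv_of_real)
    qed
    show ?case
      using Nil by (auto simp: linear_iff wedge_Cons c wedge_add_left wedge_add_right wedge_scale_left
          wedge_scale_right scaleR_conv_of_real[where 'a = complex] algebra_simps)
  next
    case (Cons x xs)
    have "linear (\<lambda>v. wedge (contr x \<alpha>) \<beta> (xs @ v # ys) + wedge (sgn_inv \<alpha>) (contr x \<beta>) (xs @ v # ys))"
      by (intro linear_compose_add Cons.IH altp_contr altp_sgn_inv Cons.prems)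
    then show ?case by (simp add: wedge_Cons)
  qed
  ultimately show ?thesis using assms unfolding altp_def by blast
qed

lemma altp_wedge_power: "altp \<alpha> \<Longrightarrow> altp (wedge_power \<alpha> k)"
  by (induction k) (simp_all add: wedge_power_0 wedge_power_Suc altp_wedge)

lemma altp_lform: "linear \<xi> \<Longrightarrow> altp (lform \<xi>)"
  unfolding altp_def
proof (intro conjI allI)
  fix xs ys :: "(complex ^ 'a) list" and u
  show "lform \<xi> (xs @ u # u # ys) = 0"
    by (cases xs; cases "tl xs") (auto simp: lform_def split: list.split)
  assume l: "linear \<xi>"
  show "linear (\<lambda>v. lform \<xi> (xs @ v # ys))"
  proof (cases "xs = [] \<and> ys = []")
    case True
    then show ?thesis using l by (simp add: lform_def)
  next
    case False
    then have "(\<lambda>v. lform \<xi> (xs @ v # ys)) = (\<lambda>v. 0)"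
      by (cases xs; cases ys) (auto simp: lform_def split: list.split)
    then show ?thesis by (simp add: linear_zero)
  qed
qed

lemma altp_swap:
  assumes "altp \<omega>"
  shows "\<omega> (xs @ u # v # ys) = - \<omega> (xs @ v # u # ys)"
proof -
  have l1: "linear (\<lambda>w. \<omega> (xs @ w # zs))" and l2: "linear (\<lambda>w. \<omega> ((xs @ [y]) @ w # zs))"
    and z: "\<omega> (xs @ w # w # zs) = 0" for zs y w
    by (rule altpD[OF assms])+
  have "0 = \<omega> (xs @ (u + v) # (u + v) # ys)" using z by simp
  also have "\<dots> = \<omega> (xs @ u # (u + v) # ys) + \<omega> (xs @ v # (u + v) # ys)"
    using linear_add[OF l1] by simp
  also have "\<dots> = \<omega> (xs @ u # v # ys) + \<omega> (xs @ v # u # ys)"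
    using linear_add[OF l2] z by simp
  finally show ?thesis by (simp add: eq_neg_iff_add_eq_0)
qed

lemma altp_not_distinct:
  assumes "altp \<omega>" "\<not> distinct vs"
  shows "\<omega> vs = 0"
proof -
  obtain xs u zs ys where vs: "vs = xs @ [u] @ zs @ [u] @ ys"
    using assms(2) not_distinct_decomp by blast
  have "\<omega> (xs @ u # zs @ u # ys) = 0"
  proof (induction zs arbitrary: xs)
    case Nil
    then show ?case using altpD(1)[OF assms(1), of xs u ys] by simp
  next
    case (Cons z zs)
    have "\<omega> (xs @ u # (z # zs) @ u # ys) = - \<omega> ((xs @ [z]) @ u # zs @ u # ys)"
      using altp_swap[OF assms(1), of xs u z "zs @ u # ys"] by simp
    also have "\<omega> ((xs @ [z]) @ u # zs @ u # ys) = 0" by (rule Cons.IH)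
    finally show ?case by simp
  qed
  then show ?thesis by (simp add: vs)
qed

section \<open>The oriented basis and forms of top degree\<close>

lemma oriented_basis_js:
  obtains js :: "'n::finite list" where "distinct js" "set js = UNIV"
    "(oriented_basis :: (complex ^ 'n) list) = concat (map (\<lambda>j. [axis j 1, axis j \<i>]) js)"
proof -
  define js :: "'n list" where "js = (SOME js. distinct js \<and> set js = UNIV)"
  have "\<exists>js :: 'n list. distinct js \<and> set js = UNIV"
    using finite_distinct_list[of "UNIV :: 'n set"] by auto
  from someI_ex[OF this] have "distinct js" "set js = UNIV" by (simp_all add: js_def)
  then show ?thesis by (rule that) (simp add: js_def oriented_basis_def)
qed

lemma set_oriented_basis: "set (oriented_basis :: (complex ^ 'n::finite) list) = Basis"
proof -
  obtain js :: "'n list" where js: "distinct js" "set js = UNIV"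
    "(oriented_basis :: (complex ^ 'n) list) = concat (map (\<lambda>j. [axis j 1, axis j \<i>]) js)"
    by (rule oriented_basis_js)
  have "set (oriented_basis :: (complex ^ 'n) list) = (\<Union>j. {axis j 1, axis j \<i>})"
    by (simp add: js)
  also have "\<dots> = Basis"
    by (auto simp: Basis_vec_def Basis_complex_def)
  finally show ?thesis .
qed

text \<open>A form of degree greater than the dimension vanishes; its contractions give the identities between top
  degree forms.\<close>

lemma vol_coeff_contr:
  assumes "altp \<omega>"
  shows "vol_coeff (contr v \<omega>) = 0"
proof -
  have l: "linear (\<lambda>v. \<omega> (v # oriented_basis))"
    using altpD(2)[OF assms, of "[]"] by simp
  have "(\<lambda>v. \<omega> (v # oriented_basis)) = (\<lambda>v. 0)"
    by (rule linear_eq_stdbasis[OF l linear_zero])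
      (auto intro!: altp_not_distinct[OF assms] simp: set_oriented_basis)
  then show ?thesis unfolding vol_coeff_def contr_def by meson
qed

subsection \<open>The differential operators on forms\<close>

definition D2 :: "('a::euclidean_space \<Rightarrow> 'b::real_normed_vector) \<Rightarrow> 'a \<Rightarrow> 'a \<Rightarrow> 'a \<Rightarrow> 'b" where
  "D2 c z u v = frechet_derivative (\<lambda>w. frechet_derivative c (at w) v) (at z) u"

definition twice_diff :: "('a::euclidean_space \<Rightarrow> 'b::real_normed_vector) \<Rightarrow> bool" where
  "twice_diff c \<longleftrightarrow> (\<forall>w. c differentiable (at w)) \<and>
     (\<forall>v w. (\<lambda>w. frechet_derivative c (at w) v) differentiable (at w))"

definition Lap :: "('a::euclidean_space \<Rightarrow> 'b::real_normed_vector) \<Rightarrow> 'a \<Rightarrow> 'b" where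
  "Lap c z = (\<Sum>b\<in>Basis. D2 c z b b)"

lemma linear_frechet: "c differentiable (at z) \<Longrightarrow> linear (frechet_derivative c (at z))"
  by (simp add: frechet_derivative_works has_derivative_linear)

lemma linear_D2_left: "twice_diff c \<Longrightarrow> linear (\<lambda>u. D2 c z u v)"
  unfolding D2_def twice_diff_def by (simp add: linear_frechet)

lemma frechet_eqI: "(f has_derivative f') (at z) \<Longrightarrow> frechet_derivative f (at z) = f'"
  using frechet_derivative_at by metis

lemma linear_D2_right:
  assumes "twice_diff c"
  shows "linear (D2 c z u)"
proof (rule linearI)
  have l: "linear (frechet_derivative c (at w))" for w
    using assms by (simp add: twice_diff_def linear_frechet)
  have d: "((\<lambda>w. frechet_derivative c (at w) v) has_derivative
      frechet_derivative (\<lambda>w. frechet_derivative c (at w) v) (at z)) (at z)" for v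
    using assms by (simp add: twice_diff_def frechet_derivative_works)
  show "D2 c z u (v + w) = D2 c z u v + D2 c z u w" for v w
    unfolding D2_def linear_add[OF l] by (subst frechet_eqI[OF has_derivative_add[OF d d]]) simp
  show "D2 c z u (r *\<^sub>R v) = r *\<^sub>R D2 c z u v" for r v
    unfolding D2_def linear_scale[OF l] by (subst frechet_eqI[OF has_derivative_scaleR_right[OF d]]) simp
qed

lemma linear_Basis_sum:
  assumes "linear (f :: 'a::euclidean_space \<Rightarrow> 'b::real_vector)"
  shows "f v = (\<Sum>b\<in>Basis. (v \<bullet> b) *\<^sub>R f b)"
proof -
  have "f v = f (\<Sum>b\<in>Basis. (v \<bullet> b) *\<^sub>R b)" by (simp add: euclidean_representation)
  also have "\<dots> = (\<Sum>b\<in>Basis. (v \<bullet> b) *\<^sub>R f b)"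
    using assms by (simp add: linear_sum linear_scale)
  finally show ?thesis .
qed

lemma wedge_lform_Cons:
  "wedge (lform \<xi>) \<omega> (v # vs) = \<xi> v * \<omega> vs - wedge (lform \<xi>) (contr v \<omega>) vs"
  by (simp add: wedge_Cons contr_lform wedge_scalar_left sgn_inv_lform wedge_minus_left)

lemma wedge_lform_expand:
  "wedge (lform \<xi>) \<omega> vs = (\<Sum>k<length vs. (-1) ^ k * \<xi> (vs ! k) * \<omega> (remove_nth k vs))"
proof (induction vs arbitrary: \<omega>)
  case (Cons v vs)
  have "wedge (lform \<xi>) \<omega> (v # vs) =
      \<xi> v * \<omega> vs - (\<Sum>k<length vs. (-1) ^ k * \<xi> (vs ! k) * \<omega> (v # remove_nth k vs))"
    unfolding wedge_lform_Cons Cons.IH by (simp add: contr_def)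
  also have "\<dots> = (\<Sum>k<length (v # vs). (-1) ^ k * \<xi> ((v # vs) ! k) * \<omega> (remove_nth k (v # vs)))"
    by (simp add: sum.lessThan_Suc_shift remove_nth_def sum_negf del: sum.lessThan_Suc)
  finally show ?case .
qed simp

text \<open>The constant forms \<open>D i\<close> pull out of the derivative, and for a function c
  the combination (i / 4 pi)(delbar c - del c) evaluated at u is -(1 / 4 pi) dc(i u).\<close>

lemma ext_dc_sum:
  fixes c :: "'i \<Rightarrow> complex ^ 'n::finite \<Rightarrow> complex"
  assumes "\<And>i w. i \<in> I \<Longrightarrow> c i differentiable (at w)"
  shows "ext_dc (\<lambda>w vs. \<Sum>i\<in>I. c i w * D i vs) z vs =
    (\<Sum>i\<in>I. wedge (lform (\<lambda>u. - (1 / (4 * of_real pi)) * frechet_derivative (c i) (at z) (\<i> *s u))) (D i) vs)"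
proof -
  have fd: "frechet_derivative (\<lambda>w. \<Sum>i\<in>I. c i w * D i us) (at z) =
      (\<lambda>v. \<Sum>i\<in>I. frechet_derivative (c i) (at z) v * D i us)" for us
    by (rule frechet_eqI) (auto intro!: has_derivative_sum has_derivative_mult_left
        simp: assms frechet_derivative_works[symmetric])
  have k: "\<i> / (4 * of_real pi) * ((x + \<i> * y) / 2 - (x - \<i> * y) / 2) = - (1 / (4 * of_real pi)) * y" for x y :: complex
    by (simp add: field_simps)
  have "ext_dc (\<lambda>w vs. \<Sum>i\<in>I. c i w * D i vs) z vs =
    (\<Sum>k<length vs. (-1) ^ k * (\<i> / (4 * of_real pi) * (
       delbar_dir (\<lambda>w. \<Sum>i\<in>I. c i w * D i (remove_nth k vs)) z (vs ! k) -
       del_dir (\<lambda>w. \<Sum>i\<in>I. c i w * D i (remove_nth k vs)) z (vs ! k))))"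
    by (simp add: ext_dc_def del_def delbar_def sum_subtractf[symmetric] sum_distrib_left algebra_simps)
  also have "\<dots> = (\<Sum>k<length vs. (-1) ^ k * (- (1 / (4 * of_real pi)) *
      (\<Sum>i\<in>I. frechet_derivative (c i) (at z) (\<i> *s (vs ! k)) * D i (remove_nth k vs))))"
    unfolding delbar_dir_def del_dir_def k fd by simp
  also have "\<dots> = (\<Sum>i\<in>I. wedge (lform (\<lambda>u. - (1 / (4 * of_real pi)) * frechet_derivative (c i) (at z) (\<i> *s u))) (D i) vs)"
    unfolding wedge_lform_expand sum_distrib_left
    by (subst sum.swap) (simp add: mult_ac)
  finally show ?thesis .
qed

lemma ext_d_eq: "ext_d \<eta> z vs =
    (\<Sum>k<length vs. (-1) ^ k * frechet_derivative (\<lambda>w. \<eta> w (remove_nth k vs)) (at z) (vs ! k))"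
proof -
  have k: "(x - \<i> * y) / 2 + (x + \<i> * y) / 2 = x" for x y :: complex
    by (simp add: add_divide_distrib diff_divide_distrib)
  show ?thesis
    by (simp only: ext_d_def del_def delbar_def sum.distrib[symmetric] distrib_left[symmetric]
        del_dir_def delbar_dir_def k)
qed

text \<open>All forms to be differentiated are finite sums of functions times constant forms, so
  only second derivatives of the coefficients occur. The outer differential is expanded over the
  real basis: each b contributes its coordinate one-form wedged with the b-derivative of the
  one-form from \<open>ext_dc_sum\<close>.\<close>

lemma ddc_sum:
  fixes c :: "'i \<Rightarrow> complex ^ 'n::finite \<Rightarrow> complex"
  assumes td: "\<And>i. i \<in> I \<Longrightarrow> twice_diff (c i)"
  shows "ddc (\<lambda>w vs. \<Sum>i\<in>I. c i w * D i vs) z vs =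
    (\<Sum>i\<in>I. \<Sum>b\<in>Basis. wedge (lform (\<lambda>u. of_real (u \<bullet> b)))
        (wedge (lform (\<lambda>u. - (1 / (4 * of_real pi)) * D2 (c i) z b (\<i> *s u))) (D i)) vs)"
proof -
  define K :: complex where "K = - (1 / (4 * of_real pi))"
  define F where "F i v u = K * D2 (c i) z v (\<i> *s u)" for i v u
  have diff: "c i differentiable (at w)" if "i \<in> I" for i w
    using td[OF that] by (simp add: twice_diff_def)
  have d: "((\<lambda>w. frechet_derivative (c i) (at w) v) has_derivative (\<lambda>u. D2 (c i) z u v)) (at z)"
    if "i \<in> I" for i v
    using td[OF that] unfolding D2_def by (simp add: twice_diff_def frechet_derivative_works[symmetric])
  have fd: "frechet_derivative (\<lambda>w. ext_dc (\<lambda>w vs. \<Sum>i\<in>I. c i w * D i vs) w us) (at z) v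
      = (\<Sum>i\<in>I. wedge (lform (F i v)) (D i) us)" for us v
  proof -
    have e: "(\<lambda>w. ext_dc (\<lambda>w vs. \<Sum>i\<in>I. c i w * D i vs) w us) = (\<lambda>w. \<Sum>i\<in>I. \<Sum>k<length us.
        (-1) ^ k * (K * frechet_derivative (c i) (at w) (\<i> *s (us ! k))) * D i (remove_nth k us))"
      by (rule ext, subst ext_dc_sum) (auto simp: diff wedge_lform_expand K_def)
    have "((\<lambda>w. ext_dc (\<lambda>w vs. \<Sum>i\<in>I. c i w * D i vs) w us) has_derivative
       (\<lambda>v. \<Sum>i\<in>I. \<Sum>k<length us. (-1) ^ k * (K * D2 (c i) z v (\<i> *s (us ! k))) * D i (remove_nth k us))) (at z)"
      unfolding e
      by (intro has_derivative_sum has_derivative_mult_left has_derivative_mult_right d)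
    from frechet_eqI[OF this] show ?thesis
      by (simp add: wedge_lform_expand F_def)
  qed
  have lin: "wedge (lform (F i v)) \<omega> vs = (\<Sum>b\<in>Basis. of_real (v \<bullet> b) * wedge (lform (F i b)) \<omega> vs)"
    if "i \<in> I" for i v \<omega> vs
  proof -
    have "F i v u = (\<Sum>b\<in>Basis. of_real (v \<bullet> b) * F i b u)" for u
      unfolding F_def by (subst linear_Basis_sum[OF linear_D2_left[OF td[OF that]]])
        (simp add: sum_distrib_left scaleR_conv_of_real mult_ac)
    then show ?thesis
      by (simp add: wedge_lform_expand sum_distrib_left sum_distrib_right)
        (subst sum.swap, simp add: mult_ac)
  qed
  have "ddc (\<lambda>w vs. \<Sum>i\<in>I. c i w * D i vs) z vs =
      (\<Sum>k<length vs. (-1) ^ k * (\<Sum>i\<in>I. \<Sum>b\<in>Basis. of_real (vs ! k \<bullet> b) * wedge (lform (F i b)) (D i) (remove_nth k vs)))"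
    unfolding ddc_def ext_d_eq fd by (simp add: lin cong: sum.cong)
  also have "\<dots> = (\<Sum>i\<in>I. \<Sum>b\<in>Basis. \<Sum>k<length vs. (-1) ^ k * of_real (vs ! k \<bullet> b) * wedge (lform (F i b)) (D i) (remove_nth k vs))"
    unfolding sum_distrib_left
    by (subst sum.swap, rule sum.cong[OF refl], subst sum.swap) (simp add: mult_ac)
  also have "\<dots> = (\<Sum>i\<in>I. \<Sum>b\<in>Basis. wedge (lform (\<lambda>u. of_real (u \<bullet> b))) (wedge (lform (F i b)) (D i)) vs)"
    by (subst (2) wedge_lform_expand) simp
  finally show ?thesis by (simp add: F_def[abs_def] K_def)
qed

subsection \<open>The standard Kaehler form\<close>

lemma J_J [simp]: "\<i> *s (\<i> *s u) = - (u :: complex ^ 'n::finite)"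
  by (simp add: vec_eq_iff flip: mult.assoc)

lemma J_scaleR [simp]: "\<i> *s (r *\<^sub>R u) = r *\<^sub>R (\<i> *s (u :: complex ^ 'n::finite))"
  by (simp add: vec_eq_iff)

lemma inner_J_J [simp]: "(\<i> *s u) \<bullet> (\<i> *s v) = u \<bullet> (v :: complex ^ 'n::finite)"
  by (simp add: inner_vec_def inner_complex_def algebra_simps)

lemma inner_J_left: "(\<i> *s u) \<bullet> v = - (u \<bullet> (\<i> *s (v :: complex ^ 'n::finite)))"
  by (simp add: inner_vec_def inner_complex_def algebra_simps sum_negf[symmetric])

lemma inner_J_self [simp]: "u \<bullet> (\<i> *s u) = 0" "(\<i> *s u) \<bullet> (u :: complex ^ 'n::finite) = 0"
proof -
  show "u \<bullet> (\<i> *s u) = 0" using inner_J_left[of u u] by (simp add: inner_commute)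
  then show "(\<i> *s u) \<bullet> u = 0" by (simp add: inner_commute)
qed

definition pform :: "complex ^ 'n::finite \<Rightarrow> 'n covec" where
  "pform v = lform (\<lambda>u. of_real (v \<bullet> u))"

lemma linear_of_real_inner: "linear (\<lambda>u. of_real (v \<bullet> u) :: complex)"
  by (auto simp: linear_iff inner_add_right scaleR_conv_of_real)

lemma wedge_lform_lform_Cons:
  "wedge (lform \<xi>) (lform \<zeta>) (u # vs) = lform (\<lambda>v. \<xi> u * \<zeta> v - \<zeta> u * \<xi> v) vs"
  unfolding wedge_lform_Cons contr_lform wedge_scalar_right by (auto simp: lform_def split: list.split)

lemma beta_eq:
  "beta = (\<lambda>vs. \<Sum>b\<in>Basis. wedge (lform (\<lambda>u. of_real (u \<bullet> b)))
        (lform (\<lambda>u. - (1 / (2 * of_real pi)) * of_real (b \<bullet> (\<i> *s u)))) vs)"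
proof
  fix vs :: "(complex ^ 'n::finite) list"
  define c where "c = (\<lambda>z :: complex ^ 'n. complex_of_real ((norm z)\<^sup>2))"
  have d1: "(c has_derivative (\<lambda>u. of_real (2 * (u \<bullet> z)))) (at z)" for z
    unfolding c_def power2_norm_eq_inner
    by (auto intro!: derivative_eq_intros simp: inner_commute)
  have f1: "frechet_derivative c (at z) = (\<lambda>u. of_real (2 * (u \<bullet> z)))" for z
    by (rule frechet_eqI[OF d1])
  have d2: "((\<lambda>w. frechet_derivative c (at w) v) has_derivative (\<lambda>u. of_real (2 * (v \<bullet> u)))) (at z)" for v z
    unfolding f1 by (auto intro!: derivative_eq_intros)
  have td: "twice_diff c"
    unfolding twice_diff_def using d1 d2 by (auto simp: differentiable_def)
  have D2c: "D2 c z u v = of_real (2 * (v \<bullet> u))" for z u v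
    unfolding D2_def frechet_eqI[OF d2] ..
  have "(\<lambda>z. scalar_form (c z)) = (\<lambda>w vs :: (complex ^ 'n) list. \<Sum>i\<in>{()}. c w * scalar_form 1 vs)"
    by (auto simp: scalar_form_def fun_eq_iff)
  then have "beta vs = ddc (\<lambda>w vs. \<Sum>i\<in>{()}. c w * scalar_form 1 vs) 0 vs"
    by (simp add: beta_def c_def)
  also have "\<dots> = (\<Sum>b\<in>Basis. wedge (lform (\<lambda>u. of_real (u \<bullet> b)))
        (lform (\<lambda>u. - (1 / (2 * of_real pi)) * of_real (b \<bullet> (\<i> *s u)))) vs)"
    by (subst ddc_sum) (simp_all add: td D2c wedge_scalar_right inner_commute)
  finally show "beta vs = \<dots>" .
qed

text \<open>Multiplication by i is skew for the real inner product, so the two halves of the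
  antisymmetrised sum coincide. Hence \<beta>[v, u] = <i v, u> / pi, and every real one-form is a
  contraction of \<beta>.\<close>

lemma contr_beta: "contr v beta = lform (\<lambda>u. of_real (1 / pi * ((\<i> *s v) \<bullet> u)))"
proof
  fix vs
  have e: "(\<Sum>b\<in>Basis. (v \<bullet> b) * (b \<bullet> (\<i> *s u)) - (b \<bullet> (\<i> *s v)) * (u \<bullet> b)) = - 2 * ((\<i> *s v) \<bullet> u)" for u
  proof -
    have "(\<Sum>b\<in>Basis. (v \<bullet> b) * (b \<bullet> (\<i> *s u)) - (b \<bullet> (\<i> *s v)) * (u \<bullet> b))
      = v \<bullet> (\<i> *s u) - u \<bullet> (\<i> *s v)"
      by (simp add: sum_subtractf euclidean_inner[of v] euclidean_inner[of u] inner_commute mult.commute)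
    then show ?thesis by (simp add: inner_J_left inner_commute[of u])
  qed
  have "contr v beta vs = (\<Sum>b\<in>Basis. lform (\<lambda>u. of_real (v \<bullet> b) * (- (1 / (2 * of_real pi)) * of_real (b \<bullet> (\<i> *s u)))
      - (- (1 / (2 * of_real pi)) * of_real (b \<bullet> (\<i> *s v))) * of_real (u \<bullet> b)) vs)"
    unfolding contr_def beta_eq wedge_lform_lform_Cons ..
  also have "\<dots> = lform (\<lambda>u. \<Sum>b\<in>Basis. of_real (v \<bullet> b) * (- (1 / (2 * of_real pi)) * of_real (b \<bullet> (\<i> *s u)))
      - (- (1 / (2 * of_real pi)) * of_real (b \<bullet> (\<i> *s v))) * of_real (u \<bullet> b)) vs"
    by (simp add: lform_def split: list.split)
  also have "(\<lambda>u. \<Sum>b\<in>Basis. of_real (v \<bullet> b) * (- (1 / (2 * of_real pi)) * of_real (b \<bullet> (\<i> *s u)))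
      - (- (1 / (2 * of_real pi)) * of_real (b \<bullet> (\<i> *s v))) * of_real (u \<bullet> b)) =
      (\<lambda>u. of_real (- (1 / (2 * pi)) * (\<Sum>b\<in>Basis. (v \<bullet> b) * (b \<bullet> (\<i> *s u)) - (b \<bullet> (\<i> *s v)) * (u \<bullet> b))) :: complex)"
    by (simp add: sum_distrib_left algebra_simps)
  also have "\<dots> = (\<lambda>u. of_real (1 / pi * ((\<i> *s v) \<bullet> u)))"
    unfolding e by (simp add: field_simps)
  finally show "contr v beta vs = lform (\<lambda>u. of_real (1 / pi * ((\<i> *s v) \<bullet> u))) vs" .
qed

lemma beta_values: "beta [] = 0" "beta (u # vs) = lform (\<lambda>v. of_real (1 / pi * ((\<i> *s u) \<bullet> v))) vs"
  using fun_cong[OF contr_beta[of u], of vs] by (simp_all add: contr_def beta_eq)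

lemma sgn_inv_beta: "sgn_inv beta = beta"
proof
  fix vs show "sgn_inv beta vs = (beta :: 'a covec) vs"
    by (cases vs) (auto simp: sgn_inv_def beta_values lform_def split: list.split)
qed

lemma altp_sum: "(\<And>i. i \<in> I \<Longrightarrow> altp (\<omega> i)) \<Longrightarrow> altp (\<lambda>vs. \<Sum>i\<in>I. \<omega> i vs)"
proof (induction I rule: infinite_finite_induct)
  case (insert i I)
  then show ?case using altp_add[of "\<omega> i" "\<lambda>vs. \<Sum>i\<in>I. \<omega> i vs"] by simp
qed (simp_all add: altp_def linear_zero)

lemma altp_beta: "altp beta"
  unfolding beta_eq
proof (intro altp_sum altp_wedge altp_lform)
  show "linear (\<lambda>u. - (1 / (2 * complex_of_real pi)) * complex_of_real (b \<bullet> (\<i> *s u)))" for b :: "complex ^ 'a"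
    by (auto simp: linear_iff inner_add_right scaleR_conv_of_real[where 'a = complex] field_simps)
qed (auto simp: linear_iff inner_add_left scaleR_conv_of_real[where 'a = complex])

lemma contr_beta_power:
  "contr v (wedge_power beta k) =
    (\<lambda>vs. of_nat k * wedge (pform ((1 / pi) *\<^sub>R (\<i> *s v))) (wedge_power beta (k - 1)) vs)"
  unfolding contr_wedge_power[OF sgn_inv_beta] contr_beta pform_def by simp

lemma J_axis: "\<i> *s axis j 1 = (axis j \<i> :: complex ^ 'n::finite)"
  by (auto simp: vec_eq_iff axis_def)

text \<open>Contracting by the first vector of a pair leaves a multiple of the covector dual to the
  second, which vanishes on all other pairs. Each pair thus contributes a factor 1/pi and the
  current exponent, whence the factorial.\<close>

lemma beta_power_basis:
  fixes js :: "'n::finite list"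
  assumes "distinct js"
  shows "wedge_power beta (length js) (concat (map (\<lambda>j. [axis j 1, axis j \<i> :: complex ^ 'n]) js))
    = of_real (fact (length js) / pi ^ length js)"
  using assms
proof (induction js)
  case Nil
  then show ?case by (simp add: wedge_power_0 scalar_form_def)
next
  case (Cons j js)
  define rest where "rest = concat (map (\<lambda>j. [axis j 1, axis j \<i> :: complex ^ 'n]) js)"
  define q where "q = pform ((1 / pi) *\<^sub>R axis j \<i> :: complex ^ 'n)"
  have z: "wedge q \<omega> rest = 0" for \<omega>
    unfolding q_def pform_def
    by (rule wedge_lform_vanish) (use Cons.prems in \<open>auto simp: rest_def inner_axis_axis\<close>)
  have "wedge_power beta (length (j # js)) (concat (map (\<lambda>j. [axis j 1, axis j \<i>]) (j # js)))
      = contr (axis j 1) (wedge_power beta (Suc (length js))) (axis j \<i> # rest)"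
    by (simp add: contr_def rest_def)
  also have "\<dots> = of_nat (Suc (length js)) * wedge q (wedge_power beta (length js)) (axis j \<i> # rest)"
    unfolding contr_beta_power J_axis q_def by simp
  also have "wedge q (wedge_power beta (length js)) (axis j \<i> # rest) =
      of_real (1 / pi) * wedge_power beta (length js) rest"
    using z unfolding q_def pform_def wedge_lform_Cons by (simp add: inner_axis_axis)
  finally have e: "wedge_power beta (length (j # js)) (concat (map (\<lambda>j. [axis j 1, axis j \<i>]) (j # js))) =
      of_nat (Suc (length js)) * (of_real (1 / pi) * wedge_power beta (length js) rest)" .
  have "wedge_power beta (length js) rest = of_real (fact (length js) / pi ^ length js)"
    using Cons by (simp add: rest_def)
  then show ?case unfolding e by (simp add: field_simps)
qed

lemma vol_coeff_beta_power:
  "vol_coeff (wedge_power beta CARD('n) :: 'n::finite covec) = of_real (fact CARD('n) / pi ^ CARD('n))"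
proof -
  obtain js :: "'n list" where js: "distinct js" "set js = UNIV"
    "(oriented_basis :: (complex ^ 'n) list) = concat (map (\<lambda>j. [axis j 1, axis j \<i>]) js)"
    by (rule oriented_basis_js)
  have "length js = CARD('n)" using js distinct_card by metis
  then show ?thesis using beta_power_basis[OF js(1)] js(3) by (simp add: vol_coeff_def)
qed


subsection \<open>Top degree identities\<close>

lemma altp_pform: "altp (pform v)"
  unfolding pform_def by (rule altp_lform[OF linear_of_real_inner])

lemma vol_coeff_lin:
  "vol_coeff (\<lambda>vs. \<alpha> vs + \<beta> vs) = vol_coeff \<alpha> + vol_coeff \<beta>"
  "vol_coeff (\<lambda>vs. c * \<alpha> vs) = c * vol_coeff \<alpha>"
  "vol_coeff (\<lambda>vs. - \<alpha> vs) = - vol_coeff \<alpha>"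
  "vol_coeff (\<lambda>vs. \<Sum>i\<in>I. \<omega> i vs) = (\<Sum>i\<in>I. vol_coeff (\<omega> i))"
  by (simp_all add: vol_coeff_def)

lemma contr_lform_wedge:
  "contr w (wedge (lform \<zeta>) \<omega>) = (\<lambda>vs. \<zeta> w * \<omega> vs + - wedge (lform \<zeta>) (contr w \<omega>) vs)"
  by (simp add: contr_wedge contr_lform wedge_scalar_left sgn_inv_lform wedge_minus_left)

text \<open>By i^2 = -1 the vector w = - pi i v is the one whose contraction with \<beta> is
  \<open>pform v\<close>; this explains the w chosen in the next two proofs.\<close>

lemma pform_as_contr: "pform ((1 / pi) *\<^sub>R (\<i> *s ((- pi) *\<^sub>R (\<i> *s v)))) = pform v"
  by (simp only: J_scaleR J_J) simp

text \<open>The form \<zeta> \<and> \<beta>^n has degree 2n + 1, so its contraction by w vanishes in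
  top degree. Written out by the antiderivation rule, this relates \<zeta>(w) \<beta>^n to \<zeta>
  \<and> \<open>pform v\<close> \<and> \<beta>^(n-1).\<close>

lemma vol_lform_pform_beta:
  fixes \<zeta> :: "complex ^ 'n::finite \<Rightarrow> complex"
  assumes "linear \<zeta>"
  shows "of_nat CARD('n) * vol_coeff (wedge (lform \<zeta>) (wedge (pform v) (wedge_power beta (CARD('n) - 1))))
    = - of_real pi * \<zeta> (\<i> *s v) * vol_coeff (wedge_power beta CARD('n) :: 'n covec)"
proof -
  define w where "w = (- pi) *\<^sub>R (\<i> *s v)"
  have "0 = vol_coeff (contr w (wedge (lform \<zeta>) (wedge_power beta CARD('n))))"
    by (rule vol_coeff_contr[symmetric]) (intro altp_wedge altp_lform altp_wedge_power altp_beta assms)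
  also have "\<dots> = \<zeta> w * vol_coeff (wedge_power beta CARD('n) :: 'n covec)
      - of_nat CARD('n) * vol_coeff (wedge (lform \<zeta>) (wedge (pform v) (wedge_power beta (CARD('n) - 1))))"
    unfolding contr_lform_wedge contr_beta_power wedge_scale_right vol_coeff_lin w_def pform_as_contr by simp
  also have "\<zeta> w = - of_real pi * \<zeta> (\<i> *s v)"
    unfolding w_def linear_scale[OF assms] by (simp add: scaleR_conv_of_real)
  finally show ?thesis by (simp add: algebra_simps)
qed

text \<open>The same contraction argument for \<zeta> \<and> \<alpha> \<and> \<beta>^(n-1). The
  additional term comes from the contraction hitting \<alpha>, and evenness lets
  \<open>pform v\<close> move past \<alpha>.\<close>

lemma vol_lform_pform_even:
  fixes \<zeta> :: "complex ^ 'n::finite \<Rightarrow> complex"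
  assumes "linear \<zeta>" and alt: "altp \<alpha>" and ev: "sgn_inv \<alpha> = \<alpha>"
  shows "of_nat (CARD('n) - 1) *
      vol_coeff (wedge (lform \<zeta>) (wedge (pform v) (wedge \<alpha> (wedge_power beta (CARD('n) - 2)))))
    = - of_real pi * \<zeta> (\<i> *s v) * vol_coeff (wedge \<alpha> (wedge_power beta (CARD('n) - 1)))
      + of_real pi * vol_coeff (wedge (lform \<zeta>) (wedge (contr (\<i> *s v) \<alpha>) (wedge_power beta (CARD('n) - 1))))"
proof -
  define w where "w = (- pi) *\<^sub>R (\<i> *s v)"
  have cw: "contr w \<alpha> = (\<lambda>vs. of_real (- pi) * contr (\<i> *s v) \<alpha> vs)"
  proof
    fix x show "contr w \<alpha> x = of_real (- pi) * contr (\<i> *s v) \<alpha> x"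
      using linear_scale[OF altpD(2)[OF alt, of "[]" x], of "- pi" "\<i> *s v"]
      unfolding w_def contr_def append_Nil by (simp add: scaleR_conv_of_real[where 'a = complex])
  qed
  have c: "contr w (wedge \<alpha> (wedge_power beta (CARD('n) - 1))) =
    (\<lambda>vs. of_real (- pi) * wedge (contr (\<i> *s v) \<alpha>) (wedge_power beta (CARD('n) - 1)) vs +
      of_nat (CARD('n) - 1) * wedge (pform v) (wedge \<alpha> (wedge_power beta (CARD('n) - 2))) vs)"
    unfolding contr_wedge ev contr_beta_power pform_as_contr w_def[symmetric] cw wedge_scale_left
    unfolding w_def pform_as_contr wedge_scale_right
    by (simp add: wedge_assoc[symmetric] wedge_commute_even[OF ev, of "pform v"] numeral_2_eq_2)
  have "0 = vol_coeff (contr w (wedge (lform \<zeta>) (wedge \<alpha> (wedge_power beta (CARD('n) - 1)))))"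
    by (rule vol_coeff_contr[symmetric]) (intro altp_wedge altp_lform altp_wedge_power altp_beta assms)
  also have "\<dots> = \<zeta> w * vol_coeff (wedge \<alpha> (wedge_power beta (CARD('n) - 1)))
      - (of_real (- pi) * vol_coeff (wedge (lform \<zeta>) (wedge (contr (\<i> *s v) \<alpha>) (wedge_power beta (CARD('n) - 1))))
      + of_nat (CARD('n) - 1) *
      vol_coeff (wedge (lform \<zeta>) (wedge (pform v) (wedge \<alpha> (wedge_power beta (CARD('n) - 2))))))"
    unfolding contr_lform_wedge c wedge_add_right wedge_scale_right vol_coeff_lin by simp
  also have "\<zeta> w = - of_real pi * \<zeta> (\<i> *s v)"
    unfolding w_def linear_scale[OF assms(1)] by (simp add: scaleR_conv_of_real)
  finally show ?thesis by (simp add: algebra_simps)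
qed

text \<open>For a unit vector v, \<open>theta v v\<close> is the part of \<beta> along the complex
  line through v. Two separate vectors are allowed so that \<open>theta v v\<close> can be expanded
  bilinearly over a basis.\<close>

definition theta :: "complex ^ 'n::finite \<Rightarrow> complex ^ 'n \<Rightarrow> 'n covec" where
  "theta v w = (\<lambda>vs. of_real (1 / pi) * wedge (pform v) (pform (\<i> *s w)) vs)"

lemma altp_theta: "altp (theta v w)"
  unfolding theta_def by (intro altp_scale altp_wedge altp_pform)

lemma sgn_inv_pform: "sgn_inv (pform v) = (\<lambda>vs. - pform v vs)"
  by (simp add: pform_def sgn_inv_lform)

lemma sgn_inv_theta: "sgn_inv (theta v w) = theta v w"
  unfolding theta_def sgn_inv_scale sgn_inv_wedge sgn_inv_pform wedge_minus_left wedge_minus_right by simp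

lemma contr_theta: "contr u (theta v w) =
    (\<lambda>vs. of_real (1 / pi) * (of_real (v \<bullet> u) * pform (\<i> *s w) vs + - of_real ((\<i> *s w) \<bullet> u) * pform v vs))"
  unfolding theta_def contr_scale
  by (simp add: pform_def contr_lform_wedge contr_lform wedge_scalar_right)

lemma theta_square: "wedge (theta v w) (theta v w) = (\<lambda>vs. 0)"
proof -
  have "wedge (pform v) (wedge (pform (\<i> *s w)) (wedge (pform v) (pform (\<i> *s w)))) = (\<lambda>vs. 0)"
    unfolding pform_def lform_anticommute[of "\<lambda>u. of_real (v \<bullet> u)"]
    by (simp add: wedge_minus_right wedge_assoc[symmetric] lform_square)
  then show ?thesis
    unfolding theta_def wedge_scale_left wedge_scale_right wedge_assoc by simp
qed

lemma vol_theta_beta: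
  fixes v w :: "complex ^ 'n::finite"
  shows
  "of_nat CARD('n) * vol_coeff (wedge (theta v w) (wedge_power beta (CARD('n) - 1)))
    = of_real (v \<bullet> w) * vol_coeff (wedge_power beta CARD('n) :: 'n::finite covec)"
proof -
  have "of_nat CARD('n) * vol_coeff (wedge (theta v w) (wedge_power beta (CARD('n) - 1))) =
    of_real (1 / pi) * (of_nat CARD('n) *
      vol_coeff (wedge (pform v) (wedge (pform (\<i> *s w)) (wedge_power beta (CARD('n) - 1)))))"
    unfolding theta_def wedge_scale_left wedge_assoc vol_coeff_lin by simp
  also have "\<dots> = of_real (v \<bullet> w) * vol_coeff (wedge_power beta CARD('n) :: 'n::finite covec)"
    using vol_lform_pform_beta[OF linear_of_real_inner[of v], of "\<i> *s w"]
    unfolding pform_def[of v, symmetric] by simp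
  finally show ?thesis .
qed

text \<open>The contraction of \<open>theta v w\<close> is a combination of two one-forms, so both
  terms of \<open>vol_lform_pform_even\<close> reduce to the identities against powers of \<beta>
  alone.\<close>

lemma vol_lform_pform_theta:
  fixes \<zeta> :: "complex ^ 'n::finite \<Rightarrow> complex"
  assumes l: "linear \<zeta>"
  shows "of_nat CARD('n) * (of_nat (CARD('n) - 1) *
      vol_coeff (wedge (lform \<zeta>) (wedge (pform u) (wedge (theta v w) (wedge_power beta (CARD('n) - 2))))))
    = of_real pi * (- \<zeta> (\<i> *s u) * of_real (v \<bullet> w) + of_real (v \<bullet> (\<i> *s u)) * \<zeta> w + of_real (w \<bullet> u) * \<zeta> (\<i> *s v))
       * vol_coeff (wedge_power beta CARD('n) :: 'n covec)"
proof -
  define V where "V = vol_coeff (wedge_power beta CARD('n) :: 'n covec)"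
  define n :: complex where "n = of_nat CARD('n)"
  define X where "X = (\<lambda>v. vol_coeff (wedge (lform \<zeta>) (wedge (pform v) (wedge_power beta (CARD('n) - 1)))))"
  have X: "n * X v = - of_real pi * \<zeta> (\<i> *s v) * V" for v
    unfolding X_def n_def V_def by (rule vol_lform_pform_beta[OF l])
  have th: "n * vol_coeff (wedge (theta v w) (wedge_power beta (CARD('n) - 1))) = of_real (v \<bullet> w) * V"
    unfolding n_def V_def by (rule vol_theta_beta)
  have z: "\<zeta> (- y) = - \<zeta> y" for y using linear_neg[OF l] .
  have "vol_coeff (wedge (lform \<zeta>) (wedge (contr (\<i> *s u) (theta v w)) (wedge_power beta (CARD('n) - 1))))
    = of_real (1 / pi) * (of_real (v \<bullet> (\<i> *s u)) * X (\<i> *s w) - of_real (w \<bullet> u) * X v)"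
    unfolding contr_theta wedge_scale_left wedge_add_left wedge_scale_right wedge_add_right vol_coeff_lin X_def
    by simp
  then have "n * vol_coeff (wedge (lform \<zeta>) (wedge (contr (\<i> *s u) (theta v w)) (wedge_power beta (CARD('n) - 1))))
    = of_real (1 / pi) * (of_real (v \<bullet> (\<i> *s u)) * (n * X (\<i> *s w)) - of_real (w \<bullet> u) * (n * X v))"
    by (simp only: right_diff_distrib mult_ac)
  also have "\<dots> = (of_real (v \<bullet> (\<i> *s u)) * \<zeta> w + of_real (w \<bullet> u) * \<zeta> (\<i> *s v)) * V"
    unfolding X by (simp add: z field_simps)
  finally have ct: "n * vol_coeff (wedge (lform \<zeta>) (wedge (contr (\<i> *s u) (theta v w)) (wedge_power beta (CARD('n) - 1))))
    = (of_real (v \<bullet> (\<i> *s u)) * \<zeta> w + of_real (w \<bullet> u) * \<zeta> (\<i> *s v)) * V" .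
  have "n * (of_nat (CARD('n) - 1) *
      vol_coeff (wedge (lform \<zeta>) (wedge (pform u) (wedge (theta v w) (wedge_power beta (CARD('n) - 2))))))
    = - of_real pi * \<zeta> (\<i> *s u) * (n * vol_coeff (wedge (theta v w) (wedge_power beta (CARD('n) - 1))))
      + of_real pi * (n * vol_coeff (wedge (lform \<zeta>) (wedge (contr (\<i> *s u) (theta v w)) (wedge_power beta (CARD('n) - 1)))))"
    unfolding vol_lform_pform_even[OF l altp_theta sgn_inv_theta] by (simp add: algebra_simps)
  also have "\<dots> = of_real pi * (- \<zeta> (\<i> *s u) * of_real (v \<bullet> w) + of_real (v \<bullet> (\<i> *s u)) * \<zeta> w + of_real (w \<bullet> u) * \<zeta> (\<i> *s v)) * V"
    unfolding th ct by (simp add: algebra_simps)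
  finally show ?thesis unfolding n_def V_def .
qed

lemma linear_D2_J:
  assumes "twice_diff (c :: complex ^ 'n::finite \<Rightarrow> complex)"
  shows "linear (\<lambda>u. k * D2 c z b (\<i> *s u))"
  using linear_D2_right[OF assms] by (auto simp: linear_iff distrib_left)

lemma of_real_inner_left: "lform (\<lambda>u. of_real (u \<bullet> b)) = pform b"
  by (simp add: pform_def inner_commute)

lemma wedge_pform_lform: "wedge (pform b) (wedge (lform \<zeta>) \<omega>) = (\<lambda>vs. - wedge (lform \<zeta>) (wedge (pform b) \<omega>) vs)"
  unfolding wedge_assoc[symmetric] pform_def
  by (subst lform_anticommute) (simp add: wedge_minus_left)

lemma vol_ddc_beta:
  fixes c :: "complex ^ 'n::finite \<Rightarrow> complex"
  assumes td: "twice_diff c"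
  shows "4 * of_nat CARD('n) * (\<Sum>b\<in>Basis. vol_coeff (wedge (lform (\<lambda>u. of_real (u \<bullet> b)))
        (wedge (lform (\<lambda>u. - (1 / (4 * of_real pi)) * D2 c z b (\<i> *s u))) (wedge_power beta (CARD('n) - 1)))))
    = Lap c z * vol_coeff (wedge_power beta CARD('n) :: 'n covec)"
proof -
  have "4 * of_nat CARD('n) * vol_coeff (wedge (lform (\<lambda>u. of_real (u \<bullet> b)))
        (wedge (lform (\<lambda>u. - (1 / (4 * of_real pi)) * D2 c z b (\<i> *s u))) (wedge_power beta (CARD('n) - 1))))
     = D2 c z b b * vol_coeff (wedge_power beta CARD('n) :: 'n covec)" for b
    using vol_lform_pform_beta[OF linear_D2_J[OF td], of "- (1 / (4 * of_real pi))" z b b]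
    unfolding of_real_inner_left wedge_pform_lform vol_coeff_lin
    by (simp add: linear_neg[OF linear_D2_right[OF td]] field_simps)
  then show ?thesis by (simp add: sum_distrib_left Lap_def sum_distrib_right)
qed

text \<open>Wedging with \<open>theta v v\<close> for a unit vector v removes from the trace of the
  Hessian its part along the complex line of v: the second derivatives in the directions v and i
  v.\<close>

lemma vol_ddc_theta:
  fixes c :: "complex ^ 'n::finite \<Rightarrow> complex"
  assumes td: "twice_diff c"
  shows "4 * of_nat CARD('n) * of_nat (CARD('n) - 1) * (\<Sum>b\<in>Basis. vol_coeff (wedge (lform (\<lambda>u. of_real (u \<bullet> b)))
        (wedge (lform (\<lambda>u. - (1 / (4 * of_real pi)) * D2 c z b (\<i> *s u)))
          (wedge (theta v w) (wedge_power beta (CARD('n) - 2))))))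
    = (of_real (v \<bullet> w) * Lap c z - D2 c z w v - D2 c z (\<i> *s v) (\<i> *s w)) *
      vol_coeff (wedge_power beta CARD('n) :: 'n covec)"
proof -
  define V where "V = vol_coeff (wedge_power beta CARD('n) :: 'n covec)"
  have 1: "4 * of_nat CARD('n) * of_nat (CARD('n) - 1) * vol_coeff (wedge (lform (\<lambda>u. of_real (u \<bullet> b)))
        (wedge (lform (\<lambda>u. - (1 / (4 * of_real pi)) * D2 c z b (\<i> *s u)))
          (wedge (theta v w) (wedge_power beta (CARD('n) - 2)))))
     = (of_real (v \<bullet> w) * D2 c z b b - of_real (w \<bullet> b) * D2 c z b v - of_real ((\<i> *s v) \<bullet> b) * D2 c z b (\<i> *s w)) * V" for b
  proof -
    define X where "X = vol_coeff (wedge (lform (\<lambda>u. - (1 / (4 * of_real pi)) * D2 c z b (\<i> *s u)))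
          (wedge (pform b) (wedge (theta v w) (wedge_power beta (CARD('n) - 2)))))"
    have "4 * of_nat CARD('n) * of_nat (CARD('n) - 1) * - X = - 4 * (of_nat CARD('n) * (of_nat (CARD('n) - 1) * X))"
      by simp
    also have "\<dots> = (of_real (v \<bullet> w) * D2 c z b b - of_real (w \<bullet> b) * D2 c z b v - of_real ((\<i> *s v) \<bullet> b) * D2 c z b (\<i> *s w)) * V"
      unfolding X_def vol_lform_pform_theta[OF linear_D2_J[OF td]] V_def[symmetric]
      by (simp add: linear_neg[OF linear_D2_right[OF td]] inner_J_left field_simps)
    finally show ?thesis
      unfolding of_real_inner_left wedge_pform_lform vol_coeff_lin X_def .
  qed
  have "(\<Sum>b\<in>Basis. of_real (w \<bullet> b) * D2 c z b v) = D2 c z w v"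
    by (subst linear_Basis_sum[OF linear_D2_left[OF td, of z v], of w]) (simp add: scaleR_conv_of_real)
  moreover have "(\<Sum>b\<in>Basis. of_real ((\<i> *s v) \<bullet> b) * D2 c z b (\<i> *s w)) = D2 c z (\<i> *s v) (\<i> *s w)"
    by (subst linear_Basis_sum[OF linear_D2_left[OF td, of z "\<i> *s w"], of "\<i> *s v"])
      (simp add: scaleR_conv_of_real)
  ultimately show ?thesis
    unfolding sum_distrib_left 1 V_def[symmetric] sum_distrib_right[symmetric] sum_subtractf
    by (simp add: Lap_def sum_distrib_left[symmetric])
qed

lemma wedge_pform_real: "wedge (pform u) (pform v) vs \<in> \<real>"
  by (rule wedge_real) (auto simp: pform_def lform_def split: list.split)

section \<open>An extremal m-positive form\<close>

lemma altp_form_alternating: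
  assumes "altp \<omega>" "\<And>vs. length vs \<noteq> k \<Longrightarrow> \<omega> vs = 0"
  shows "alternating_form k \<omega>"
  unfolding alternating_form_def
proof (intro conjI allI impI)
  fix vs :: "(complex ^ 'a) list" and i
  assume "length vs = k" "i < k"
  then have "(\<lambda>v. \<omega> (vs[i := v])) = (\<lambda>v. \<omega> (take i vs @ v # drop (Suc i) vs))"
    by (simp add: upd_conv_take_nth_drop)
  then show "linear (\<lambda>v. \<omega> (vs[i := v]))" using altpD(2)[OF assms(1)] by simp
qed (use assms altp_not_distinct[OF assms(1)] in blast)+

lemma beta_length: "length vs \<noteq> 2 \<Longrightarrow> beta vs = 0"
  by (cases vs; cases "tl vs"; cases "tl (tl vs)") (auto simp: beta_values lform_def split: list.split)

lemma theta_length: "length vs \<noteq> 2 \<Longrightarrow> theta v w vs = 0"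
  unfolding theta_def pform_def
  by (cases vs; cases "tl vs"; cases "tl (tl vs)") (auto simp: wedge_lform_lform_Cons)

text \<open>Nilpotency of \<open>theta v v\<close> gives \<gamma>^j \<and> \<beta>^(n-j) = (1 - j
  |v|^2 / m) \<beta>^n in top degree. For a unit vector n/m is therefore the largest admissible
  multiple, the condition j = m being sharp. The inequality \<open>v \<bullet> v \<le> 1\<close>
  also admits v = 0, where \<gamma> = \<beta>.\<close>

lemma m_positive_gamma:
  fixes v :: "complex ^ 'n::finite"
  assumes m: "1 \<le> m" "m \<le> CARD('n)" and v: "v \<bullet> v \<le> 1"
  shows "m_positive m (\<lambda>vs. beta vs + - of_real (CARD('n) / m) * theta v v vs)"
proof -
  define \<gamma> where "\<gamma> = (\<lambda>vs. beta vs + - of_real (CARD('n) / m) * theta v v vs)"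
  have "alternating_form 2 \<gamma>"
    unfolding \<gamma>_def
  proof (rule altp_form_alternating)
    show "altp (\<lambda>vs. beta vs + - of_real (CARD('n) / m) * theta v v vs)"
      by (intro altp_add altp_scale altp_beta altp_theta)
  qed (simp add: beta_length theta_length)
  moreover have "\<gamma> vs \<in> \<real>" for vs
  proof -
    have "beta vs \<in> \<real>" by (cases vs) (auto simp: beta_values lform_def split: list.split)
    moreover have "theta v v vs \<in> \<real>"
      unfolding theta_def by (intro Reals_mult wedge_pform_real) auto
    moreover have "- complex_of_real (CARD('n) / m) \<in> \<real>" by simp
    ultimately show ?thesis unfolding \<gamma>_def by (intro Reals_add Reals_mult)
  qed
  moreover have "\<gamma> [\<i> *s a, \<i> *s b] = \<gamma> [a, b]" for a b
    unfolding \<gamma>_def theta_def pform_def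
    by (simp add: beta_values wedge_lform_lform_Cons inner_J_left)
  moreover have "vol_coeff (wedge (wedge_power \<gamma> j) (wedge_power beta (CARD('n) - j))) \<in> \<real>\<^sub>\<ge>\<^sub>0" if j: "j \<in> {1..m}" for j
  proof -
    have e: "wedge (wedge_power \<gamma> j) (wedge_power beta (CARD('n) - j)) =
      (\<lambda>vs. wedge_power beta CARD('n) vs + of_nat j * - of_real (CARD('n) / m) * wedge (theta v v) (wedge_power beta (CARD('n) - 1)) vs)"
      unfolding \<gamma>_def wedge_power_add_nilpotent[OF sgn_inv_beta sgn_inv_theta theta_square] wedge_add_left wedge_scale_left
        wedge_assoc wedge_power_add using j m by simp
    have "vol_coeff (wedge (theta v v) (wedge_power beta (CARD('n) - 1)))
      = of_real ((v \<bullet> v) / CARD('n)) * vol_coeff (wedge_power beta CARD('n) :: 'n covec)"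
      using vol_theta_beta[of v v] by (simp add: field_simps)
    then have "vol_coeff (wedge (wedge_power \<gamma> j) (wedge_power beta (CARD('n) - j)))
      = of_real ((1 - j * (v \<bullet> v) / m) * (fact CARD('n) / pi ^ CARD('n)))"
      unfolding e vol_coeff_lin vol_coeff_beta_power by (simp add: field_simps)
    moreover have "real j * (v \<bullet> v) \<le> real m * 1"
      using j v by (intro mult_mono) auto
    then have "(1 - j * (v \<bullet> v) / m) * (fact CARD('n) / pi ^ CARD('n)) \<ge> 0"
      using m by (intro mult_nonneg_nonneg) (auto simp: field_simps)
    ultimately show ?thesis by (simp only: nonneg_Reals_of_real_iff)
  qed
  ultimately show ?thesis unfolding m_positive_def real_11_form_def \<gamma>_def by blast
qed

subsection \<open>Smooth functions\<close>

lemma smoothD: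
  assumes "smooth f"
  shows "f differentiable (at z)" "smooth (\<lambda>z. frechet_derivative f (at z) v)"
proof -
  show "f differentiable (at z)"
    using assms unfolding smooth_def by (metis iterated_dir_deriv.simps(1))
  show "smooth (\<lambda>z. frechet_derivative f (at z) v)"
    unfolding smooth_def
  proof (intro allI)
    fix vs z
    show "iterated_dir_deriv vs (\<lambda>z. frechet_derivative f (at z) v) differentiable (at z)"
      using assms[unfolded smooth_def, rule_format, of "v # vs" z] by simp
  qed
qed

lemma smooth_has_derivative: "smooth f \<Longrightarrow> (f has_derivative frechet_derivative f (at z)) (at z)"
  using smoothD(1) frechet_derivative_works by blast

lemma has_derivative_frechet_eq: "(f has_derivative f') (at z) \<Longrightarrow> frechet_derivative f (at z) = f'"
  using frechet_derivative_at by metis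

text \<open>Smoothness as a greatest fixed point: it suffices to exhibit a class P of differentiable
  functions that is closed under directional derivatives. Products, compositions and inverses each
  get such a class below.\<close>

lemma smooth_coinduct:
  assumes "P f"
    and step: "\<And>g. P g \<Longrightarrow> \<exists>g'. (\<forall>z. (g has_derivative g' z) (at z)) \<and> (\<forall>v. P (\<lambda>z. g' z v))"
  shows "smooth f"
proof -
  have "iterated_dir_deriv vs g differentiable (at z)" if "P g" for vs g z
    using that
  proof (induction vs arbitrary: g)
    case Nil
    then show ?case using step[OF Nil] by (auto simp: differentiable_def)
  next
    case (Cons v vs)
    obtain g' where g': "\<And>z. (g has_derivative g' z) (at z)" "\<And>v. P (\<lambda>z. g' z v)"
      using step[OF Cons.prems] by blast
    show ?case using Cons.IH[OF g'(2)[of v]] by (simp add: has_derivative_frechet_eq[OF g'(1)])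
  qed
  then show ?thesis using assms(1) by (simp add: smooth_def)
qed

lemma smoothI:
  assumes "\<And>z. (f has_derivative f' z) (at z)" "\<And>v. smooth (\<lambda>z. f' z v)"
  shows "smooth f"
proof (rule smooth_coinduct[where P = "\<lambda>g. g = f \<or> smooth g"])
  fix g assume "g = f \<or> smooth g"
  then show "\<exists>g'. (\<forall>z. (g has_derivative g' z) (at z)) \<and> (\<forall>v. (\<lambda>z. g' z v) = f \<or> smooth (\<lambda>z. g' z v))"
  proof
    assume "g = f"
    then show ?thesis using assms by blast
  next
    assume g: "smooth g"
    then show ?thesis
      by (intro exI[of _ "\<lambda>z. frechet_derivative g (at z)"]) (simp add: smooth_has_derivative smoothD(2))
  qed
qed simp

lemma smooth_const [simp]: "smooth (\<lambda>z. c)"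
  by (rule smooth_coinduct[where P = "\<lambda>g. \<exists>c. g = (\<lambda>z. c)"]) (auto intro!: exI[of _ "\<lambda>z v. 0"])

lemma smooth_linear:
  assumes "bounded_linear h"
  shows "smooth h"
  by (rule smoothI[of h "\<lambda>z. h"]) (simp_all add: bounded_linear_imp_has_derivative assms)

lemma smooth_bounded_linear_compose:
  assumes h: "bounded_linear h" and "smooth f"
  shows "smooth (\<lambda>z. h (f z))"
proof (rule smooth_coinduct[where P = "\<lambda>g. \<exists>f. g = (\<lambda>z. h (f z)) \<and> smooth f"])
  fix g assume "\<exists>f. g = (\<lambda>z. h (f z)) \<and> smooth f"
  then obtain f where f: "g = (\<lambda>z. h (f z))" "smooth f" by blast
  show "\<exists>g'. (\<forall>z. (g has_derivative g' z) (at z)) \<and> (\<forall>v. \<exists>f. (\<lambda>z. g' z v) = (\<lambda>z. h (f z)) \<and> smooth f)"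
    by (rule exI[of _ "\<lambda>z v. h (frechet_derivative f (at z) v)"])
      (use f in \<open>auto intro!: bounded_linear.has_derivative[OF h] smooth_has_derivative
        simp: smoothD(2) intro: exI[of _ "\<lambda>z. frechet_derivative f (at z) _"]\<close>)
qed (use assms in blast)

lemma smooth_add:
  assumes "smooth f" "smooth g"
  shows "smooth (\<lambda>z. f z + g z)"
proof (rule smooth_coinduct[where P = "\<lambda>F. \<exists>f g. F = (\<lambda>z. f z + g z) \<and> smooth f \<and> smooth g"])
  fix F :: "'a \<Rightarrow> 'b" assume "\<exists>f g. F = (\<lambda>z. f z + g z) \<and> smooth f \<and> smooth g"
  then obtain f g where F: "F = (\<lambda>z. f z + g z)" "smooth f" "smooth g" by blast
  show "\<exists>F'. (\<forall>z. (F has_derivative F' z) (at z)) \<and> (\<forall>v. \<exists>f g. (\<lambda>z. F' z v) = (\<lambda>z. f z + g z) \<and> smooth f \<and> smooth g)"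
  proof (intro exI conjI allI)
    show "(F has_derivative (\<lambda>v. frechet_derivative f (at z) v + frechet_derivative g (at z) v)) (at z)" for z
      unfolding F by (intro has_derivative_add smooth_has_derivative F)
  qed (rule refl smoothD(2)[OF F(2)] smoothD(2)[OF F(3)])+
qed (use assms in blast)

lemma smooth_sum: "(\<And>i. i \<in> I \<Longrightarrow> smooth (f i)) \<Longrightarrow> smooth (\<lambda>z. \<Sum>i\<in>I. f i z)"
  by (induction I rule: infinite_finite_induct) (auto intro: smooth_add)

text \<open>The Leibniz rule leaves the set of products but not the set of their finite
  sums.\<close>

inductive prodcl :: "('a::real_normed_vector \<Rightarrow> 'b::real_normed_algebra) \<Rightarrow> bool" where
  prodcl_mult: "smooth f \<Longrightarrow> smooth g \<Longrightarrow> prodcl (\<lambda>z. f z * g z)"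
| prodcl_add: "prodcl F \<Longrightarrow> prodcl G \<Longrightarrow> prodcl (\<lambda>z. F z + G z)"

lemma smooth_mult:
  assumes "smooth f" "smooth g"
  shows "smooth (\<lambda>z. f z * g z :: 'b::real_normed_algebra)"
proof (rule smooth_coinduct[where P = prodcl])
  show "\<exists>F'. (\<forall>z. (F has_derivative F' z) (at z)) \<and> (\<forall>v. prodcl (\<lambda>z. F' z v))" if "prodcl F" for F :: "'a \<Rightarrow> 'b"
    using that
  proof induction
    case (prodcl_mult f g)
    show ?case
    proof (intro exI conjI allI)
      show "((\<lambda>z. f z * g z) has_derivative
          (\<lambda>v. f z * frechet_derivative g (at z) v + frechet_derivative f (at z) v * g z)) (at z)" for z
        by (intro has_derivative_mult smooth_has_derivative prodcl_mult)
    qed (intro prodcl.intros smoothD(2) prodcl_mult)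
  next
    case (prodcl_add F G)
    then obtain F' G' where "\<And>z. (F has_derivative F' z) (at z)" "\<And>v. prodcl (\<lambda>z. F' z v)"
      "\<And>z. (G has_derivative G' z) (at z)" "\<And>v. prodcl (\<lambda>z. G' z v)" by blast
    then show ?case
      by (intro exI[of _ "\<lambda>z v. F' z v + G' z v"]) (auto intro: has_derivative_add prodcl.intros)
  qed
qed (intro prodcl_mult assms)

lemma smooth_minus: "smooth f \<Longrightarrow> smooth (\<lambda>z. - f z)"
  by (rule smooth_bounded_linear_compose[OF bounded_linear_minus[OF bounded_linear_ident]])

lemma smooth_diff: "smooth f \<Longrightarrow> smooth g \<Longrightarrow> smooth (\<lambda>z. f z - g z)"
  using smooth_add[of f "\<lambda>z. - g z"] smooth_minus[of g] by simp

lemma smooth_power: "smooth f \<Longrightarrow> smooth (\<lambda>z. f z ^ k :: 'b::real_normed_algebra_1)"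
  by (induction k) (simp_all add: smooth_mult)

lemma smooth_of_real: "smooth f \<Longrightarrow> smooth (\<lambda>z. of_real (f z) :: 'b::{real_normed_algebra_1})"
  by (rule smooth_bounded_linear_compose[OF bounded_linear_of_real])

lemma smooth_of_real_iff: "smooth (\<lambda>z. complex_of_real (f z)) \<longleftrightarrow> smooth f"
  using smooth_bounded_linear_compose[OF bounded_linear_Re, of "\<lambda>z. complex_of_real (f z)"]
    smooth_of_real[of f] by auto

section \<open>Functions of one real variable, composition and inverse\<close>

definition rderiv :: "(real \<Rightarrow> real) \<Rightarrow> real \<Rightarrow> real" where
  "rderiv h s = frechet_derivative h (at s) 1"

lemma smooth_rderiv: "smooth h \<Longrightarrow> smooth (rderiv h)"
  unfolding rderiv_def[abs_def] by (rule smoothD(2))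

lemma frechet_rderiv:
  assumes "smooth h"
  shows "frechet_derivative h (at s) v = rderiv h s * v"
proof -
  have "linear (frechet_derivative h (at s))"
    using smooth_has_derivative[OF assms] by (rule has_derivative_linear)
  from linear_scale[OF this, of v 1] show ?thesis by (simp add: rderiv_def)
qed

lemma smooth_has_rderiv: "smooth h \<Longrightarrow> (h has_real_derivative rderiv h s) (at s)"
proof -
  assume h: "smooth h"
  have "frechet_derivative h (at s) = (*) (rderiv h s)"
    by (rule ext) (rule frechet_rderiv[OF h])
  then show ?thesis using smooth_has_derivative[OF h, of s] by (simp add: has_field_derivative_def)
qed

text \<open>Both factors must vary: the derivative of g h(f) is g' h(f) + (g f') h'(f), of the same
  shape with new g and new h.\<close>

inductive compcl :: "('a::real_normed_vector \<Rightarrow> real) \<Rightarrow> ('a \<Rightarrow> real) \<Rightarrow> bool" for f where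
  compcl_base: "smooth g \<Longrightarrow> smooth h \<Longrightarrow> compcl f (\<lambda>z. g z * h (f z))"
| compcl_add: "compcl f F \<Longrightarrow> compcl f G \<Longrightarrow> compcl f (\<lambda>z. F z + G z)"

lemma smooth_compose_real:
  fixes h :: "real \<Rightarrow> real"
  assumes h: "smooth h" and f: "smooth f"
  shows "smooth (\<lambda>z. h (f z))"
proof -
  have "smooth (\<lambda>z. 1 * h (f z))"
  proof (rule smooth_coinduct[where P = "compcl f"])
    show "\<exists>F'. (\<forall>z. (F has_derivative F' z) (at z)) \<and> (\<forall>v. compcl f (\<lambda>z. F' z v))" if "compcl f F" for F
      using that
    proof induction
      case (compcl_base g h)
      define f' where "f' z = frechet_derivative f (at z)" for z
      define g' where "g' z = frechet_derivative g (at z)" for z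
      have d: "((\<lambda>z. h (f z)) has_derivative (\<lambda>v. rderiv h (f z) * f' z v)) (at z)" for z
        using has_derivative_compose[OF smooth_has_derivative[OF f] smooth_has_derivative[OF compcl_base(2)]]
        by (simp add: frechet_rderiv[OF compcl_base(2)] f'_def)
      show ?case
      proof (intro exI conjI allI)
        have "((\<lambda>z. g z * h (f z)) has_derivative (\<lambda>v. g z * (rderiv h (f z) * f' z v) + g' z v * h (f z))) (at z)" for z
          unfolding g'_def by (intro has_derivative_mult d smooth_has_derivative compcl_base)
        then show "((\<lambda>z. g z * h (f z)) has_derivative (\<lambda>v. g' z v * h (f z) + (g z * f' z v) * rderiv h (f z))) (at z)" for z
          by (simp add: algebra_simps)
        show "compcl f (\<lambda>z. g' z v * h (f z) + (g z * f' z v) * rderiv h (f z))" for v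
          unfolding g'_def f'_def by (intro compcl.intros smooth_mult smoothD(2) smooth_rderiv compcl_base f)
      qed
    next
      case (compcl_add F G)
      then obtain F' G' where "\<And>z. (F has_derivative F' z) (at z)" "\<And>v. compcl f (\<lambda>z. F' z v)"
        "\<And>z. (G has_derivative G' z) (at z)" "\<And>v. compcl f (\<lambda>z. G' z v)" by blast
      then show ?case
        by (intro exI[of _ "\<lambda>z v. F' z v + G' z v"]) (auto intro: has_derivative_add compcl.intros)
    qed
  qed (intro compcl_base h smooth_const)
  then show ?thesis by simp
qed

text \<open>Arbitrary powers k are included because each derivative of f^-k raises k by one; the
  factor -k f' goes into the smooth coefficient.\<close>

inductive invcl :: "('a::real_normed_vector \<Rightarrow> real) \<Rightarrow> ('a \<Rightarrow> real) \<Rightarrow> bool" for f where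
  invcl_base: "smooth g \<Longrightarrow> invcl f (\<lambda>z. g z * inverse (f z) ^ k)"
| invcl_add: "invcl f F \<Longrightarrow> invcl f G \<Longrightarrow> invcl f (\<lambda>z. F z + G z)"

lemma smooth_inverse:
  fixes f :: "'a::real_normed_vector \<Rightarrow> real"
  assumes f: "smooth f" and nz: "\<And>z. f z \<noteq> 0"
  shows "smooth (\<lambda>z. inverse (f z))"
proof -
  have "smooth (\<lambda>z. 1 * inverse (f z) ^ 1)"
  proof (rule smooth_coinduct[where P = "invcl f"])
    show "\<exists>F'. (\<forall>z. (F has_derivative F' z) (at z)) \<and> (\<forall>v. invcl f (\<lambda>z. F' z v))" if "invcl f F" for F
      using that
    proof induction
      case (invcl_base g k)
      define f' where "f' z = frechet_derivative f (at z)" for z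
      define g' where "g' z = frechet_derivative g (at z)" for z
      have fd: "(f has_derivative f' z) (at z)" for z
        unfolding f'_def by (rule smooth_has_derivative[OF f])
      have d: "((\<lambda>z. inverse (f z) ^ k) has_derivative (\<lambda>v. - real k * f' z v * inverse (f z) ^ Suc k)) (at z)" for z
      proof (induction k)
        case (Suc k)
        have i: "((\<lambda>z. inverse (f z)) has_derivative (\<lambda>v. - (inverse (f z) * f' z v * inverse (f z)))) (at z)"
          by (rule Deriv.has_derivative_inverse[OF nz fd])
        have "((\<lambda>z. inverse (f z) * inverse (f z) ^ k) has_derivative
            (\<lambda>v. inverse (f z) * (- real k * f' z v * inverse (f z) ^ Suc k) +
               - (inverse (f z) * f' z v * inverse (f z)) * inverse (f z) ^ k)) (at z)"
          by (intro has_derivative_mult i Suc.IH)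
        then show ?case by (simp add: algebra_simps)
      qed simp
      show ?case
      proof (intro exI conjI allI)
        have "((\<lambda>z. g z * inverse (f z) ^ k) has_derivative
            (\<lambda>v. g z * (- real k * f' z v * inverse (f z) ^ Suc k) + g' z v * inverse (f z) ^ k)) (at z)" for z
          unfolding g'_def by (intro has_derivative_mult d smooth_has_derivative invcl_base)
        then show "((\<lambda>z. g z * inverse (f z) ^ k) has_derivative
            (\<lambda>v. g' z v * inverse (f z) ^ k + (- real k * (g z * f' z v)) * inverse (f z) ^ Suc k)) (at z)" for z
          by (simp add: algebra_simps)
        show "invcl f (\<lambda>z. g' z v * inverse (f z) ^ k + (- real k * (g z * f' z v)) * inverse (f z) ^ Suc k)" for v
          unfolding g'_def f'_def by (intro invcl.intros smooth_mult smoothD(2) smooth_const invcl_base f)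
      qed
    next
      case (invcl_add F G)
      then obtain F' G' where "\<And>z. (F has_derivative F' z) (at z)" "\<And>v. invcl f (\<lambda>z. F' z v)"
        "\<And>z. (G has_derivative G' z) (at z)" "\<And>v. invcl f (\<lambda>z. G' z v)" by blast
      then show ?case
        by (intro exI[of _ "\<lambda>z v. F' z v + G' z v"]) (auto intro: has_derivative_add invcl.intros)
    qed
  qed (intro invcl_base smooth_const)
  then show ?thesis by simp
qed

section \<open>The squared norm and a smooth step function\<close>

lemma smooth_norm_square: "smooth (\<lambda>z :: 'a::real_inner. (norm (z - y))\<^sup>2)"
proof (rule smoothI[of _ "\<lambda>z v. 2 * ((z - y) \<bullet> v)"])
  show "((\<lambda>z. (norm (z - y))\<^sup>2) has_derivative (\<lambda>v. 2 * ((z - y) \<bullet> v))) (at z)" for z :: 'a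
    unfolding power2_norm_eq_inner by (auto intro!: derivative_eq_intros simp: inner_commute)
  show "smooth (\<lambda>z. 2 * ((z - y) \<bullet> v))" for v
    unfolding inner_diff_left
    by (intro smooth_mult smooth_const smooth_diff smooth_linear bounded_linear_inner_left)
qed

text \<open>The classical flat function exp(-1/s) is \<open>bump 0\<close>. The negative powers are
  carried along because the derivative of \<open>bump k\<close> is a combination of
  \<open>bump (k + 2)\<close> and \<open>bump (k + 1)\<close>.\<close>

definition bump :: "nat \<Rightarrow> real \<Rightarrow> real" where
  "bump k s = (if s \<le> 0 then 0 else inverse s ^ k * exp (- inverse s))"

lemma power_div_fact_le_exp: "0 \<le> x \<Longrightarrow> x ^ k / fact k \<le> exp (x :: real)"
proof -
  assume x: "0 \<le> x"
  have "(\<Sum>i\<in>{k}. x ^ i /\<^sub>R fact i) \<le> (\<Sum>i. x ^ i /\<^sub>R fact i)"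
    by (rule sum_le_suminf) (use x sums_summable[OF exp_converges[of x]] in auto)
  then show ?thesis by (simp add: exp_def field_simps)
qed

text \<open>Follows from exp(x) >= x^(k+2) / (k+2)! at x = 1/s. The order s^2 makes the difference
  quotient at 0 tend to 0.\<close>

lemma bump_bound: "\<bar>bump k s\<bar> \<le> fact (k + 2) * s\<^sup>2"
proof (cases "s \<le> 0")
  case False
  then have s: "0 < s" by simp
  have "inverse s ^ (k + 2) / fact (k + 2) \<le> exp (inverse s)"
    by (rule power_div_fact_le_exp) (use s in simp)
  then have "inverse s ^ (k + 2) \<le> fact (k + 2) * exp (inverse s)"
    by (simp add: divide_le_eq mult.commute del: fact_Suc power_Suc power_inverse)
  then have "inverse s ^ (k + 2) * exp (- inverse s) \<le> fact (k + 2) * exp (inverse s) * exp (- inverse s)"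
    by (rule mult_right_mono) simp
  then have "inverse s ^ (k + 2) * exp (- inverse s) \<le> fact (k + 2)"
    by (simp add: mult.assoc mult_exp_exp del: fact_Suc power_Suc power_inverse)
  then have "inverse s ^ (k + 2) * exp (- inverse s) * s\<^sup>2 \<le> fact (k + 2) * s\<^sup>2"
    by (rule mult_right_mono) simp
  moreover have "inverse s ^ (k + 2) * exp (- inverse s) * s\<^sup>2 = inverse s ^ k * exp (- inverse s)"
    using s by (simp add: power2_eq_square field_simps)
  ultimately have "inverse s ^ k * exp (- inverse s) \<le> fact (k + 2) * s\<^sup>2"
    by (simp only:)
  then show ?thesis using s by (simp add: bump_def del: fact_Suc)
qed (simp add: bump_def)

lemma DERIV_inverse_power_nat:
  "s \<noteq> 0 \<Longrightarrow> ((\<lambda>s. inverse s ^ k) has_real_derivative - real k * inverse s ^ Suc k) (at s)"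
proof (induction k)
  case (Suc k)
  have "((\<lambda>s. inverse s * inverse s ^ k) has_real_derivative
      inverse s * (- real k * inverse s ^ Suc k) + - (inverse s ^ Suc (Suc 0)) * inverse s ^ k) (at s)"
    using Suc by (intro DERIV_mult' DERIV_inverse) auto
  then show ?case by (simp add: algebra_simps)
qed simp

lemma bump_deriv: "(bump k has_real_derivative (bump (k + 2) s - k * bump (k + 1) s)) (at s)"
proof -
  consider "s < 0" | "s = 0" | "s > 0" by linarith
  then show ?thesis
  proof cases
    case 1
    have "((\<lambda>s. 0) has_real_derivative 0) (at s)" by simp
    then have "(bump k has_real_derivative 0) (at s)"
      by (rule has_field_derivative_transform_within_open[where S = "{..<0}"]) (use 1 in \<open>auto simp: bump_def\<close>)
    then show ?thesis using 1 by (simp add: bump_def)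
  next
    case 2
    have "(\<lambda>h. bump k (0 + h) / h) \<midarrow>0\<rightarrow> 0"
    proof (rule Lim_null_comparison[where g = "\<lambda>h. fact (k + 2) * \<bar>h\<bar>"])
      show "\<forall>\<^sub>F h in at 0. norm (bump k (0 + h) / h) \<le> fact (k + 2) * \<bar>h\<bar>"
      proof (intro always_eventually allI)
        fix h :: real
        have "\<bar>bump k h\<bar> \<le> fact (k + 2) * \<bar>h\<bar> * \<bar>h\<bar>"
          using bump_bound[of k h] by (simp add: power2_eq_square mult.assoc del: fact_Suc)
        then show "norm (bump k (0 + h) / h) \<le> fact (k + 2) * \<bar>h\<bar>"
          by (cases "h = 0") (simp_all add: divide_le_eq del: fact_Suc)
      qed
      show "(\<lambda>h :: real. fact (k + 2) * \<bar>h\<bar>) \<midarrow>0\<rightarrow> 0"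
        by (auto intro!: tendsto_eq_intros simp del: fact_Suc)
    qed
    then show ?thesis using 2 by (simp add: DERIV_def bump_def)
  next
    case 3
    have "((\<lambda>s. inverse s ^ k * exp (- inverse s)) has_real_derivative
        (inverse s ^ (k + 2) * exp (- inverse s) - k * (inverse s ^ (k + 1) * exp (- inverse s)))) (at s)"
    proof -
      have "((\<lambda>s. exp (- inverse s)) has_real_derivative exp (- inverse s) * inverse s ^ 2) (at s)"
        using 3 by (auto intro!: derivative_eq_intros simp: power2_eq_square)
      from DERIV_mult'[OF DERIV_inverse_power_nat this, of k] 3 show ?thesis
        by (simp add: algebra_simps power_add power2_eq_square)
    qed
    then have "(bump k has_real_derivative
        (inverse s ^ (k + 2) * exp (- inverse s) - k * (inverse s ^ (k + 1) * exp (- inverse s)))) (at s)"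
      by (rule has_field_derivative_transform_within_open[where S = "{0<..}"]) (use 3 in \<open>auto simp: bump_def\<close>)
    then show ?thesis using 3 by (simp add: bump_def)
  qed
qed

inductive bumpcl :: "(real \<Rightarrow> real) \<Rightarrow> bool" where
  bumpcl_base: "bumpcl (\<lambda>s. c * bump k s)"
| bumpcl_add: "bumpcl F \<Longrightarrow> bumpcl G \<Longrightarrow> bumpcl (\<lambda>z. F z + G z)"

lemma smooth_bump: "smooth (bump k)"
proof -
  have "smooth (\<lambda>s. 1 * bump k s)"
  proof (rule smooth_coinduct[where P = bumpcl])
    show "\<exists>F'. (\<forall>z. (F has_derivative F' z) (at z)) \<and> (\<forall>v. bumpcl (\<lambda>z. F' z v))" if "bumpcl F" for F
      using that
    proof induction
      case (bumpcl_base c k)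
      show ?case
      proof (intro exI conjI allI)
        have "((\<lambda>s. c * bump k s) has_real_derivative c * (bump (k + 2) s - k * bump (k + 1) s)) (at s)" for s
          by (rule DERIV_cmult[OF bump_deriv])
        then show "((\<lambda>s. c * bump k s) has_derivative
            (\<lambda>v. (c * v) * bump (k + 2) s + (- c * v * k) * bump (k + 1) s)) (at s)" for s
          unfolding has_field_derivative_def
          by (rule has_derivative_eq_rhs) (simp add: fun_eq_iff algebra_simps)
      qed (intro bumpcl.intros)
    next
      case (bumpcl_add F G)
      then obtain F' G' where "\<And>z. (F has_derivative F' z) (at z)" "\<And>v. bumpcl (\<lambda>z. F' z v)"
        "\<And>z. (G has_derivative G' z) (at z)" "\<And>v. bumpcl (\<lambda>z. G' z v)" by blast
      then show ?case
        by (intro exI[of _ "\<lambda>z v. F' z v + G' z v"]) (auto intro: has_derivative_add bumpcl.intros)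
    qed
  qed (rule bumpcl_base)
  then show ?thesis by simp
qed

definition step :: "real \<Rightarrow> real" where
  "step s = bump 0 s * inverse (bump 0 s + bump 0 (1 - s))"

lemma bump_nonneg: "0 \<le> bump k s"
  by (simp add: bump_def)

lemma bump_denominator_pos: "0 < bump 0 s + bump 0 (1 - s)"
  by (auto simp: bump_def intro: add_pos_pos)

lemma step_simps:
  "s \<le> 0 \<Longrightarrow> step s = 0" "1 \<le> s \<Longrightarrow> step s = 1" "0 \<le> step s" "step s \<le> 1"
proof -
  show "s \<le> 0 \<Longrightarrow> step s = 0" by (simp add: step_def bump_def)
  show "1 \<le> s \<Longrightarrow> step s = 1" by (simp add: step_def bump_def)
  show "0 \<le> step s" "step s \<le> 1"
    unfolding step_def divide_inverse[symmetric]
    using bump_nonneg[of 0 s] bump_nonneg[of 0 "1 - s"] bump_denominator_pos[of s]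
    by (auto simp: divide_le_eq)
qed

lemma smooth_step: "smooth step"
  unfolding step_def[abs_def]
proof (intro smooth_mult smooth_inverse smooth_add smooth_bump)
  show "smooth (\<lambda>s. bump 0 (1 - s))"
    by (intro smooth_compose_real[OF smooth_bump] smooth_diff smooth_const smooth_linear bounded_linear_ident)
  show "bump 0 s + bump 0 (1 - s) \<noteq> 0" for s
    using bump_denominator_pos[of s] by simp
qed

lemma smooth_continuous_on: "smooth f \<Longrightarrow> continuous_on S f"
  by (intro continuous_at_imp_continuous_on ballI differentiable_imp_continuous_within smoothD(1))

subsection \<open>Testing against radial forms\<close>

lemma smooth_twice_diff: "smooth f \<Longrightarrow> twice_diff f"
  by (simp add: twice_diff_def smoothD)

lemma D2_of_real:
  assumes "twice_diff (g :: 'a::euclidean_space \<Rightarrow> real)"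
  shows "D2 (\<lambda>z. of_real (g z) :: complex) z u v = of_real (D2 g z u v)"
proof -
  have d: "((\<lambda>z. of_real (g z) :: complex) has_derivative (\<lambda>v. of_real (frechet_derivative g (at z) v))) (at z)" for z
    using assms unfolding twice_diff_def
    by (intro has_derivative_of_real) (simp add: frechet_derivative_works[symmetric])
  have "((\<lambda>z. of_real (frechet_derivative g (at z) v) :: complex) has_derivative (\<lambda>u. of_real (D2 g z u v))) (at z)"
    using assms unfolding twice_diff_def D2_def
    by (intro has_derivative_of_real) (simp add: frechet_derivative_works[symmetric])
  from frechet_eqI[OF this] show ?thesis
    unfolding D2_def[of "\<lambda>z. of_real (g z)"] frechet_eqI[OF d] by simp
qed

lemma Lap_of_real: "twice_diff g \<Longrightarrow> Lap (\<lambda>z. of_real (g z) :: complex) z = of_real (Lap g z)"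
  by (simp add: Lap_def D2_of_real)

lemma D2_sum:
  assumes "\<And>i. i \<in> I \<Longrightarrow> twice_diff (f i)"
  shows "D2 (\<lambda>z. \<Sum>i\<in>I. f i z) z u v = (\<Sum>i\<in>I. D2 (f i) z u v)"
proof -
  have d: "((\<lambda>z. \<Sum>i\<in>I. f i z) has_derivative (\<lambda>v. \<Sum>i\<in>I. frechet_derivative (f i) (at z) v)) (at z)" for z
    using assms unfolding twice_diff_def
    by (intro has_derivative_sum) (simp add: frechet_derivative_works[symmetric])
  have "((\<lambda>z. \<Sum>i\<in>I. frechet_derivative (f i) (at z) v) has_derivative (\<lambda>u. \<Sum>i\<in>I. D2 (f i) z u v)) (at z)"
    using assms unfolding twice_diff_def D2_def
    by (intro has_derivative_sum) (simp add: frechet_derivative_works[symmetric])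
  from frechet_eqI[OF this] show ?thesis
    unfolding D2_def[of "\<lambda>z. \<Sum>i\<in>I. f i z"] frechet_eqI[OF d] by simp
qed

text \<open>The factor relating \<open>dd\<^sup>c g \<and> \<beta>\<^sup>n\<^sup>-\<^sup>1\<close> to the Laplacian of \<open>g\<close>.\<close>

definition trace_const :: "'n::finite itself \<Rightarrow> real" where
  "trace_const _ = fact CARD('n) / pi ^ CARD('n) / (4 * CARD('n))"

lemma trace_const_pos: "trace_const TYPE('n::finite) > 0"
  by (simp add: trace_const_def)

lemma vol_coeff_ddc_sum:
  fixes c :: "'i \<Rightarrow> complex ^ 'n::finite \<Rightarrow> complex"
  assumes "\<And>i. i \<in> I \<Longrightarrow> twice_diff (c i)"
  shows "vol_coeff (ddc (\<lambda>w vs. \<Sum>i\<in>I. c i w * D i vs) z) =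
    (\<Sum>i\<in>I. \<Sum>b\<in>Basis. vol_coeff (wedge (lform (\<lambda>u. of_real (u \<bullet> b)))
        (wedge (lform (\<lambda>u. - (1 / (4 * of_real pi)) * D2 (c i) z b (\<i> *s u))) (D i))))"
  unfolding vol_coeff_def by (rule ddc_sum[OF assms])

lemma vol_ddc_scalar_beta:
  fixes g :: "complex ^ 'n::finite \<Rightarrow> real"
  assumes g: "twice_diff g"
  shows "vol_coeff (ddc (\<lambda>w vs. of_real (g w) * wedge_power beta (CARD('n) - 1) vs) z) = of_real (trace_const TYPE('n) * Lap g z)"
proof -
  have td: "twice_diff (\<lambda>z. complex_of_real (g z))"
  proof -
    have d: "((\<lambda>z. of_real (g z) :: complex) has_derivative (\<lambda>v. of_real (frechet_derivative g (at z) v))) (at z)" for z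
      using g unfolding twice_diff_def
      by (intro has_derivative_of_real) (simp add: frechet_derivative_works[symmetric])
    have "((\<lambda>z. of_real (frechet_derivative g (at z) v) :: complex) has_derivative (\<lambda>u. of_real (D2 g z u v))) (at z)" for z v
      using g unfolding twice_diff_def D2_def
      by (intro has_derivative_of_real) (simp add: frechet_derivative_works[symmetric])
    with d show ?thesis unfolding twice_diff_def frechet_eqI[OF d] by (auto simp: differentiable_def)
  qed
  have "vol_coeff (ddc (\<lambda>w vs. \<Sum>i\<in>{()}. of_real (g w) * wedge_power beta (CARD('n) - 1) vs) z) =
     (\<Sum>b\<in>Basis. vol_coeff (wedge (lform (\<lambda>u. of_real (u \<bullet> b)))
        (wedge (lform (\<lambda>u. - (1 / (4 * of_real pi)) * D2 (\<lambda>w. complex_of_real (g w)) z b (\<i> *s u)))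
         (wedge_power beta (CARD('n) - 1) :: 'n covec))))"
    by (subst vol_coeff_ddc_sum) (use td in simp_all)
  also have "\<dots> = of_real (Lap g z) * of_real (fact CARD('n) / pi ^ CARD('n)) / (4 * of_nat CARD('n))"
    using vol_ddc_beta[OF td, of z] unfolding vol_coeff_beta_power Lap_of_real[OF g] by (simp add: field_simps)
  also have "\<dots> = of_real (trace_const TYPE('n) * Lap g z)"
    by (simp add: trace_const_def)
  finally show ?thesis by simp
qed

lemma vol_ddc_theta_sum:
  fixes a :: "complex ^ 'n::finite \<Rightarrow> real" and s :: "complex ^ 'n \<Rightarrow> complex ^ 'n \<Rightarrow> complex ^ 'n \<Rightarrow> real"
  assumes a: "smooth a" and s: "\<And>b b'. smooth (s b b')" and n: "2 \<le> CARD('n)"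
  shows "vol_coeff (ddc (\<lambda>w vs. of_real (a w) * wedge_power beta (CARD('n) - 1) vs +
      of_real k * (\<Sum>b\<in>Basis. \<Sum>b'\<in>Basis. of_real (s b b' w) * wedge (theta b b') (wedge_power beta (CARD('n) - 2)) vs)) z)
    = of_real (trace_const TYPE('n) * (Lap a z + k / (CARD('n) - 1) *
       (\<Sum>b\<in>Basis. \<Sum>b'\<in>Basis. (b \<bullet> b') * Lap (s b b') z - D2 (s b b') z b' b - D2 (s b b') z (\<i> *s b) (\<i> *s b'))))"
proof -
  \<comment> \<open>A single index set brings both summands under the rule for finite sums:
    \<open>None\<close> indexes the term with \<open>a\<close>, and \<open>Some (b, b')\<close> the
    terms with \<open>theta b b'\<close>.\<close>
  define I :: "((complex ^ 'n) \<times> (complex ^ 'n)) option set" where "I = insert None (Some ` (Basis \<times> Basis))"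
  define c where "c i w = (case i of None \<Rightarrow> complex_of_real (a w) | Some (b, b') \<Rightarrow> complex_of_real (s b b' w))" for i w
  define D :: "_ \<Rightarrow> 'n covec" where "D i = (case i of None \<Rightarrow> wedge_power beta (CARD('n) - 1)
     | Some (b, b') \<Rightarrow> (\<lambda>vs. of_real k * wedge (theta b b') (wedge_power beta (CARD('n) - 2)) vs))" for i
  have sumI: "(\<Sum>i\<in>I. F i) = F None + (\<Sum>b\<in>Basis. \<Sum>b'\<in>Basis. F (Some (b, b')))" for F :: "_ \<Rightarrow> complex"
    unfolding I_def by (subst sum.insert) (auto simp: sum.reindex sum.cartesian_product)
  have tda: "twice_diff (\<lambda>z. complex_of_real (a z))" and tds: "twice_diff (\<lambda>z. complex_of_real (s b b' z))" for b b'
    by (intro smooth_twice_diff smooth_of_real a s)+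
  have td: "twice_diff (c i)" for i
    using tda tds by (cases i) (auto simp: c_def[abs_def])
  have 1: "(\<Sum>d\<in>Basis. vol_coeff (wedge (lform (\<lambda>u. of_real (u \<bullet> d)))
        (wedge (lform (\<lambda>u. - (1 / (4 * of_real pi)) * D2 (\<lambda>w. complex_of_real (a w)) z d (\<i> *s u)))
         (wedge_power beta (CARD('n) - 1) :: 'n covec)))) = of_real (trace_const TYPE('n) * Lap a z)"
    using vol_ddc_beta[OF tda, of z] unfolding vol_coeff_beta_power Lap_of_real[OF smooth_twice_diff[OF a]]
    by (simp add: field_simps trace_const_def)
  have 2: "(\<Sum>d\<in>Basis. vol_coeff (wedge (lform (\<lambda>u. of_real (u \<bullet> d)))
        (wedge (lform (\<lambda>u. - (1 / (4 * of_real pi)) * D2 (\<lambda>w. complex_of_real (s b b' w)) z d (\<i> *s u)))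
         (\<lambda>vs. of_real k * wedge (theta b b') (wedge_power beta (CARD('n) - 2)) vs)))) =
      of_real (trace_const TYPE('n) * (k / (CARD('n) - 1) *
        ((b \<bullet> b') * Lap (s b b') z - D2 (s b b') z b' b - D2 (s b b') z (\<i> *s b) (\<i> *s b'))))" for b b'
  proof -
    define X where "X = (\<Sum>d\<in>Basis. vol_coeff (wedge (lform (\<lambda>u. of_real (u \<bullet> d)))
        (wedge (lform (\<lambda>u. - (1 / (4 * of_real pi)) * D2 (\<lambda>w. complex_of_real (s b b' w)) z d (\<i> *s u)))
         (wedge (theta b b') (wedge_power beta (CARD('n) - 2))))))"
    have "4 * of_nat CARD('n) * of_nat (CARD('n) - 1) * X = of_real (((b \<bullet> b') * Lap (s b b') z - D2 (s b b') z b' b - D2 (s b b') z (\<i> *s b) (\<i> *s b'))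
        * (fact CARD('n) / pi ^ CARD('n)))"
      unfolding X_def by (subst vol_ddc_theta[OF tds])
        (simp add: vol_coeff_beta_power Lap_of_real[OF smooth_twice_diff[OF s]] D2_of_real[OF smooth_twice_diff[OF s]])
    note eq = this
    have nz: "4 * complex_of_nat CARD('n) * complex_of_nat (CARD('n) - 1) \<noteq> 0" using n by simp
    have "X = of_real (((b \<bullet> b') * Lap (s b b') z - D2 (s b b') z b' b - D2 (s b b') z (\<i> *s b) (\<i> *s b'))
        * (fact CARD('n) / pi ^ CARD('n))) / (4 * of_nat CARD('n) * of_nat (CARD('n) - 1))"
      unfolding nonzero_eq_divide_eq[OF nz] by (subst mult.commute) (rule eq)
    moreover have "(\<Sum>d\<in>Basis. vol_coeff (wedge (lform (\<lambda>u. of_real (u \<bullet> d)))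
        (wedge (lform (\<lambda>u. - (1 / (4 * of_real pi)) * D2 (\<lambda>w. complex_of_real (s b b' w)) z d (\<i> *s u)))
         (\<lambda>vs. of_real k * wedge (theta b b') (wedge_power beta (CARD('n) - 2)) vs)))) = of_real k * X"
      unfolding X_def sum_distrib_left by (simp only: wedge_scale_right vol_coeff_lin)
    ultimately show ?thesis
      using n by (simp add: trace_const_def of_nat_diff mult_ac)
  qed
  have "(\<lambda>w vs. of_real (a w) * wedge_power beta (CARD('n) - 1) vs +
      of_real k * (\<Sum>b\<in>Basis. \<Sum>b'\<in>Basis. of_real (s b b' w) * wedge (theta b b') (wedge_power beta (CARD('n) - 2)) vs))
    = (\<lambda>w vs. \<Sum>i\<in>I. c i w * D i vs)"
    unfolding sumI by (simp add: c_def D_def sum_distrib_left mult_ac)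
  note form = this
  have cD: "c None = (\<lambda>w. complex_of_real (a w))" "c (Some (b, b')) = (\<lambda>w. complex_of_real (s b b' w))"
    "D None = wedge_power beta (CARD('n) - 1)"
    "D (Some (b, b')) = (\<lambda>vs. of_real k * wedge (theta b b') (wedge_power beta (CARD('n) - 2)) vs)" for b b'
    by (simp_all add: c_def[abs_def] D_def)
  show ?thesis
    unfolding form vol_coeff_ddc_sum[OF td]
    unfolding sumI cD 1 2
    by (simp only: of_real_sum[symmetric] of_real_add[symmetric] sum_distrib_left[symmetric] distrib_left[symmetric])
qed

section \<open>Expansion of \<open>theta v v\<close> in constant forms\<close>

lemma inner_Basis_expand: "v \<bullet> u = (\<Sum>b\<in>Basis. (v \<bullet> b) * (b \<bullet> u))"
proof -
  have "v \<bullet> u = (\<Sum>b\<in>Basis. (v \<bullet> b) * (u \<bullet> b))" by (rule euclidean_inner)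
  also have "\<dots> = (\<Sum>b\<in>Basis. (v \<bullet> b) * (b \<bullet> u))"
    by (intro sum.cong refl arg_cong2[of _ _ _ _ "(*)"] inner_commute)
  finally show ?thesis .
qed

lemma lform_sum: "lform (\<lambda>u. \<Sum>b\<in>I. c b * \<xi> b u) vs = (\<Sum>b\<in>I. c b * lform (\<xi> b) vs)"
  by (auto simp: lform_def split: list.split)

lemma pform_expand: "pform v = (\<lambda>vs. \<Sum>b\<in>Basis. of_real (v \<bullet> b) * pform b vs)"
proof -
  have "(\<lambda>u. complex_of_real (v \<bullet> u)) = (\<lambda>u. \<Sum>b\<in>Basis. of_real (v \<bullet> b) * of_real (b \<bullet> u))"
    proof
    fix u
    show "complex_of_real (v \<bullet> u) = (\<Sum>b\<in>Basis. of_real (v \<bullet> b) * of_real (b \<bullet> u))"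
      by (simp only: inner_Basis_expand[of v u] of_real_sum of_real_mult)
  qed
  then show ?thesis unfolding pform_def lform_sum[symmetric] by simp
qed

lemma pform_J_expand: "pform (\<i> *s v) = (\<lambda>vs. \<Sum>b\<in>Basis. of_real (v \<bullet> b) * pform (\<i> *s b) vs)"
proof -
  have "(\<i> *s v) \<bullet> u = (\<Sum>b\<in>Basis. (v \<bullet> b) * ((\<i> *s b) \<bullet> u))" for u
    by (simp only: inner_J_left inner_Basis_expand[of v "\<i> *s u"] sum_negf mult_minus_right)
  then have "(\<lambda>u. complex_of_real ((\<i> *s v) \<bullet> u)) = (\<lambda>u. \<Sum>b\<in>Basis. of_real (v \<bullet> b) * of_real ((\<i> *s b) \<bullet> u))"
    by simp
  then show ?thesis unfolding pform_def lform_sum[symmetric] by simp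
qed

text \<open>The coefficients are polynomial in v. For v = z - y they are smooth in z also at the
  centre, whereas the unit direction is singular there.\<close>

lemma theta_expand:
  "theta v v = (\<lambda>vs. \<Sum>b\<in>Basis. \<Sum>b'\<in>Basis. of_real ((v \<bullet> b) * (v \<bullet> b')) * theta b b' vs)"
proof -
  have "wedge (pform v) (pform (\<i> *s v)) =
      (\<lambda>vs. \<Sum>b\<in>Basis. of_real (v \<bullet> b) * (\<Sum>b'\<in>Basis. of_real (v \<bullet> b') * wedge (pform b) (pform (\<i> *s b')) vs))"
    by (subst pform_expand, subst pform_J_expand)
      (simp only: wedge_sum_left wedge_scale_left wedge_sum_right wedge_scale_right)
  then show ?thesis unfolding theta_def by (simp add: sum_distrib_left mult_ac)
qed

lemma theta_scaleR: "theta (r *\<^sub>R v) (r *\<^sub>R v) = (\<lambda>vs. of_real (r\<^sup>2) * theta v v vs)"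
proof -
  have "pform (r *\<^sub>R u) = (\<lambda>vs. of_real r * pform u vs)" for u :: "complex ^ 'a"
    by (auto simp: pform_def lform_def fun_eq_iff split: list.split)
  then show ?thesis
    unfolding theta_def J_scaleR by (simp add: wedge_scale_left wedge_scale_right power2_eq_square mult_ac)
qed

text \<open>The definition asks for exactly n choose q summands. This number is positive since q <=
  n, so the power is placed first with coefficient r and the remaining summands get coefficient
  0.\<close>

lemma strongly_m_positive_power:
  assumes "m_positive m \<gamma>" "q \<le> CARD('n)" "0 \<le> r"
  shows "strongly_m_positive m q (\<lambda>vs. of_real r * wedge_power (\<gamma> :: 'n::finite covec) q vs)"
proof -
  define a where "a k = (if k = 0 then r else 0)" for k :: nat
  have "0 < CARD('n) choose q" using assms(2) by simp
  moreover have "map (\<lambda>_. \<gamma>) [0..<q] = replicate q \<gamma>" by (simp add: map_replicate_const)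
  ultimately have e: "(\<Sum>k < CARD('n) choose q. of_real (a k) * wedge_list (map (\<lambda>_. \<gamma>) [0..<q]) vs) = of_real r * wedge_power \<gamma> q vs" for vs
    by (simp add: a_def if_distrib[of "\<lambda>x. of_real x * _"] sum.delta wedge_power_def cong: if_cong)
  have a0: "0 \<le> a k" for k using assms(3) by (simp add: a_def)
  show ?thesis
    unfolding strongly_m_positive_def
    by (rule exI[of _ a], rule exI[of _ "\<lambda>k j. \<gamma>"]) (use assms a0 in \<open>simp add: e\<close>)
qed

section \<open>Positivity of the current on concrete test forms\<close>

lemma ddc_current_real:
  assumes "\<And>z. vol_coeff (ddc (\<lambda>w. wedge (wedge_power beta k) (\<eta> w)) z) = of_real (F z)"
  shows "ddc_current \<Omega> \<phi> k \<eta> = of_real (LINT z:\<Omega>|lborel. real_of_ereal (\<phi> z) * F z)"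
  unfolding ddc_current_def assms set_lebesgue_integral_def
  by (simp add: scaleR_conv_of_real flip: of_real_mult integral_complex_of_real)

text \<open>The test form g \<beta>^(m-1) completes \<beta>^(n-m) to \<beta>^(n-1), and the pairing
  becomes a positive multiple of the integral of \<phi> against the Laplacian of g.\<close>

lemma m_subharmonic_trace:
  fixes \<Omega> :: "(complex ^ 'n::finite) set"
  assumes m: "1 \<le> m" "m < CARD('n)" and sh: "m_subharmonic m \<Omega> \<phi>"
    and g: "smooth g" "\<And>z. 0 \<le> g z" and K: "compact K" "K \<subseteq> \<Omega>" "\<And>z. z \<notin> K \<Longrightarrow> g z = 0"
  shows "0 \<le> (LINT z:\<Omega>|lborel. real_of_ereal (\<phi> z) * Lap g z)"
proof -
  define \<alpha> :: "'n dform" where "\<alpha> = (\<lambda>z vs. of_real (g z) * wedge_power beta (m - 1) vs)"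
  \<comment> \<open>\<open>theta 0 0\<close> vanishes, so m-positivity of \<beta> is the case v = 0
    of \<open>m_positive_gamma\<close>.\<close>
  have "\<gamma> = beta" if "\<gamma> = (\<lambda>vs. beta vs + - of_real (CARD('n) / m) * theta 0 0 vs)" for \<gamma> :: "'n covec"
  proof -
    have "theta 0 (0 :: complex ^ 'n) = (\<lambda>vs. 0 :: complex)"
      using theta_scaleR[of 0 "0 :: complex ^ 'n"] by simp
    with that show ?thesis by simp
  qed
  then have "m_positive m (beta :: 'n covec)" using m_positive_gamma[of m "0 :: complex ^ 'n"] m by simp
  then have "strongly_m_positive m (m - 1) (\<alpha> z)" for z
    unfolding \<alpha>_def by (rule strongly_m_positive_power) (use m g in auto)
  moreover have "test_form \<Omega> \<alpha>"
    unfolding test_form_def \<alpha>_def using K g by (auto intro!: smooth_mult smooth_of_real exI[of _ K])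
  ultimately have nn: "ddc_current \<Omega> \<phi> (CARD('n) - m) \<alpha> \<in> \<real>\<^sub>\<ge>\<^sub>0"
    using sh unfolding m_subharmonic_def by blast
  have "(\<lambda>w. wedge (wedge_power beta (CARD('n) - m)) (\<alpha> w)) = (\<lambda>w vs. of_real (g w) * wedge_power beta (CARD('n) - 1) vs)"
    unfolding \<alpha>_def wedge_scale_right wedge_power_add using m by simp
  then have "vol_coeff (ddc (\<lambda>w. wedge (wedge_power beta (CARD('n) - m)) (\<alpha> w)) z) = of_real (trace_const TYPE('n) * Lap g z)" for z
    by (simp only: vol_ddc_scalar_beta[OF smooth_twice_diff[OF g(1)]])
  from nn[unfolded ddc_current_real[OF this]]
  have "0 \<le> (LINT z:\<Omega>|lborel. real_of_ereal (\<phi> z) * (trace_const TYPE('n) * Lap g z))"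
    by (simp only: nonneg_Reals_of_real_iff)
  also have "\<dots> = trace_const TYPE('n) * (LINT z:\<Omega>|lborel. real_of_ereal (\<phi> z) * Lap g z)"
    by (simp add: set_lebesgue_integral_def mult_ac flip: integral_mult_right_zero)
  finally show ?thesis using trace_const_pos[where 'n = 'n] by (simp add: zero_le_mult_iff)
qed

lemma ddc_current_trace:
  fixes \<Omega> :: "(complex ^ 'n::finite) set"
  assumes g: "smooth g"
  shows "ddc_current \<Omega> \<phi> (CARD('n) - 1) (\<lambda>z. scalar_form (of_real (g z))) =
    of_real (trace_const TYPE('n) * (LINT z:\<Omega>|lborel. real_of_ereal (\<phi> z) * Lap g z))"
proof -
  have "ddc_current \<Omega> \<phi> (CARD('n) - 1) (\<lambda>z. scalar_form (of_real (g z))) =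
    of_real (LINT z:\<Omega>|lborel. real_of_ereal (\<phi> z) * (trace_const TYPE('n) * Lap g z))"
    by (rule ddc_current_real) (simp only: wedge_scalar_right vol_ddc_scalar_beta[OF smooth_twice_diff[OF g]])
  then show ?thesis
    by (simp add: set_lebesgue_integral_def mult_ac flip: integral_mult_right_zero)
qed

text \<open>At each point the test form is a nonnegative multiple of \<open>\<gamma>\<^sup>m\<^sup>-\<^sup>1\<close>, where \<open>\<gamma>\<close> has the radial direction as
  an eigenvector for the extremal negative eigenvalue \<open>1 - n/m\<close> and is the identity on the complement.\<close>

lemma m_subharmonic_radial_aux:
  fixes \<Omega> :: "(complex ^ 'n::finite) set" and y :: "complex ^ 'n"
  assumes m: "1 \<le> m" "m < CARD('n)" and sh: "m_subharmonic m \<Omega> \<phi>"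
    and g: "smooth g" "\<And>z. 0 \<le> g z" and K: "compact K" "K \<subseteq> \<Omega>" "\<And>z. z \<notin> K \<Longrightarrow> g z = 0"
  defines "s \<equiv> \<lambda>b b' z. g z * (((z - y) \<bullet> b) * ((z - y) \<bullet> b'))"
    and "a \<equiv> \<lambda>z. g z * (norm (z - y))\<^sup>2"
  shows "0 \<le> (LINT z:\<Omega>|lborel. real_of_ereal (\<phi> z) * ((real CARD('n) - m) * Lap a z +
     CARD('n) * (real m - 1) * (\<Sum>b\<in>Basis. \<Sum>b'\<in>Basis. D2 (s b b') z b' b + D2 (s b b') z (\<i> *s b) (\<i> *s b'))))"
proof -
  define n where "n = CARD('n)"
  have n: "2 \<le> CARD('n)" "m < n" using m by (auto simp: n_def)
  \<comment> \<open>The coefficient of \<open>theta\<close> \<and> \<beta>^(m-2) in \<gamma>^(m-1):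
    the binomial factor m - 1 times -n/m.\<close>
  define k where "k = - ((real m - 1) * n / m)"
  define \<gamma> where "\<gamma> v = (\<lambda>vs. beta vs + - of_real (CARD('n) / m) * theta v v vs)" for v :: "complex ^ 'n"
  define \<alpha> :: "'n dform" where "\<alpha> = (\<lambda>z vs. of_real (a z) * wedge_power beta (m - 1) vs +
      of_real k * (\<Sum>b\<in>Basis. \<Sum>b'\<in>Basis. of_real (s b b' z) * wedge (theta b b') (wedge_power beta (m - 2)) vs))"
  have sm_s: "smooth (s b b')" for b b'
    unfolding s_def inner_diff_left
    by (intro smooth_mult g smooth_diff smooth_const smooth_linear bounded_linear_inner_left)
  have sm_a: "smooth a"
    unfolding a_def by (intro smooth_mult g smooth_norm_square)
  \<comment> \<open>At z = y the convention 1 / 0 = 0 makes the direction 0, and both sides vanish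
    because \<open>a y = 0\<close>. Elsewhere the factor |z - y|^2 in \<open>a\<close> cancels the
    normalisation, which is what makes the coefficients of \<alpha> smooth.\<close>
  have \<alpha>_eq: "\<alpha> z = (\<lambda>vs. of_real (a z) * wedge_power (\<gamma> ((1 / norm (z - y)) *\<^sub>R (z - y))) (m - 1) vs)" for z
  proof
    fix vs
    define x where "x = z - y"
    have k: "of_nat (m - 1) * - complex_of_real (CARD('n) / m) = of_real k"
      using m by (simp add: k_def n_def of_nat_diff)
    have "of_real (a z) * theta ((1 / norm x) *\<^sub>R x) ((1 / norm x) *\<^sub>R x) vs = of_real (g z) * theta x x vs" for vs
    proof (cases "x = 0")
      case True
      have "theta x x = (\<lambda>vs. 0 :: complex)" using theta_scaleR[of 0 x] True by simp
      then show ?thesis by (simp add: True a_def x_def)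
    next
      case False
      then show ?thesis unfolding theta_scaleR by (simp add: a_def x_def power_divide field_simps)
    qed
    then have "(\<lambda>vs. of_real (a z) * theta ((1 / norm x) *\<^sub>R x) ((1 / norm x) *\<^sub>R x) vs) =
       (\<lambda>vs. \<Sum>b\<in>Basis. \<Sum>b'\<in>Basis. of_real (s b b' z) * theta b b' vs)"
      by (simp add: theta_expand[of x] s_def x_def[symmetric] sum_distrib_left mult_ac)
    from arg_cong[OF this, of "\<lambda>t. wedge t (wedge_power beta (m - 2)) vs"]
    have *: "of_real (a z) * wedge (theta ((1 / norm x) *\<^sub>R x) ((1 / norm x) *\<^sub>R x)) (wedge_power beta (m - 2)) vs =
      (\<Sum>b\<in>Basis. \<Sum>b'\<in>Basis. of_real (s b b' z) * wedge (theta b b') (wedge_power beta (m - 2)) vs)"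
      by (simp add: wedge_scale_left wedge_sum_left)
    have "of_real (a z) * wedge_power (\<gamma> ((1 / norm x) *\<^sub>R x)) (m - 1) vs =
       of_real (a z) * wedge_power beta (m - 1) vs + of_real k *
       (of_real (a z) * wedge (theta ((1 / norm x) *\<^sub>R x) ((1 / norm x) *\<^sub>R x)) (wedge_power beta (m - 2)) vs)"
      unfolding \<gamma>_def wedge_power_add_nilpotent[OF sgn_inv_beta sgn_inv_theta theta_square] k
      by (simp add: distrib_left numeral_2_eq_2 mult_ac)
    then show "\<alpha> z vs = of_real (a z) * wedge_power (\<gamma> ((1 / norm (z - y)) *\<^sub>R (z - y))) (m - 1) vs"
      unfolding * x_def[symmetric] \<alpha>_def by simp
  qed
  have "strongly_m_positive m (m - 1) (\<alpha> z)" for z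
    unfolding \<alpha>_eq \<gamma>_def
  proof (intro strongly_m_positive_power m_positive_gamma)
    show "((1 / norm (z - y)) *\<^sub>R (z - y)) \<bullet> ((1 / norm (z - y)) *\<^sub>R (z - y)) \<le> 1"
      by (simp add: power2_norm_eq_inner[symmetric] power2_eq_square)
  qed (use m g in \<open>auto simp: a_def\<close>)
  moreover have "test_form \<Omega> \<alpha>"
    unfolding test_form_def
  proof (intro conjI allI exI[of _ K] impI)
    show "smooth (\<lambda>z. \<alpha> z vs)" for vs
      unfolding \<alpha>_def by (intro smooth_add smooth_mult smooth_sum smooth_of_real smooth_const sm_a sm_s)
    show "\<alpha> z vs = 0" if "z \<notin> K" for z vs
      using K(3)[OF that] by (simp add: \<alpha>_def a_def s_def)
  qed (use K in auto)
  ultimately have nn: "ddc_current \<Omega> \<phi> (CARD('n) - m) \<alpha> \<in> \<real>\<^sub>\<ge>\<^sub>0"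
    using sh unfolding m_subharmonic_def by blast
  \<comment> \<open>The factor k is kept because it vanishes for m = 1, where m - 2 is truncated and
    the exponents of \<beta> do not add up.\<close>
  have w: "of_real k * wedge (wedge_power beta (CARD('n) - m)) (wedge (theta b b') (wedge_power beta (m - 2))) vs =
      of_real k * wedge (theta b b') (wedge_power beta (CARD('n) - 2)) vs" for b b' :: "complex ^ 'n" and vs
  proof (cases "m = 1")
    case False
    have "wedge (wedge_power beta (CARD('n) - m)) (wedge (theta b b') (wedge_power beta (m - 2)))
      = wedge (theta b b') (wedge (wedge_power beta (CARD('n) - m)) (wedge_power beta (m - 2)))"
      by (metis wedge_assoc wedge_commute_even[OF sgn_inv_theta])
    also have "\<dots> = wedge (theta b b') (wedge_power beta (CARD('n) - 2))"
      unfolding wedge_power_add using m False by (intro arg_cong2[of _ _ _ _ wedge] refl arg_cong2[of _ _ _ _ wedge_power]) auto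
    finally show ?thesis by simp
  qed (simp add: k_def)
  have e: "(\<lambda>w. wedge (wedge_power beta (CARD('n) - m)) (\<alpha> w)) = (\<lambda>w vs. of_real (a w) * wedge_power beta (CARD('n) - 1) vs +
      of_real k * (\<Sum>b\<in>Basis. \<Sum>b'\<in>Basis. of_real (s b b' w) * wedge (theta b b') (wedge_power beta (CARD('n) - 2)) vs))"
  proof (intro ext)
    fix z vs
    have "wedge (wedge_power beta (CARD('n) - m)) (\<alpha> z) vs = of_real (a z) * wedge_power beta (CARD('n) - m + (m - 1)) vs +
      (\<Sum>b\<in>Basis. \<Sum>b'\<in>Basis. of_real (s b b' z) * (of_real k * wedge (wedge_power beta (CARD('n) - m)) (wedge (theta b b') (wedge_power beta (m - 2))) vs))"
      unfolding \<alpha>_def wedge_add_right wedge_scale_right wedge_sum_right wedge_power_add sum_distrib_left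
      by (simp add: mult_ac)
    then show "wedge (wedge_power beta (CARD('n) - m)) (\<alpha> z) vs = of_real (a z) * wedge_power beta (CARD('n) - 1) vs +
      of_real k * (\<Sum>b\<in>Basis. \<Sum>b'\<in>Basis. of_real (s b b' z) * wedge (theta b b') (wedge_power beta (CARD('n) - 2)) vs)"
      unfolding w using m by (simp add: sum_distrib_left mult_ac)
  qed
  define F where "F z = (real n - m) * Lap a z +
     n * (real m - 1) * (\<Sum>b\<in>Basis. \<Sum>b'\<in>Basis. D2 (s b b') z b' b + D2 (s b b') z (\<i> *s b) (\<i> *s b'))" for z
  define C where "C = trace_const TYPE('n) / (m * (real n - 1))"
  have C: "C > 0" using m by (simp add: C_def n_def trace_const_pos)
  have lap: "(\<Sum>b\<in>Basis. \<Sum>b'\<in>Basis. (b \<bullet> b') * Lap (s b b') z) = Lap a z" for z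
  proof -
    have "(\<Sum>b\<in>Basis. \<Sum>b'\<in>Basis. (b \<bullet> b') * Lap (s b b') z) = (\<Sum>b\<in>Basis. Lap (s b b) z)"
      by (simp add: inner_Basis if_distrib[of "\<lambda>x. x * _"] cong: if_cong)
    also have "\<dots> = Lap (\<lambda>z. \<Sum>b\<in>Basis. s b b z) z"
      unfolding Lap_def by (subst D2_sum) (auto intro: smooth_twice_diff sm_s sum.swap)
    also have "(\<lambda>z. \<Sum>b\<in>Basis. s b b z) = a"
    proof
      fix z
      have "(\<Sum>b\<in>Basis. s b b z) = g z * (\<Sum>b\<in>Basis. ((z - y) \<bullet> b) * ((z - y) \<bullet> b))"
        by (simp add: s_def sum_distrib_left)
      also have "\<dots> = a z"
        by (simp only: a_def power2_norm_eq_inner euclidean_inner[of "z - y" "z - y", symmetric])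
      finally show "(\<Sum>b\<in>Basis. s b b z) = a z" .
    qed
    finally show ?thesis .
  qed
  have "trace_const TYPE('n) * (Lap a z + k / (CARD('n) - 1) *
       (\<Sum>b\<in>Basis. \<Sum>b'\<in>Basis. (b \<bullet> b') * Lap (s b b') z - D2 (s b b') z b' b - D2 (s b b') z (\<i> *s b) (\<i> *s b')))
     = C * F z" for z
  proof -
    define T where "T = (\<Sum>b\<in>Basis. \<Sum>b'\<in>Basis. D2 (s b b') z b' b + D2 (s b b') z (\<i> *s b) (\<i> *s b'))"
    have A: "(\<Sum>b\<in>Basis. \<Sum>b'\<in>Basis. (b \<bullet> b') * Lap (s b b') z - D2 (s b b') z b' b - D2 (s b b') z (\<i> *s b) (\<i> *s b'))
       = Lap a z - T"
      unfolding lap[symmetric] T_def by (simp add: sum_subtractf[symmetric] algebra_simps)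
    have B: "real (CARD('n) - 1) = real n - 1" using m by (simp add: n_def of_nat_diff)
    have "(Lap a z + k / (real n - 1) * (Lap a z - T)) * (m * (real n - 1)) = (real n - m) * Lap a z + n * (real m - 1) * T"
      using n m by (simp add: k_def field_simps)
    then have E: "Lap a z + k / (real n - 1) * (Lap a z - T) = ((real n - m) * Lap a z + n * (real m - 1) * T) / (m * (real n - 1))"
      using n m by (simp add: eq_divide_eq n_def)
    show ?thesis unfolding A B E C_def F_def T_def[symmetric] by simp
  qed
  then have "vol_coeff (ddc (\<lambda>w. wedge (wedge_power beta (CARD('n) - m)) (\<alpha> w)) z) = of_real (C * F z)" for z
    by (simp only: e vol_ddc_theta_sum[OF sm_a sm_s n(1)])
  from nn[unfolded ddc_current_real[OF this]]
  have "0 \<le> (LINT z:\<Omega>|lborel. real_of_ereal (\<phi> z) * (C * F z))"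
    by (simp only: nonneg_Reals_of_real_iff)
  also have "\<dots> = C * (LINT z:\<Omega>|lborel. real_of_ereal (\<phi> z) * F z)"
    by (simp add: set_lebesgue_integral_def mult_ac flip: integral_mult_right_zero)
  finally show ?thesis using C by (simp add: zero_le_mult_iff F_def n_def)
qed

subsection \<open>Subharmonic functions\<close>

locale subharmonic_fun =
  fixes \<Omega> :: "'a::euclidean_space set" and \<phi> :: "'a \<Rightarrow> ereal"
  assumes open_\<Omega>: "open \<Omega>" and sub: "subharmonic_on \<Omega> \<phi>"
begin

text \<open>Extension by 0 gives a Borel function on the whole space, so that integrals can be taken
  over \<open>lborel\<close> without restricting to \<Omega>.\<close>

definition \<psi> :: "'a \<Rightarrow> ereal" where "\<psi> z = (if z \<in> \<Omega> then \<phi> z else 0)"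
definition f :: "'a \<Rightarrow> real" where "f z = real_of_ereal (\<psi> z)"
text \<open>The mass of the negative part, kept in \<open>ennreal\<close> because its finiteness on
  compact sets has to be derived from the sub-mean value property.\<close>

definition N :: "'a set \<Rightarrow> ennreal" where "N K = (\<integral>\<^sup>+z\<in>K. e2ennreal (- \<psi> z) \<partial>lborel)"

lemma not_PInf: "z \<in> \<Omega> \<Longrightarrow> \<phi> z \<noteq> \<infinity>"
  using sub by (simp add: subharmonic_on_def)

lemma open_sublevel: "open {z \<in> \<Omega>. \<phi> z < t}"
proof (subst open_subopen, intro ballI)
  fix z assume z: "z \<in> {z \<in> \<Omega>. \<phi> z < t}"
  then have "\<forall>\<^sub>F w in at z within \<Omega>. \<phi> w < t"
    using sub by (simp add: subharmonic_on_def)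
  then have "\<forall>\<^sub>F w in at z. \<phi> w < t"
    using z at_within_open[OF _ open_\<Omega>, of z] by simp
  then obtain S where S: "open S" "z \<in> S" "\<And>w. w \<in> S \<Longrightarrow> w \<noteq> z \<Longrightarrow> \<phi> w < t"
    unfolding eventually_at_topological by blast
  show "\<exists>T. open T \<and> z \<in> T \<and> T \<subseteq> {z \<in> \<Omega>. \<phi> z < t}"
  proof (intro exI[of _ "S \<inter> \<Omega>"] conjI subsetI)
    show "open (S \<inter> \<Omega>)" using S open_\<Omega> by auto
    show "z \<in> S \<inter> \<Omega>" using S z by auto
    show "w \<in> {z \<in> \<Omega>. \<phi> z < t}" if "w \<in> S \<inter> \<Omega>" for w
      using S(3)[of w] that z by (cases "w = z") auto
  qed
qed

lemma measurable_\<psi> [measurable]: "\<psi> \<in> borel_measurable borel"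
proof (rule borel_measurableI_less)
  fix t
  have "{x \<in> space borel. \<psi> x < t} = {z \<in> \<Omega>. \<phi> z < t} \<union> (if 0 < t then - \<Omega> else {})"
    by (auto simp: \<psi>_def)
  then show "{x \<in> space borel. \<psi> x < t} \<in> sets borel"
    using open_sublevel[of t] open_\<Omega> by simp
qed

lemma measurable_f [measurable]: "f \<in> borel_measurable borel"
  unfolding f_def[abs_def] by measurable

lemma upper_bound:
  assumes "compact K" "K \<subseteq> \<Omega>"
  obtains M :: real where "0 \<le> M" "\<And>z. z \<in> K \<Longrightarrow> \<psi> z \<le> ereal M"
proof -
  have "K \<subseteq> (\<Union>n. {z \<in> \<Omega>. \<phi> z < ereal (real n)})"
  proof
    fix z assume "z \<in> K"
    then have "z \<in> \<Omega>" using assms by auto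
    then obtain n where "\<phi> z < ereal (real n)"
      using not_PInf[of z] less_PInf_Ex_of_nat[of "\<phi> z"] by auto
    then show "z \<in> (\<Union>n. {z \<in> \<Omega>. \<phi> z < ereal (real n)})" using \<open>z \<in> \<Omega>\<close> by auto
  qed
  then obtain C where C: "finite C" "K \<subseteq> (\<Union>n\<in>C. {z \<in> \<Omega>. \<phi> z < ereal (real n)})"
    using compactE_image[OF assms(1), of UNIV "\<lambda>n. {z \<in> \<Omega>. \<phi> z < ereal (real n)}"] open_sublevel by auto
  obtain k where k: "C \<subseteq> {..<k}" using finite_nat_bounded[OF C(1)] by auto
  show ?thesis
  proof (rule that[of "real k"])
    fix z assume "z \<in> K"
    then obtain n where n: "n \<in> C" "z \<in> \<Omega>" "\<phi> z < ereal (real n)" using C by auto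
    then have "ereal (real n) \<le> ereal (real k)" using k by auto
    with n show "\<psi> z \<le> ereal (real k)" by (auto simp: \<psi>_def intro: less_imp_le order.trans)
  qed simp
qed

lemma N_mono: "A \<subseteq> B \<Longrightarrow> N A \<le> N B"
  unfolding N_def by (intro nn_integral_mono) (auto simp: indicator_def)

lemma N_UN_finite:
  assumes "finite C" "\<And>i. i \<in> C \<Longrightarrow> A i \<in> sets borel" "\<And>i. i \<in> C \<Longrightarrow> N (A i) < \<infinity>"
  shows "N (\<Union>i\<in>C. A i) < \<infinity>"
proof -
  have "N (\<Union>i\<in>C. A i) \<le> (\<integral>\<^sup>+z. (\<Sum>i\<in>C. e2ennreal (- \<psi> z) * indicator (A i) z) \<partial>lborel)"
    unfolding N_def
  proof (rule nn_integral_mono)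
    fix z
    show "e2ennreal (- \<psi> z) * indicator (\<Union>i\<in>C. A i) z \<le> (\<Sum>i\<in>C. e2ennreal (- \<psi> z) * indicator (A i) z)"
    proof (cases "z \<in> (\<Union>i\<in>C. A i)")
      case True
      then obtain i where i: "i \<in> C" "z \<in> A i" by blast
      then have "e2ennreal (- \<psi> z) * indicator (A i) z \<le> (\<Sum>i\<in>C. e2ennreal (- \<psi> z) * indicator (A i) z)"
        by (intro member_le_sum assms) auto
      then show ?thesis using True i by simp
    qed simp
  qed
  also have "\<dots> = (\<Sum>i\<in>C. N (A i))"
    unfolding N_def
  proof (rule nn_integral_sum)
    fix i assume "i \<in> C"
    then have [measurable]: "A i \<in> sets borel" by (rule assms)
    show "(\<lambda>z. e2ennreal (- \<psi> z) * indicator (A i) z) \<in> borel_measurable lborel" by measurable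
  qed
  also have "\<dots> < \<infinity>" using assms by (simp add: less_top)
  finally show ?thesis .
qed

lemma positive_part_finite:
  assumes "compact K" "K \<subseteq> \<Omega>"
  shows "(\<integral>\<^sup>+z\<in>K. e2ennreal (\<psi> z) \<partial>lborel) < \<infinity>"
proof -
  obtain M where M: "0 \<le> M" "\<And>z. z \<in> K \<Longrightarrow> \<psi> z \<le> ereal M" using upper_bound[OF assms] by blast
  have "(\<integral>\<^sup>+z\<in>K. e2ennreal (\<psi> z) \<partial>lborel) \<le> (\<integral>\<^sup>+z. ennreal M * indicator K z \<partial>lborel)"
  proof (intro nn_integral_mono)
    fix z
    show "e2ennreal (\<psi> z) * indicator K z \<le> ennreal M * indicator K z"
      using M(1) e2ennreal_mono[OF M(2)[of z]] by (cases "z \<in> K") (auto simp: e2ennreal_ereal)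
  qed
  also have "\<dots> = ennreal M * emeasure lborel K"
    using assms by (intro nn_integral_cmult_indicator) (auto simp: borel_compact)
  also have "\<dots> < \<infinity>" using emeasure_compact_finite[OF assms(1)] by (simp add: ennreal_mult_less_top)
  finally show ?thesis .
qed

lemma ball_mean_eq:
  assumes "cball a r \<subseteq> \<Omega>"
  shows "ball_mean \<phi> a r = (enn2ereal (\<integral>\<^sup>+z\<in>cball a r. e2ennreal (\<psi> z) \<partial>lborel) - enn2ereal (N (cball a r)))
     / ereal (measure lborel (cball a r))"
proof -
  have "(\<integral>\<^sup>+z\<in>cball a r. e2ennreal (\<phi> z) \<partial>lborel) = (\<integral>\<^sup>+z\<in>cball a r. e2ennreal (\<psi> z) \<partial>lborel)"
    "(\<integral>\<^sup>+z\<in>cball a r. e2ennreal (- \<phi> z) \<partial>lborel) = N (cball a r)"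
    unfolding N_def using assms by (auto intro!: nn_integral_cong simp: \<psi>_def indicator_def)
  then show ?thesis by (simp add: ball_mean_def)
qed

lemma measure_cball_pos: "0 < r \<Longrightarrow> 0 < measure lborel (cball (a :: 'a) r)"
  using content_cball_pos[of r a] by simp

text \<open>The positive part has finite integral, so an infinite negative part would make the mean
  -\<infinity> and force \<phi> a = -\<infinity>.\<close>

lemma mean_value:
  assumes "0 < r" "cball a r \<subseteq> \<Omega>" "\<phi> a \<noteq> - \<infinity>"
  shows "N (cball a r) < \<infinity>"
proof (rule ccontr)
  assume "\<not> N (cball a r) < \<infinity>"
  then have N: "N (cball a r) = \<infinity>" by (metis infinity_ennreal_def top.not_eq_extremum)
  have "\<phi> a \<le> ball_mean \<phi> a r" using sub assms by (simp add: subharmonic_on_def)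
  also have "\<dots> = - \<infinity>"
    using positive_part_finite[OF compact_cball assms(2)] measure_cball_pos[OF assms(1), of a]
    unfolding ball_mean_eq[OF assms(2)] N
    by (cases "\<integral>\<^sup>+z\<in>cball a r. e2ennreal (\<psi> z) \<partial>lborel") (auto simp: enn2ereal_ennreal)
  finally show False using assms by simp
qed

text \<open>A connectedness argument. The set G of points with finite negative mass nearby and the
  set Z of points near which \<phi> is identically -\<infinity> are open and cover \<Omega>. They
  are disjoint, since on a common ball the negative mass would be infinite. Each component contains
  a point with \<phi> different from -\<infinity>, which lies outside Z; so the whole component lies
  in G.\<close>

lemma N_locally_finite:
  assumes "z \<in> \<Omega>"
  shows "\<exists>r>0. cball z r \<subseteq> \<Omega> \<and> N (cball z r) < \<infinity>"
proof -
  define G where "G = {z \<in> \<Omega>. \<exists>r>0. cball z r \<subseteq> \<Omega> \<and> N (cball z r) < \<infinity>}"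
  define Z where "Z = {z \<in> \<Omega>. \<exists>r>0. cball z r \<subseteq> \<Omega> \<and> (\<forall>w\<in>cball z r. \<phi> w = - \<infinity>)}"
  have cov: "z \<in> G \<union> Z" if z: "z \<in> \<Omega>" for z
  proof -
    obtain e where e: "0 < e" "cball z e \<subseteq> \<Omega>" using open_\<Omega> z open_contains_cball by blast
    show ?thesis
    proof (cases "\<exists>w\<in>cball z (e / 4). \<phi> w \<noteq> - \<infinity>")
      case True
      then obtain w where w: "dist z w \<le> e / 4" "\<phi> w \<noteq> - \<infinity>" by auto
      \<comment> \<open>The centre moves from z to a nearby w where \<phi> is finite; the radius e/2
        is large enough to cover a ball about z and small enough to stay inside
        \<open>cball z e\<close>.\<close>
      have sub1: "cball w (e / 2) \<subseteq> cball z e" "cball z (e / 4) \<subseteq> cball w (e / 2)"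
      proof -
        show "cball w (e / 2) \<subseteq> cball z e"
        proof
          fix u assume "u \<in> cball w (e / 2)"
          then show "u \<in> cball z e" using dist_triangle[of z u w] w(1) e(1) by simp
        qed
        show "cball z (e / 4) \<subseteq> cball w (e / 2)"
        proof
          fix u assume "u \<in> cball z (e / 4)"
          then show "u \<in> cball w (e / 2)" using dist_triangle[of w u z] w(1) e(1) by (simp add: dist_commute)
        qed
      qed
      have "N (cball w (e / 2)) < \<infinity>" by (rule mean_value) (use e w sub1 in auto)
      then have "N (cball z (e / 4)) < \<infinity>" using N_mono[OF sub1(2)] by (rule le_less_trans[rotated])
      then show ?thesis using z e unfolding G_def by (intro UnI1 CollectI conjI exI[of _ "e / 4"]) auto
    next
      case False
      then show ?thesis using z e unfolding Z_def by (intro UnI2 CollectI conjI exI[of _ "e / 4"]) auto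
    qed
  qed
  have opG: "open G"
    unfolding open_contains_ball
  proof
    fix z assume "z \<in> G"
    then obtain r where r: "0 < r" "cball z r \<subseteq> \<Omega>" "N (cball z r) < \<infinity>" unfolding G_def by blast
    have "ball z (r / 2) \<subseteq> G"
    proof
      fix w assume w: "w \<in> ball z (r / 2)"
      have s: "cball w (r / 2) \<subseteq> cball z r"
      proof
        fix u assume "u \<in> cball w (r / 2)"
        then show "u \<in> cball z r" using w dist_triangle[of z u w] by auto
      qed
      then have "N (cball w (r / 2)) < \<infinity>" using N_mono[OF s] r by (auto intro: le_less_trans)
      moreover have "w \<in> \<Omega>" "cball w (r / 2) \<subseteq> \<Omega>" using s r w by (auto simp: subset_iff)
      ultimately show "w \<in> G" unfolding G_def using r by (intro CollectI conjI exI[of _ "r / 2"]) auto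
    qed
    then show "\<exists>e>0. ball z e \<subseteq> G" using r by (intro exI[of _ "r / 2"]) auto
  qed
  have opZ: "open Z"
    unfolding open_contains_ball
  proof
    fix z assume "z \<in> Z"
    then obtain r where r: "0 < r" "cball z r \<subseteq> \<Omega>" "\<And>w. w \<in> cball z r \<Longrightarrow> \<phi> w = - \<infinity>" unfolding Z_def by blast
    have "ball z (r / 2) \<subseteq> Z"
    proof
      fix w assume w: "w \<in> ball z (r / 2)"
      have s: "cball w (r / 2) \<subseteq> cball z r"
      proof
        fix u assume "u \<in> cball w (r / 2)"
        then show "u \<in> cball z r" using w dist_triangle[of z u w] by auto
      qed
      moreover have "w \<in> \<Omega>" using r w by (auto simp: subset_iff)
      ultimately show "w \<in> Z" unfolding Z_def using r by (intro CollectI conjI exI[of _ "r / 2"]) auto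
    qed
    then show "\<exists>e>0. ball z e \<subseteq> Z" using r by (intro exI[of _ "r / 2"]) auto
  qed
  have disj: "G \<inter> Z = {}"
  proof (rule ccontr)
    assume "G \<inter> Z \<noteq> {}"
    then obtain z where z: "z \<in> G" "z \<in> Z" by blast
    obtain r where r: "0 < r" "cball z r \<subseteq> \<Omega>" "N (cball z r) < \<infinity>" using z unfolding G_def by blast
    obtain r' where r': "0 < r'" "\<And>w. w \<in> cball z r' \<Longrightarrow> \<phi> w = - \<infinity>" using z unfolding Z_def by blast
    define s where "s = min r r'"
    have s: "0 < s" "cball z s \<subseteq> cball z r" "cball z s \<subseteq> cball z r'" using r r' by (auto simp: s_def)
    have "N (cball z s) = (\<integral>\<^sup>+w. \<infinity> * indicator (cball z s) w \<partial>lborel)"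
      unfolding N_def
    proof (rule nn_integral_cong)
      fix w
      have "\<psi> w = - \<infinity>" if "w \<in> cball z s"
        using that r(2) r'(2)[of w] s unfolding \<psi>_def by (auto simp: subset_iff)
      then show "e2ennreal (- \<psi> w) * indicator (cball z s) w = \<infinity> * indicator (cball z s) w"
        by (cases "w \<in> cball z s") (auto simp: e2ennreal_infty)
    qed
    also have "\<dots> = \<infinity> * emeasure lborel (cball z s)"
      by (rule nn_integral_cmult_indicator) simp
    also have "\<dots> = \<infinity>"
    proof -
      have "emeasure lborel (cball z s) \<noteq> 0"
        using measure_cball_pos[OF s(1), of z] by (metis measure_def enn2real_0 less_irrefl)
      then show ?thesis by (simp add: ennreal_top_mult)
    qed
    finally show False using N_mono[OF s(2)] r(3) by (simp add: top_unique)
  qed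
  define C where "C = connected_component_set \<Omega> z"
  have C: "C \<in> components \<Omega>" "z \<in> C" "connected C" "C \<subseteq> \<Omega>"
    unfolding C_def using assms by (auto simp: components_def connected_component_subset)
  obtain w where w: "w \<in> C" "\<phi> w \<noteq> - \<infinity>" using sub C(1) unfolding subharmonic_on_def by blast
  have 1: "G \<inter> Z \<inter> C = {}" using disj by simp
  have 2: "C \<subseteq> G \<union> Z" using cov C by blast
  have "C \<inter> G = {} \<or> C \<inter> Z = {}"
    using connectedD[OF C(3) opG opZ 1 2] by (simp only: Int_commute)
  moreover have "w \<notin> Z"
  proof
    assume "w \<in> Z"
    then obtain r where "0 < r" "\<And>u. u \<in> cball w r \<Longrightarrow> \<phi> u = - \<infinity>" unfolding Z_def by blast
    then show False using w(2) by simp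
  qed
  then have "w \<in> G" using cov[of w] w C by auto
  ultimately have "z \<notin> Z" using w C by auto
  then have "z \<in> G" using cov[OF assms] by auto
  then show ?thesis unfolding G_def by blast
qed

lemma N_compact:
  assumes "compact K" "K \<subseteq> \<Omega>"
  shows "N K < \<infinity>"
proof -
  obtain r where r: "\<And>z. z \<in> \<Omega> \<Longrightarrow> 0 < r z" "\<And>z. z \<in> \<Omega> \<Longrightarrow> N (cball z (r z)) < \<infinity>"
    using N_locally_finite by metis
  have "K \<subseteq> (\<Union>z\<in>K. ball z (r z))" using r(1) assms by force
  then obtain C where C: "C \<subseteq> K" "finite C" "K \<subseteq> (\<Union>z\<in>C. ball z (r z))"
    using compactE_image[OF assms(1), of K "\<lambda>z. ball z (r z)"] by auto
  have "N K \<le> N (\<Union>z\<in>C. cball z (r z))" using C by (intro N_mono) force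
  also have "\<dots> < \<infinity>" using C r assms by (intro N_UN_finite) auto
  finally show ?thesis .
qed

lemma AE_compact:
  assumes "compact K" "K \<subseteq> \<Omega>"
  shows "AE z in lborel. z \<in> K \<longrightarrow> \<bar>\<psi> z\<bar> \<noteq> \<infinity>"
proof -
  have "AE z in lborel. e2ennreal (- \<psi> z) * indicator K z \<noteq> \<infinity>"
    using N_compact[OF assms] borel_compact[OF assms(1)] unfolding N_def
    by (intro nn_integral_PInf_AE) auto
  then show ?thesis
  proof eventually_elim
    fix z assume z: "e2ennreal (- \<psi> z) * indicator K z \<noteq> \<infinity>"
    show "z \<in> K \<longrightarrow> \<bar>\<psi> z\<bar> \<noteq> \<infinity>"
    proof
      assume K: "z \<in> K"
      then have "\<psi> z \<noteq> - \<infinity>" using z by (auto simp: e2ennreal_infty)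
      moreover have "\<psi> z \<noteq> \<infinity>" using not_PInf[of z] K assms by (auto simp: \<psi>_def)
      ultimately show "\<bar>\<psi> z\<bar> \<noteq> \<infinity>" by (cases "\<psi> z") auto
    qed
  qed
qed

lemma AE_finite: "AE z in lborel. z \<in> \<Omega> \<longrightarrow> \<bar>\<psi> z\<bar> \<noteq> \<infinity>"
proof -
  obtain D :: "'a set set" where D: "countable D" "D \<subseteq> Pow \<Omega>" "\<And>X. X \<in> D \<Longrightarrow> \<exists>a b. X = cbox a b" "\<Union>D = \<Omega>"
    by (rule open_countable_Union_open_cbox[OF open_\<Omega>], rule that)
  have 1: "AE z in lborel. z \<in> X \<longrightarrow> \<bar>\<psi> z\<bar> \<noteq> \<infinity>" if X: "X \<in> D" for X
  proof -
    obtain a b where "X = cbox a b" using D(3)[OF X] by blast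
    moreover have "X \<subseteq> \<Omega>" using D(2) X by blast
    ultimately show ?thesis by (intro AE_compact) (simp_all add: compact_cbox)
  qed
  have "AE z in lborel. \<forall>X\<in>D. z \<in> X \<longrightarrow> \<bar>\<psi> z\<bar> \<noteq> \<infinity>"
    unfolding AE_ball_countable[OF D(1)] by (rule ballI, rule 1)
  then show ?thesis
  proof eventually_elim
    fix z assume z: "\<forall>X\<in>D. z \<in> X \<longrightarrow> \<bar>\<psi> z\<bar> \<noteq> \<infinity>"
    show "z \<in> \<Omega> \<longrightarrow> \<bar>\<psi> z\<bar> \<noteq> \<infinity>"
    proof
      assume "z \<in> \<Omega>"
      then have "z \<in> \<Union>D" by (simp only: D(4))
      then obtain X where X: "X \<in> D" "z \<in> X" by (rule UnionE)
      show "\<bar>\<psi> z\<bar> \<noteq> \<infinity>" by (rule mp[OF bspec[OF z X(1)] X(2)])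
    qed
  qed
qed

lemma ennreal_f: "\<bar>\<psi> z\<bar> \<noteq> \<infinity> \<Longrightarrow> e2ennreal (\<psi> z) = ennreal (f z)" "\<bar>\<psi> z\<bar> \<noteq> \<infinity> \<Longrightarrow> e2ennreal (- \<psi> z) = ennreal (- f z)"
  by (cases "\<psi> z"; simp add: f_def e2ennreal_ereal)+

lemma integrable_f:
  assumes "compact K" "K \<subseteq> \<Omega>"
  shows "integrable lborel (\<lambda>z. indicator K z * f z)"
proof (rule integrableI_bounded)
  have K [measurable]: "K \<in> sets borel" by (rule borel_compact[OF assms(1)])
  show "(\<lambda>z. indicator K z * f z) \<in> borel_measurable lborel" by measurable
  have "(\<integral>\<^sup>+z. ennreal (norm (indicator K z * f z)) \<partial>lborel) =
      (\<integral>\<^sup>+z. e2ennreal (\<psi> z) * indicator K z + e2ennreal (- \<psi> z) * indicator K z \<partial>lborel)"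
  proof (rule nn_integral_cong_AE)
    show "AE z in lborel. ennreal (norm (indicator K z * f z)) = e2ennreal (\<psi> z) * indicator K z + e2ennreal (- \<psi> z) * indicator K z"
      using AE_compact[OF assms]
    proof eventually_elim
      fix z assume "z \<in> K \<longrightarrow> \<bar>\<psi> z\<bar> \<noteq> \<infinity>"
      then show "ennreal (norm (indicator K z * f z)) = e2ennreal (\<psi> z) * indicator K z + e2ennreal (- \<psi> z) * indicator K z"
        by (cases "z \<in> K"; cases "0 \<le> f z") (auto simp: ennreal_f ennreal_neg)
    qed
  qed
  also have "\<dots> = (\<integral>\<^sup>+z\<in>K. e2ennreal (\<psi> z) \<partial>lborel) + N K"
    unfolding N_def by (intro nn_integral_add) measurable
  also have "\<dots> < \<infinity>" using positive_part_finite[OF assms] N_compact[OF assms] by simp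
  finally show "(\<integral>\<^sup>+z. ennreal (norm (indicator K z * f z)) \<partial>lborel) < \<infinity>" .
qed

lemma f_upper_bound:
  assumes "compact K" "K \<subseteq> \<Omega>"
  obtains M :: real where "0 \<le> M" "\<And>z. z \<in> K \<Longrightarrow> f z \<le> M"
proof -
  obtain M where M: "0 \<le> M" "\<And>z. z \<in> K \<Longrightarrow> \<psi> z \<le> ereal M" using upper_bound[OF assms] by blast
  show ?thesis
  proof (rule that[OF M(1)])
    fix z assume "z \<in> K"
    from M(2)[OF this] show "f z \<le> M" using M(1) by (cases "\<psi> z") (auto simp: f_def)
  qed
qed

lemma sub_mean_value:
  assumes "0 < r" "cball a r \<subseteq> \<Omega>" "\<bar>\<psi> a\<bar> \<noteq> \<infinity>"
  shows "f a * measure lborel (cball a r) \<le> (\<integral>z. indicator (cball a r) z * f z \<partial>lborel)"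
proof -
  define P where "P = (\<integral>\<^sup>+z\<in>cball a r. e2ennreal (\<psi> z) \<partial>lborel)"
  have a: "a \<in> \<Omega>" using assms by auto
  have P: "P < \<infinity>" unfolding P_def by (rule positive_part_finite[OF compact_cball assms(2)])
  have Nf: "N (cball a r) < \<infinity>" by (rule N_compact[OF compact_cball assms(2)])
  have AE: "AE z in lborel. z \<in> cball a r \<longrightarrow> \<bar>\<psi> z\<bar> \<noteq> \<infinity>" by (rule AE_compact[OF compact_cball assms(2)])
  have 1: "(\<integral>\<^sup>+z. ennreal (indicator (cball a r) z * f z) \<partial>lborel) = P"
    unfolding P_def using AE
    by (intro nn_integral_cong_AE, eventually_elim) (auto simp: indicator_def ennreal_f)
  have 2: "(\<integral>\<^sup>+z. ennreal (- (indicator (cball a r) z * f z)) \<partial>lborel) = N (cball a r)"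
    unfolding N_def using AE
    by (intro nn_integral_cong_AE, eventually_elim) (auto simp: indicator_def ennreal_f)
  have int: "(\<integral>z. indicator (cball a r) z * f z \<partial>lborel) = enn2real P - enn2real (N (cball a r))"
    unfolding real_lebesgue_integral_def[OF integrable_f[OF compact_cball assms(2)]] 1 2 ..
  have "\<phi> a \<le> ball_mean \<phi> a r" using sub assms by (simp add: subharmonic_on_def)
  also have "\<phi> a = ereal (f a)" using assms(3) a by (simp add: f_def \<psi>_def ereal_real)
  also have "ball_mean \<phi> a r = ereal ((enn2real P - enn2real (N (cball a r))) / measure lborel (cball a r))"
    using P Nf measure_cball_pos[OF assms(1), of a]
    unfolding ball_mean_eq[OF assms(2)] P_def[symmetric]
    by (cases P; cases "N (cball a r)") (auto simp: enn2ereal_ennreal)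
  finally show ?thesis
    using measure_cball_pos[OF assms(1), of a] by (simp add: int pos_le_divide_eq)
qed

end

subsection \<open>Positive functionals on test functions\<close>

text \<open>Finitely many radial bumps cover K. Their sum is at least 1 near K, and a further
  application of \<open>step\<close> flattens it to exactly 1 there while keeping values in
  [0, 1].\<close>

lemma smooth_cutoff:
  fixes K U :: "'a::euclidean_space set"
  assumes "compact K" "open U" "K \<subseteq> U"
  obtains \<kappa> :: "'a \<Rightarrow> real" and W K' where "smooth \<kappa>" "\<And>z. 0 \<le> \<kappa> z" "\<And>z. \<kappa> z \<le> 1" "open W" "K \<subseteq> W"
    "\<And>z. z \<in> W \<Longrightarrow> \<kappa> z = 1" "compact K'" "K' \<subseteq> U" "\<And>z. z \<notin> K' \<Longrightarrow> \<kappa> z = 0"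
proof -
  have "\<exists>r>0. cball z (2 * r) \<subseteq> U" if z: "z \<in> K" for z
  proof -
    obtain e where "e > 0" "cball z e \<subseteq> U"
      using assms z open_contains_cball by blast
    then show ?thesis by (intro exI[of _ "e / 2"]) auto
  qed
  then obtain r where r: "\<And>z. z \<in> K \<Longrightarrow> 0 < r z" "\<And>z. z \<in> K \<Longrightarrow> cball z (2 * r z) \<subseteq> U"
    by metis
  have "K \<subseteq> (\<Union>z\<in>K. ball z (r z))" using r(1) by force
  then obtain C where C: "C \<subseteq> K" "finite C" "K \<subseteq> (\<Union>z\<in>C. ball z (r z))"
    using compactE_image[OF assms(1), of K "\<lambda>z. ball z (r z)"] by auto
  \<comment> \<open>With d = |w - z| the argument is 2 - d^2 / (r z)^2: at least 1 on the ball of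
    radius r z, and at most 0 once d^2 >= 2 (r z)^2, hence outside the ball of radius 2 r z.\<close>
  define b where "b z w = step (2 - inverse ((r z)\<^sup>2) * (norm (w - z))\<^sup>2)" for z w
  define \<kappa> where "\<kappa> w = step (\<Sum>z\<in>C. b z w)" for w
  have b1: "b z w = 1" if "z \<in> C" "w \<in> ball z (r z)" for z w
  proof -
    have "(norm (w - z))\<^sup>2 \<le> (r z)\<^sup>2"
      using that by (intro power_mono) (auto simp: dist_norm norm_minus_commute)
    moreover have "0 < r z" using that C r by auto
    ultimately have "inverse ((r z)\<^sup>2) * (norm (w - z))\<^sup>2 \<le> 1"
      by (simp add: field_simps)
    then show ?thesis unfolding b_def by (intro step_simps) simp
  qed
  have b0: "b z w = 0" if "z \<in> C" "w \<notin> cball z (2 * r z)" for z w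
  proof -
    have r0: "0 < r z" using that C r by auto
    have "(2 * r z)\<^sup>2 \<le> (norm (w - z))\<^sup>2"
      using that r0 by (intro power_mono) (auto simp: dist_norm norm_minus_commute)
    then have "4 * (r z)\<^sup>2 \<le> (norm (w - z))\<^sup>2"
      by (simp add: power_mult_distrib)
    then have "2 * (r z)\<^sup>2 \<le> (norm (w - z))\<^sup>2"
      using zero_le_power2[of "r z"] by linarith
    then have "2 \<le> inverse ((r z)\<^sup>2) * (norm (w - z))\<^sup>2"
      using r0 by (simp add: field_simps)
    then show ?thesis unfolding b_def by (intro step_simps) simp
  qed
  show ?thesis
  proof (rule that[of \<kappa> "\<Union>z\<in>C. ball z (r z)" "\<Union>z\<in>C. cball z (2 * r z)"])
    show "smooth \<kappa>"
      unfolding \<kappa>_def b_def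
      by (intro smooth_compose_real[OF smooth_step] smooth_sum smooth_diff smooth_mult smooth_const smooth_norm_square)
    show "\<kappa> w = 1" if w: "w \<in> (\<Union>z\<in>C. ball z (r z))" for w
    proof -
      obtain z where z: "z \<in> C" "w \<in> ball z (r z)" using w by blast
      have "b z w \<le> (\<Sum>z\<in>C. b z w)"
        by (rule member_le_sum) (use z C in \<open>auto simp: b_def step_simps\<close>)
      then show ?thesis unfolding \<kappa>_def using b1[OF z] by (intro step_simps) simp
    qed
    show "\<kappa> w = 0" if w: "w \<notin> (\<Union>z\<in>C. cball z (2 * r z))" for w
    proof -
      have "(\<Sum>z\<in>C. b z w) = 0" using w b0 by (intro sum.neutral) blast
      then show ?thesis by (simp add: \<kappa>_def step_simps)
    qed
    show "compact (\<Union>z\<in>C. cball z (2 * r z))" using C by auto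
    show "(\<Union>z\<in>C. cball z (2 * r z)) \<subseteq> U" using C r by blast
  qed (use C in \<open>auto simp: \<kappa>_def step_simps\<close>)
qed

section \<open>The Riesz construction: content of open sets and outer measure\<close>

definition test_functions :: "'a::euclidean_space set \<Rightarrow> ('a \<Rightarrow> real) set" where
  "test_functions \<Omega> = {g. smooth g \<and> (\<exists>K. compact K \<and> K \<subseteq> \<Omega> \<and> (\<forall>z. z \<notin> K \<longrightarrow> g z = 0))}"

locale positive_functional =
  fixes \<Omega> :: "'a::euclidean_space set" and L :: "('a \<Rightarrow> real) \<Rightarrow> real"
  assumes open_\<Omega>: "open \<Omega>"
    and L_add: "g \<in> test_functions \<Omega> \<Longrightarrow> h \<in> test_functions \<Omega> \<Longrightarrow> L (\<lambda>z. g z + h z) = L g + L h"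
    and L_scale: "g \<in> test_functions \<Omega> \<Longrightarrow> L (\<lambda>z. c * g z) = c * L g"
    and L_pos: "g \<in> test_functions \<Omega> \<Longrightarrow> (\<And>z. 0 \<le> g z) \<Longrightarrow> 0 \<le> L g"
begin

abbreviation T where "T \<equiv> test_functions \<Omega>"

text \<open>The competitors of the Riesz construction, taken smooth since L is controlled only on
  test functions. Supports lie in both U and \<Omega>, so U may be any open set of the ambient
  space.\<close>

definition tests :: "'a set \<Rightarrow> ('a \<Rightarrow> real) set" where
  "tests U = {g. smooth g \<and> (\<forall>z. 0 \<le> g z \<and> g z \<le> 1) \<and>
     (\<exists>K. compact K \<and> K \<subseteq> U \<inter> \<Omega> \<and> (\<forall>z. z \<notin> K \<longrightarrow> g z = 0))}"

definition cont :: "'a set \<Rightarrow> ennreal" where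
  "cont U = (SUP g\<in>tests U. ennreal (L g))"

definition outm :: "'a set \<Rightarrow> ennreal" where
  "outm A = (INF U\<in>{U. open U \<and> A \<subseteq> U}. cont U)"

lemma testsI:
  "smooth g \<Longrightarrow> (\<And>z. 0 \<le> g z) \<Longrightarrow> (\<And>z. g z \<le> 1) \<Longrightarrow> compact K \<Longrightarrow> K \<subseteq> U \<Longrightarrow> K \<subseteq> \<Omega> \<Longrightarrow>
    (\<And>z. z \<notin> K \<Longrightarrow> g z = 0) \<Longrightarrow> g \<in> tests U"
  unfolding tests_def by blast

lemma testsE:
  assumes "g \<in> tests U"
  obtains K where "smooth g" "\<And>z. 0 \<le> g z" "\<And>z. g z \<le> 1" "compact K" "K \<subseteq> U" "K \<subseteq> \<Omega>"
    "\<And>z. z \<notin> K \<Longrightarrow> g z = 0"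
  using assms unfolding tests_def by blast

lemma TI: "smooth g \<Longrightarrow> compact K \<Longrightarrow> K \<subseteq> \<Omega> \<Longrightarrow> (\<And>z. z \<notin> K \<Longrightarrow> g z = 0) \<Longrightarrow> g \<in> T"
  unfolding test_functions_def by blast

lemma tests_T: "g \<in> tests U \<Longrightarrow> g \<in> T"
  by (erule testsE) (rule TI)

lemma T_add: "g \<in> T \<Longrightarrow> h \<in> T \<Longrightarrow> (\<lambda>z. g z + h z) \<in> T"
proof -
  assume "g \<in> T" "h \<in> T"
  then obtain K K' where "smooth g" "smooth h" "compact K" "K \<subseteq> \<Omega>" "compact K'" "K' \<subseteq> \<Omega>"
    "\<forall>z. z \<notin> K \<longrightarrow> g z = 0" "\<forall>z. z \<notin> K' \<longrightarrow> h z = 0" unfolding test_functions_def by blast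
  then show ?thesis by (intro TI[of _ "K \<union> K'"] smooth_add compact_Un) auto
qed

lemma T_scale: "g \<in> T \<Longrightarrow> (\<lambda>z. c * g z) \<in> T"
  unfolding test_functions_def by (auto intro!: smooth_mult)

lemma T_zero: "(\<lambda>z. 0) \<in> T"
  by (rule TI[of _ "{}"]) auto

lemma L_zero: "L (\<lambda>z. 0) = 0"
  using L_scale[OF T_zero, of 0] by simp

lemma T_diff: "g \<in> T \<Longrightarrow> h \<in> T \<Longrightarrow> (\<lambda>z. g z - h z) \<in> T"
  using T_add[OF _ T_scale[of h "- 1"], of g] by simp

lemma L_tests_nonneg: "g \<in> tests U \<Longrightarrow> 0 \<le> L g"
  by (rule L_pos[OF tests_T]) (auto elim: testsE)

lemma L_diff: "g \<in> T \<Longrightarrow> h \<in> T \<Longrightarrow> L (\<lambda>z. g z - h z) = L g - L h"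
  using L_add[OF _ T_scale[of h "- 1"], of g] L_scale[of h "- 1"] by simp

lemma L_mono: "g \<in> T \<Longrightarrow> h \<in> T \<Longrightarrow> (\<And>z. g z \<le> h z) \<Longrightarrow> L g \<le> L h"
  using L_pos[OF T_diff[of h g]] L_diff[of h g] by simp

lemma T_sum: "(\<And>i. i \<in> I \<Longrightarrow> g i \<in> T) \<Longrightarrow> (\<lambda>z. \<Sum>i\<in>I. g i z) \<in> T"
  by (induction I rule: infinite_finite_induct) (auto intro: T_add T_zero)

lemma L_sum: "(\<And>i. i \<in> I \<Longrightarrow> g i \<in> T) \<Longrightarrow> L (\<lambda>z. \<Sum>i\<in>I. g i z) = (\<Sum>i\<in>I. L (g i))"
  by (induction I rule: infinite_finite_induct) (simp_all add: L_add T_sum L_zero)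

lemma zero_tests: "(\<lambda>z. 0) \<in> tests U"
  by (rule testsI[of _ "{}"]) auto

lemma cont_upper: "g \<in> tests U \<Longrightarrow> ennreal (L g) \<le> cont U"
  unfolding cont_def by (rule SUP_upper)

lemma cont_least: "(\<And>g. g \<in> tests U \<Longrightarrow> ennreal (L g) \<le> c) \<Longrightarrow> cont U \<le> c"
  unfolding cont_def by (rule SUP_least)

lemma tests_mono: "U \<subseteq> V \<Longrightarrow> tests U \<subseteq> tests V"
  unfolding tests_def by blast

lemma cont_mono: "U \<subseteq> V \<Longrightarrow> cont U \<le> cont V"
  unfolding cont_def by (rule SUP_subset_mono[OF tests_mono]) auto

lemma cont_approx:
  assumes "cont U < \<infinity>" "0 < e"
  shows "\<exists>h\<in>tests U. cont U < ennreal (L h) + ennreal e"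
proof (rule SUP_approx_ennreal)
  show "tests U \<noteq> {}" using zero_tests by blast
  show "cont U = (SUP g\<in>tests U. ennreal (L g))" by (rule cont_def)
  show "cont U \<noteq> \<infinity>" using assms(1) by auto
qed (rule assms)

lemma cont_empty: "cont {} = 0"
proof -
  have "L g = 0" if "g \<in> tests {}" for g
  proof -
    have "g = (\<lambda>z. 0)" using that by (auto simp: tests_def)
    then show ?thesis by (simp add: L_zero)
  qed
  then have "cont {} \<le> 0" by (intro cont_least) simp
  then show ?thesis by simp
qed

text \<open>A two-piece smooth partition: with \<kappa> = 1 near K - V and support in U, the
  function g splits into g \<kappa>, supported in U, and g (1 - \<kappa>), supported in V.\<close>

lemma cont_Un:
  assumes "open U" "open V"
  shows "cont (U \<union> V) \<le> cont U + cont V"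
proof (rule cont_least)
  fix g assume "g \<in> tests (U \<union> V)"
  then obtain K where g: "smooth g" "\<And>z. 0 \<le> g z" "\<And>z. g z \<le> 1" "compact K" "K \<subseteq> U \<union> V" "K \<subseteq> \<Omega>"
    "\<And>z. z \<notin> K \<Longrightarrow> g z = 0" by (rule testsE) blast
  have "compact (K - V)" using g assms by (simp add: compact_diff)
  then obtain \<kappa> W K' where \<kappa>: "smooth \<kappa>" "\<And>z. 0 \<le> \<kappa> z" "\<And>z. \<kappa> z \<le> (1::real)" "open W" "K - V \<subseteq> W"
    "\<And>z. z \<in> W \<Longrightarrow> \<kappa> z = 1" "compact K'" "K' \<subseteq> U" "\<And>z. z \<notin> K' \<Longrightarrow> \<kappa> z = 0"
  proof -
    have "K - V \<subseteq> U" using g(5) by auto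
    from smooth_cutoff[OF \<open>compact (K - V)\<close> assms(1) this, where thesis = thesis] show thesis by (meson that)
  qed
  have 1: "(\<lambda>z. g z * \<kappa> z) \<in> tests U"
    by (rule testsI[of _ "K \<inter> K'"]) (use g \<kappa> in \<open>auto intro!: smooth_mult mult_le_one simp: compact_Int\<close>)
  have 2: "(\<lambda>z. g z * (1 - \<kappa> z)) \<in> tests V"
  proof (rule testsI[of _ "K - W"])
    show "smooth (\<lambda>z. g z * (1 - \<kappa> z))" by (intro smooth_mult smooth_diff smooth_const g \<kappa>)
    show "g z * (1 - \<kappa> z) \<le> 1" for z using g(2,3)[of z] \<kappa>(2,3)[of z] by (intro mult_le_one) auto
    show "0 \<le> g z * (1 - \<kappa> z)" for z using g(2,3)[of z] \<kappa>(2,3)[of z] by (intro mult_nonneg_nonneg) auto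
    show "g z * (1 - \<kappa> z) = 0" if "z \<notin> K - W" for z using that g(7) \<kappa>(6) by (cases "z \<in> K") auto
  qed (use g \<kappa> in \<open>auto simp: compact_diff\<close>)
  have "L g = L (\<lambda>z. g z * \<kappa> z + g z * (1 - \<kappa> z))" by (simp add: algebra_simps)
  also have "\<dots> = L (\<lambda>z. g z * \<kappa> z) + L (\<lambda>z. g z * (1 - \<kappa> z))"
    by (intro L_add tests_T[OF 1] tests_T[OF 2])
  finally have "ennreal (L g) = ennreal (L (\<lambda>z. g z * \<kappa> z)) + ennreal (L (\<lambda>z. g z * (1 - \<kappa> z)))"
    by (simp add: L_tests_nonneg[OF 1] L_tests_nonneg[OF 2])
  also have "\<dots> \<le> cont U + cont V"
    by (intro add_mono cont_upper 1 2)
  finally show "ennreal (L g) \<le> cont U + cont V" .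
qed

lemma cont_UN_finite: "(\<And>i. open (U i)) \<Longrightarrow> cont (\<Union>i<n. U i) \<le> (\<Sum>i<n. cont (U i :: 'a set))" for n :: nat
proof (induction n)
  case (Suc n)
  have "cont (\<Union>i<Suc n. U i) = cont ((\<Union>i<n. U i) \<union> U n)"
    by (simp add: lessThan_Suc Un_commute)
  also have "\<dots> \<le> cont (\<Union>i<n. U i) + cont (U n)"
    by (intro cont_Un open_UN ballI Suc.prems)
  also have "\<dots> \<le> (\<Sum>i<Suc n. cont (U i))"
    using Suc by (simp add: add_right_mono)
  finally show ?case .
qed (simp add: cont_empty)

lemma cont_UN:
  assumes "\<And>i :: nat. open (U i)"
  shows "cont (\<Union>i. U i) \<le> (\<Sum>i. cont (U i))"
proof (rule cont_least)
  fix g assume "g \<in> tests (\<Union>i. U i)"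
  then obtain K where g: "smooth g" "\<And>z. 0 \<le> g z" "\<And>z. g z \<le> 1" "compact K" "K \<subseteq> (\<Union>i. U i)" "K \<subseteq> \<Omega>"
    "\<And>z. z \<notin> K \<Longrightarrow> g z = 0" by (rule testsE) blast
  obtain C where C: "finite C" "K \<subseteq> (\<Union>i\<in>C. U i)"
    using compactE_image[OF g(4), of UNIV U] assms g(5) by auto
  obtain n where n: "C \<subseteq> {..<n}" using finite_nat_bounded[OF C(1)] by auto
  have "K \<subseteq> (\<Union>i<n. U i)" using C(2) n by blast
  then have "g \<in> tests (\<Union>i<n. U i)" by (intro testsI[of _ K] g)
  then have "ennreal (L g) \<le> cont (\<Union>i<n. U i)" by (rule cont_upper)
  also have "\<dots> \<le> (\<Sum>i<n. cont (U i))" by (rule cont_UN_finite[OF assms])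
  also have "\<dots> \<le> (\<Sum>i. cont (U i))" by (intro sum_le_suminf) auto
  finally show "ennreal (L g) \<le> (\<Sum>i. cont (U i))" .
qed

lemma outm_open: "open U \<Longrightarrow> outm U = cont U"
  unfolding outm_def by (rule antisym) (auto intro!: INF_lower INF_greatest cont_mono)

lemma outm_le: "open U \<Longrightarrow> A \<subseteq> U \<Longrightarrow> outm A \<le> cont U"
  unfolding outm_def by (auto intro!: INF_lower)

lemma outm_mono: "A \<subseteq> B \<Longrightarrow> outm A \<le> outm B"
  unfolding outm_def by (rule INF_superset_mono) auto

lemma outm_approx:
  assumes "outm A < \<infinity>" "0 < e"
  obtains U where "open U" "A \<subseteq> U" "cont U \<le> outm A + ennreal e"
proof -
  have "outm A < outm A + ennreal e"
    using assms by (cases "outm A") (auto simp: ennreal_less_iff simp flip: ennreal_plus)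
  then obtain U where "open U" "A \<subseteq> U" "cont U < outm A + ennreal e"
    unfolding outm_def INF_less_iff by blast
  then show ?thesis by (intro that) auto
qed

lemma outm_countably_subadditive: "outm (\<Union>i. A i) \<le> (\<Sum>i. outm (A i))" for A :: "nat \<Rightarrow> 'a set"
proof (cases "\<exists>i. outm (A i) = \<infinity>")
  case True
  then obtain i where "outm (A i) = \<infinity>" by blast
  moreover have "outm (A i) \<le> (\<Sum>i. outm (A i))"
    using sum_le_suminf[of "\<lambda>i. outm (A i)" "{i}"] by simp
  ultimately show ?thesis by (simp add: top_unique)
next
  case False
  then have fin: "outm (A i) < \<infinity>" for i by (simp add: less_top)
  show ?thesis
  proof (rule ennreal_le_epsilon)
    fix e :: real assume e: "0 < e"
    have "\<exists>U. open U \<and> A i \<subseteq> U \<and> cont U \<le> outm (A i) + ennreal (e * (1 / 2) ^ Suc i)" for i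
      using outm_approx[OF fin, of "e * (1 / 2) ^ Suc i" i] e by (metis zero_less_mult_iff zero_less_power zero_less_divide_1_iff zero_less_numeral)
    then obtain U where U: "\<And>i. open (U i)" "\<And>i. A i \<subseteq> U i" "\<And>i. cont (U i) \<le> outm (A i) + ennreal (e * (1 / 2) ^ Suc i)"
      by metis
    have "outm (\<Union>i. A i) \<le> cont (\<Union>i. U i)" using U by (intro outm_le) auto
    also have "\<dots> \<le> (\<Sum>i. cont (U i))" by (rule cont_UN[OF U(1)])
    also have "\<dots> \<le> (\<Sum>i. outm (A i) + ennreal (e * (1 / 2) ^ Suc i))" by (intro suminf_le U(3)) auto
    also have "\<dots> = (\<Sum>i. outm (A i)) + (\<Sum>i. ennreal (e * (1 / 2) ^ Suc i))"
      by (simp add: suminf_add)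
    also have "(\<Sum>i. ennreal (e * (1 / 2) ^ Suc i)) = ennreal e"
      using e by (subst suminf_ennreal_eq[where x = e]) (use sums_mult[OF power_half_series, of e] in auto)
    finally show "outm (\<Union>i. A i) \<le> (\<Sum>i. outm (A i)) + ennreal e" .
  qed
qed

lemma outm_empty: "outm {} = 0"
  by (simp add: outm_open cont_empty)

lemma outm_subadditive: "outm (A \<union> B) \<le> outm A + outm B"
proof -
  have "(\<Union>i::nat. (if i = 0 then A else if i = 1 then B else {})) = A \<union> B"
    by (auto split: if_splits)
  moreover have "(\<Sum>i::nat. outm (if i = 0 then A else if i = 1 then B else {})) = outm A + outm B"
    by (subst suminf_finite[of "{0, 1}"]) (auto simp: outm_empty)
  ultimately show ?thesis
    using outm_countably_subadditive[of "\<lambda>i. if i = 0 then A else if i = 1 then B else {}"] by simp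
qed

text \<open>It suffices to treat open V in place of X. If g is a competitor for U \<inter> V with
  support K and h is one for V - K, then g + h is a competitor for V, since the supports are
  disjoint. As V - K is an open set containing V - U, taking suprema over h and then over g gives
  the claim.\<close>

lemma caratheodory_open:
  assumes "open U"
  shows "outm (U \<inter> X) + outm (- U \<inter> X) = outm X"
proof (rule antisym)
  have op: "cont (U \<inter> V) + outm (- U \<inter> V) \<le> cont V" if "open V" for V
  proof -
    have le: "ennreal (L g) + outm (- U \<inter> V) \<le> cont V" if g': "g \<in> tests (U \<inter> V)" for g
    proof -
      obtain K where g: "smooth g" "\<And>z. 0 \<le> g z" "\<And>z. g z \<le> 1" "compact K" "K \<subseteq> U \<inter> V" "K \<subseteq> \<Omega>"
        "\<And>z. z \<notin> K \<Longrightarrow> g z = 0" using g' by (rule testsE) blast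
      have oVK: "open (V - K)" using \<open>open V\<close> g(4) by (intro open_Diff compact_imp_closed)
      have "ennreal (L h) \<le> cont V - ennreal (L g)" if h': "h \<in> tests (V - K)" for h
      proof -
        obtain K' where h: "smooth h" "\<And>z. 0 \<le> h z" "\<And>z. h z \<le> 1" "compact K'" "K' \<subseteq> V - K" "K' \<subseteq> \<Omega>"
          "\<And>z. z \<notin> K' \<Longrightarrow> h z = 0" using h' by (rule testsE) blast
        have "(\<lambda>z. g z + h z) \<in> tests V"
        proof (rule testsI[of _ "K \<union> K'"])
          show "g z + h z \<le> 1" for z
            using g(3)[of z] h(3)[of z] g(7)[of z] h(7)[of z] h(5) by (cases "z \<in> K"; cases "z \<in> K'") auto
        qed (use g h in \<open>auto intro!: smooth_add add_nonneg_nonneg simp: compact_Un\<close>)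
        then have "ennreal (L (\<lambda>z. g z + h z)) \<le> cont V" by (rule cont_upper)
        then have "ennreal (L g) + ennreal (L h) \<le> cont V"
          by (simp add: L_add tests_T[OF g'] tests_T[OF h'] L_tests_nonneg[OF g'] L_tests_nonneg[OF h'])
        then show ?thesis by (simp add: ennreal_le_minus_iff add.commute)
      qed
      then have "cont (V - K) \<le> cont V - ennreal (L g)" by (rule cont_least)
      moreover have "outm (- U \<inter> V) \<le> cont (V - K)" by (rule outm_le[OF oVK]) (use g in auto)
      ultimately have "outm (- U \<inter> V) \<le> cont V - ennreal (L g)" by order
      moreover have "ennreal (L g) \<le> cont V"
        using g' tests_mono[of "U \<inter> V" V] by (intro cont_upper) auto
      ultimately show ?thesis by (auto simp add: ennreal_le_minus_iff add.commute)
    qed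
    show ?thesis
    proof (cases "outm (- U \<inter> V) = \<infinity>")
      case True
      then show ?thesis using le[OF zero_tests]
        by (simp add: top_unique)
    next
      case False
      have "(SUP g\<in>tests (U \<inter> V). ennreal (L g)) + outm (- U \<inter> V) = (SUP g\<in>tests (U \<inter> V). ennreal (L g) + outm (- U \<inter> V))"
        by (rule ennreal_SUP_add_left[symmetric]) (use zero_tests False in auto)
      then show ?thesis
        unfolding cont_def[of "U \<inter> V"] using le
        by (auto intro!: SUP_least)
    qed
  qed
  show "outm (U \<inter> X) + outm (- U \<inter> X) \<le> outm X"
    unfolding outm_def[of X]
  proof (rule INF_greatest)
    fix V assume "V \<in> {V. open V \<and> X \<subseteq> V}"
    then have V: "open V" "X \<subseteq> V" by auto
    have "outm (U \<inter> X) + outm (- U \<inter> X) \<le> cont (U \<inter> V) + outm (- U \<inter> V)"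
      by (intro add_mono outm_le outm_mono) (use V assms in auto)
    also have "\<dots> \<le> cont V" by (rule op[OF V(1)])
    finally show "outm (U \<inter> X) + outm (- U \<inter> X) \<le> cont V" .
  qed
  have "X = (U \<inter> X) \<union> (- U \<inter> X)" by auto
  then show "outm X \<le> outm (U \<inter> X) + outm (- U \<inter> X)" by (metis outm_subadditive)
qed

lemma borel_measure_space: "measure_space UNIV (sets borel) outm"
proof -
  define S where "S = lambda_system UNIV (Pow UNIV) outm"
  have "outer_measure_space (Pow UNIV) outm"
    unfolding outer_measure_space_def positive_def increasing_def countably_subadditive_def
    using outm_empty outm_mono outm_countably_subadditive by auto
  from sigma_algebra.caratheodory_lemma[OF sigma_algebra_Pow this] have ms: "measure_space UNIV S outm" by (simp add: S_def)
  then have sa: "sigma_algebra UNIV S" and pos: "positive S outm" and ca: "countably_additive S outm"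
    by (auto simp: measure_space_def)
  have "{U. open U} \<subseteq> S"
    unfolding S_def lambda_system_def using caratheodory_open by (auto simp: Compl_eq_Diff_UNIV)
  then have "sets borel \<subseteq> S"
    unfolding borel_def using sigma_algebra.sigma_sets_subset[OF sa, of "{U. open U}"] by simp
  then show ?thesis
    unfolding measure_space_def using pos ca sets.sigma_algebra_axioms[of "borel :: 'a measure"]
    by (auto simp: positive_def countably_additive_def)
qed

section \<open>The representing measure and its integrals\<close>

definition \<mu>0 :: "'a measure" where "\<mu>0 = measure_of UNIV (sets borel) outm"

lemma sets_\<mu>0 [simp, measurable_cong]: "sets \<mu>0 = sets borel"
  unfolding \<mu>0_def by (simp add: sigma_algebra.sigma_sets_eq[OF sets.sigma_algebra_axioms[of "borel :: 'a measure", simplified]])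

lemma emeasure_\<mu>0: "A \<in> sets borel \<Longrightarrow> emeasure \<mu>0 A = outm A"
  unfolding \<mu>0_def using borel_measure_space
  by (intro emeasure_measure_of_sigma) (auto simp: measure_space_def)

text \<open>The outer measure may charge the complement of \<Omega>: if mass accumulates at the
  boundary, the contents of the neighbourhoods of the complement can stay bounded away from 0. The
  density restricts the measure to \<Omega>, as \<open>represents_trace\<close> demands.\<close>

definition \<mu> :: "'a measure" where "\<mu> = density \<mu>0 (indicator \<Omega>)"

lemma sets_\<mu> [simp, measurable_cong]: "sets \<mu> = sets borel"
  by (simp add: \<mu>_def)

lemma emeasure_\<mu>: "A \<in> sets borel \<Longrightarrow> emeasure \<mu> A = outm (A \<inter> \<Omega>)"
  unfolding \<mu>_def using open_\<Omega>
  by (subst emeasure_density) (auto intro!: borel_measurable_indicator simp: emeasure_\<mu>0[symmetric] indicator_inter_arith[symmetric] Int_commute mult.commute)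

lemma emeasure_\<mu>_open: "open U \<Longrightarrow> emeasure \<mu> U = cont U"
proof -
  assume "open U"
  then have "emeasure \<mu> U = cont (U \<inter> \<Omega>)" using open_\<Omega> by (simp add: emeasure_\<mu> outm_open open_Int)
  moreover have "cont (U \<inter> \<Omega>) = cont U"
    unfolding cont_def tests_def by (rule arg_cong[where f = "\<lambda>S. SUP g\<in>S. ennreal (L g)"]) auto
  ultimately show ?thesis by simp
qed

lemma cont_le_cutoff:
  assumes "\<kappa> \<in> T" "\<And>z. 0 \<le> \<kappa> z" "\<And>z. z \<in> W \<Longrightarrow> 1 \<le> \<kappa> z"
  shows "cont W \<le> ennreal (L \<kappa>)"
proof (rule cont_least)
  fix g assume g: "g \<in> tests W"
  then obtain K where K: "\<And>z. g z \<le> 1" "K \<subseteq> W" "\<And>z. z \<notin> K \<Longrightarrow> g z = 0" by (rule testsE) blast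
  have "g z \<le> \<kappa> z" for z
  proof (cases "z \<in> K")
    case True
    then have "1 \<le> \<kappa> z" using assms(3) K(2) by auto
    with K(1)[of z] show ?thesis by linarith
  qed (simp add: K(3) assms)
  then show "ennreal (L g) \<le> ennreal (L \<kappa>)"
    by (intro ennreal_leI L_mono tests_T[OF g] assms)
qed

lemma compact_cutoff:
  assumes "compact K" "K \<subseteq> \<Omega>"
  obtains W \<kappa> where "open W" "K \<subseteq> W" "\<kappa> \<in> tests \<Omega>" "\<And>z. z \<in> W \<Longrightarrow> \<kappa> z = 1" "cont W < \<infinity>"
proof -
  obtain \<kappa> W K' where \<kappa>: "smooth \<kappa>" "\<And>z. 0 \<le> \<kappa> z" "\<And>z. \<kappa> z \<le> (1::real)" "open W" "K \<subseteq> W"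
    "\<And>z. z \<in> W \<Longrightarrow> \<kappa> z = 1" "compact K'" "K' \<subseteq> \<Omega>" "\<And>z. z \<notin> K' \<Longrightarrow> \<kappa> z = 0"
    by (rule smooth_cutoff[OF assms(1) open_\<Omega> assms(2)], rule that)
  have t: "\<kappa> \<in> tests \<Omega>" by (rule testsI[of _ K']) (use \<kappa> in auto)
  have "cont W \<le> ennreal (L \<kappa>)" by (rule cont_le_cutoff) (use \<kappa> tests_T[OF t] in auto)
  also have "\<dots> < \<infinity>" by simp
  finally show ?thesis using that \<kappa> t by blast
qed

lemma emeasure_compact: "compact K \<Longrightarrow> K \<subseteq> \<Omega> \<Longrightarrow> emeasure \<mu> K < \<infinity>"
proof -
  assume K: "compact K" "K \<subseteq> \<Omega>"
  then obtain W \<kappa> where W: "open W" "K \<subseteq> W" "cont W < \<infinity>" by (rule compact_cutoff) blast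
  have "emeasure \<mu> K \<le> emeasure \<mu> W" by (rule emeasure_mono) (use W in auto)
  also have "\<dots> < \<infinity>" using W by (simp add: emeasure_\<mu>_open)
  finally show ?thesis .
qed

lemma emeasure_support:
  assumes "g \<in> tests UNIV" "compact K" "\<And>z. z \<notin> K \<Longrightarrow> g z = 0" "K \<subseteq> \<Omega>"
  shows "ennreal (L g) \<le> emeasure \<mu> K"
proof -
  have "ennreal (L g) \<le> cont U" if "K \<subseteq> U" for U
  proof (rule cont_upper)
    show "g \<in> tests U" using assms that by (elim testsE, intro testsI[of _ K]) auto
  qed
  then have "ennreal (L g) \<le> outm K" unfolding outm_def by (intro INF_greatest) auto
  then show ?thesis using assms(2,4) by (simp add: emeasure_\<mu> Int_absorb2 borel_compact)
qed

lemma integrable_test: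
  assumes "g \<in> T"
  shows "integrable \<mu> g"
proof -
  obtain K where g: "smooth g" "compact K" "K \<subseteq> \<Omega>" "\<And>z. z \<notin> K \<Longrightarrow> g z = 0"
    using assms unfolding test_functions_def by blast
  have "bounded (g ` K)" using g by (intro compact_imp_bounded compact_continuous_image smooth_continuous_on)
  then obtain B where B: "\<And>z. z \<in> K \<Longrightarrow> norm (g z) \<le> B" by (auto simp: bounded_iff)
  have m: "g \<in> borel_measurable \<mu>"
    using borel_measurable_continuous_onI[OF smooth_continuous_on[OF g(1)]]
    by (simp add: measurable_cong_sets[OF sets_\<mu> refl])
  show ?thesis
  proof (rule Bochner_Integration.integrable_bound[where f = "\<lambda>z. B * indicator K z :: real"])
    show "integrable \<mu> (\<lambda>z. B * indicator K z :: real)"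
      using g emeasure_compact[OF g(2,3)] by (intro integrable_mult_right integrable_real_indicator) (auto simp: borel_compact)
    show "AE z in \<mu>. norm (g z) \<le> norm (B * indicator K z :: real)"
    proof (intro AE_I2)
      fix z show "norm (g z) \<le> norm (B * indicator K z :: real)"
        using B[of z] g(4)[of z] by (cases "z \<in> K") auto
    qed
  qed fact
qed

text \<open>Approximating \<open>f\<close> from below by sums of test functions supported in its superlevel sets.\<close>

lemma integral_le_L_aux:
  assumes f: "f \<in> tests UNIV" and K: "compact K" "K \<subseteq> \<Omega>" "\<And>z. z \<notin> K \<Longrightarrow> f z = 0" and N: "0 < N"
  shows "(\<integral>z. f z \<partial>\<mu>) \<le> L f + (measure \<mu> K + 1) / real N"
proof -
  define U where "U k = {z. f z > real k / real N}" for k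
  have cf: "continuous_on UNIV f" using f by (auto elim: testsE intro: smooth_continuous_on)
  have oU: "open (U k)" for k
    unfolding U_def by (intro open_Collect_less continuous_on_const cf)
  have UK: "U k \<subseteq> K" for k
  proof
    fix z assume "z \<in> U k"
    then have "0 < f z" unfolding U_def using N by (auto intro: le_less_trans[of 0 "real k / real N"])
    then show "z \<in> K" using K(3)[of z] by force
  qed
  have fin: "emeasure \<mu> (U k) < \<infinity>" for k
    using emeasure_mono[OF UK[of k], of \<mu>] emeasure_compact[OF K(1,2)] K by (auto intro: le_less_trans simp: borel_compact)
  \<comment> \<open>Each superlevel set is exhausted up to 1/N; fewer than N such errors, averaged
    with the weight 1/N, cost at most 1/N in total.\<close>
  have "\<exists>h\<in>tests (U k). measure \<mu> (U k) \<le> L h + 1 / real N" for k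
  proof -
    have "\<exists>h\<in>tests (U k). cont (U k) < ennreal (L h) + ennreal (1 / real N)"
      using fin[of k] N zero_tests
      by (intro cont_approx) (auto simp: emeasure_\<mu>_open[OF oU])
    then obtain h where h: "h \<in> tests (U k)" "cont (U k) < ennreal (L h) + ennreal (1 / real N)" by blast
    have "0 \<le> L h" using h(1) by (auto intro!: L_pos[OF tests_T] simp: tests_def)
    then have "ennreal (measure \<mu> (U k)) < ennreal (L h + 1 / real N)"
      using h(2) fin[of k] by (simp add: emeasure_eq_ennreal_measure less_top emeasure_\<mu>_open[OF oU, symmetric] flip: ennreal_plus)
    then have "measure \<mu> (U k) < L h + 1 / real N" by (subst (asm) ennreal_less_iff) simp_all
    then show ?thesis using h(1) by (intro bexI[of _ h]) auto
  qed
  then obtain h where h: "\<And>k. h k \<in> tests (U k)" "\<And>k. measure \<mu> (U k) \<le> L (h k) + 1 / real N" by metis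
  have h01: "0 \<le> h k z" "h k z \<le> 1" "z \<notin> U k \<Longrightarrow> h k z = 0" for k z
    using h(1)[of k] by (auto simp: tests_def)
  \<comment> \<open>With c the ceiling of N f(z), exactly the levels 1 <= k < c lie below N f(z), so
    their number differs from N f(z) by at most 1. For c = 0 the truncated c - 1 still gives the
    right count.\<close>
  have count: "real (card {k\<in>{1..<N}. z \<in> U k}) \<le> real N * f z" "real N * f z \<le> indicator K z + real (card {k\<in>{1..<N}. z \<in> U k})" for z
  proof -
    have f01: "0 \<le> f z" "f z \<le> 1" using f by (auto simp: tests_def)
    have Uiff: "z \<in> U k \<longleftrightarrow> real k < real N * f z" for k
      using N by (simp add: U_def field_simps)
    define c where "c = nat \<lceil>real N * f z\<rceil>"
    have c1: "real c \<ge> real N * f z" unfolding c_def by (rule real_nat_ceiling_ge)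
    have "0 \<le> real N * f z" using f01 by simp
    then have "0 \<le> \<lceil>real N * f z\<rceil>" by (metis ceiling_mono ceiling_zero)
    then have c2: "real c < real N * f z + 1" unfolding c_def by (simp add: ceiling_less_iff) linarith
    have c3: "k < c \<longleftrightarrow> real k < real N * f z" for k :: nat
      unfolding c_def by (simp add: zless_nat_eq_int_zless less_ceiling_iff)
    note c = c1 c2 c3
    have "real N * f z \<le> real N" using f01 by (simp add: mult_left_le)
    then have "real c < real N + 1" using c(2) by linarith
    then have "real c < real (Suc N)" by simp
    then have cN: "c \<le> N" unfolding of_nat_less_iff by (rule less_Suc_eq_le[THEN iffD1])
    have mem: "z \<in> U k \<longleftrightarrow> k < c" for k by (rule trans[OF Uiff c3[symmetric]])
    have "{k\<in>{1..<N}. k < c} = {1..<c}" using cN by auto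
    then have card: "card {k\<in>{1..<N}. z \<in> U k} = c - 1" unfolding mem by simp
    show "real (card {k\<in>{1..<N}. z \<in> U k}) \<le> real N * f z"
    proof (cases c)
      case 0
      then show ?thesis unfolding card using f01(1) by simp
    next
      case (Suc d)
      then show ?thesis unfolding card using c2 by simp
    qed
    show "real N * f z \<le> indicator K z + real (card {k\<in>{1..<N}. z \<in> U k})"
    proof (cases "z \<in> K")
      case True
      have "real c \<le> 1 + real (c - 1)" by simp
      then show ?thesis unfolding card using c1 True by simp
    next
      case False
      then show ?thesis using K(3) by simp
    qed
  qed
  have sumind: "(\<Sum>k=1..<N. indicator (U k) z) = real (card {k\<in>{1..<N}. z \<in> U k})" for z
    by (simp add: indicator_def sum.If_cases Int_def)
  have "L (\<lambda>z. (1 / real N) * (\<Sum>k=1..<N. h k z)) \<le> L f"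
  proof (rule L_mono)
    show "(\<lambda>z. (1 / real N) * (\<Sum>k=1..<N. h k z)) \<in> T"
      by (intro T_scale T_sum tests_T[OF h(1)])
    show "f \<in> T" by (rule tests_T[OF f])
    fix z
    have "(\<Sum>k=1..<N. h k z) \<le> (\<Sum>k=1..<N. indicator (U k) z)"
      by (intro sum_mono) (use h01 in \<open>auto simp: indicator_def\<close>)
    also have "\<dots> \<le> real N * f z" unfolding sumind by (rule count)
    finally show "(1 / real N) * (\<Sum>k=1..<N. h k z) \<le> f z" using N by (simp add: field_simps)
  qed
  also have "L (\<lambda>z. (1 / real N) * (\<Sum>k=1..<N. h k z)) = (1 / real N) * (\<Sum>k=1..<N. L (h k))"
    by (subst L_scale) (simp_all add: T_sum L_sum tests_T[OF h(1)])
  finally have Lh: "(1 / real N) * (\<Sum>k=1..<N. L (h k)) \<le> L f" .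
  have "(\<integral>z. f z \<partial>\<mu>) \<le> (\<integral>z. (1 / real N) * (indicator K z + (\<Sum>k=1..<N. indicator (U k) z)) \<partial>\<mu>)"
  proof (rule integral_mono)
    show "integrable \<mu> f" by (rule integrable_test[OF tests_T[OF f]])
    show "integrable \<mu> (\<lambda>z. (1 / real N) * (indicator K z + (\<Sum>k=1..<N. indicator (U k) z)))"
      using K fin emeasure_compact[OF K(1,2)] oU borel_compact[OF K(1)]
      by (intro integrable_mult_right Bochner_Integration.integrable_add Bochner_Integration.integrable_sum integrable_real_indicator) auto
    show "f z \<le> (1 / real N) * (indicator K z + (\<Sum>k=1..<N. indicator (U k) z))" for z
      unfolding sumind using count(2)[of z] N by (simp add: field_simps)
  qed
  also have "\<dots> = (1 / real N) * (measure \<mu> K + (\<Sum>k=1..<N. measure \<mu> (U k)))"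
    using K fin emeasure_compact[OF K(1,2)] oU borel_compact[OF K(1)]
    by (subst integral_mult_right_zero, subst Bochner_Integration.integral_add)
      (auto intro!: Bochner_Integration.integrable_sum integrable_real_indicator simp: Bochner_Integration.integral_sum)
  also have "(\<Sum>k=1..<N. measure \<mu> (U k)) \<le> (\<Sum>k=1..<N. L (h k)) + 1"
  proof -
    have "(\<Sum>k=1..<N. measure \<mu> (U k)) \<le> (\<Sum>k=1..<N. L (h k) + 1 / real N)"
      by (intro sum_mono h)
    also have "\<dots> = (\<Sum>k=1..<N. L (h k)) + real (N - 1) / real N"
      by (simp add: sum.distrib)
    also have "real (N - 1) / real N \<le> 1" using N by simp
    finally show ?thesis by simp
  qed
  finally have "(\<integral>z. f z \<partial>\<mu>) \<le> (1 / real N) * (measure \<mu> K + ((\<Sum>k=1..<N. L (h k)) + 1))"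
    using N by (simp add: divide_right_mono)
  also have "\<dots> = (1 / real N) * (\<Sum>k=1..<N. L (h k)) + (measure \<mu> K + 1) / real N"
    by (simp add: field_simps add_divide_distrib)
  finally show ?thesis using Lh by linarith
qed

lemma integral_le_L:
  assumes f: "f \<in> tests UNIV"
  shows "(\<integral>z. f z \<partial>\<mu>) \<le> L f"
proof -
  obtain K where K: "compact K" "K \<subseteq> \<Omega>" "\<And>z. z \<notin> K \<Longrightarrow> f z = 0" using f by (rule testsE) blast
  have "(\<lambda>N. L f + (measure \<mu> K + 1) / real N) \<longlonglongrightarrow> L f + 0"
    by (intro tendsto_add tendsto_const lim_const_over_n)
  then show ?thesis
    using integral_le_L_aux[OF f K]
    by (intro LIMSEQ_le_const[where X = "\<lambda>N. L f + (measure \<mu> K + 1) / real N" and x = "L f"])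
      (auto intro!: exI[of _ 1])
qed

text \<open>For the reverse inequality, \<open>integral_le_L\<close> is applied to \<kappa> - f,
  where \<kappa> is a cutoff with \<kappa> = 1 on the support of f and L \<kappa> at most its
  integral plus e.\<close>

lemma integral_eq_L_tests:
  assumes f: "f \<in> tests UNIV"
  shows "(\<integral>z. f z \<partial>\<mu>) = L f"
proof (rule antisym)
  show "(\<integral>z. f z \<partial>\<mu>) \<le> L f" by (rule integral_le_L[OF f])
  obtain K where K: "compact K" "K \<subseteq> \<Omega>" "\<And>z. z \<notin> K \<Longrightarrow> f z = 0" using f by (rule testsE) blast
  obtain W where W: "open W" "K \<subseteq> W" "cont W < \<infinity>" using compact_cutoff[OF K(1,2)] by metis
  have W': "cont (W \<inter> \<Omega>) < \<infinity>" using W(3) cont_mono[of "W \<inter> \<Omega>" W] by (auto intro: le_less_trans)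
  have "L f \<le> (\<integral>z. f z \<partial>\<mu>) + e" if e: "0 < e" for e
  proof -
    have "\<exists>h\<in>tests (W \<inter> \<Omega>). cont (W \<inter> \<Omega>) < ennreal (L h) + ennreal e"
      using W' e by (intro cont_approx)
    then obtain h where h: "h \<in> tests (W \<inter> \<Omega>)" "cont (W \<inter> \<Omega>) < ennreal (L h) + ennreal e" by blast
    obtain H where H: "compact H" "H \<subseteq> W \<inter> \<Omega>" "\<And>z. z \<notin> H \<Longrightarrow> h z = 0" using h(1) by (rule testsE) blast
    \<comment> \<open>Since h almost exhausts the content of W \<inter> \<Omega> and \<kappa> = 1 on
      the support H of h, L \<kappa> <= L h + e, L h <= \<mu>(H), and \<mu>(H) is at most the
      integral of \<kappa>.\<close>
    obtain \<kappa> V K' where \<kappa>: "smooth \<kappa>" "\<And>z. 0 \<le> \<kappa> z" "\<And>z. \<kappa> z \<le> (1::real)" "open V" "K \<union> H \<subseteq> V"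
      "\<And>z. z \<in> V \<Longrightarrow> \<kappa> z = 1" "compact K'" "K' \<subseteq> W \<inter> \<Omega>" "\<And>z. z \<notin> K' \<Longrightarrow> \<kappa> z = 0"
    proof -
      have c: "compact (K \<union> H)" "open (W \<inter> \<Omega>)" "K \<union> H \<subseteq> W \<inter> \<Omega>"
        using W H K open_\<Omega> by (auto intro: open_Int)
      show thesis by (rule smooth_cutoff[OF c], rule that)
    qed
    have t: "\<kappa> \<in> tests (W \<inter> \<Omega>)" by (rule testsI[of _ K']) (use \<kappa> in auto)
    have tU: "\<kappa> \<in> tests UNIV" using t tests_mono[of "W \<inter> \<Omega>" UNIV] by auto
    have hU: "h \<in> tests UNIV" using h(1) tests_mono[of "W \<inter> \<Omega>" UNIV] by auto
    have h0: "0 \<le> L h" using h(1) by (auto intro!: L_pos[OF tests_T] simp: tests_def)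
    have "ennreal (L \<kappa>) < ennreal (L h + e)"
      using cont_upper[OF t] h(2) h0 e by (simp add: ennreal_plus) 
    then have "L \<kappa> < L h + e" by (subst (asm) ennreal_less_iff) (simp_all add: L_tests_nonneg[OF t])
    then have 1: "L \<kappa> \<le> L h + e" by simp
    have "ennreal (L h) \<le> emeasure \<mu> H" by (rule emeasure_support[OF hU H(1) H(3)]) (use H in auto)
    then have 2: "L h \<le> measure \<mu> H"
      using emeasure_compact[OF H(1)] H(2) h0
      by (simp add: emeasure_eq_ennreal_measure less_top[symmetric])
    have "measure \<mu> H = (\<integral>z. indicator H z \<partial>\<mu>)" using borel_compact[OF H(1)] by simp
    also have "\<dots> \<le> (\<integral>z. \<kappa> z \<partial>\<mu>)"
    proof (rule integral_mono)
      show "integrable \<mu> (indicator H :: 'a \<Rightarrow> real)"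
        using H emeasure_compact[OF H(1)] by (intro integrable_real_indicator) (auto simp: borel_compact)
      show "integrable \<mu> \<kappa>" by (rule integrable_test[OF tests_T[OF t]])
      show "indicator H z \<le> \<kappa> z" for z using \<kappa>(2)[of z] \<kappa>(6)[of z] \<kappa>(5) by (auto simp: indicator_def)
    qed
    finally have 3: "measure \<mu> H \<le> (\<integral>z. \<kappa> z \<partial>\<mu>)" .
    have "(\<lambda>z. \<kappa> z - f z) \<in> tests UNIV"
    proof (rule testsI[of _ "K' \<union> K"])
      have f01: "0 \<le> f z" "f z \<le> 1" for z using f by (auto simp: tests_def)
      show "0 \<le> \<kappa> z - f z" for z
      proof (cases "z \<in> K")
        case True
        then have "\<kappa> z = 1" using \<kappa>(5,6) by auto
        then show ?thesis using f01 by simp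
      qed (simp add: K \<kappa>)
      show "\<kappa> z - f z \<le> 1" for z using f01(1)[of z] \<kappa>(3)[of z] by simp
      show "smooth (\<lambda>z. \<kappa> z - f z)" using f \<kappa> by (auto intro!: smooth_diff simp: tests_def)
    qed (use \<kappa> K in auto)
    from integral_le_L[OF this] have "(\<integral>z. \<kappa> z \<partial>\<mu>) - (\<integral>z. f z \<partial>\<mu>) \<le> L \<kappa> - L f"
      by (simp add: L_diff tests_T[OF t] tests_T[OF f] integrable_test)
    with 1 2 3 show ?thesis by linarith
  qed
  then show "L f \<le> (\<integral>z. f z \<partial>\<mu>)" by (rule field_le_epsilon)
qed

lemma integral_eq_L:
  assumes g: "g \<in> T"
  shows "(\<integral>z. g z \<partial>\<mu>) = L g"
proof -
  obtain K where K: "smooth g" "compact K" "K \<subseteq> \<Omega>" "\<And>z. z \<notin> K \<Longrightarrow> g z = 0"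
    using g unfolding test_functions_def by blast
  have "bounded (g ` K)" using K by (intro compact_imp_bounded compact_continuous_image smooth_continuous_on)
  then obtain B where B: "0 < B" "\<And>z. z \<in> K \<Longrightarrow> \<bar>g z\<bar> \<le> B" by (auto simp: bounded_pos)
  obtain W \<kappa> where \<kappa>: "K \<subseteq> W" "\<kappa> \<in> tests \<Omega>" "\<And>z. z \<in> W \<Longrightarrow> \<kappa> z = 1" using compact_cutoff[OF K(2,3)] by metis
  have \<kappa>U: "\<kappa> \<in> tests UNIV" using \<kappa>(2) tests_mono[of \<Omega> UNIV] by auto
  obtain K' where K': "smooth \<kappa>" "\<And>z. 0 \<le> \<kappa> z" "\<And>z. \<kappa> z \<le> 1" "compact K'" "K' \<subseteq> \<Omega>" "\<And>z. z \<notin> K' \<Longrightarrow> \<kappa> z = 0"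
    using \<kappa>(2) by (rule testsE) blast
  \<comment> \<open>An affine change into [0, 1]: on K one has \<kappa> = 1 and |g| <= B, and off K
    the function g vanishes. Both f and \<kappa> are covered by the previous lemma, and g is a
    combination of them.\<close>
  define f where "f z = inverse (2 * B) * (g z + B * \<kappa> z)" for z
  have f: "f \<in> tests UNIV"
  proof (rule testsI[of _ "K \<union> K'"])
    show "smooth f" unfolding f_def by (intro smooth_mult smooth_add smooth_const K K')
    have "0 \<le> f z \<and> f z \<le> 1" for z
    proof (cases "z \<in> K")
      case True
      then have "\<kappa> z = 1" using \<kappa> by auto
      then show ?thesis using B(1) B(2)[OF True] by (simp add: f_def field_simps abs_le_iff)
    next
      case False
      then show ?thesis using B(1) K'(2,3)[of z] K(4)[OF False] by (simp add: f_def field_simps)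
    qed
    then show "0 \<le> f z" "f z \<le> 1" for z by auto
  qed (use K K' in \<open>auto simp: f_def\<close>)
  have g_eq: "g z = 2 * B * f z - B * \<kappa> z" for z using B by (simp add: f_def field_simps)
  have fT: "f \<in> T" and \<kappa>T: "\<kappa> \<in> T" using f \<kappa>U by (auto intro: tests_T)
  have "L g = L (\<lambda>z. 2 * B * f z - B * \<kappa> z)" by (simp add: g_eq[abs_def])
  also have "\<dots> = 2 * B * L f - B * L \<kappa>"
    by (simp add: L_diff T_scale L_scale fT \<kappa>T)
  also have "\<dots> = 2 * B * (\<integral>z. f z \<partial>\<mu>) - B * (\<integral>z. \<kappa> z \<partial>\<mu>)"
    by (simp add: integral_eq_L_tests f \<kappa>U)
  also have "\<dots> = (\<integral>z. g z \<partial>\<mu>)"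
    unfolding g_eq by (simp add: integrable_test fT \<kappa>T)
  finally show ?thesis by simp
qed

end

subsection \<open>Radial kernels\<close>

lemma has_derivative_radial:
  fixes y :: "'a::real_inner"
  assumes "(h has_real_derivative h') (at ((norm (z - y))\<^sup>2))"
  shows "((\<lambda>z. h ((norm (z - y))\<^sup>2)) has_derivative (\<lambda>v. 2 * h' * ((z - y) \<bullet> v))) (at z)"
proof -
  have "((\<lambda>z. (norm (z - y))\<^sup>2) has_derivative (\<lambda>v. 2 * ((z - y) \<bullet> v))) (at z)"
    unfolding power2_norm_eq_inner by (auto intro!: derivative_eq_intros simp: inner_commute)
  from has_derivative_compose[OF this assms[unfolded has_field_derivative_def]] show ?thesis
    by (simp add: mult_ac)
qed

lemma sum_D2_left:
  assumes "\<And>i. i \<in> I \<Longrightarrow> twice_diff (f i)"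
  shows "(\<Sum>i\<in>I. D2 (f i) z u (e i)) = frechet_derivative (\<lambda>w. \<Sum>i\<in>I. frechet_derivative (f i) (at w) (e i)) (at z) u"
proof -
  have "((\<lambda>w. \<Sum>i\<in>I. frechet_derivative (f i) (at w) (e i)) has_derivative (\<lambda>u. \<Sum>i\<in>I. D2 (f i) z u (e i))) (at z)"
    using assms unfolding twice_diff_def D2_def
    by (intro has_derivative_sum) (simp add: frechet_derivative_works[symmetric])
  from frechet_eqI[OF this] show ?thesis by simp
qed

lemma sum_inner_Basis_square: "(\<Sum>b\<in>Basis. (x \<bullet> b) * (x \<bullet> b)) = (norm (x :: 'a::euclidean_space))\<^sup>2"
  using euclidean_inner[of x x] by (simp only: power2_norm_eq_inner)

lemma Lap_radial:
  fixes y :: "complex ^ 'n::finite"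
  assumes d1: "\<And>t. 0 \<le> t \<Longrightarrow> (h has_real_derivative w t) (at t)"
    and d2: "\<And>t. 0 \<le> t \<Longrightarrow> (w has_real_derivative w' t) (at t)"
  shows "Lap (\<lambda>z. h ((norm (z - y))\<^sup>2)) z =
    4 * (norm (z - y))\<^sup>2 * w' ((norm (z - y))\<^sup>2) + 2 * real (2 * CARD('n)) * w ((norm (z - y))\<^sup>2)"
proof -
  define T where "T z = (norm (z - y))\<^sup>2" for z
  have fa: "frechet_derivative (\<lambda>z. h (T z)) (at z) = (\<lambda>v. 2 * w (T z) * ((z - y) \<bullet> v))" for z
    unfolding T_def by (rule frechet_eqI[OF has_derivative_radial[OF d1]]) simp
  have dw: "((\<lambda>z. w (T z)) has_derivative (\<lambda>v. 2 * w' (T z) * ((z - y) \<bullet> v))) (at z)"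
    unfolding T_def by (rule has_derivative_radial[OF d2]) simp
  have "D2 (\<lambda>z. h (T z)) z b b = 4 * w' (T z) * (((z - y) \<bullet> b) * ((z - y) \<bullet> b)) + 2 * w (T z)"
    if b: "b \<in> Basis" for b
  proof -
    have "((\<lambda>z. 2 * w (T z) * ((z - y) \<bullet> b)) has_derivative
       (\<lambda>v. 4 * w' (T z) * ((z - y) \<bullet> v) * ((z - y) \<bullet> b) + 2 * w (T z) * (v \<bullet> b))) (at z)"
      using dw by (auto intro!: derivative_eq_intros simp: algebra_simps)
    from frechet_eqI[OF this] show ?thesis unfolding D2_def fa by (simp add: b inner_Basis)
  qed
  then have "Lap (\<lambda>z. h (T z)) z = (\<Sum>b\<in>Basis. 4 * w' (T z) * (((z - y) \<bullet> b) * ((z - y) \<bullet> b)) + 2 * w (T z))"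
    unfolding Lap_def by (rule sum.cong[OF refl])
  also have "\<dots> = 4 * w' (T z) * T z + real (2 * CARD('n)) * (2 * w (T z))"
    unfolding sum.distrib sum_distrib_left[symmetric] sum_inner_Basis_square T_def[symmetric] by (simp add: DIM_cart)
  finally show ?thesis by (simp add: T_def algebra_simps)
qed

text \<open>With E = t d/dt and h1, h2 standing for h' and h'', this is the Euler operator (E + n)(E
  + p) h, which annihilates t^-n and t^-p.\<close>

definition kern :: "nat \<Rightarrow> (real \<Rightarrow> real) \<Rightarrow> (real \<Rightarrow> real) \<Rightarrow> (real \<Rightarrow> real) \<Rightarrow> real \<Rightarrow> real \<Rightarrow> real" where
  "kern n h h1 h2 p t = t\<^sup>2 * h2 t + (real n + 1 + p) * t * h1 t + real n * p * h t"

text \<open>Derivatives of h are demanded only for t >= 0, the range of the squared distance,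
  because (1 + \<tau>t)^-n has a pole at negative t. Smoothness is therefore stated for the
  composition.\<close>

locale radial =
  fixes y :: "complex ^ 'n::finite" and h h1 h2 :: "real \<Rightarrow> real"
  assumes d1: "\<And>t. 0 \<le> t \<Longrightarrow> (h has_real_derivative h1 t) (at t)"
    and d2: "\<And>t. 0 \<le> t \<Longrightarrow> (h1 has_real_derivative h2 t) (at t)"
    and sm: "smooth (\<lambda>z. h ((norm (z - y))\<^sup>2))"
begin

abbreviation T where "T z \<equiv> (norm (z - y))\<^sup>2"

definition s where "s b b' z = h (T z) * (((z - y) \<bullet> b) * ((z - y) \<bullet> b'))"
definition a where "a z = h (T z) * T z"

lemma smooth_s: "smooth (s b b')"
  unfolding s_def[abs_def] inner_diff_left
  by (intro smooth_mult sm smooth_diff smooth_const smooth_linear bounded_linear_inner_left)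

lemma smooth_a: "smooth a"
  unfolding a_def[abs_def] by (intro smooth_mult sm smooth_norm_square)

lemma frechet_s: "frechet_derivative (s b b') (at z) v =
    2 * h1 (T z) * ((z - y) \<bullet> v) * (((z - y) \<bullet> b) * ((z - y) \<bullet> b')) +
    h (T z) * ((v \<bullet> b) * ((z - y) \<bullet> b') + ((z - y) \<bullet> b) * (v \<bullet> b'))"
proof -
  have "((\<lambda>z. h (T z)) has_derivative (\<lambda>v. 2 * h1 (T z) * ((z - y) \<bullet> v))) (at z)"
    by (rule has_derivative_radial[OF d1]) simp
  then have "(s b b' has_derivative (\<lambda>v. 2 * h1 (T z) * ((z - y) \<bullet> v) * (((z - y) \<bullet> b) * ((z - y) \<bullet> b')) +
    h (T z) * ((v \<bullet> b) * ((z - y) \<bullet> b') + ((z - y) \<bullet> b) * (v \<bullet> b')))) (at z)"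
    unfolding s_def[abs_def]
    by (auto intro!: derivative_eq_intros simp: algebra_simps)
  from frechet_eqI[OF this] show ?thesis by simp
qed

text \<open>A double divergence of the matrix field h x x^T with x = z - y. The inner sum is again
  radial, H(t) x with H = 2 t h1 + (N + 1) h, so the second divergence has the same form as the
  first.\<close>

lemma sum_D2_s1:
  defines "N \<equiv> real (2 * CARD('n))"
  shows "(\<Sum>b\<in>Basis. \<Sum>b'\<in>Basis. D2 (s b b') z b' b) =
    2 * T z * (2 * h2 (T z) * T z + (N + 3) * h1 (T z)) + N * (2 * h1 (T z) * T z + (N + 1) * h (T z))"
proof -
  define H where "H t = 2 * h1 t * t + (N + 1) * h t" for t
  have dH: "(H has_real_derivative (2 * h2 t * t + (N + 3) * h1 t)) (at t)" if "0 \<le> t" for t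
    unfolding H_def[abs_def] using d1[OF that] d2[OF that]
    by (auto intro!: derivative_eq_intros simp: algebra_simps)
  have G: "(\<Sum>b\<in>Basis. frechet_derivative (s b b') (at w) b) = H (T w) * ((w - y) \<bullet> b')" if "b' \<in> Basis" for w b'
  proof -
    have "(\<Sum>b\<in>Basis. frechet_derivative (s b b') (at w) b) =
      (\<Sum>b\<in>Basis. 2 * h1 (T w) * ((w - y) \<bullet> b') * (((w - y) \<bullet> b) * ((w - y) \<bullet> b))
        + h (T w) * ((w - y) \<bullet> b') + h (T w) * (((w - y) \<bullet> b) * (b \<bullet> b')))"
      unfolding frechet_s by (intro sum.cong refl) (simp add: inner_Basis algebra_simps)
    also have "\<dots> = 2 * h1 (T w) * ((w - y) \<bullet> b') * (\<Sum>b\<in>Basis. ((w - y) \<bullet> b) * ((w - y) \<bullet> b))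
        + N * h (T w) * ((w - y) \<bullet> b') + h (T w) * (\<Sum>b\<in>Basis. ((w - y) \<bullet> b) * (b \<bullet> b'))"
      by (simp add: sum.distrib sum_distrib_left N_def DIM_cart)
    also have "\<dots> = H (T w) * ((w - y) \<bullet> b')"
      unfolding sum_inner_Basis_square inner_Basis_expand[symmetric] H_def by (simp add: algebra_simps)
    finally show ?thesis .
  qed
  have "(\<Sum>b\<in>Basis. \<Sum>b'\<in>Basis. D2 (s b b') z b' b) = (\<Sum>b'\<in>Basis. \<Sum>b\<in>Basis. D2 (s b b') z b' b)"
    by (rule sum.swap)
  also have "\<dots> = (\<Sum>b'\<in>Basis. 2 * (2 * h2 (T z) * T z + (N + 3) * h1 (T z)) * (((z - y) \<bullet> b') * ((z - y) \<bullet> b')) + H (T z))"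
  proof (rule sum.cong[OF refl])
    fix b' :: "complex ^ 'n" assume b': "b' \<in> Basis"
    have "((\<lambda>w. H (T w)) has_derivative (\<lambda>v. 2 * (2 * h2 (T z) * T z + (N + 3) * h1 (T z)) * ((z - y) \<bullet> v))) (at z)"
      by (rule has_derivative_radial[OF dH]) simp
    then have "((\<lambda>w. H (T w) * ((w - y) \<bullet> b')) has_derivative
        (\<lambda>v. 2 * (2 * h2 (T z) * T z + (N + 3) * h1 (T z)) * ((z - y) \<bullet> v) * ((z - y) \<bullet> b') + H (T z) * (v \<bullet> b'))) (at z)"
      by (auto intro!: derivative_eq_intros simp: algebra_simps)
    from frechet_eqI[OF this]
    show "(\<Sum>b\<in>Basis. D2 (s b b') z b' b) =
      2 * (2 * h2 (T z) * T z + (N + 3) * h1 (T z)) * (((z - y) \<bullet> b') * ((z - y) \<bullet> b')) + H (T z)"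
      by (subst sum_D2_left) (simp_all add: smooth_twice_diff smooth_s G[OF b'] inner_Basis b')
  qed
  also have "\<dots> = 2 * T z * (2 * h2 (T z) * T z + (N + 3) * h1 (T z)) + N * H (T z)"
    unfolding sum.distrib sum_distrib_left[symmetric] sum_inner_Basis_square by (simp add: N_def DIM_cart)
  finally show ?thesis by (simp add: H_def)
qed

text \<open>The same double divergence along the rotated basis. Since x is orthogonal to i x, the h1
  term drops out of the inner sum, and only - h <x, i b> remains to be differentiated.\<close>

lemma sum_D2_s2:
  defines "N \<equiv> real (2 * CARD('n))"
  shows "(\<Sum>b\<in>Basis. \<Sum>b'\<in>Basis. D2 (s b b') z (\<i> *s b) (\<i> *s b')) = - (2 * h1 (T z) * T z + N * h (T z))"
proof -
  have G: "(\<Sum>b'\<in>Basis. frechet_derivative (s b b') (at w) (\<i> *s b')) = - (h (T w) * ((w - y) \<bullet> (\<i> *s b)))" for w b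
  proof -
    define x where "x = w - y"
    have e1: "(\<Sum>b'\<in>Basis. (x \<bullet> (\<i> *s b')) * (x \<bullet> b')) = 0"
    proof -
      have "(\<Sum>b'\<in>Basis. (x \<bullet> (\<i> *s b')) * (x \<bullet> b')) = - (\<Sum>b'\<in>Basis. ((\<i> *s x) \<bullet> b') * (x \<bullet> b'))"
        by (simp add: inner_J_left sum_negf)
      also have "(\<Sum>b'\<in>Basis. ((\<i> *s x) \<bullet> b') * (x \<bullet> b')) = (\<i> *s x) \<bullet> x" by (rule euclidean_inner[symmetric])
      finally show ?thesis by simp
    qed
    have e2: "(\<Sum>b'\<in>Basis. ((\<i> *s b') \<bullet> b) * (x \<bullet> b')) = - (x \<bullet> (\<i> *s b))"
    proof -
      have "(\<Sum>b'\<in>Basis. ((\<i> *s b') \<bullet> b) * (x \<bullet> b')) = - (\<Sum>b'\<in>Basis. (x \<bullet> b') * (b' \<bullet> (\<i> *s b)))"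
        by (simp add: inner_J_left sum_negf mult.commute)
      then show ?thesis by (simp only: inner_Basis_expand[symmetric])
    qed
    have "(\<Sum>b'\<in>Basis. frechet_derivative (s b b') (at w) (\<i> *s b')) =
      (\<Sum>b'\<in>Basis. 2 * h1 (T w) * (x \<bullet> b) * ((x \<bullet> (\<i> *s b')) * (x \<bullet> b')) + h (T w) * (((\<i> *s b') \<bullet> b) * (x \<bullet> b')))"
      unfolding frechet_s x_def[symmetric] by (intro sum.cong refl) (simp add: algebra_simps)
    also have "\<dots> = 2 * h1 (T w) * (x \<bullet> b) * (\<Sum>b'\<in>Basis. (x \<bullet> (\<i> *s b')) * (x \<bullet> b')) + h (T w) * (\<Sum>b'\<in>Basis. ((\<i> *s b') \<bullet> b) * (x \<bullet> b'))"
      by (simp add: sum.distrib sum_distrib_left)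
    finally show ?thesis unfolding e1 e2 by (simp add: x_def)
  qed
  have "(\<Sum>b'\<in>Basis. D2 (s b b') z (\<i> *s b) (\<i> *s b')) = - (2 * h1 (T z) * (((\<i> *s (z - y)) \<bullet> b) * ((\<i> *s (z - y)) \<bullet> b)) + h (T z))"
    if b: "b \<in> Basis" for b
  proof -
    have "((\<lambda>z. h (T z)) has_derivative (\<lambda>v. 2 * h1 (T z) * ((z - y) \<bullet> v))) (at z)"
      by (rule has_derivative_radial[OF d1]) simp
    then have "((\<lambda>w. - (h (T w) * ((w - y) \<bullet> (\<i> *s b)))) has_derivative
        (\<lambda>v. - (2 * h1 (T z) * ((z - y) \<bullet> v) * ((z - y) \<bullet> (\<i> *s b)) + h (T z) * (v \<bullet> (\<i> *s b))))) (at z)"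
      by (auto intro!: derivative_eq_intros simp: algebra_simps)
    from frechet_eqI[OF this] show ?thesis
      by (subst sum_D2_left) (simp_all add: smooth_twice_diff smooth_s G inner_J_left inner_Basis inner_diff_left b algebra_simps)
  qed
  then have "(\<Sum>b\<in>Basis. \<Sum>b'\<in>Basis. D2 (s b b') z (\<i> *s b) (\<i> *s b')) =
      (\<Sum>b\<in>Basis. - (2 * h1 (T z) * (((\<i> *s (z - y)) \<bullet> b) * ((\<i> *s (z - y)) \<bullet> b)) + h (T z)))"
    by (rule sum.cong[OF refl])
  also have "\<dots> = - (2 * h1 (T z) * (norm (\<i> *s (z - y)))\<^sup>2 + N * h (T z))"
    unfolding sum_negf sum.distrib sum_distrib_left[symmetric] sum_inner_Basis_square by (simp add: N_def DIM_cart)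
  also have "(norm (\<i> *s (z - y)))\<^sup>2 = T z" by (simp only: power2_norm_eq_inner inner_J_J)
  finally show ?thesis .
qed

lemma Lap_a:
  defines "N \<equiv> real (2 * CARD('n))"
  shows "Lap a z = 4 * T z * (h2 (T z) * T z + 2 * h1 (T z)) + 2 * N * (h1 (T z) * T z + h (T z))"
  unfolding a_def[abs_def] N_def
proof (rule Lap_radial[where h = "\<lambda>t. h t * t"])
  show "((\<lambda>t. h t * t) has_real_derivative h1 t * t + h t) (at t)" if "0 \<le> t" for t
    using d1[OF that] by (auto intro!: derivative_eq_intros simp: algebra_simps)
  show "((\<lambda>t. h1 t * t + h t) has_real_derivative h2 t * t + 2 * h1 t) (at t)" if "0 \<le> t" for t
    using d1[OF that] d2[OF that] by (auto intro!: derivative_eq_intros simp: algebra_simps)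
qed

text \<open>This identity is the origin of p: the coefficient of h is 4 n (n - 1)((n + 1) m - n),
  which is 4 n (n - 1) m p. The coefficients of h1 and h2 then match those of the Euler operator
  with the same p.\<close>

lemma combination:
  fixes m :: nat
  assumes m: "1 \<le> m"
  defines "p \<equiv> real CARD('n) + 1 - CARD('n) / m"
  shows "(real CARD('n) - m) * Lap a z +
     CARD('n) * (real m - 1) * (\<Sum>b\<in>Basis. \<Sum>b'\<in>Basis. D2 (s b b') z b' b + D2 (s b b') z (\<i> *s b) (\<i> *s b'))
    = 4 * m * (real CARD('n) - 1) * kern CARD('n) h h1 h2 p (T z)"
proof -
  define n where "n = real CARD('n)"
  define M where "M = real m"
  have M: "M \<noteq> 0" using m by (simp add: M_def)
  have "M * p = (n + 1) * M - n" using M unfolding p_def n_def[symmetric] M_def[symmetric] by (simp add: field_simps)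
  then have pM: "p * M = (n + 1) * M - n" by (simp add: mult.commute)
  show ?thesis
    unfolding sum.distrib sum_D2_s1 sum_D2_s2 Lap_a kern_def n_def[symmetric] M_def[symmetric] of_nat_mult of_nat_numeral
  proof -
    define A B C t where "A = h (T z)" and "B = h1 (T z)" and "C = h2 (T z)" and "t = T z"
    have "4 * M * (n - 1) * (t\<^sup>2 * C + (n + 1 + p) * t * B + n * p * A) =
       4 * (n - 1) * (M * t\<^sup>2 * C + ((n + 1) * M + p * M) * t * B + n * (p * M) * A)"
      by (simp add: algebra_simps)
    also have "\<dots> = (n - M) * (4 * t * (C * t + 2 * B) + 2 * (2 * n) * (B * t + A)) +
      n * (M - 1) * (2 * t * (2 * C * t + (2 * n + 3) * B) + 2 * n * (2 * B * t + (2 * n + 1) * A) + - (2 * B * t + 2 * n * A))"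
      unfolding pM by (simp add: algebra_simps power2_eq_square)
    finally show "(n - M) * (4 * T z * (h2 (T z) * T z + 2 * h1 (T z)) + 2 * (2 * n) * (h1 (T z) * T z + h (T z))) +
      n * (M - 1) * (2 * T z * (2 * h2 (T z) * T z + (2 * n + 3) * h1 (T z)) + 2 * n * (2 * h1 (T z) * T z + (2 * n + 1) * h (T z)) +
        - (2 * h1 (T z) * T z + 2 * n * h (T z))) =
      4 * M * (n - 1) * ((T z)\<^sup>2 * h2 (T z) + (n + 1 + p) * T z * h1 (T z) + n * p * h (T z))"
      by (simp add: A_def B_def C_def t_def)
  qed
qed

end

section \<open>Integrals of derivatives of compactly supported functions\<close>

lemma lborel_integral_translate:
  fixes F :: "'a::euclidean_space \<Rightarrow> real"
  assumes "F \<in> borel_measurable borel"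
  shows "(LINT z|lborel. F (c + z)) = (LINT z|lborel. F z)"
proof -
  have "(LINT z|lborel. F z) = (LINT z|distr lborel borel ((+) c). F z)" by (simp add: lborel_distr_plus)
  also have "\<dots> = (LINT z|lborel. F (c + z))" using assms by (subst integral_distr) auto
  finally show ?thesis by simp
qed

lemma integrable_continuous_compact_support:
  fixes F :: "'a::euclidean_space \<Rightarrow> real"
  assumes "continuous_on UNIV F" "compact K" "\<And>z. z \<notin> K \<Longrightarrow> F z = 0"
  shows "integrable lborel F"
proof -
  have "integrable lborel (\<lambda>z. indicator K z *\<^sub>R F z)"
    by (rule borel_integrable_compact[OF assms(2)]) (rule continuous_on_subset[OF assms(1)], simp)
  moreover have "(\<lambda>z. indicator K z *\<^sub>R F z) = F" using assms(3) by (auto simp: indicator_def fun_eq_iff)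
  ultimately show ?thesis by simp
qed

lemma smooth_frechet_support:
  assumes "compact K" "\<And>z. z \<notin> K \<Longrightarrow> F z = (0::'b::real_normed_vector)" "z \<notin> K"
  shows "frechet_derivative F (at z) v = 0"
proof -
  have "((\<lambda>z. 0::'b) has_derivative (\<lambda>v. 0)) (at z)" by simp
  moreover have "open (- K)" using compact_imp_closed[OF assms(1)] by (simp add: open_Compl)
  ultimately have "(F has_derivative (\<lambda>v. 0)) (at z)"
    by (rule has_derivative_transform_within_open) (use assms in auto)
  from frechet_eqI[OF this] show ?thesis by simp
qed

text \<open>Difference quotients have integral 0 by translation invariance of Lebesgue measure. They
  are bounded by the mean value theorem, so dominated convergence passes this on to the
  derivative.\<close>

lemma integral_frechet_zero:
  fixes F :: "'a::euclidean_space \<Rightarrow> real"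
  assumes sm: "smooth F" and K: "compact K" "\<And>z. z \<notin> K \<Longrightarrow> F z = 0"
  shows "(LINT z|lborel. frechet_derivative F (at z) v) = 0"
proof -
  define G where "G z = frechet_derivative F (at z) v" for z
  have cG: "continuous_on UNIV G" unfolding G_def[abs_def] by (intro smooth_continuous_on smoothD(2) sm)
  have cF: "continuous_on UNIV F" by (rule smooth_continuous_on[OF sm])
  have mF: "F \<in> borel_measurable borel" by (rule borel_measurable_continuous_onI[OF cF])
  have G0: "G z = 0" if "z \<notin> K" for z unfolding G_def by (rule smooth_frechet_support[OF K that])
  have "bounded (G ` K)" using K by (intro compact_imp_bounded compact_continuous_image continuous_on_subset[OF cG]) auto
  then obtain B where B: "0 < B" "\<And>z. z \<in> K \<Longrightarrow> \<bar>G z\<bar> \<le> B" by (auto simp: bounded_pos)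
  have GB: "\<bar>G z\<bar> \<le> B" for z using B G0 by (cases "z \<in> K") auto
  obtain R where R: "K \<subseteq> cball 0 R"
    using compact_imp_bounded[OF K(1)] by (auto simp: bounded_iff subset_iff)
  \<comment> \<open>The increments are at most |v| in length, so this ball contains the supports of
    all difference quotients.\<close>
  define S where "S = cball (0::'a) (R + norm v)"
  define q where "q k z = real (Suc k) * (F (inverse (real (Suc k)) *\<^sub>R v + z) - F z)" for k z
  have line: "((\<lambda>t. F (t *\<^sub>R v + z)) has_real_derivative G (t *\<^sub>R v + z)) (at t)" for t z
  proof -
    have "((\<lambda>t. t *\<^sub>R v + z) has_derivative (\<lambda>s. s *\<^sub>R v)) (at t)" by (auto intro!: derivative_eq_intros)
    from has_derivative_compose[OF this smooth_has_derivative[OF sm]]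
    have "((\<lambda>t. F (t *\<^sub>R v + z)) has_derivative (\<lambda>s. frechet_derivative F (at (t *\<^sub>R v + z)) (s *\<^sub>R v))) (at t)" .
    moreover have "frechet_derivative F (at (t *\<^sub>R v + z)) (s *\<^sub>R v) = G (t *\<^sub>R v + z) * s" for s
      unfolding G_def using linear_scale[OF linear_frechet[OF smoothD(1)[OF sm]]] by simp
    ultimately show ?thesis by (simp add: has_field_derivative_def)
  qed
  have qB: "\<bar>q k z\<bar> \<le> B" for k z
  proof -
    define e where "e = inverse (real (Suc k))"
    have e: "0 < e" by (simp add: e_def)
    obtain t where t: "F (e *\<^sub>R v + z) - F (0 *\<^sub>R v + z) = (e - 0) * G (t *\<^sub>R v + z)"
      using MVT2[OF e, of "\<lambda>t. F (t *\<^sub>R v + z)" "\<lambda>t. G (t *\<^sub>R v + z)"] line by blast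
    have "q k z = inverse e * (F (e *\<^sub>R v + z) - F (0 *\<^sub>R v + z))" by (simp add: q_def e_def)
    also have "\<dots> = G (t *\<^sub>R v + z)" unfolding t using e by simp
    finally show ?thesis using GB by simp
  qed
  have q0: "q k z = 0" if "z \<notin> S" for k z
  proof -
    define e where "e = inverse (real (Suc k))"
    have e: "0 < e" "e \<le> 1" by (auto simp: e_def inverse_le_1_iff)
    have nz: "R + norm v < norm z" using that by (simp add: S_def)
    have "norm z \<le> norm (e *\<^sub>R v + z) + norm (e *\<^sub>R v)"
      using norm_triangle_ineq4[of "e *\<^sub>R v + z" "e *\<^sub>R v"] by simp
    moreover have "norm (e *\<^sub>R v) \<le> norm v" using e by (simp add: mult_left_le_one_le)
    ultimately have "R < norm (e *\<^sub>R v + z)" using nz by simp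
    then have 1: "e *\<^sub>R v + z \<notin> K" using R by auto
    have "R < norm z" using nz norm_ge_zero[of v] by linarith
    then have 2: "z \<notin> K" using R by auto
    show ?thesis unfolding q_def e_def[symmetric] K(2)[OF 1] K(2)[OF 2] by simp
  qed
  have mq: "q k \<in> borel_measurable lborel" for k
    unfolding q_def[abs_def] using mF by (auto intro!: borel_measurable_times borel_measurable_diff measurable_compose[OF _ mF])
  have lim: "(\<lambda>k. q k z) \<longlonglongrightarrow> G z" for z
  proof -
    have "((\<lambda>e. (F ((0 + e) *\<^sub>R v + z) - F (0 *\<^sub>R v + z)) / e) \<longlongrightarrow> G (0 *\<^sub>R v + z)) (at 0)"
      using line[of z 0] unfolding DERIV_def .
    moreover have "filterlim (\<lambda>k. inverse (real (Suc k))) (at 0) sequentially"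
      unfolding filterlim_at using LIMSEQ_inverse_real_of_nat by auto
    ultimately have "(\<lambda>k. (F ((0 + inverse (real (Suc k))) *\<^sub>R v + z) - F (0 *\<^sub>R v + z)) / inverse (real (Suc k))) \<longlonglongrightarrow> G (0 *\<^sub>R v + z)"
      by (rule filterlim_compose)
    then show ?thesis by (simp add: q_def divide_inverse mult.commute)
  qed
  have "(\<lambda>k. LINT z|lborel. q k z) \<longlonglongrightarrow> (LINT z|lborel. G z)"
  proof (rule integral_dominated_convergence[where w = "\<lambda>z. B * indicator S z"])
    show "integrable lborel (\<lambda>z. B * indicator S z)"
      unfolding S_def by (intro integrable_mult_right integrable_real_indicator) (use emeasure_compact_finite[OF compact_cball, of "0 :: 'a" "R + norm v"] in auto)
    show "AE z in lborel. norm (q k z) \<le> B * indicator S z" for k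
      using qB q0 by (intro AE_I2) (auto simp: indicator_def)
    show "G \<in> borel_measurable lborel" using borel_measurable_continuous_onI[OF cG] by simp
  qed (use lim mq in auto)
  moreover have "(LINT z|lborel. q k z) = 0" for k
  proof -
    have iF: "integrable lborel F" by (rule integrable_continuous_compact_support[OF cF K])
    have iF': "integrable lborel (\<lambda>z. F (c + z))" for c
    proof -
      have "integrable (distr lborel borel ((+) c)) F" using iF by (simp add: lborel_distr_plus)
      then show ?thesis using mF by (subst (asm) integrable_distr_eq) auto
    qed
    show ?thesis
      unfolding q_def using lborel_integral_translate[OF mF] iF iF'
      by (simp add: Bochner_Integration.integral_diff)
  qed
  ultimately show ?thesis by (simp add: G_def LIMSEQ_const_iff)
qed

lemma integral_D2_zero:
  fixes c :: "'a::euclidean_space \<Rightarrow> real"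
  assumes "smooth c" "compact K" "\<And>z. z \<notin> K \<Longrightarrow> c z = 0"
  shows "(LINT z|lborel. D2 c z u v) = 0" "integrable lborel (\<lambda>z. D2 c z u v)"
proof -
  have s: "smooth (\<lambda>w. frechet_derivative c (at w) v)" by (rule smoothD(2)[OF assms(1)])
  have z: "frechet_derivative c (at w) v = 0" if "w \<notin> K" for w
    by (rule smooth_frechet_support[OF assms(2,3) that])
  show "(LINT z|lborel. D2 c z u v) = 0"
    unfolding D2_def by (rule integral_frechet_zero[OF s assms(2) z])
  show "integrable lborel (\<lambda>z. D2 c z u v)"
    unfolding D2_def
    by (rule integrable_continuous_compact_support[OF smooth_continuous_on[OF smoothD(2)[OF s]] assms(2)])
      (rule smooth_frechet_support[OF assms(2) z])
qed

text \<open>The kernel is a combination of second derivatives of compactly supported functions, so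
  its integral vanishes. This allows a constant to be subtracted from \<phi>, which makes the
  integrand one-signed while keeping the inequality of the second claim.\<close>

lemma (in radial)
  fixes m :: nat and R :: real
  assumes m: "1 \<le> m" "m < CARD('n)" and supp: "\<And>t. R\<^sup>2 \<le> t \<Longrightarrow> h t = 0" and R: "0 < R"
    and nn: "\<And>t. 0 \<le> t \<Longrightarrow> 0 \<le> h t"
  defines "p \<equiv> real CARD('n) + 1 - CARD('n) / m"
  shows integral_kern_zero: "(LINT z|lborel. kern CARD('n) h h1 h2 p (T z)) = 0"
    and integral_kern_nonneg: "m_subharmonic m \<Omega> \<phi> \<Longrightarrow> cball y R \<subseteq> \<Omega> \<Longrightarrow>
      0 \<le> (LINT z:\<Omega>|lborel. real_of_ereal (\<phi> z) * kern CARD('n) h h1 h2 p (T z))"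
proof -
  have T0: "R\<^sup>2 \<le> T z" if "z \<notin> cball y R" for z
    using that R by (intro power_mono) (auto simp: dist_norm norm_minus_commute)
  define C where "C = 4 * m * (real CARD('n) - 1)"
  have C: "0 < C" using m by (simp add: C_def)
  have kern_eq: "kern CARD('n) h h1 h2 p (T z) = ((real CARD('n) - m) * Lap a z +
     CARD('n) * (real m - 1) * (\<Sum>b\<in>Basis. \<Sum>b'\<in>Basis. D2 (s b b') z b' b + D2 (s b b') z (\<i> *s b) (\<i> *s b'))) / C" for z
    unfolding combination[OF m(1)] p_def[symmetric] C_def[symmetric] using C by simp
  have sz: "s b b' z = 0" "a z = 0" if "z \<notin> cball y R" for b b' z
    using supp[OF T0[OF that]] by (simp_all add: s_def a_def)
  note int_s = integral_D2_zero[OF smooth_s compact_cball sz(1)]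
  note int_a = integral_D2_zero[OF smooth_a compact_cball sz(2)]
  have "(LINT z|lborel. (real CARD('n) - m) * Lap a z +
     CARD('n) * (real m - 1) * (\<Sum>b\<in>Basis. \<Sum>b'\<in>Basis. D2 (s b b') z b' b + D2 (s b b') z (\<i> *s b) (\<i> *s b'))) = 0"
  proof -
    have hs: "has_bochner_integral lborel (\<lambda>z. D2 (s b b') z u v) 0" for b b' u v
      using int_s has_bochner_integral_integrable by metis
    have ha: "has_bochner_integral lborel (\<lambda>z. D2 a z u v) 0" for u v
      using int_a has_bochner_integral_integrable by metis
    have "has_bochner_integral lborel (\<lambda>z. (real CARD('n) - m) * Lap a z +
     CARD('n) * (real m - 1) * (\<Sum>b\<in>Basis. \<Sum>b'\<in>Basis. D2 (s b b') z b' b + D2 (s b b') z (\<i> *s b) (\<i> *s b')))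
     ((real CARD('n) - m) * (\<Sum>b\<in>(Basis :: (complex ^ 'n) set). 0) +
     CARD('n) * (real m - 1) * (\<Sum>b\<in>(Basis :: (complex ^ 'n) set). \<Sum>b'\<in>(Basis :: (complex ^ 'n) set). 0 + 0))"
      unfolding Lap_def
      by (intro has_bochner_integral_add has_bochner_integral_mult_right has_bochner_integral_sum hs ha)
    from has_bochner_integral_integral_eq[OF this] show ?thesis by simp
  qed
  then show "(LINT z|lborel. kern CARD('n) h h1 h2 p (T z)) = 0" unfolding kern_eq by simp
  assume sh: "m_subharmonic m \<Omega> \<phi>" and sub: "cball y R \<subseteq> \<Omega>"
  have "0 \<le> (LINT z:\<Omega>|lborel. real_of_ereal (\<phi> z) * ((real CARD('n) - m) * Lap a z +
     CARD('n) * (real m - 1) * (\<Sum>b\<in>Basis. \<Sum>b'\<in>Basis. D2 (s b b') z b' b + D2 (s b b') z (\<i> *s b) (\<i> *s b'))))"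
    using m_subharmonic_radial_aux[OF m sh sm, of "cball y R" y] nn sub supp T0
    unfolding s_def[abs_def] a_def[abs_def] by simp
  also have "\<dots> = C * (LINT z:\<Omega>|lborel. real_of_ereal (\<phi> z) * kern CARD('n) h h1 h2 p (T z))"
    unfolding kern_eq set_lebesgue_integral_def integral_mult_right_zero[symmetric] using C
    by (intro Bochner_Integration.integral_cong) auto
  finally show "0 \<le> (LINT z:\<Omega>|lborel. real_of_ereal (\<phi> z) * kern CARD('n) h h1 h2 p (T z))" using C by (simp add: zero_le_mult_iff)
qed

lemma has_derivative_under_integral:
  fixes g :: "'a::euclidean_space \<Rightarrow> real" and P P' :: "real \<Rightarrow> 'a \<Rightarrow> real"
  assumes g: "integrable lborel g" and t: "t \<in> {l<..<u}"
    and P: "\<And>s z. s \<in> {l<..<u} \<Longrightarrow> ((\<lambda>s. P s z) has_real_derivative P' s z) (at s)"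
    and B: "\<And>s z. s \<in> {l<..<u} \<Longrightarrow> \<bar>P' s z\<bar> \<le> B"
    and mP: "\<And>s. s \<in> {l<..<u} \<Longrightarrow> P s \<in> borel_measurable borel" and mP': "P' t \<in> borel_measurable borel"
    and iP: "\<And>s. s \<in> {l<..<u} \<Longrightarrow> integrable lborel (\<lambda>z. g z * P s z)"
  shows "((\<lambda>s. LINT z|lborel. g z * P s z) has_real_derivative (LINT z|lborel. g z * P' t z)) (at t)"
  unfolding DERIV_def tendsto_at_iff_sequentially
proof (intro allI impI)
  fix X :: "nat \<Rightarrow> real" assume X0: "\<forall>i. X i \<in> UNIV - {0}" and X: "X \<longlonglongrightarrow> 0"
  define \<Psi> where "\<Psi> s = (LINT z|lborel. g z * P s z)" for s
  have "(\<lambda>i. t + X i) \<longlonglongrightarrow> t + 0" by (intro tendsto_intros X)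
  then have "\<forall>\<^sub>F i in sequentially. t + X i \<in> {l<..<u}"
    using t by (intro topological_tendstoD) auto
  \<comment> \<open>The hypotheses hold only for parameters in the open interval, so an initial
    segment of the sequence is discarded.\<close>
  then obtain k where k: "\<And>i. t + X (i + k) \<in> {l<..<u}"
    unfolding eventually_sequentially by (metis le_add2)
  define Y where "Y i = X (i + k)" for i
  have Y: "Y i \<noteq> 0" "t + Y i \<in> {l<..<u}" for i using X0 k by (auto simp: Y_def)
  have Ylim: "Y \<longlonglongrightarrow> 0" unfolding Y_def[abs_def] by (rule LIMSEQ_ignore_initial_segment[OF X])
  have gm: "g \<in> borel_measurable lborel" using g by (rule borel_measurable_integrable)
  have quot: "\<bar>(P (t + Y i) z - P t z) / Y i\<bar> \<le> B" for i z
  proof (cases "0 < Y i")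
    case True
    have "\<exists>s>t. s < t + Y i \<and> P (t + Y i) z - P t z = (t + Y i - t) * P' s z"
    proof (rule MVT2)
      show "t < t + Y i" using True by simp
      show "((\<lambda>s. P s z) has_real_derivative P' s z) (at s)" if "t \<le> s" "s \<le> t + Y i" for s
        by (rule P) (use that t Y(2)[of i] in auto)
    qed
    then obtain s where s: "s > t" "s < t + Y i" "P (t + Y i) z - P t z = (t + Y i - t) * P' s z" by blast
    then have "s \<in> {l<..<u}" using t Y(2)[of i] by auto
    then show ?thesis using s B[of s z] True by simp
  next
    case False
    then have n: "Y i < 0" using Y(1)[of i] by simp
    have "\<exists>s>t + Y i. s < t \<and> P t z - P (t + Y i) z = (t - (t + Y i)) * P' s z"
    proof (rule MVT2)
      show "t + Y i < t" using n by simp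
      show "((\<lambda>s. P s z) has_real_derivative P' s z) (at s)" if "t + Y i \<le> s" "s \<le> t" for s
        by (rule P) (use that t Y(2)[of i] in auto)
    qed
    then obtain s where s: "s > t + Y i" "s < t" "P t z - P (t + Y i) z = (t - (t + Y i)) * P' s z" by blast
    then have "s \<in> {l<..<u}" using t Y(2)[of i] by auto
    moreover have "(P (t + Y i) z - P t z) / Y i = P' s z" using s(3) n by (simp add: field_simps)
    ultimately show ?thesis using B[of s z] by simp
  qed
  have lim: "(\<lambda>i. (P (t + Y i) z - P t z) / Y i) \<longlonglongrightarrow> P' t z" for z
  proof -
    have "((\<lambda>h. (P (t + h) z - P t z) / h) \<longlongrightarrow> P' t z) (at 0)"
      using P[OF t, of z] unfolding DERIV_def .
    moreover have "filterlim Y (at 0) sequentially" unfolding filterlim_at using Ylim Y by auto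
    ultimately show ?thesis by (rule filterlim_compose)
  qed
  have "(\<lambda>i. LINT z|lborel. g z * ((P (t + Y i) z - P t z) / Y i)) \<longlonglongrightarrow> (LINT z|lborel. g z * P' t z)"
  proof (rule integral_dominated_convergence[where w = "\<lambda>z. B * \<bar>g z\<bar>"])
    show "integrable lborel (\<lambda>z. B * \<bar>g z\<bar>)" using g by simp
    show "(\<lambda>z. g z * P' t z) \<in> borel_measurable lborel" using gm mP' by simp
    show "(\<lambda>z. g z * ((P (t + Y i) z - P t z) / Y i)) \<in> borel_measurable lborel" for i
      using gm mP[OF Y(2)[of i]] mP[OF t] by simp
    show "AE z in lborel. (\<lambda>i. g z * ((P (t + Y i) z - P t z) / Y i)) \<longlonglongrightarrow> g z * P' t z"
      by (intro AE_I2 tendsto_mult tendsto_const lim)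
    show "AE z in lborel. norm (g z * ((P (t + Y i) z - P t z) / Y i)) \<le> B * \<bar>g z\<bar>" for i
    proof (rule AE_I2)
      fix z
      have "\<bar>g z\<bar> * \<bar>(P (t + Y i) z - P t z) / Y i\<bar> \<le> \<bar>g z\<bar> * B" by (rule mult_left_mono[OF quot]) simp
      then show "norm (g z * ((P (t + Y i) z - P t z) / Y i)) \<le> B * \<bar>g z\<bar>" by (simp add: abs_mult mult.commute)
    qed
  qed
  note lim0 = this
  have eq: "(LINT z|lborel. g z * ((P (t + Y i) z - P t z) / Y i)) = (\<Psi> (t + Y i) - \<Psi> t) / Y i" for i
  proof -
    have "(LINT z|lborel. g z * ((P (t + Y i) z - P t z) / Y i)) = (LINT z|lborel. (g z * P (t + Y i) z - g z * P t z) / Y i)"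
      by (simp add: right_diff_distrib)
    also have "\<dots> = (\<Psi> (t + Y i) - \<Psi> t) / Y i"
      unfolding \<Psi>_def using iP[OF Y(2)[of i]] iP[OF t] by simp
    finally show ?thesis .
  qed
  have "(\<lambda>i. (\<Psi> (t + Y i) - \<Psi> t) / Y i) \<longlonglongrightarrow> (LINT z|lborel. g z * P' t z)"
    using lim0 unfolding eq .
  then have "(\<lambda>i. (\<Psi> (t + X i) - \<Psi> t) / X i) \<longlonglongrightarrow> (LINT z|lborel. g z * P' t z)"
    unfolding Y_def by (rule LIMSEQ_offset)
  then show "((\<lambda>h. ((LINT z|lborel. g z * P (t + h) z) - (LINT z|lborel. g z * P t z)) / h) \<circ> X)
      \<longlonglongrightarrow> (LINT z|lborel. g z * P' t z)"
    by (simp add: \<Psi>_def comp_def)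
qed

section \<open>The kernels (1 + \<tau>t)^-n with a cutoff\<close>

definition cutf :: "real \<Rightarrow> real \<Rightarrow> real" where
  "cutf R t = step (2 - 2 / R\<^sup>2 * t)"

lemma smooth_cutf: "smooth (cutf R)"
  unfolding cutf_def[abs_def]
  by (intro smooth_compose_real[OF smooth_step] smooth_diff smooth_const smooth_mult smooth_linear bounded_linear_ident)

lemma cutf_simps:
  assumes "0 < R"
  shows "t \<le> R\<^sup>2 / 2 \<Longrightarrow> cutf R t = 1" "R\<^sup>2 \<le> t \<Longrightarrow> cutf R t = 0" "0 \<le> cutf R t" "cutf R t \<le> 1"
  using assms by (auto simp: cutf_def step_simps field_simps)

lemma rderiv_const_zero:
  assumes "smooth h" "open S" "t \<in> S" "\<And>s. s \<in> S \<Longrightarrow> h s = c"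
  shows "rderiv h t = 0"
proof -
  have "((\<lambda>s. c) has_real_derivative 0) (at t)" by simp
  then have "(h has_real_derivative 0) (at t)"
    by (rule has_field_derivative_transform_within_open[OF _ assms(2,3)]) (simp add: assms(4))
  with smooth_has_rderiv[OF assms(1)] show ?thesis by (rule DERIV_unique)
qed

lemma rderiv_cutf_zero:
  assumes "0 < R" "t < R\<^sup>2 / 2 \<or> R\<^sup>2 < t"
  shows "rderiv (cutf R) t = 0" "rderiv (rderiv (cutf R)) t = 0"
proof -
  have 1: "rderiv (cutf R) t = 0" if "t < R\<^sup>2 / 2" for t
    by (rule rderiv_const_zero[OF smooth_cutf open_lessThan[of "R\<^sup>2 / 2"], of _ _ 1]) (use that cutf_simps[OF assms(1)] in auto)
  have 2: "rderiv (cutf R) t = 0" if "R\<^sup>2 < t" for t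
    by (rule rderiv_const_zero[OF smooth_cutf open_greaterThan[of "R\<^sup>2"], of _ _ 0]) (use that cutf_simps[OF assms(1)] in auto)
  show "rderiv (cutf R) t = 0" using 1 2 assms(2) by blast
  have 3: "rderiv (rderiv (cutf R)) t = 0" if "t < R\<^sup>2 / 2" for t
    by (rule rderiv_const_zero[OF smooth_rderiv[OF smooth_cutf] open_lessThan[of "R\<^sup>2 / 2"], of _ _ 0]) (use that 1 in auto)
  have 4: "rderiv (rderiv (cutf R)) t = 0" if "R\<^sup>2 < t" for t
    by (rule rderiv_const_zero[OF smooth_rderiv[OF smooth_cutf] open_greaterThan[of "R\<^sup>2"], of _ _ 0]) (use that 2 in auto)
  show "rderiv (rderiv (cutf R)) t = 0" using 3 4 assms(2) by blast
qed

lemma rderiv_cutf_bounded: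
  assumes "0 < R"
  obtains B where "0 < B" "\<And>t. 0 \<le> t \<Longrightarrow> \<bar>rderiv (cutf R) t\<bar> \<le> B" "\<And>t. 0 \<le> t \<Longrightarrow> \<bar>rderiv (rderiv (cutf R)) t\<bar> \<le> B"
proof -
  have b: "\<exists>B>0. \<forall>t\<in>{0..R\<^sup>2}. \<bar>h t\<bar> \<le> B" if "smooth h" for h :: "real \<Rightarrow> real"
  proof -
    have "bounded (h ` {0..R\<^sup>2})"
      by (intro compact_imp_bounded compact_continuous_image smooth_continuous_on that compact_Icc)
    then show ?thesis by (auto simp: bounded_pos)
  qed
  obtain B1 where B1: "B1 > 0" "\<And>t. t \<in> {0..R\<^sup>2} \<Longrightarrow> \<bar>rderiv (cutf R) t\<bar> \<le> B1"
    using b[OF smooth_rderiv[OF smooth_cutf]] by blast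
  obtain B2 where B2: "B2 > 0" "\<And>t. t \<in> {0..R\<^sup>2} \<Longrightarrow> \<bar>rderiv (rderiv (cutf R)) t\<bar> \<le> B2"
    using b[OF smooth_rderiv[OF smooth_rderiv[OF smooth_cutf]]] by blast
  show ?thesis
  proof (rule that[of "max B1 B2"])
    fix t :: real assume t: "0 \<le> t"
    show "\<bar>rderiv (cutf R) t\<bar> \<le> max B1 B2"
      using B1(2)[of t] B1(1) rderiv_cutf_zero(1)[OF assms, of t] t by (cases "t \<le> R\<^sup>2") auto
    show "\<bar>rderiv (rderiv (cutf R)) t\<bar> \<le> max B1 B2"
      using B2(2)[of t] B2(1) rderiv_cutf_zero(2)[OF assms, of t] t by (cases "t \<le> R\<^sup>2") auto
  qed (use B1 in auto)
qed

definition powf :: "nat \<Rightarrow> real \<Rightarrow> real \<Rightarrow> real" where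
  "powf k \<tau> t = inverse (1 + \<tau> * t) ^ k"

lemma powf_deriv:
  assumes "0 \<le> \<tau>" "0 \<le> t"
  shows "(powf k \<tau> has_real_derivative - (real k * \<tau> * powf (Suc k) \<tau> t)) (at t)"
proof -
  have "1 + \<tau> * t \<noteq> 0" using mult_nonneg_nonneg[OF assms] by linarith
  from DERIV_inverse_power_nat[OF this, of k]
  have "((\<lambda>s. inverse s ^ k) has_real_derivative - real k * inverse (1 + \<tau> * t) ^ Suc k) (at (1 + \<tau> * t))" .
  moreover have "((\<lambda>t. 1 + \<tau> * t) has_real_derivative \<tau>) (at t)" by (auto intro!: derivative_eq_intros)
  ultimately have "((\<lambda>t. inverse (1 + \<tau> * t) ^ k) has_real_derivative (- real k * inverse (1 + \<tau> * t) ^ Suc k) * \<tau>) (at t)"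
    by (rule DERIV_chain2)
  then show ?thesis by (simp add: powf_def[abs_def] mult_ac)
qed

lemma powf_bounds:
  assumes "0 \<le> \<tau>" "0 \<le> t"
  shows "0 \<le> powf k \<tau> t" "powf k \<tau> t \<le> 1" "\<tau> * t * powf (Suc k) \<tau> t \<le> powf k \<tau> t"
    "(1 + \<tau> * t) * powf (Suc k) \<tau> t = powf k \<tau> t"
proof -
  have p: "0 \<le> \<tau> * t" using assms by simp
  have i: "0 \<le> inverse (1 + \<tau> * t)" "inverse (1 + \<tau> * t) \<le> 1"
    using p by (auto simp: inverse_le_1_iff)
  show "0 \<le> powf k \<tau> t" "powf k \<tau> t \<le> 1"
    unfolding powf_def using i by (auto intro: power_le_one)
  have nz: "1 + \<tau> * t \<noteq> 0" using p by linarith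
  then show e: "(1 + \<tau> * t) * powf (Suc k) \<tau> t = powf k \<tau> t" by (simp add: powf_def)
  have "0 \<le> powf (Suc k) \<tau> t" unfolding powf_def using i by simp
  then show "\<tau> * t * powf (Suc k) \<tau> t \<le> powf k \<tau> t"
    unfolding e[symmetric] by (intro mult_right_mono) auto
qed

text \<open>The function \<open>\<sigma>\<^sub>\<tau> = (1 + \<tau>t)\<^sup>-\<^sup>n\<close>, cut off at radius \<open>R\<close>; up to the cutoff error, its kernel is the
  \<open>\<tau>\<close>-derivative of a multiple of the positive kernel \<open>(1 + \<tau>t)\<^sup>-\<^sup>n\<^sup>-\<^sup>1\<close>.\<close>

definition hfun where "hfun n R \<tau> t = cutf R t * powf n \<tau> t"
definition hfun1 where "hfun1 n R \<tau> t = rderiv (cutf R) t * powf n \<tau> t - cutf R t * (real n * \<tau> * powf (Suc n) \<tau> t)"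
definition hfun2 where "hfun2 n R \<tau> t = rderiv (rderiv (cutf R)) t * powf n \<tau> t - 2 * rderiv (cutf R) t * (real n * \<tau> * powf (Suc n) \<tau> t)
  + cutf R t * (real n * \<tau> * (real (Suc n) * \<tau> * powf (Suc (Suc n)) \<tau> t))"
definition err where "err n R \<tau> p t = t\<^sup>2 * (rderiv (rderiv (cutf R)) t * powf n \<tau> t - 2 * rderiv (cutf R) t * (real n * \<tau> * powf (Suc n) \<tau> t))
   + (real n + 1 + p) * t * (rderiv (cutf R) t * powf n \<tau> t)"

lemma radial_hfun:
  fixes y :: "complex ^ 'n::finite"
  assumes \<tau>: "0 < \<tau>"
  shows "radial y (hfun n R \<tau>) (hfun1 n R \<tau>) (hfun2 n R \<tau>)"
proof
  fix t :: real assume t: "0 \<le> t"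
  note dp = powf_deriv[OF less_imp_le[OF \<tau>] t]
  note dc = smooth_has_rderiv[OF smooth_cutf] smooth_has_rderiv[OF smooth_rderiv[OF smooth_cutf]]
  show "(hfun n R \<tau> has_real_derivative hfun1 n R \<tau> t) (at t)"
    unfolding hfun_def[abs_def] hfun1_def
    by (rule DERIV_cong[OF DERIV_mult[OF dc(1) dp]]) (simp add: algebra_simps)
  show "(hfun1 n R \<tau> has_real_derivative hfun2 n R \<tau> t) (at t)"
    unfolding hfun1_def[abs_def] hfun2_def
    by (rule DERIV_cong[OF DERIV_diff[OF DERIV_mult[OF dc(2) dp] DERIV_mult[OF dc(1) DERIV_cmult[OF dp]]]])
      (simp add: algebra_simps)
next
  have "1 + \<tau> * (norm (z - y))\<^sup>2 \<noteq> 0" for z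
    using \<tau> mult_nonneg_nonneg[of \<tau> "(norm (z - y))\<^sup>2"] by (smt (verit) zero_le_power2)
  then show "smooth (\<lambda>z. hfun n R \<tau> ((norm (z - y))\<^sup>2))"
    unfolding hfun_def powf_def
    by (intro smooth_mult smooth_compose_real[OF smooth_cutf] smooth_norm_square smooth_power smooth_inverse smooth_add smooth_const)
qed

text \<open>All terms containing a derivative of the cutoff are collected in \<open>err\<close>. The
  rest is the cutoff times (E + n)(E + p) applied to (1 + \<tau>t)^-n, where E = t d/dt.\<close>

lemma kern_hfun:
  assumes \<tau>: "0 < \<tau>" and t: "0 \<le> t"
  shows "kern n (hfun n R \<tau>) (hfun1 n R \<tau>) (hfun2 n R \<tau>) p t =
    cutf R t * (real n * powf (Suc (Suc n)) \<tau> t * (p - (real n + 1 - p) * (\<tau> * t))) + err n R \<tau> p t"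
proof -
  define i where "i = powf (Suc (Suc n)) \<tau> t"
  define a where "a = \<tau> * t"
  have e1: "powf (Suc n) \<tau> t = (1 + a) * i" "powf n \<tau> t = (1 + a) * ((1 + a) * i)"
    using powf_bounds(4)[OF less_imp_le[OF \<tau>] t] by (simp_all add: i_def a_def)
  have "t\<^sup>2 * (real n * \<tau> * (real (Suc n) * \<tau> * i)) - (real n + 1 + p) * t * (real n * \<tau> * ((1 + a) * i)) + real n * p * ((1 + a) * ((1 + a) * i))
     = real n * i * (p - (real n + 1 - p) * a)"
    unfolding a_def by (simp add: algebra_simps power2_eq_square)
  then have "cutf R t * (t\<^sup>2 * (real n * \<tau> * (real (Suc n) * \<tau> * i)) - (real n + 1 + p) * t * (real n * \<tau> * ((1 + a) * i)) + real n * p * ((1 + a) * ((1 + a) * i)))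
     = cutf R t * (real n * i * (p - (real n + 1 - p) * a))" by simp
  then show ?thesis
    unfolding kern_def hfun_def hfun1_def hfun2_def err_def e1 i_def[symmetric] a_def[symmetric]
    by (simp add: algebra_simps)
qed

text \<open>Derivatives of the cutoff live on R^2/2 <= t <= R^2, where 1 / (1 + \<tau>t) <= 2 / (R^2
  \<tau>). The explicit \<tau> in \<open>err\<close> always comes as \<tau>t times one further power
  of 1 / (1 + \<tau>t), a product that is at most 1.\<close>

lemma err_bound:
  assumes R: "0 < R"
  obtains C where "0 \<le> C" "\<And>\<tau> t. 0 < \<tau> \<Longrightarrow> 0 \<le> t \<Longrightarrow> \<bar>err n R \<tau> p t\<bar> \<le> C * inverse \<tau> ^ n"
proof -
  obtain B where B: "0 < B" "\<And>t. 0 \<le> t \<Longrightarrow> \<bar>rderiv (cutf R) t\<bar> \<le> B" "\<And>t. 0 \<le> t \<Longrightarrow> \<bar>rderiv (rderiv (cutf R)) t\<bar> \<le> B"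
    using rderiv_cutf_bounded[OF R] by blast
  define D where "D = (R\<^sup>2)\<^sup>2 * B + R\<^sup>2 * (2 * B * real n) + \<bar>real n + 1 + p\<bar> * R\<^sup>2 * B"
  define C where "C = D * (2 / R\<^sup>2) ^ n"
  have D: "0 \<le> D" using B by (simp add: D_def)
  show ?thesis
  proof (rule that[of C])
    show "0 \<le> C" using D by (simp add: C_def)
    fix \<tau> t :: real assume \<tau>: "0 < \<tau>" and t: "0 \<le> t"
    show "\<bar>err n R \<tau> p t\<bar> \<le> C * inverse \<tau> ^ n"
    proof (cases "t < R\<^sup>2 / 2 \<or> R\<^sup>2 < t")
      case True
      then show ?thesis using \<open>0 \<le> C\<close> \<tau> by (simp add: err_def rderiv_cutf_zero[OF R True])
    next
      case False
      then have t1: "R\<^sup>2 / 2 \<le> t" "t \<le> R\<^sup>2" by auto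
      define i where "i = powf n \<tau> t"
      define j where "j = \<tau> * t * powf (Suc n) \<tau> t"
      have i: "0 \<le> i" "j \<le> i" "0 \<le> j"
        using powf_bounds[OF less_imp_le[OF \<tau>] t] \<tau> t by (simp_all add: i_def j_def)
      define r1 r2 where "r1 = rderiv (cutf R) t" and "r2 = rderiv (rderiv (cutf R)) t"
      have r: "\<bar>r1\<bar> \<le> B" "\<bar>r2\<bar> \<le> B" using B t by (simp_all add: r1_def r2_def)
      have e: "err n R \<tau> p t = t\<^sup>2 * (r2 * i) - t * (2 * r1 * real n * j) + (real n + 1 + p) * t * (r1 * i)"
        by (simp add: err_def i_def j_def r1_def r2_def algebra_simps power2_eq_square)
      have b1: "\<bar>t\<^sup>2 * (r2 * i)\<bar> \<le> (R\<^sup>2)\<^sup>2 * (B * i)"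
        unfolding abs_mult abs_power2 using power_mono[OF t1(2) t, of 2] i r by (intro mult_mono) auto
      have b2: "\<bar>t * (2 * r1 * real n * j)\<bar> \<le> R\<^sup>2 * (2 * B * real n * i)"
        unfolding abs_mult using t t1 i r by (intro mult_mono) auto
      have b3: "\<bar>(real n + 1 + p) * t * (r1 * i)\<bar> \<le> \<bar>real n + 1 + p\<bar> * R\<^sup>2 * (B * i)"
        unfolding abs_mult using t t1 i r by (intro mult_mono) auto
      have "\<bar>err n R \<tau> p t\<bar> \<le> (R\<^sup>2)\<^sup>2 * (B * i) + R\<^sup>2 * (2 * B * real n * i) + \<bar>real n + 1 + p\<bar> * R\<^sup>2 * (B * i)"
        unfolding e using b1 b2 b3 by linarith
      also have "\<dots> = D * i" by (simp add: D_def algebra_simps)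
      also have "\<dots> \<le> D * ((2 / R\<^sup>2) ^ n * inverse \<tau> ^ n)"
      proof (rule mult_left_mono[OF _ D])
        have "\<tau> * (R\<^sup>2 / 2) \<le> 1 + \<tau> * t" using mult_left_mono[OF t1(1), of \<tau>] \<tau> by linarith
        then have "inverse (1 + \<tau> * t) \<le> inverse (\<tau> * (R\<^sup>2 / 2))"
          using \<tau> R by (intro le_imp_inverse_le) auto
        also have "\<dots> = 2 / R\<^sup>2 * inverse \<tau>" by (simp add: field_simps)
        finally have "inverse (1 + \<tau> * t) ^ n \<le> (2 / R\<^sup>2 * inverse \<tau>) ^ n"
          using \<tau> t by (intro power_mono) auto
        then show "i \<le> (2 / R\<^sup>2) ^ n * inverse \<tau> ^ n" unfolding power_mult_distrib[symmetric] by (simp add: i_def powf_def)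
      qed
      finally show ?thesis by (simp add: C_def mult_ac)
    qed
  qed
qed

text \<open>Symmetry of \<tau>t lets \<open>powf_deriv\<close> serve for the derivative in \<tau> as
  well.\<close>

lemma powf_commute: "powf k \<tau> t = powf k t \<tau>"
  by (simp add: powf_def mult.commute)

lemma integrable_mult_bounded:
  fixes g k :: "'a::euclidean_space \<Rightarrow> real"
  assumes "integrable lborel g" "k \<in> borel_measurable borel" "\<And>z. \<bar>k z\<bar> \<le> B"
  shows "integrable lborel (\<lambda>z. g z * k z)"
proof (rule Bochner_Integration.integrable_bound[where f = "\<lambda>z. B * \<bar>g z\<bar>"])
  show "integrable lborel (\<lambda>z. B * \<bar>g z\<bar>)" using assms(1) by simp
  show "(\<lambda>z. g z * k z) \<in> borel_measurable lborel"
    using borel_measurable_integrable[OF assms(1)] assms(2) by simp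
  show "AE z in lborel. norm (g z * k z) \<le> norm (B * \<bar>g z\<bar>)"
  proof (rule AE_I2)
    fix z
    have "\<bar>g z\<bar> * \<bar>k z\<bar> \<le> \<bar>g z\<bar> * B" by (rule mult_left_mono[OF assms(3)]) simp
    then show "norm (g z * k z) \<le> norm (B * \<bar>g z\<bar>)" using assms(3)[of z] by (simp add: abs_mult mult.commute)
  qed
qed

section \<open>Means of an m-subharmonic function over small balls\<close>

locale msh = subharmonic_fun \<Omega> \<phi> for \<Omega> :: "(complex ^ 'n::finite) set" and \<phi> +
  fixes m :: nat
  assumes m: "1 \<le> m" "m < CARD('n)" and sh: "m_subharmonic m \<Omega> \<phi>"
begin

definition p :: real where "p = real CARD('n) + 1 - CARD('n) / m"

text \<open>The bound p < n is m < n in disguise and makes \<tau>^(p-n-1) integrable at infinity; 1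
  <= p makes \<tau>^(p-1) monotone.\<close>

lemma p_bounds: "1 \<le> p" "p < CARD('n)"
proof -
  have n: "real m < real CARD('n)" "1 \<le> real m" using m by simp_all
  have "real CARD('n) * 1 \<le> real CARD('n) * m" by (rule mult_left_mono) (use n in auto)
  then have "real CARD('n) / m \<le> real CARD('n)" using n by (simp add: divide_le_eq)
  then show "1 \<le> p" by (simp add: p_def)
  have "1 < real CARD('n) / m" using n by (simp add: less_divide_eq)
  then show "p < CARD('n)" by (simp add: p_def)
qed

lemma LINT_f: "(LINT z:\<Omega>|lborel. real_of_ereal (\<phi> z) * k z) = (LINT z|lborel. f z * k z)"
  unfolding set_lebesgue_integral_def
  by (intro Bochner_Integration.integral_cong) (auto simp: f_def \<psi>_def)

text \<open>This is \<tau>^(1-p) times the \<tau>-derivative of \<open>pkern\<close>; the last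
  factor results from differentiating \<tau>^p (1 + \<tau>t)^-(n+1).\<close>

definition bkern :: "real \<Rightarrow> real \<Rightarrow> real \<Rightarrow> real" where
  "bkern R \<tau> t = cutf R t * (real CARD('n) * powf (Suc (Suc CARD('n))) \<tau> t * (p - (real CARD('n) + 1 - p) * (\<tau> * t)))"

lemma bkern_bound:
  assumes "0 < R" "0 < \<tau>" "0 \<le> t"
  shows "\<bar>bkern R \<tau> t\<bar> \<le> real CARD('n) * (p + (real CARD('n) + 1 - p))"
proof -
  define i where "i = powf (Suc (Suc CARD('n))) \<tau> t"
  define c where "c = real CARD('n) + 1 - p"
  have c: "0 \<le> c" "0 \<le> p" using p_bounds by (auto simp: c_def)
  have i: "0 \<le> i" "i \<le> 1" "0 \<le> \<tau> * t * i" "\<tau> * t * i \<le> 1"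
  proof -
    note pb = powf_bounds[OF less_imp_le[OF assms(2)] assms(3)]
    show "0 \<le> i" "i \<le> 1" unfolding i_def by (rule pb)+
    then show "0 \<le> \<tau> * t * i" using assms by simp
    show "\<tau> * t * i \<le> 1" unfolding i_def by (rule order.trans[OF pb(3) pb(2)])
  qed
  have "\<bar>i * (p - c * (\<tau> * t))\<bar> = \<bar>p * i - c * (\<tau> * t * i)\<bar>" by (simp add: algebra_simps)
  also have "\<dots> \<le> p * i + c * (\<tau> * t * i)" using c i by (intro abs_leI) (auto intro: add_nonneg_nonneg order.trans[of _ 0])
  also have "\<dots> \<le> p * 1 + c * 1" using c i by (intro add_mono mult_left_mono)
  finally have 1: "\<bar>i * (p - c * (\<tau> * t))\<bar> \<le> p + c" by simp
  have "\<bar>bkern R \<tau> t\<bar> = cutf R t * (real CARD('n) * \<bar>i * (p - c * (\<tau> * t))\<bar>)"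
    unfolding bkern_def i_def[symmetric] c_def[symmetric] using cutf_simps(3)[OF assms(1)] by (simp add: abs_mult mult_ac)
  also have "\<dots> \<le> 1 * (real CARD('n) * (p + c))"
    using cutf_simps(3,4)[OF assms(1)] 1 by (intro mult_mono mult_left_mono) auto
  finally show ?thesis by (simp add: c_def)
qed

lemma measurable_cutf [measurable]: "cutf R \<in> borel_measurable borel"
  "rderiv (cutf R) \<in> borel_measurable borel" "rderiv (rderiv (cutf R)) \<in> borel_measurable borel"
  by (intro borel_measurable_continuous_onI smooth_continuous_on smooth_cutf smooth_rderiv)+

lemma measurable_powf [measurable]: "powf k \<tau> \<in> borel_measurable borel"
  unfolding powf_def[abs_def] by measurable

lemma measurable_bkern [measurable]: "bkern R \<tau> \<in> borel_measurable borel"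
  unfolding bkern_def[abs_def] by measurable

lemma measurable_err [measurable]: "err n R \<tau> q \<in> borel_measurable borel"
  unfolding err_def[abs_def] by measurable

text \<open>The full kernel \<open>bkern + err\<close> pairs nonnegatively with f and has integral
  0, so it also pairs nonnegatively with f - M. Moving \<open>err\<close> to the other side leaves
  the stated bound. Its right-hand data are the same for all centres y in \<open>cball x R\<close>,
  because all supports lie in \<open>cball x (2 * R)\<close>.\<close>

lemma bkern_lower:
  fixes x y :: "complex ^ 'n" and M :: real
  assumes R: "0 < R" and sub: "cball x (2 * R) \<subseteq> \<Omega>" and y: "y \<in> cball x R" and \<tau>: "0 < \<tau>"
    and C: "\<And>t. 0 \<le> t \<Longrightarrow> \<bar>err CARD('n) R \<tau> p t\<bar> \<le> C"
  defines "g \<equiv> \<lambda>z. indicator (cball x (2 * R)) z * (f z - M)"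
  shows "- (C * (LINT z|lborel. \<bar>g z\<bar>)) \<le> (LINT z|lborel. g z * bkern R \<tau> ((norm (z - y))\<^sup>2))"
proof -
  define T where "T z = (norm (z - y))\<^sup>2" for z
  have mT [measurable]: "T \<in> borel_measurable borel" unfolding T_def[abs_def] by measurable
  have T0: "0 \<le> T z" for z by (simp add: T_def)
  define F where "F z = indicator (cball x (2 * R)) z * f z" for z
  define k where "k z = bkern R \<tau> (T z) + err CARD('n) R \<tau> p (T z)" for z
  have k_eq: "k z = kern CARD('n) (hfun CARD('n) R \<tau>) (hfun1 CARD('n) R \<tau>) (hfun2 CARD('n) R \<tau>) p (T z)" for z
    unfolding k_def bkern_def by (rule kern_hfun[OF \<tau> T0, symmetric])
  have mk [measurable]: "k \<in> borel_measurable borel" unfolding k_def[abs_def] by measurable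
  have subB: "cball y R \<subseteq> cball x (2 * R)"
  proof
    fix u assume "u \<in> cball y R"
    then show "u \<in> cball x (2 * R)" using y dist_triangle[of x u y] by simp
  qed
  have k0: "k z = 0" if "z \<notin> cball y R" for z
  proof -
    have "R\<^sup>2 < T z" unfolding T_def
      using that R by (intro power_strict_mono) (auto simp: dist_norm norm_minus_commute)
    then show ?thesis using R by (simp add: k_def bkern_def err_def cutf_simps rderiv_cutf_zero)
  qed
  define Bk where "Bk = real CARD('n) * (p + (real CARD('n) + 1 - p)) + C"
  have kB: "\<bar>k z\<bar> \<le> Bk" for z
    using bkern_bound[OF R \<tau> T0[of z]] C[OF T0[of z]] unfolding k_def Bk_def by linarith
  have iF: "integrable lborel F" unfolding F_def[abs_def] by (rule integrable_f[OF compact_cball sub])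
  have iI: "integrable lborel (indicator (cball x (2 * R)) :: complex ^ 'n \<Rightarrow> real)"
    using emeasure_compact_finite[OF compact_cball, of x "2 * R"] by (intro integrable_real_indicator) auto
  have ig: "integrable lborel g"
  proof -
    have "g = (\<lambda>z. F z - M * indicator (cball x (2 * R)) z)" by (auto simp: g_def F_def algebra_simps)
    then show ?thesis using iF iI by simp
  qed
  have iFk: "integrable lborel (\<lambda>z. F z * k z)" by (rule integrable_mult_bounded[OF iF mk kB])
  have ik: "integrable lborel k"
  proof -
    have "(\<lambda>z. indicator (cball x (2 * R)) z * k z) = k"
    proof
      fix z show "indicator (cball x (2 * R)) z * k z = k z"
        using k0[of z] subsetD[OF subB, of z] by (cases "z \<in> cball y R") auto
    qed
    then show ?thesis using integrable_mult_bounded[OF iI mk kB] by simp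
  qed
  interpret r: radial y "hfun CARD('n) R \<tau>" "hfun1 CARD('n) R \<tau>" "hfun2 CARD('n) R \<tau>"
    by (rule radial_hfun[OF \<tau>])
  have h0: "hfun CARD('n) R \<tau> t = 0" if "R\<^sup>2 \<le> t" for t
    using that R by (simp add: hfun_def cutf_simps)
  have hn: "0 \<le> hfun CARD('n) R \<tau> t" if "0 \<le> t" for t
    using powf_bounds[OF less_imp_le[OF \<tau>] that] cutf_simps(3)[OF R] by (simp add: hfun_def)
  have subO: "cball y R \<subseteq> \<Omega>" using subB sub by blast
  have kz: "(LINT z|lborel. k z) = 0"
    unfolding k_eq T_def p_def by (rule r.integral_kern_zero[OF m h0 R hn])
  have "0 \<le> (LINT z:\<Omega>|lborel. real_of_ereal (\<phi> z) * k z)"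
    unfolding k_eq T_def p_def by (rule r.integral_kern_nonneg[OF m h0 R hn sh subO])
  also have "\<dots> = (LINT z|lborel. F z * k z)"
    unfolding LINT_f
  proof (rule Bochner_Integration.integral_cong[OF refl])
    fix z show "f z * k z = F z * k z"
      using k0[of z] subsetD[OF subB, of z] by (cases "z \<in> cball y R") (auto simp: F_def)
  qed
  also have "\<dots> = (LINT z|lborel. F z * k z - M * k z)"
    using iFk ik kz by simp
  also have "\<dots> = (LINT z|lborel. g z * k z)"
  proof (rule Bochner_Integration.integral_cong[OF refl])
    fix z show "F z * k z - M * k z = g z * k z"
      using k0[of z] subsetD[OF subB, of z] by (cases "z \<in> cball y R") (auto simp: F_def g_def algebra_simps)
  qed
  also have "\<dots> = (LINT z|lborel. g z * bkern R \<tau> (T z) + g z * err CARD('n) R \<tau> p (T z))"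
    by (simp add: k_def distrib_left)
  also have "\<dots> = (LINT z|lborel. g z * bkern R \<tau> (T z)) + (LINT z|lborel. g z * err CARD('n) R \<tau> p (T z))"
  proof (rule Bochner_Integration.integral_add)
    show "integrable lborel (\<lambda>z. g z * bkern R \<tau> (T z))"
      by (rule integrable_mult_bounded[OF ig _ bkern_bound[OF R \<tau> T0]]) measurable
    show "integrable lborel (\<lambda>z. g z * err CARD('n) R \<tau> p (T z))"
      by (rule integrable_mult_bounded[OF ig _ C[OF T0]]) measurable
  qed
  also have "(LINT z|lborel. g z * err CARD('n) R \<tau> p (T z)) \<le> (LINT z|lborel. C * \<bar>g z\<bar>)"
  proof (rule integral_mono)
    show "integrable lborel (\<lambda>z. g z * err CARD('n) R \<tau> p (T z))"
      by (rule integrable_mult_bounded[OF ig _ C[OF T0]]) measurable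
    show "integrable lborel (\<lambda>z. C * \<bar>g z\<bar>)" using ig by simp
    fix z
    have "g z * err CARD('n) R \<tau> p (T z) \<le> \<bar>g z\<bar> * \<bar>err CARD('n) R \<tau> p (T z)\<bar>" by (metis abs_ge_self abs_mult)
    also have "\<dots> \<le> \<bar>g z\<bar> * C" by (rule mult_left_mono[OF C[OF T0]]) simp
    finally show "g z * err CARD('n) R \<tau> p (T z) \<le> C * \<bar>g z\<bar>" by (simp add: mult.commute)
  qed
  finally show ?thesis by (simp add: T_def)
qed

definition pkern :: "real \<Rightarrow> real \<Rightarrow> real \<Rightarrow> real" where
  "pkern R \<tau> t = \<tau> powr p * (cutf R t * (real CARD('n) * powf (Suc CARD('n)) \<tau> t))"

lemma pkern_deriv:
  assumes "0 < \<tau>" "0 \<le> t"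
  shows "((\<lambda>\<tau>. pkern R \<tau> t) has_real_derivative \<tau> powr (p - 1) * bkern R \<tau> t) (at \<tau>)"
proof -
  define i where "i = powf (Suc (Suc CARD('n))) \<tau> t"
  have e: "powf (Suc CARD('n)) \<tau> t = (1 + \<tau> * t) * i"
    using powf_bounds(4)[OF less_imp_le[OF assms(1)] assms(2)] by (simp add: i_def)
  have tp: "\<tau> powr p = \<tau> powr (p - 1) * \<tau>"
    using assms powr_add[of \<tau> "p - 1" 1] by simp
  have d1: "((\<lambda>\<tau>. powf (Suc CARD('n)) \<tau> t) has_real_derivative - (real (Suc CARD('n)) * t * i)) (at \<tau>)"
  proof -
    have "(\<lambda>\<tau>. powf (Suc CARD('n)) \<tau> t) = powf (Suc CARD('n)) t" by (rule ext) (rule powf_commute)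
    then show ?thesis
      using powf_deriv[OF assms(2) less_imp_le[OF assms(1)], of "Suc CARD('n)"]
      by (simp add: i_def powf_commute[of _ \<tau> t])
  qed
  have d2: "((\<lambda>\<tau>. \<tau> powr p) has_real_derivative p * \<tau> powr (p - 1)) (at \<tau>)"
    by (rule has_real_derivative_powr[OF assms(1)])
  have "((\<lambda>\<tau>. \<tau> powr p * (cutf R t * (real CARD('n) * powf (Suc CARD('n)) \<tau> t))) has_real_derivative
    p * \<tau> powr (p - 1) * (cutf R t * (real CARD('n) * powf (Suc CARD('n)) \<tau> t)) +
    (cutf R t * (real CARD('n) * - (real (Suc CARD('n)) * t * i))) * \<tau> powr p) (at \<tau>)"
    by (intro DERIV_mult d2 DERIV_cmult d1)
  then show ?thesis
    unfolding pkern_def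
    by (rule DERIV_cong) (simp add: e tp bkern_def i_def[symmetric] algebra_simps)
qed

text \<open>The integral \<Psi> of g against \<open>pkern\<close> has \<tau>-derivative at least -
  C1 A \<tau>^(p-n-1), so \<Psi> stays bounded below on \<tau> >= 1. As g <= 0 and the weight is
  nonnegative and at least a multiple of r^(-2p) on the ball when \<tau> = r^-2, the integral of g
  over the ball is at least - C r^(2p). C is uniform in y because the later argument integrates over
  centres.\<close>

lemma mean_lower_bound:
  fixes x :: "complex ^ 'n" and M :: real
  assumes R: "0 < R" and sub: "cball x (2 * R) \<subseteq> \<Omega>" and M: "\<And>z. z \<in> cball x (2 * R) \<Longrightarrow> f z \<le> M"
  defines "g \<equiv> \<lambda>z. indicator (cball x (2 * R)) z * (f z - M)"
  obtains C where "0 < C" "\<And>y r. y \<in> cball x R \<Longrightarrow> 0 < r \<Longrightarrow> r \<le> 1 \<Longrightarrow> r\<^sup>2 \<le> R\<^sup>2 / 2 \<Longrightarrow>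
    - (C * r powr (2 * p)) \<le> (LINT z|lborel. indicator (cball y r) z * g z)"
proof -
  define n where "n = real CARD('n)"
  have n: "1 \<le> n" "p < n" using p_bounds m by (auto simp: n_def)
  define A where "A = (LINT z|lborel. \<bar>g z\<bar>)"
  have A: "0 \<le> A" by (simp add: A_def)
  have ig: "integrable lborel g"
  proof -
    have "integrable lborel (\<lambda>z. indicator (cball x (2 * R)) z * f z)" by (rule integrable_f[OF compact_cball sub])
    moreover have "integrable lborel (indicator (cball x (2 * R)) :: complex ^ 'n \<Rightarrow> real)"
      using emeasure_compact_finite[OF compact_cball, of x "2 * R"] by (intro integrable_real_indicator) auto
    moreover have "g = (\<lambda>z. indicator (cball x (2 * R)) z * f z - M * indicator (cball x (2 * R)) z)"
      by (auto simp: g_def algebra_simps)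
    ultimately show ?thesis by simp
  qed
  have g0: "g z \<le> 0" for z using M[of z] by (auto simp: g_def indicator_def)
  obtain C1 where C1: "0 \<le> C1" "\<And>\<tau> t. 0 < \<tau> \<Longrightarrow> 0 \<le> t \<Longrightarrow> \<bar>err CARD('n) R \<tau> p t\<bar> \<le> C1 * inverse \<tau> ^ CARD('n)"
    using err_bound[OF R] by metis
  \<comment> \<open>The integral of C1 A \<tau>^(p-n-1) over \<tau> >= 1. Adding the antiderivative
    - C2 \<tau>^(p-n) to \<Psi> makes it nondecreasing.\<close>
  define C2 where "C2 = C1 * A / (n - p)"
  define C3 where "C3 = n * A + C2"
  have C2: "0 \<le> C2" using C1 A n by (simp add: C2_def)
  have C3: "0 \<le> C3" using C2 A n by (simp add: C3_def)
  \<comment> \<open>On the ball \<tau>t <= 1, hence n (1 + \<tau>t)^-(n+1) >= n / 2^(n+1); C divides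
    by this constant and adds 1 to be strictly positive.\<close>
  define C where "C = C3 * 2 ^ Suc CARD('n) / n + 1"
  show ?thesis
  proof (rule that[of C])
    show "0 < C" using C3 n by (simp add: C_def add_nonneg_pos)
    fix y r assume y: "y \<in> cball x R" and r: "0 < r" "r \<le> 1" "r\<^sup>2 \<le> R\<^sup>2 / 2"
    define T where "T z = (norm (z - y))\<^sup>2" for z
    have mT [measurable]: "T \<in> borel_measurable borel" unfolding T_def[abs_def] by measurable
    have T0: "0 \<le> T z" for z by (simp add: T_def)
    define \<Psi> where "\<Psi> \<tau> = (LINT z|lborel. g z * pkern R \<tau> (T z))" for \<tau>
    have mp [measurable]: "pkern R \<tau> \<in> borel_measurable borel" for \<tau>
      unfolding pkern_def[abs_def] by measurable
    have pk: "0 \<le> pkern R \<tau> t" "\<bar>pkern R \<tau> t\<bar> \<le> \<tau> powr p * n" if "0 < \<tau>" "0 \<le> t" for \<tau> t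
    proof -
      note pb = powf_bounds[OF less_imp_le[OF that(1)] that(2), of "Suc CARD('n)"]
      show 0: "0 \<le> pkern R \<tau> t" unfolding pkern_def using pb cutf_simps[OF R, of t] by simp
      have "pkern R \<tau> t \<le> \<tau> powr p * (1 * (n * 1))"
        unfolding pkern_def n_def[symmetric] using pb cutf_simps[OF R, of t] n by (intro mult_left_mono mult_mono) auto
      with 0 show "\<bar>pkern R \<tau> t\<bar> \<le> \<tau> powr p * n" by simp
    qed
    have ip: "integrable lborel (\<lambda>z. g z * pkern R \<tau> (T z))" if "0 < \<tau>" for \<tau>
      by (rule integrable_mult_bounded[OF ig _ pk(2)[OF that T0]]) measurable
    have d\<Psi>: "(\<Psi> has_real_derivative (LINT z|lborel. g z * (\<tau> powr (p - 1) * bkern R \<tau> (T z)))) (at \<tau>)" if \<tau>: "0 < \<tau>" for \<tau>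
      unfolding \<Psi>_def[abs_def]
    proof (rule has_derivative_under_integral[OF ig, of \<tau> 0 "\<tau> + 1" "\<lambda>\<tau> z. pkern R \<tau> (T z)" "\<lambda>\<tau> z. \<tau> powr (p - 1) * bkern R \<tau> (T z)"
          "(\<tau> + 1) powr (p - 1) * (n * (p + (n + 1 - p)))"])
      fix s z assume s: "s \<in> {0<..<\<tau> + 1}"
      show "((\<lambda>\<tau>. pkern R \<tau> (T z)) has_real_derivative s powr (p - 1) * bkern R s (T z)) (at s)"
        by (rule pkern_deriv) (use s T0 in auto)
      have "\<bar>bkern R s (T z)\<bar> \<le> n * (p + (n + 1 - p))"
        unfolding n_def by (rule bkern_bound[OF R]) (use s T0 in auto)
      moreover have "s powr (p - 1) \<le> (\<tau> + 1) powr (p - 1)" using s p_bounds by (intro powr_mono2) auto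
      ultimately show "\<bar>s powr (p - 1) * bkern R s (T z)\<bar> \<le> (\<tau> + 1) powr (p - 1) * (n * (p + (n + 1 - p)))"
        unfolding abs_mult by (intro mult_mono) auto
    next
      fix s assume s: "s \<in> {0<..<\<tau> + 1}"
      show "(\<lambda>z. pkern R s (T z)) \<in> borel_measurable borel" by measurable
      show "integrable lborel (\<lambda>z. g z * pkern R s (T z))" by (rule ip) (use s in auto)
    next
      show "(\<lambda>z. \<tau> powr (p - 1) * bkern R \<tau> (T z)) \<in> borel_measurable borel" by measurable
    qed (use \<tau> in auto)
    have lower: "- (C1 * A * \<tau> powr (p - n - 1)) \<le> (LINT z|lborel. g z * (\<tau> powr (p - 1) * bkern R \<tau> (T z)))" if \<tau>: "0 < \<tau>" for \<tau>
    proof -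
      have "- (C1 * inverse \<tau> ^ CARD('n) * A) \<le> (LINT z|lborel. g z * bkern R \<tau> (T z))"
        unfolding A_def g_def T_def by (rule bkern_lower[OF R sub y \<tau> C1(2)[OF \<tau>]])
      then have "\<tau> powr (p - 1) * - (C1 * inverse \<tau> ^ CARD('n) * A) \<le> \<tau> powr (p - 1) * (LINT z|lborel. g z * bkern R \<tau> (T z))"
        by (rule mult_left_mono) simp
      also have "\<dots> = (LINT z|lborel. g z * (\<tau> powr (p - 1) * bkern R \<tau> (T z)))"
        by (subst integral_mult_right_zero[symmetric]) (simp add: mult_ac)
      also have "\<tau> powr (p - 1) * - (C1 * inverse \<tau> ^ CARD('n) * A) = - (C1 * A * \<tau> powr (p - n - 1))"
      proof -
        have "inverse \<tau> ^ CARD('n) = \<tau> powr (- n)"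
          using \<tau> by (simp add: n_def powr_minus powr_realpow power_inverse)
        moreover have "\<tau> powr (p - 1) * \<tau> powr (- n) = \<tau> powr (p - n - 1)"
          by (simp add: powr_add[symmetric] algebra_simps)
        ultimately show ?thesis by (simp add: mult_ac)
      qed
      finally show ?thesis .
    qed
    \<comment> \<open>The scale at which the ball of radius r is the set \<tau>t <= 1; it is at
      least 1 because r <= 1.\<close>
    define \<tau> where "\<tau> = inverse (r\<^sup>2)"
    have \<tau>: "1 \<le> \<tau>" using r by (simp add: \<tau>_def one_le_inverse_iff power_le_one)
    have "\<Psi> 1 - C2 * 1 powr (p - n) \<le> \<Psi> \<tau> - C2 * \<tau> powr (p - n)"
    proof (rule DERIV_nonneg_imp_nondecreasing[OF \<tau>])
      fix s :: real assume "1 \<le> s" "s \<le> \<tau>"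
      then have s: "0 < s" by simp
      have "((\<lambda>\<tau>. \<Psi> \<tau> - C2 * \<tau> powr (p - n)) has_real_derivative
         (LINT z|lborel. g z * (s powr (p - 1) * bkern R s (T z))) - C2 * ((p - n) * s powr (p - n - 1))) (at s)"
        by (intro DERIV_diff d\<Psi>[OF s] DERIV_cmult has_real_derivative_powr[OF s])
      moreover have "C2 * ((p - n) * s powr (p - n - 1)) = - (C1 * A * s powr (p - n - 1))"
        using n by (simp add: C2_def field_simps)
      ultimately show "\<exists>d. ((\<lambda>\<tau>. \<Psi> \<tau> - C2 * \<tau> powr (p - n)) has_real_derivative d) (at s) \<and> 0 \<le> d"
        using lower[OF s] by (intro exI conjI) auto
    qed
    moreover have "0 \<le> C2 * \<tau> powr (p - n)" using C2 by simp
    ultimately have "\<Psi> 1 - C2 \<le> \<Psi> \<tau>" by simp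
    moreover have "- (n * A) \<le> \<Psi> 1"
    proof -
      have "- (n * A) = (LINT z|lborel. - (n * \<bar>g z\<bar>))" by (simp add: A_def)
      also have "\<dots> \<le> \<Psi> 1" unfolding \<Psi>_def
      proof (rule integral_mono)
        show "integrable lborel (\<lambda>z. - (n * \<bar>g z\<bar>))" using ig by simp
        show "integrable lborel (\<lambda>z. g z * pkern R 1 (T z))" by (rule ip) simp
        fix z
        have "\<bar>g z * pkern R 1 (T z)\<bar> \<le> \<bar>g z\<bar> * n"
          unfolding abs_mult using pk(2)[OF _ T0, of 1 z] by (intro mult_left_mono) auto
        then show "- (n * \<bar>g z\<bar>) \<le> g z * pkern R 1 (T z)" by (simp add: abs_le_iff mult.commute)
      qed
      finally show ?thesis .
    qed
    ultimately have "- C3 \<le> \<Psi> \<tau>" by (simp add: C3_def)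
    also have "\<Psi> \<tau> \<le> (LINT z|lborel. \<tau> powr p * (n * (1 / 2) ^ Suc CARD('n)) * (indicator (cball y r) z * g z))"
      unfolding \<Psi>_def
    proof (rule integral_mono)
      show "integrable lborel (\<lambda>z. g z * pkern R \<tau> (T z))" by (rule ip) (use \<tau> in simp)
      have "integrable lborel (\<lambda>z. g z * indicator (cball y r) z)"
        by (rule integrable_mult_bounded[OF ig, of _ 1]) (auto simp: indicator_def)
      then show "integrable lborel (\<lambda>z. \<tau> powr p * (n * (1 / 2) ^ Suc CARD('n)) * (indicator (cball y r) z * g z))"
        by (simp add: mult.commute)
      fix z
      show "g z * pkern R \<tau> (T z) \<le> \<tau> powr p * (n * (1 / 2) ^ Suc CARD('n)) * (indicator (cball y r) z * g z)"
      proof (cases "z \<in> cball y r")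
        case True
        have t: "T z \<le> r\<^sup>2" unfolding T_def using True r by (intro power_mono) (auto simp: dist_norm norm_minus_commute)
        have c: "cutf R (T z) = 1" using t r cutf_simps(1)[OF R] by simp
        have "\<tau> * T z \<le> 1" using t r by (simp add: \<tau>_def field_simps)
        then have "1 / 2 \<le> inverse (1 + \<tau> * T z)" using \<tau> T0[of z] by (simp add: field_simps add_pos_nonneg)
        then have "(1 / 2) ^ Suc CARD('n) \<le> powf (Suc CARD('n)) \<tau> (T z)" unfolding powf_def by (intro power_mono) auto
        then have "\<tau> powr p * (n * (1 / 2) ^ Suc CARD('n)) \<le> pkern R \<tau> (T z)"
          unfolding pkern_def c n_def[symmetric] mult_1 using n by (intro mult_left_mono) auto
        then have "g z * pkern R \<tau> (T z) \<le> g z * (\<tau> powr p * (n * (1 / 2) ^ Suc CARD('n)))"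
          using g0[of z] by (rule mult_left_mono_neg)
        then show ?thesis using True by (simp add: mult_ac)
      next
        case False
        then show ?thesis using g0[of z] pk(1)[OF _ T0, of \<tau> z] \<tau> by (simp add: mult_nonpos_nonneg)
      qed
    qed
    also have "\<dots> = \<tau> powr p * (n * (1 / 2) ^ Suc CARD('n)) * (LINT z|lborel. indicator (cball y r) z * g z)"
      by (rule integral_mult_right_zero)
    finally have fin: "- C3 \<le> \<tau> powr p * (n * (1 / 2) ^ Suc CARD('n)) * (LINT z|lborel. indicator (cball y r) z * g z)" .
    have tp: "\<tau> powr p * r powr (2 * p) = 1"
    proof -
      have "\<tau> = r powr (- 2)" using r by (simp add: \<tau>_def powr_minus powr_numeral)
      then have "\<tau> powr p = r powr (- 2 * p)" by (simp add: powr_powr)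
      then show ?thesis using r by (simp add: powr_add[symmetric])
    qed
    define I where "I = (LINT z|lborel. indicator (cball y r) z * g z)"
    define K where "K = n * (1 / 2) ^ Suc CARD('n)"
    have K: "0 < K" using n by (simp add: K_def)
    have "- C3 * r powr (2 * p) \<le> (\<tau> powr p * K * I) * r powr (2 * p)"
      using fin unfolding I_def K_def by (rule mult_right_mono) simp
    also have "\<dots> = (\<tau> powr p * r powr (2 * p)) * (K * I)" by (simp add: mult_ac)
    also have "\<dots> = K * I" unfolding tp by simp
    finally have "- (C3 / K * r powr (2 * p)) \<le> I" using K by (simp add: field_simps)
    moreover have "C3 / K \<le> C" by (simp add: C_def K_def power_one_over field_simps)
    then have "C3 / K * r powr (2 * p) \<le> C * r powr (2 * p)" by (rule mult_right_mono) simp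
    ultimately show "- (C * r powr (2 * p)) \<le> (LINT z|lborel. indicator (cball y r) z * g z)" by (simp add: I_def)
  qed
qed

end

subsection \<open>Volume of sublevel sets\<close>

lemma integral_symmetric_zero:
  fixes F :: "'a::euclidean_space \<Rightarrow> real"
  assumes F: "F \<in> borel_measurable borel" and odd: "\<And>u. F (- u) = - F u"
  shows "(LINT u|lborel. F u) = 0"
proof -
  have "(\<lambda>x :: 'a. 0 + (\<Sum>j\<in>Basis. (- 1 * (x \<bullet> j)) *\<^sub>R j)) = uminus"
    by (simp add: fun_eq_iff sum_negf euclidean_representation)
  with lborel_affine_euclidean[where 'a = 'a and c = "\<lambda>_. - 1" and t = 0]
  have "distr lborel borel uminus = (lborel :: 'a measure)" by (simp add: density_1)
  then have "(LINT u|lborel. F u) = (LINT u|distr lborel borel uminus. F u)" by simp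
  also have "\<dots> = (LINT u|lborel. F (- u))" using F by (subst integral_distr) auto
  also have "\<dots> = - (LINT u|lborel. F u)" unfolding odd by simp
  finally show ?thesis by simp
qed

definition ball_vol :: "'a::euclidean_space itself \<Rightarrow> real \<Rightarrow> real" where
  "ball_vol _ r = unit_ball_vol (DIM('a)) * r ^ DIM('a)"

lemma measure_cball_eq: "0 \<le> r \<Longrightarrow> measure lborel (cball (a :: 'a::euclidean_space) r) = ball_vol TYPE('a) r"
  using content_cball[of r a] by (simp add: ball_vol_def)

lemma ball_vol_pos: "0 < r \<Longrightarrow> 0 < ball_vol TYPE('a::euclidean_space) r"
  by (simp add: ball_vol_def)

lemma integrable_indicator_cball: "integrable lborel (indicator (cball (a :: 'a::euclidean_space) r) :: 'a \<Rightarrow> real)"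
  using emeasure_compact_finite[OF compact_cball, of a r] by (intro integrable_real_indicator) auto

text \<open>Expanding |a - x|^2 about z, the linear term is odd and averages to 0, and the quadratic
  one costs at most r^2. Where the truncation is active, w z = 0 and the left side is
  nonpositive.\<close>

lemma paraboloid_mean:
  fixes x z :: "'a::euclidean_space" and \<rho> r :: real
  assumes r: "0 < r"
  defines "w \<equiv> \<lambda>a. max 0 (\<rho>\<^sup>2 - (norm (a - x))\<^sup>2)"
  shows "(w z - r\<^sup>2) * ball_vol TYPE('a) r \<le> (LINT a|lborel. indicator (cball z r) a * w a)"
proof -
  define I :: "'a \<Rightarrow> real" where "I = indicator (cball z r)"
  have mw: "w \<in> borel_measurable borel" unfolding w_def by measurable
  have iI: "integrable lborel I" unfolding I_def by (rule integrable_indicator_cball)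
  have wB: "\<bar>w a\<bar> \<le> \<rho>\<^sup>2" for a by (simp add: w_def)
  have iw: "integrable lborel (\<lambda>a. I a * w a)" by (rule integrable_mult_bounded[OF iI mw wB])
  show ?thesis
  proof (cases "w z = 0")
    case True
    have "0 \<le> (LINT a|lborel. I a * w a)" by (simp add: I_def w_def)
    moreover have "(w z - r\<^sup>2) * ball_vol TYPE('a) r \<le> 0"
      unfolding True using ball_vol_pos[OF r, where 'a = 'a] by (simp add: mult_nonpos_nonneg)
    ultimately show ?thesis by (simp add: I_def)
  next
    case False
    then have wz: "w z = \<rho>\<^sup>2 - (norm (z - x))\<^sup>2" by (simp add: w_def max_def split: if_splits)
    define c where "c = w z - r\<^sup>2"
    define F where "F u = indicator (cball (0::'a) r) u * (2 * (u \<bullet> (z - x)))" for u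
    have [measurable]: "cball (0::'a) r \<in> sets borel" by simp
    have mF: "F \<in> borel_measurable borel" unfolding F_def by measurable
    have "(LINT u|lborel. F u) = 0"
      by (rule integral_symmetric_zero[OF mF]) (simp add: F_def indicator_def)
    then have F0: "(LINT a|lborel. F (- z + a)) = 0" using lborel_integral_translate[OF mF, of "- z"] by simp
    have Feq: "F (- z + a) = I a * (2 * ((a - z) \<bullet> (z - x)))" for a
      by (simp add: F_def I_def indicator_def dist_norm norm_minus_commute)
    have iF: "integrable lborel (\<lambda>a. F (- z + a))"
    proof (rule Bochner_Integration.integrable_bound[where f = "\<lambda>a. (2 * (r * norm (z - x))) * I a"])
      show "integrable lborel (\<lambda>a. (2 * (r * norm (z - x))) * I a)" using iI by simp
      show "(\<lambda>a. F (- z + a)) \<in> borel_measurable lborel" using mF by measurable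
      show "AE a in lborel. norm (F (- z + a)) \<le> norm ((2 * (r * norm (z - x))) * I a)"
      proof (rule AE_I2)
        fix a
        show "norm (F (- z + a)) \<le> norm ((2 * (r * norm (z - x))) * I a)"
        proof (cases "a \<in> cball z r")
          case True
          have "\<bar>(a - z) \<bullet> (z - x)\<bar> \<le> norm (a - z) * norm (z - x)" by (rule Cauchy_Schwarz_ineq2)
          also have "\<dots> \<le> r * norm (z - x)" using True by (intro mult_right_mono) (auto simp: dist_norm norm_minus_commute)
          finally show ?thesis unfolding Feq using True r by (simp add: I_def abs_mult)
        next
          case False
          then show ?thesis unfolding Feq by (simp add: I_def)
        qed
      qed
    qed
    have "c * ball_vol TYPE('a) r = (LINT a|lborel. c * I a - F (- z + a))"
      using iI iF F0 r by (simp add: I_def measure_cball_eq)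
    also have "\<dots> \<le> (LINT a|lborel. I a * w a)"
    proof (rule integral_mono)
      show "integrable lborel (\<lambda>a. c * I a - F (- z + a))" using iI iF by simp
      show "integrable lborel (\<lambda>a. I a * w a)" by (rule iw)
      fix a
      show "c * I a - F (- z + a) \<le> I a * w a"
      proof (cases "a \<in> cball z r")
        case True
        have "(norm (a - z))\<^sup>2 \<le> r\<^sup>2" using True by (intro power_mono) (auto simp: dist_norm norm_minus_commute)
        moreover have "(norm (a - x))\<^sup>2 = (norm (z - x))\<^sup>2 + 2 * ((a - z) \<bullet> (z - x)) + (norm (a - z))\<^sup>2"
          by (simp add: power2_norm_eq_inner inner_diff_left inner_diff_right inner_commute algebra_simps)
        ultimately have "c - 2 * ((a - z) \<bullet> (z - x)) \<le> \<rho>\<^sup>2 - (norm (a - x))\<^sup>2" by (simp add: c_def wz)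
        also have "\<dots> \<le> w a" by (simp add: w_def)
        finally show ?thesis unfolding Feq using True by (simp add: I_def)
      next
        case False
        then show ?thesis unfolding Feq by (simp add: I_def)
      qed
    qed
    finally show ?thesis by (simp add: c_def I_def)
  qed
qed

text \<open>Both sides integrate w a * g z over the pairs with dist a z <= r, a condition symmetric
  in a and z; boundedness of the indicator gives integrability on the product.\<close>

lemma Fubini_cball:
  fixes g w :: "'a::euclidean_space \<Rightarrow> real"
  assumes g: "integrable lborel g" and w: "integrable lborel w" "w \<in> borel_measurable borel" "\<And>a. 0 \<le> w a"
  shows "(LINT a|lborel. w a * (LINT z|lborel. indicator (cball a r) z * g z)) =
      (LINT z|lborel. g z * (LINT a|lborel. indicator (cball z r) a * w a))" (is ?eq)
    and "integrable lborel (\<lambda>a. w a * (LINT z|lborel. indicator (cball a r) z * g z))" (is ?int)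
proof -
  define Q :: "'a \<Rightarrow> 'a \<Rightarrow> real" where "Q a z = w a * (if dist a z \<le> r then 1 else 0) * g z" for a z
  have mg [measurable]: "g \<in> borel_measurable borel" using borel_measurable_integrable[OF g] by simp
  note [measurable] = w(2)
  have mQ: "case_prod Q \<in> borel_measurable (lborel \<Otimes>\<^sub>M lborel)"
    unfolding Q_def[abs_def] by measurable
  have Q1: "Q a z = w a * (indicator (cball a r) z * g z)" for a z by (simp add: Q_def indicator_def)
  have Q2: "Q a z = g z * (indicator (cball z r) a * w a)" for a z by (simp add: Q_def indicator_def dist_commute)
  have ind: "integrable lborel (\<lambda>z. indicator (cball a r) z * g z)" for a
  proof -
    have "integrable lborel (\<lambda>z. g z * indicator (cball a r) z)"
      by (rule integrable_mult_bounded[OF g borel_measurable_indicator, where B = 1]) (auto simp: indicator_def)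
    then show ?thesis by (simp only: mult.commute)
  qed
  define A where "A = (LINT z|lborel. \<bar>g z\<bar>)"
  have bound: "(LINT z|lborel. norm (Q a z)) \<le> A * w a" for a
  proof -
    have "(LINT z|lborel. norm (Q a z)) \<le> (LINT z|lborel. w a * \<bar>g z\<bar>)"
    proof (rule integral_mono)
      show "integrable lborel (\<lambda>z. norm (Q a z))" unfolding Q1 using ind by simp
      show "integrable lborel (\<lambda>z. w a * \<bar>g z\<bar>)" using g by simp
      show "norm (Q a z) \<le> w a * \<bar>g z\<bar>" for z using w(3)[of a] by (simp add: Q_def abs_mult)
    qed
    then show ?thesis by (simp add: A_def mult.commute)
  qed
  have int: "integrable (lborel \<Otimes>\<^sub>M lborel) (case_prod Q)"
  proof (rule lborel_pair.Fubini_integrable[OF mQ])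
    show "integrable lborel (\<lambda>a. LINT z|lborel. norm (case_prod Q (a, z)))"
    proof (rule Bochner_Integration.integrable_bound[where f = "\<lambda>a. A * w a"])
      show "integrable lborel (\<lambda>a. A * w a)" using w(1) by simp
      show "(\<lambda>a. LINT z|lborel. norm (case_prod Q (a, z))) \<in> borel_measurable lborel"
        using mQ by measurable
      show "AE a in lborel. norm (LINT z|lborel. norm (case_prod Q (a, z))) \<le> norm (A * w a)"
      proof (rule AE_I2)
        fix a
        have "0 \<le> (LINT z|lborel. norm (Q a z))" by simp
        then show "norm (LINT z|lborel. norm (case_prod Q (a, z))) \<le> norm (A * w a)" using bound[of a] by simp
      qed
    qed
    show "AE a in lborel. integrable lborel (\<lambda>z. case_prod Q (a, z))"
      using ind by (intro AE_I2) (simp add: Q1)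
  qed
  from lborel_pair.Fubini_integral[OF this]
  have "(LINT z|lborel. LINT a|lborel. Q a z) = (LINT a|lborel. LINT z|lborel. Q a z)" .
  moreover have "(LINT z|lborel. Q a z) = w a * (LINT z|lborel. indicator (cball a r) z * g z)" for a
    unfolding Q1 by (rule integral_mult_right_zero)
  moreover have "(LINT a|lborel. Q a z) = g z * (LINT a|lborel. indicator (cball z r) a * w a)" for z
    unfolding Q2 by (rule integral_mult_right_zero)
  ultimately show ?eq by simp
  from lborel_pair.integrable_fst[OF int]
  have "integrable lborel (\<lambda>a. LINT z|lborel. Q a z)" by simp
  then show ?int unfolding Q1 by simp
qed

section \<open>Sublevel sets and the lower bound for the exponent\<close>

context msh
begin

text \<open>In terms of m this is 2n/m - 2: the mean over a ball of radius r is at least a negative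
  multiple of r^-q.\<close>

definition q :: real where "q = 2 * CARD('n) - 2 * p"

lemma q_pos: "0 < q" using p_bounds by (simp add: q_def)

text \<open>Let I a be the ball integral of g about a and V the ball volume. The gap I a - g a V is
  nonnegative almost everywhere, and at least S V / 2 where g a < - S, because I a >= - S V / 2.
  Weighted by w and integrated, the gap becomes by Fubini the integral of g (J - w V); since g <= 0
  and J >= (w - r^2) V, this is at most r^2 V times the integral of |g|. Dividing by S, of order
  r^-q, gives the order r^(2+q).\<close>

lemma level_set_estimate:
  fixes x :: "complex ^ 'n" and M :: real
  assumes R: "0 < R" and sub: "cball x (2 * R) \<subseteq> \<Omega>" and M: "\<And>z. z \<in> cball x (2 * R) \<Longrightarrow> f z \<le> M"
  defines "g \<equiv> \<lambda>z. indicator (cball x (2 * R)) z * (f z - M)"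
  obtains C D r0 where "0 < C" "0 \<le> D" "0 < r0"
    "\<And>r. 0 < r \<Longrightarrow> r \<le> r0 \<Longrightarrow> measure lborel {z \<in> ball x (R / 4). g z < - (C * r powr (- q))} \<le> D * r powr (2 + q)"
proof -
  obtain C0 where C0: "0 < C0" "\<And>y r. y \<in> cball x R \<Longrightarrow> 0 < r \<Longrightarrow> r \<le> 1 \<Longrightarrow> r\<^sup>2 \<le> R\<^sup>2 / 2 \<Longrightarrow>
    - (C0 * r powr (2 * p)) \<le> (LINT z|lborel. indicator (cball y r) z * g z)"
    using mean_lower_bound[OF R sub M] unfolding g_def by blast
  have mf [measurable]: "f \<in> borel_measurable borel" by (rule measurable_f)
  have [measurable]: "cball x (2 * R) \<in> sets borel" by simp
  have mg [measurable]: "g \<in> borel_measurable borel" unfolding g_def by measurable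
  have ig: "integrable lborel g"
  proof -
    have "integrable lborel (\<lambda>z. indicator (cball x (2 * R)) z * f z)" by (rule integrable_f[OF compact_cball sub])
    moreover have "g = (\<lambda>z. indicator (cball x (2 * R)) z * f z - M * indicator (cball x (2 * R)) z)"
      by (auto simp: g_def algebra_simps)
    ultimately show ?thesis using integrable_indicator_cball[of x "2 * R"] by simp
  qed
  have g0: "g z \<le> 0" for z using M[of z] by (auto simp: g_def indicator_def)
  define \<omega> where "\<omega> = unit_ball_vol (real DIM(complex ^ 'n))"
  have \<omega>: "0 < \<omega>" by (simp add: \<omega>_def)
  define A where "A = (LINT z|lborel. \<bar>g z\<bar>)"
  have A: "0 \<le> A" by (simp add: A_def)
  define \<rho> where "\<rho> = R / 2"
  have \<rho>: "0 < \<rho>" using R by (simp add: \<rho>_def)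
  define w where "w = (\<lambda>a. max 0 (\<rho>\<^sup>2 - (norm (a - x))\<^sup>2))"
  have mw [measurable]: "w \<in> borel_measurable borel" unfolding w_def by measurable
  have w0: "0 \<le> w a" for a by (simp add: w_def)
  have wout: "w a = 0" if "a \<notin> cball x \<rho>" for a
  proof -
    have "\<rho>\<^sup>2 \<le> (norm (a - x))\<^sup>2" using that \<rho> by (intro power_mono) (auto simp: dist_norm norm_minus_commute)
    then show ?thesis by (simp add: w_def)
  qed
  have iw: "integrable lborel w"
  proof -
    have "(\<lambda>a. indicator (cball x \<rho>) a * w a) = w" using wout by (auto simp: indicator_def fun_eq_iff)
    moreover have "integrable lborel (\<lambda>a. indicator (cball x \<rho>) a * w a)"
      by (rule integrable_mult_bounded[OF integrable_indicator_cball mw, where B = "\<rho>\<^sup>2"]) (simp add: w_def)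
    ultimately show ?thesis by simp
  qed
  \<comment> \<open>Chosen so that the level S = C r^-q is twice as deep as the lower bound for the
    means: C0 r^(2p) = S V / 2.\<close>
  define C where "C = 2 * C0 / \<omega>"
  \<comment> \<open>On \<open>ball x (R / 4)\<close>, of radius \<rho>/2, the weight w is at least
    (3/4) \<rho>^2; together with the factor 1/2 in S V / 2 this gives 8 / (3 \<rho>^2).\<close>
  define D where "D = 8 * A / (3 * \<rho>\<^sup>2 * C)"
  define r0 where "r0 = min 1 (R / 2)"
  have C: "0 < C" using C0 \<omega> by (simp add: C_def)
  have DIM: "DIM(complex ^ 'n) = 2 * CARD('n)" by (simp add: DIM_cart)
  show ?thesis
  proof (rule that[of C D r0])
    show "0 \<le> D" using A C \<rho> by (simp add: D_def)
    show "0 < r0" using R by (simp add: r0_def)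
    fix r assume r: "0 < r" "r \<le> r0"
    have r1: "r \<le> 1" "r \<le> R / 2" using r by (auto simp: r0_def)
    have r2: "r\<^sup>2 \<le> R\<^sup>2 / 2"
    proof -
      have "r\<^sup>2 \<le> (R / 2)\<^sup>2" using r r1 by (intro power_mono) auto
      then have "r\<^sup>2 \<le> R\<^sup>2 / 4" by (simp add: power_divide)
      then show ?thesis using zero_le_power2[of R] by linarith
    qed
    define V where "V = ball_vol TYPE(complex ^ 'n) r"
    have V: "0 < V" unfolding V_def by (rule ball_vol_pos[OF r(1)])
    have Vr: "V = \<omega> * r powr (2 * CARD('n))"
      unfolding V_def ball_vol_def \<omega>_def DIM using powr_realpow[OF r(1), of "2 * CARD('n)"] by simp
    define S where "S = C * r powr (- q)"
    have S: "0 < S" using C r by (simp add: S_def)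
    have SV: "C0 * r powr (2 * p) = S * V / 2"
    proof -
      have "r powr (- q) * r powr (2 * CARD('n)) = r powr (2 * p)"
        by (simp add: powr_add[symmetric] q_def)
      then show ?thesis unfolding S_def Vr C_def using \<omega> by (simp add: mult_ac)
    qed
    define E where "E = {z \<in> ball x (R / 4). g z < - S}"
    have mE [measurable]: "E \<in> sets borel" unfolding E_def by measurable
    have finE: "emeasure lborel E < \<infinity>"
      by (rule le_less_trans[OF emeasure_mono[of E "ball x (R / 4)"] emeasure_lborel_ball_finite]) (auto simp: E_def)
    define I where "I a = (LINT z|lborel. indicator (cball a r) z * g z)" for a
    have lower: "AE a in lborel. indicator E a * (3 / 4 * \<rho>\<^sup>2 * (S * V / 2)) \<le> w a * I a - w a * g a * V"
      using AE_finite
    proof eventually_elim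
      fix a assume fin: "a \<in> \<Omega> \<longrightarrow> \<bar>\<psi> a\<bar> \<noteq> \<infinity>"
      show "indicator E a * (3 / 4 * \<rho>\<^sup>2 * (S * V / 2)) \<le> w a * I a - w a * g a * V"
      proof (cases "a \<in> cball x \<rho>")
        case False
        then have "a \<notin> E" unfolding E_def using R by (auto simp: \<rho>_def)
        then show ?thesis using wout[OF False] by simp
      next
        case True
        have sa: "cball a r \<subseteq> cball x (2 * R)"
        proof
          fix u assume "u \<in> cball a r"
          then show "u \<in> cball x (2 * R)" using True r1 R dist_triangle[of x u a] by (simp add: \<rho>_def)
        qed
        have a2: "a \<in> cball x (2 * R)"
          by (rule subsetD[OF sa]) (use r in simp)
        then have aO: "a \<in> \<Omega>" using sub by auto
        have "f a * V \<le> (LINT z|lborel. indicator (cball a r) z * f z)"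
          unfolding V_def using measure_cball_eq[of r a] r sub_mean_value[OF r(1), of a] fin aO sa sub by auto
        moreover have "(LINT z|lborel. indicator (cball a r) z * f z) - M * V = I a"
        proof -
          have "I a = (LINT z|lborel. indicator (cball a r) z * f z - M * indicator (cball a r) z)"
            unfolding I_def
          proof (rule Bochner_Integration.integral_cong[OF refl])
            fix z show "indicator (cball a r) z * g z = indicator (cball a r) z * f z - M * indicator (cball a r) z"
              using subsetD[OF sa, of z] by (cases "z \<in> cball a r") (auto simp: g_def algebra_simps)
          qed
          also have "\<dots> = (LINT z|lborel. indicator (cball a r) z * f z) - M * V"
          proof -
            have "cball a r \<subseteq> \<Omega>" using sa sub by blast
            from integrable_f[OF compact_cball this] integrable_indicator_cball[of a r] show ?thesis
              using measure_cball_eq[of r a] r by (simp add: V_def)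
          qed
          finally show ?thesis by simp
        qed
        moreover have "g a = f a - M" using a2 by (simp add: g_def)
        ultimately have H: "0 \<le> I a - g a * V"
          using left_diff_distrib[of "f a" M V] by (simp only: diff_ge_0_iff_ge)
        have eq: "w a * I a - w a * g a * V = w a * (I a - g a * V)" by (simp add: algebra_simps)
        show ?thesis
        proof (cases "a \<in> E")
          case False
          then show ?thesis unfolding eq using H w0[of a] by simp
        next
          case True
          have "(norm (a - x))\<^sup>2 \<le> (\<rho> / 2)\<^sup>2"
            using True R unfolding E_def by (intro power_mono) (auto simp: dist_norm norm_minus_commute \<rho>_def)
          then have "3 / 4 * \<rho>\<^sup>2 \<le> \<rho>\<^sup>2 - (norm (a - x))\<^sup>2" by (simp add: power_divide)
          also have "\<dots> \<le> w a" by (simp add: w_def)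
          finally have wa: "3 / 4 * \<rho>\<^sup>2 \<le> w a" .
          have "a \<in> cball x R" using True R unfolding E_def by auto
          from C0(2)[OF this r(1) r1(1) r2] have "- (S * V / 2) \<le> I a" unfolding SV I_def .
          moreover have "S * V \<le> - g a * V" using True V unfolding E_def by (intro mult_right_mono) auto
          ultimately have "S * V / 2 \<le> I a - g a * V" by simp
          then have "3 / 4 * \<rho>\<^sup>2 * (S * V / 2) \<le> w a * (I a - g a * V)"
            using wa S V w0[of a] by (intro mult_mono) auto
          then show ?thesis unfolding eq using True by simp
        qed
      qed
    qed
    define J where "J z = (LINT a|lborel. indicator (cball z r) a * w a)" for z
    have Jw: "(w z - r\<^sup>2) * V \<le> J z" for z
      unfolding J_def V_def w_def by (rule paraboloid_mean[OF r(1)])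
    have iwI: "integrable lborel (\<lambda>a. w a * I a)" unfolding I_def by (rule Fubini_cball(2)[OF ig iw mw w0])
    have igw: "integrable lborel (\<lambda>a. w a * g a * V)"
      using integrable_mult_bounded[OF ig mw, where B = "\<rho>\<^sup>2"] by (simp add: w_def mult.commute)
    have JB: "\<bar>J z\<bar> \<le> (LINT a|lborel. w a)" for z
    proof -
      have "0 \<le> J z" unfolding J_def using w0 by (intro Bochner_Integration.integral_nonneg) (auto simp: indicator_def)
      moreover have "J z \<le> (LINT a|lborel. w a)" unfolding J_def
      proof (rule integral_mono)
        show "integrable lborel (\<lambda>a. indicator (cball z r) a * w a)"
          by (rule integrable_mult_bounded[OF integrable_indicator_cball mw, where B = "\<rho>\<^sup>2"]) (simp add: w_def)
      qed (use iw w0 in \<open>auto simp: indicator_def\<close>)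
      ultimately show ?thesis by simp
    qed
    have mJ: "J \<in> borel_measurable borel"
    proof -
      have "J = (\<lambda>z. LINT a|lborel. (if dist z a \<le> r then 1 else 0) * w a)"
        by (rule ext) (auto simp: J_def indicator_def intro!: Bochner_Integration.integral_cong)
      also have "\<dots> \<in> borel_measurable borel" by measurable
      finally show ?thesis .
    qed
    have igJ: "integrable lborel (\<lambda>z. g z * J z)" by (rule integrable_mult_bounded[OF ig mJ JB])
    have "measure lborel E * (3 / 4 * \<rho>\<^sup>2 * (S * V / 2)) = (LINT a|lborel. indicator E a * (3 / 4 * \<rho>\<^sup>2 * (S * V / 2)))"
      by simp
    also have "\<dots> \<le> (LINT a|lborel. w a * I a - w a * g a * V)"
      by (rule integral_mono_AE[OF _ _ lower]) (use finE iwI igw in \<open>auto intro!: integrable_real_indicator\<close>)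
    also have "\<dots> = (LINT a|lborel. w a * I a) - (LINT a|lborel. w a * g a * V)"
      using iwI igw by simp
    also have "(LINT a|lborel. w a * I a) = (LINT z|lborel. g z * J z)"
      unfolding I_def J_def by (rule Fubini_cball(1)[OF ig iw mw w0])
    also have "(LINT z|lborel. g z * J z) - (LINT a|lborel. w a * g a * V) = (LINT z|lborel. g z * J z - w z * g z * V)"
      using igJ igw by simp
    also have "\<dots> \<le> (LINT z|lborel. (r\<^sup>2 * V) * \<bar>g z\<bar>)"
    proof (rule integral_mono)
      show "integrable lborel (\<lambda>z. g z * J z - w z * g z * V)" using igJ igw by simp
      show "integrable lborel (\<lambda>z. (r\<^sup>2 * V) * \<bar>g z\<bar>)" using ig by simp
      fix z
      have "g z * J z \<le> g z * ((w z - r\<^sup>2) * V)" using Jw[of z] g0[of z] by (rule mult_left_mono_neg)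
      then show "g z * J z - w z * g z * V \<le> (r\<^sup>2 * V) * \<bar>g z\<bar>" using g0[of z] by (simp add: algebra_simps)
    qed
    also have "\<dots> = r\<^sup>2 * V * A" by (simp add: A_def)
    finally have "measure lborel E * (3 / 4 * \<rho>\<^sup>2 * (S * V / 2)) \<le> r\<^sup>2 * V * A" .
    then have "(measure lborel E * (3 * \<rho>\<^sup>2 * S)) * V \<le> (8 * r\<^sup>2 * A) * V" by (simp add: algebra_simps)
    then have "measure lborel E * (3 * \<rho>\<^sup>2 * S) \<le> 8 * r\<^sup>2 * A" using V by simp
    then have "measure lborel E \<le> 8 * r\<^sup>2 * A / (3 * \<rho>\<^sup>2 * S)" using \<rho> S by (simp add: pos_le_divide_eq)
    also have "\<dots> = D * (r\<^sup>2 * r powr q)"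
      unfolding D_def S_def using C \<rho> r by (simp add: powr_minus field_simps)
    also have "r\<^sup>2 * r powr q = r powr (2 + q)" using r by (simp add: powr_add powr_numeral)
    finally show "measure lborel {z \<in> ball x (R / 4). g z < - (C * r powr (- q))} \<le> D * r powr (2 + q)"
      by (simp add: E_def S_def)
  qed (rule C)
qed

text \<open>A layer decomposition at the radii r0 2^-k, that is at the levels t0 b^k with b = 2^q.
  The layers have volume of order 2^(-(2+q) k), while |g|^c is of order 2^(c q k); the series is
  geometric with ratio below 1 exactly when c q < 2 + q.\<close>

lemma integrable_powr:
  fixes x :: "complex ^ 'n" and M :: real
  assumes R: "0 < R" and sub: "cball x (2 * R) \<subseteq> \<Omega>" and M: "0 \<le> M" "\<And>z. z \<in> cball x (2 * R) \<Longrightarrow> f z \<le> M"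
    and c: "0 < c" "c * q < 2 + q"
  shows "integrable lborel (\<lambda>z. indicator (ball x (R / 4)) z * \<bar>f z\<bar> powr c)"
proof -
  define g where "g = (\<lambda>z. indicator (cball x (2 * R)) z * (f z - M))"
  have mf [measurable]: "f \<in> borel_measurable borel" by (rule measurable_f)
  have [measurable]: "cball x (2 * R) \<in> sets borel" by simp
  have mg [measurable]: "g \<in> borel_measurable borel" unfolding g_def by measurable
  have g0: "g z \<le> 0" for z using M(2)[of z] by (auto simp: g_def indicator_def)
  obtain C D r0 where C: "0 < C" "0 \<le> D" "0 < r0"
    and E: "\<And>r. 0 < r \<Longrightarrow> r \<le> r0 \<Longrightarrow> measure lborel {z \<in> ball x (R / 4). g z < - (C * r powr (- q))} \<le> D * r powr (2 + q)"
    using level_set_estimate[OF R sub M(2)] unfolding g_def by blast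
  define B where "B = ball x (R / 4)"
  have mB [measurable]: "B \<in> sets borel" by (simp add: B_def)
  define b where "b = 2 powr q"
  have b: "1 < b" unfolding b_def using q_pos by simp
  define t0 where "t0 = C * r0 powr (- q)"
  have t0: "0 < t0" using C by (simp add: t0_def)
  define t where "t k = t0 * b ^ k" for k
  define Ek where "Ek k = {z \<in> B. g z < - t k}" for k
  have mEk [measurable]: "Ek k \<in> sets borel" for k unfolding Ek_def by measurable
  define e where "e = 2 powr (- (2 + q))"
  define D' where "D' = D * r0 powr (2 + q)"
  have D': "0 \<le> D'" using C by (simp add: D'_def)
  have Ek: "measure lborel (Ek k) \<le> D' * e ^ k" for k
  proof -
    define r where "r = r0 * 2 powr (- real k)"
    have r: "0 < r" "r \<le> r0"
    proof -
      show "0 < r" using C by (simp add: r_def)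
      have "2 powr (- real k) \<le> 1" by (simp add: powr_minus powr_realpow inverse_le_1_iff)
      then show "r \<le> r0" using C by (simp add: r_def mult_left_le)
    qed
    have "r powr (- q) = r0 powr (- q) * b ^ k"
      unfolding r_def b_def using C by (simp add: powr_mult powr_powr powr_power mult.commute)
    then have 1: "C * r powr (- q) = t k" by (simp add: t_def t0_def)
    have 2: "r powr (2 + q) = r0 powr (2 + q) * e ^ k"
      unfolding r_def e_def using C by (simp add: powr_mult powr_powr powr_power algebra_simps)
    show ?thesis using E[OF r] unfolding 1 2 by (simp add: Ek_def B_def D'_def mult.assoc)
  qed
  define s where "s = b powr c * e"
  have s: "0 \<le> s" "s < 1"
  proof -
    have "s = 2 powr (c * q - (2 + q))" by (simp add: s_def b_def e_def powr_powr powr_add[symmetric] algebra_simps)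
    moreover have "2 powr (c * q - (2 + q)) < 2 powr 0" using c(2) by (intro powr_less_mono) auto
    ultimately show "s < 1" "0 \<le> s" by simp_all
  qed
  have pw: "ennreal (indicator B z * \<bar>g z\<bar> powr c) \<le>
      ennreal (t0 powr c) * indicator B z + (\<Sum>k. ennreal (t (Suc k) powr c) * indicator (Ek k) z)" for z
  proof (cases "z \<in> B \<and> t0 < \<bar>g z\<bar>")
    case False
    then have "ennreal (indicator B z * \<bar>g z\<bar> powr c) \<le> ennreal (t0 powr c) * indicator B z"
      using c(1) by (cases "z \<in> B") (auto intro!: ennreal_leI powr_mono2)
    then show ?thesis by (rule order.trans[OF _ add_increasing2[OF zero_le order_refl]])
  next
    case True
    have "\<exists>k. \<bar>g z\<bar> \<le> t k"
    proof -
      obtain k where "\<bar>g z\<bar> / t0 < b ^ k" using real_arch_pow[OF b] by blast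
      then show ?thesis using t0 by (intro exI[of _ k]) (simp add: t_def pos_divide_less_eq mult.commute)
    qed
    \<comment> \<open>The least level above |g z|. It is not level 0, so z belongs to the sublevel
      set of the preceding level, and the value is controlled by one more factor b.\<close>
    then obtain k where k: "\<bar>g z\<bar> \<le> t k" "\<And>j. j < k \<Longrightarrow> \<not> \<bar>g z\<bar> \<le> t j" using exists_least_iff[of "\<lambda>k. \<bar>g z\<bar> \<le> t k"] by blast
    have "k \<noteq> 0" using k(1) True by (intro notI) (simp add: t_def)
    then obtain j where j: "k = Suc j" using not0_implies_Suc by blast
    have "z \<in> Ek j" using k(2)[of j] True g0[of z] by (simp add: j Ek_def)
    have "ennreal (indicator B z * \<bar>g z\<bar> powr c) \<le> ennreal (t (Suc j) powr c) * indicator (Ek j) z"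
      using True k(1) c(1) \<open>z \<in> Ek j\<close> by (auto simp: j intro!: ennreal_leI powr_mono2)
    also have "\<dots> \<le> (\<Sum>k. ennreal (t (Suc k) powr c) * indicator (Ek k) z)"
    proof -
      define G where "G k = ennreal (t (Suc k) powr c) * indicator (Ek k) z" for k
      have "sum G {j} \<le> suminf G" by (rule sum_le_suminf) auto
      then have "G j \<le> suminf G" by simp
      then show ?thesis unfolding G_def .
    qed
    finally show ?thesis by (rule order.trans[OF _ add_increasing[OF zero_le order_refl]])
  qed
  have finB: "emeasure lborel B < \<infinity>" unfolding B_def by (rule emeasure_lborel_ball_finite)
  have emEk: "emeasure lborel (Ek k) = ennreal (measure lborel (Ek k))" for k
  proof -
    have "emeasure lborel (Ek k) \<le> emeasure lborel B" by (rule emeasure_mono) (auto simp: Ek_def)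
    then have "emeasure lborel (Ek k) < \<infinity>" using finB by (rule le_less_trans)
    then show ?thesis by (intro emeasure_eq_ennreal_measure) auto
  qed
  have "(\<integral>\<^sup>+z. ennreal (indicator B z * \<bar>g z\<bar> powr c) \<partial>lborel) \<le>
     (\<integral>\<^sup>+z. ennreal (t0 powr c) * indicator B z + (\<Sum>k. ennreal (t (Suc k) powr c) * indicator (Ek k) z) \<partial>lborel)"
    by (rule nn_integral_mono) (rule pw)
  also have "\<dots> = ennreal (t0 powr c) * emeasure lborel B + (\<Sum>k. ennreal (t (Suc k) powr c) * emeasure lborel (Ek k))"
    by (subst nn_integral_add) (simp_all add: nn_integral_suminf nn_integral_cmult_indicator)
  also have "(\<Sum>k. ennreal (t (Suc k) powr c) * emeasure lborel (Ek k)) \<le> (\<Sum>k. ennreal ((t0 * b) powr c * D' * s ^ k))"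
  proof (rule suminf_le)
    fix k
    have "(b powr c) ^ k = (b ^ k) powr c"
      using b by (simp add: powr_realpow[symmetric] powr_powr mult.commute)
    then have tk: "t (Suc k) powr c = (t0 * b) powr c * (b powr c) ^ k"
      using t0 b by (simp add: t_def powr_mult mult_ac)
    have "t (Suc k) powr c * measure lborel (Ek k) \<le> t (Suc k) powr c * (D' * e ^ k)"
      by (rule mult_left_mono[OF Ek]) simp
    also have "\<dots> = (t0 * b) powr c * D' * s ^ k" unfolding tk s_def by (simp add: power_mult_distrib mult_ac)
    finally show "ennreal (t (Suc k) powr c) * emeasure lborel (Ek k) \<le> ennreal ((t0 * b) powr c * D' * s ^ k)"
      unfolding emEk by (simp add: ennreal_mult[symmetric] ennreal_leI)
  qed auto
  also have "(\<Sum>k. ennreal ((t0 * b) powr c * D' * s ^ k)) = ennreal ((t0 * b) powr c * D' * (1 / (1 - s)))"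
    using s D' by (intro suminf_ennreal_eq sums_mult geometric_sums) auto
  finally have "(\<integral>\<^sup>+z. ennreal (indicator B z * \<bar>g z\<bar> powr c) \<partial>lborel) < \<infinity>"
    using finB by (simp add: ennreal_mult_less_top le_less_trans less_top)
  then have ig: "integrable lborel (\<lambda>z. indicator B z * \<bar>g z\<bar> powr c)"
    by (intro integrableI_bounded) auto
  have iB: "integrable lborel (indicator B :: complex ^ 'n \<Rightarrow> real)" using finB by (intro integrable_real_indicator) auto
  have "integrable lborel (\<lambda>z. indicator B z * \<bar>f z\<bar> powr c)"
  proof (rule Bochner_Integration.integrable_bound[where f = "\<lambda>z. 2 powr c * (indicator B z * \<bar>g z\<bar> powr c) + 2 powr c * M powr c * indicator B z"])
    show "integrable lborel (\<lambda>z. 2 powr c * (indicator B z * \<bar>g z\<bar> powr c) + 2 powr c * M powr c * indicator B z)"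
      using ig iB by simp
    show "AE z in lborel. norm (indicator B z * \<bar>f z\<bar> powr c) \<le>
        norm (2 powr c * (indicator B z * \<bar>g z\<bar> powr c) + 2 powr c * M powr c * indicator B z)"
    proof (rule AE_I2)
      fix z
      show "norm (indicator B z * \<bar>f z\<bar> powr c) \<le> norm (2 powr c * (indicator B z * \<bar>g z\<bar> powr c) + 2 powr c * M powr c * indicator B z)"
      proof (cases "z \<in> B")
        case True
        then have "z \<in> cball x (2 * R)" using R by (auto simp: B_def)
        then have gz: "g z = f z - M" by (simp add: g_def)
        then have "\<bar>f z\<bar> \<le> 2 * max \<bar>g z\<bar> M" using M(1) by (auto simp: max_def abs_if)
        then have "\<bar>f z\<bar> powr c \<le> (2 * max \<bar>g z\<bar> M) powr c" using c by (intro powr_mono2) auto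
        also have "\<dots> = 2 powr c * (max \<bar>g z\<bar> M) powr c" by (simp add: powr_mult)
        also have "(max \<bar>g z\<bar> M) powr c \<le> \<bar>g z\<bar> powr c + M powr c" by (auto simp: max_def)
        finally have "\<bar>f z\<bar> powr c \<le> 2 powr c * \<bar>g z\<bar> powr c + 2 powr c * M powr c" by (simp add: distrib_left)
        then show ?thesis using True by simp
      qed simp
    qed
  qed measurable
  then show ?thesis by (simp add: B_def)
qed

lemma lower_bound_exponent:
  assumes x: "x \<in> \<Omega>"
  shows "ereal (real CARD('n) / real (CARD('n) - m)) \<le> integrability_exponent \<Omega> \<phi> x"
proof (rule ccontr)
  assume "\<not> ?thesis"
  then have lt: "integrability_exponent \<Omega> \<phi> x < ereal (real CARD('n) / real (CARD('n) - m))" by simp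
  have mn: "0 < real CARD('n) - real m" "0 < real m" using m by auto
  have nm: "real (CARD('n) - m) = real CARD('n) - real m" using m by (simp add: of_nat_diff)
  \<comment> \<open>The maximum with 0 ensures that the interpolated c is positive.\<close>
  have "max (integrability_exponent \<Omega> \<phi> x) 0 < ereal (real CARD('n) / real (CARD('n) - m))"
    using lt mn nm by (simp add: zero_less_divide_iff)
  then obtain c where c: "max (integrability_exponent \<Omega> \<phi> x) 0 < ereal c" "ereal c < ereal (real CARD('n) / real (CARD('n) - m))"
    using ereal_dense2 by blast
  have c0: "0 < c" using c(1) by simp
  have "c * (real CARD('n) - real m) < real CARD('n)" using c(2) mn nm by (simp add: less_divide_eq)
  \<comment> \<open>This relation turns c < n / (n - m) into c q < 2 + q.\<close>
  moreover have q: "q * m = 2 * (real CARD('n) - real m)" using mn by (simp add: q_def p_def field_simps)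
  ultimately have "c * (q * m) < 2 * m + q * m" unfolding q by (simp add: algebra_simps)
  then have "(c * q) * m < (2 + q) * m" by (simp add: algebra_simps)
  then have cq: "c * q < 2 + q" using mn by simp
  obtain e where e: "0 < e" "cball x e \<subseteq> \<Omega>" using open_\<Omega> x open_contains_cball by blast
  define R where "R = e / 2"
  have R: "0 < R" "cball x (2 * R) \<subseteq> \<Omega>" using e by (auto simp: R_def)
  obtain M where M: "0 \<le> M" "\<And>z. z \<in> cball x (2 * R) \<Longrightarrow> f z \<le> M" using f_upper_bound[OF compact_cball R(2)] by blast
  have int: "integrable lborel (\<lambda>z. indicator (ball x (R / 4)) z * \<bar>f z\<bar> powr c)"
    by (rule integrable_powr[OF R M c0 cq])
  have U: "ball x (R / 4) \<subseteq> \<Omega>" using R by (auto intro!: subsetD[OF R(2)])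
  have "set_integrable lborel (ball x (R / 4)) (\<lambda>z. \<bar>real_of_ereal (\<phi> z)\<bar> powr c)"
    unfolding set_integrable_def
  proof (rule Bochner_Integration.integrable_cong[THEN iffD1, OF refl _ int])
    fix z show "indicator (ball x (R / 4)) z * \<bar>f z\<bar> powr c = indicator (ball x (R / 4)) z *\<^sub>R \<bar>real_of_ereal (\<phi> z)\<bar> powr c"
      using subsetD[OF U, of z] by (cases "z \<in> ball x (R / 4)") (auto simp: f_def \<psi>_def)
  qed
  moreover have "AE z\<in>ball x (R / 4) in lborel. \<bar>\<phi> z\<bar> \<noteq> \<infinity>"
    using AE_finite by eventually_elim (use U in \<open>auto simp: \<psi>_def\<close>)
  ultimately have "ereal c \<le> integrability_exponent \<Omega> \<phi> x"
    unfolding integrability_exponent_def using c0 U R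
    by (intro Sup_upper CollectI exI[of _ c] conjI exI[of _ "ball x (R / 4)"]) auto
  moreover have "integrability_exponent \<Omega> \<phi> x < ereal c" using c(1) by (simp only: max_less_iff_conj)
  ultimately show False by (rule leD[THEN notE])
qed

end

subsection \<open>The trace measure and the Lelong number\<close>

lemma D2_add:
  assumes "twice_diff g" "twice_diff h"
  shows "D2 (\<lambda>z. g z + h z) z u v = D2 g z u v + D2 h z u v"
proof -
  have "twice_diff (if i = (0::nat) then g else h)" for i using assms by simp
  from D2_sum[of "{0, 1}" "\<lambda>i. if i = (0::nat) then g else h", OF this] show ?thesis by simp
qed

lemma D2_scale:
  fixes g :: "'a::euclidean_space \<Rightarrow> real"
  assumes "twice_diff g"
  shows "D2 (\<lambda>z. c * g z) z u v = c * D2 g z u v"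
proof -
  have d: "((\<lambda>z. c * g z) has_derivative (\<lambda>v. c * frechet_derivative g (at z) v)) (at z)" for z
    using assms unfolding twice_diff_def
    by (intro has_derivative_mult_right) (simp add: frechet_derivative_works[symmetric])
  have "((\<lambda>z. c * frechet_derivative g (at z) v) has_derivative (\<lambda>u. c * D2 g z u v)) (at z)"
    using assms unfolding twice_diff_def D2_def
    by (intro has_derivative_mult_right) (simp add: frechet_derivative_works[symmetric])
  from frechet_eqI[OF this] show ?thesis
    unfolding D2_def[of "\<lambda>z. c * g z"] frechet_eqI[OF d] by simp
qed

lemma Lap_add: "smooth g \<Longrightarrow> smooth h \<Longrightarrow> Lap (\<lambda>z. g z + h z) z = Lap g z + Lap h z"
  by (simp add: Lap_def D2_add smooth_twice_diff sum.distrib)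

lemma Lap_scale: "smooth g \<Longrightarrow> Lap (\<lambda>z. c * g z) z = c * (Lap g z :: real)"
  by (simp add: Lap_def D2_scale smooth_twice_diff sum_distrib_left)

lemma smooth_Lap: "smooth g \<Longrightarrow> smooth (Lap g)"
  unfolding Lap_def[abs_def] D2_def by (intro smooth_sum smoothD(2))

lemma Lap_support:
  fixes g :: "'a::euclidean_space \<Rightarrow> real"
  assumes "compact K" "\<And>z. z \<notin> K \<Longrightarrow> g z = 0" "z \<notin> K"
  shows "Lap g z = 0"
  unfolding Lap_def D2_def
  by (intro sum.neutral ballI smooth_frechet_support[OF assms(1) _ assms(3)] smooth_frechet_support[OF assms(1,2)])

lemma rderiv_step_bounded:
  obtains B where "0 < B" "\<And>s. \<bar>rderiv step s\<bar> \<le> B" "\<And>s. \<bar>rderiv (rderiv step) s\<bar> \<le> B"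
    "\<And>s. s < 0 \<Longrightarrow> rderiv step s = 0" "\<And>s. s < 0 \<Longrightarrow> rderiv (rderiv step) s = 0"
proof -
  have 1: "rderiv step s = 0" if "s < 0" for s
    by (rule rderiv_const_zero[OF smooth_step open_lessThan[of 0], of _ 0]) (use that in \<open>auto simp: step_simps\<close>)
  have 2: "rderiv step s = 0" if "1 < s" for s
    by (rule rderiv_const_zero[OF smooth_step open_greaterThan[of 1], of _ 1]) (use that in \<open>auto simp: step_simps\<close>)
  have 3: "rderiv (rderiv step) s = 0" if "s < 0" for s
    by (rule rderiv_const_zero[OF smooth_rderiv[OF smooth_step] open_lessThan[of 0], of _ 0]) (use that 1 in auto)
  have 4: "rderiv (rderiv step) s = 0" if "1 < s" for s
    by (rule rderiv_const_zero[OF smooth_rderiv[OF smooth_step] open_greaterThan[of 1], of _ 0]) (use that 2 in auto)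
  have b: "\<exists>B>0. \<forall>t\<in>{0..1}. \<bar>h t\<bar> \<le> B" if "smooth h" for h :: "real \<Rightarrow> real"
  proof -
    have "bounded (h ` {0..1})"
      by (intro compact_imp_bounded compact_continuous_image smooth_continuous_on that compact_Icc)
    then show ?thesis by (auto simp: bounded_pos)
  qed
  obtain B1 where B1: "B1 > 0" "\<And>t. t \<in> {0..1} \<Longrightarrow> \<bar>rderiv step t\<bar> \<le> B1"
    using b[OF smooth_rderiv[OF smooth_step]] by blast
  obtain B2 where B2: "B2 > 0" "\<And>t. t \<in> {0..1} \<Longrightarrow> \<bar>rderiv (rderiv step) t\<bar> \<le> B2"
    using b[OF smooth_rderiv[OF smooth_rderiv[OF smooth_step]]] by blast
  have "\<bar>rderiv step s\<bar> \<le> max B1 B2" for s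
    using B1(2)[of s] B1(1) 1[of s] 2[of s] by (cases "s < 0"; cases "1 < s") auto
  moreover have "\<bar>rderiv (rderiv step) s\<bar> \<le> max B1 B2" for s
    using B2(2)[of s] B2(1) 3[of s] 4[of s] by (cases "s < 0"; cases "1 < s") auto
  ultimately show ?thesis using B1(1) 1 3 by (intro that[of "max B1 B2"]) auto
qed

section \<open>The trace measure, masses of balls and the upper bound\<close>

context msh
begin

lemma integrable_f_mult:
  fixes k :: "complex ^ 'n \<Rightarrow> real"
  assumes k: "continuous_on UNIV k" and K: "compact K" "K \<subseteq> \<Omega>" "\<And>z. z \<notin> K \<Longrightarrow> k z = 0"
  shows "integrable lborel (\<lambda>z. f z * k z)"
proof -
  have "bounded (k ` K)" by (intro compact_imp_bounded compact_continuous_image continuous_on_subset[OF k] K) auto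
  then obtain B where B: "0 < B" "\<And>z. z \<in> K \<Longrightarrow> \<bar>k z\<bar> \<le> B" by (auto simp: bounded_pos)
  have kB: "\<bar>k z\<bar> \<le> B" for z using B K(3)[of z] by (cases "z \<in> K") auto
  have "integrable lborel (\<lambda>z. (indicator K z * f z) * k z)"
    by (rule integrable_mult_bounded[OF integrable_f[OF K(1,2)] borel_measurable_continuous_onI[OF k] kB])
  moreover have "(\<lambda>z. (indicator K z * f z) * k z) = (\<lambda>z. f z * k z)"
    using K(3) by (auto simp: fun_eq_iff indicator_def)
  ultimately show ?thesis by simp
qed

lemma integrable_f_Lap: "g \<in> test_functions \<Omega> \<Longrightarrow> integrable lborel (\<lambda>z. f z * Lap g z)"
proof -
  assume "g \<in> test_functions \<Omega>"
  then obtain K where g: "smooth g" "compact K" "K \<subseteq> \<Omega>" "\<And>z. z \<notin> K \<Longrightarrow> g z = 0" unfolding test_functions_def by blast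
  show ?thesis
    by (rule integrable_f_mult[OF smooth_continuous_on[OF smooth_Lap[OF g(1)]] g(2,3) Lap_support[OF g(2,4)]])
qed

definition trace_functional :: "(complex ^ 'n \<Rightarrow> real) \<Rightarrow> real" where
  "trace_functional g = trace_const TYPE('n) * (LINT z|lborel. f z * Lap g z)"

lemma positive_trace: "positive_functional \<Omega> trace_functional"
proof
  show "open \<Omega>" by (rule open_\<Omega>)
  fix g h :: "complex ^ 'n \<Rightarrow> real" and c :: real
  assume g: "g \<in> test_functions \<Omega>"
  then have sg: "smooth g" by (simp add: test_functions_def)
  show "trace_functional (\<lambda>z. c * g z) = c * trace_functional g"
    using integrable_f_Lap[OF g] by (simp add: trace_functional_def Lap_scale[OF sg] mult.left_commute[of _ c])
  show "trace_functional (\<lambda>z. g z + h z) = trace_functional g + trace_functional h" if h: "h \<in> test_functions \<Omega>"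
  proof -
    have "smooth h" using h by (simp add: test_functions_def)
    then show ?thesis
      using integrable_f_Lap[OF g] integrable_f_Lap[OF h]
      by (simp add: trace_functional_def Lap_add[OF sg] distrib_left)
  qed
  show "0 \<le> trace_functional g" if nn: "\<And>z. 0 \<le> g z"
  proof -
    obtain K where K: "compact K" "K \<subseteq> \<Omega>" "\<And>z. z \<notin> K \<Longrightarrow> g z = 0" using g unfolding test_functions_def by blast
    have "0 \<le> (LINT z|lborel. f z * Lap g z)"
      using m_subharmonic_trace[OF m sh sg nn K] unfolding LINT_f .
    then show ?thesis using trace_const_pos[where 'n = 'n] by (simp add: trace_functional_def)
  qed
qed

lemma test_form_scalar_iff:
  "test_form \<Omega> (\<lambda>z. scalar_form (of_real (g z)) :: 'n covec) \<longleftrightarrow> g \<in> test_functions \<Omega>"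
proof
  assume t: "test_form \<Omega> (\<lambda>z. scalar_form (of_real (g z)) :: 'n covec)"
  then have "smooth (\<lambda>z. (scalar_form (of_real (g z)) :: 'n covec) [])" unfolding test_form_def by blast
  then have "smooth g" by (simp add: scalar_form_def smooth_of_real_iff)
  moreover obtain K where "compact K" "K \<subseteq> \<Omega>" "\<And>z vs. z \<notin> K \<Longrightarrow> (scalar_form (of_real (g z)) :: 'n covec) vs = 0"
    using t unfolding test_form_def by blast
  moreover from this(3)[of _ "[]"] have "g z = 0" if "z \<notin> K" for z using that by (simp add: scalar_form_def)
  ultimately show "g \<in> test_functions \<Omega>" unfolding test_functions_def by blast
next
  assume "g \<in> test_functions \<Omega>"
  then obtain K where g: "smooth g" "compact K" "K \<subseteq> \<Omega>" "\<And>z. z \<notin> K \<Longrightarrow> g z = 0" unfolding test_functions_def by blast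
  have "smooth (\<lambda>z. (scalar_form (of_real (g z)) :: 'n covec) vs)" for vs
    using g(1) by (cases vs) (simp_all add: scalar_form_def smooth_of_real_iff)
  then show "test_form \<Omega> (\<lambda>z. scalar_form (of_real (g z)) :: 'n covec)"
    unfolding test_form_def using g by (auto simp: scalar_form_def intro!: exI[of _ K])
qed

lemma represents_trace_iff:
  "represents_trace \<Omega> \<phi> \<mu> \<longleftrightarrow> sets \<mu> = sets borel \<and> emeasure \<mu> (- \<Omega>) = 0 \<and>
     (\<forall>K. compact K \<longrightarrow> K \<subseteq> \<Omega> \<longrightarrow> emeasure \<mu> K < \<infinity>) \<and>
     (\<forall>g\<in>test_functions \<Omega>. trace_functional g = (\<integral>z. g z \<partial>\<mu>))"
proof -
  have "ddc_current \<Omega> \<phi> (CARD('n) - 1) (\<lambda>z. scalar_form (of_real (g z))) = of_real (trace_functional g)"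
    if "g \<in> test_functions \<Omega>" for g
    using that unfolding trace_functional_def LINT_f[symmetric]
    by (intro ddc_current_trace) (simp add: test_functions_def)
  then show ?thesis
    unfolding represents_trace_def test_form_scalar_iff by (auto simp: of_real_eq_iff)
qed

text \<open>\<open>trace_measure\<close> is a choice, so its defining properties become available
  once some representing measure exists; the Riesz measure of \<open>trace_functional\<close> is
  one.\<close>

lemma represents_trace_measure: "represents_trace \<Omega> \<phi> (trace_measure \<Omega> \<phi>)"
proof -
  interpret tr: positive_functional \<Omega> trace_functional by (rule positive_trace)
  have "emeasure tr.\<mu> (- \<Omega>) = 0"
    using open_\<Omega> by (simp add: tr.emeasure_\<mu> tr.outm_empty)
  then have "represents_trace \<Omega> \<phi> tr.\<mu>"
    unfolding represents_trace_iff
    using tr.sets_\<mu> tr.emeasure_compact tr.integral_eq_L by (intro conjI ballI allI impI) auto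
  then show ?thesis unfolding trace_measure_def by (rule someI)
qed

text \<open>A cutoff g that is 1 on the ball of radius r and 0 outside radius 2 r has Laplacian of
  order r^-2. The mass of the small ball is at most the integral of g, which is the pairing of f
  with this Laplacian.\<close>

lemma trace_ball_estimate:
  fixes x :: "complex ^ 'n"
  obtains C where "0 < C" "\<And>r. 0 < r \<Longrightarrow> cball x (2 * r) \<subseteq> \<Omega> \<Longrightarrow>
    measure (trace_measure \<Omega> \<phi>) (ball x r) \<le> C / r\<^sup>2 * (LINT z|lborel. indicator (cball x (2 * r)) z * \<bar>f z\<bar>)"
proof -
  define \<mu> where "\<mu> = trace_measure \<Omega> \<phi>"
  have \<mu>: "sets \<mu> = sets borel" "\<And>K. compact K \<Longrightarrow> K \<subseteq> \<Omega> \<Longrightarrow> emeasure \<mu> K < \<infinity>"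
    "\<And>g. g \<in> test_functions \<Omega> \<Longrightarrow> trace_functional g = (\<integral>z. g z \<partial>\<mu>)"
    using represents_trace_measure unfolding represents_trace_iff \<mu>_def by blast+
  obtain B where B: "0 < B" "\<And>s. \<bar>rderiv step s\<bar> \<le> B" "\<And>s. \<bar>rderiv (rderiv step) s\<bar> \<le> B"
    "\<And>s. s < 0 \<Longrightarrow> rderiv step s = 0" "\<And>s. s < 0 \<Longrightarrow> rderiv (rderiv step) s = 0"
    using rderiv_step_bounded by metis
  define N where "N = real (2 * CARD('n))"
  \<comment> \<open>On the ball of radius 2 r the two terms of the radial Laplacian are at most 4 B
    / r^2 and N B / r^2; the summand 1 makes C strictly positive.\<close>
  define C where "C = trace_const TYPE('n) * (4 * B + N * B) + 1"
  have N: "0 \<le> N" by (simp add: N_def)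
  show ?thesis
  proof (rule that[of C])
    have tc: "0 < trace_const TYPE('n)" by (rule trace_const_pos)
    have tB: "0 \<le> trace_const TYPE('n) * (4 * B + N * B)" using tc B N by simp
    then show "0 < C" by (simp add: C_def)
    fix r :: real assume r: "0 < r" and sub: "cball x (2 * r) \<subseteq> \<Omega>"
    \<comment> \<open>Then 2 - k t is at least 1 for t <= 2 r^2 and at most 0 for t >= 4 r^2, with t
      the squared distance.\<close>
    define k where "k = 1 / (2 * r\<^sup>2)"
    have k: "0 < k" using r by (simp add: k_def)
    define h where "h t = step (2 - k * t)" for t
    define h1 where "h1 t = - k * rderiv step (2 - k * t)" for t
    define h2 where "h2 t = k\<^sup>2 * rderiv (rderiv step) (2 - k * t)" for t
    have lin: "((\<lambda>t. 2 - k * t) has_real_derivative - k) (at t)" for t by (auto intro!: derivative_eq_intros)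
    have d1: "(h has_real_derivative h1 t) (at t)" for t
      unfolding h_def[abs_def] h1_def using DERIV_chain2[OF smooth_has_rderiv[OF smooth_step] lin, of t] by (simp add: mult.commute)
    have d2: "(h1 has_real_derivative h2 t) (at t)" for t
      unfolding h1_def[abs_def] h2_def
      using DERIV_cmult[OF DERIV_chain2[OF smooth_has_rderiv[OF smooth_rderiv[OF smooth_step]] lin], of "- k" t]
      by (simp add: power2_eq_square mult_ac)
    define g where "g z = h ((norm (z - x))\<^sup>2)" for z
    have sg: "smooth g"
      unfolding g_def[abs_def] h_def
      by (intro smooth_compose_real[OF smooth_step] smooth_diff smooth_mult smooth_const smooth_norm_square)
    have T4: "4 * r\<^sup>2 < (norm (z - x))\<^sup>2" if "z \<notin> cball x (2 * r)" for z
    proof -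
      have "(2 * r)\<^sup>2 < (norm (z - x))\<^sup>2" using that r by (intro power_strict_mono) (auto simp: dist_norm norm_minus_commute)
      then show ?thesis by (simp add: power_mult_distrib)
    qed
    have arg: "2 - k * (norm (z - x))\<^sup>2 < 0" if "z \<notin> cball x (2 * r)" for z
      using T4[OF that] r by (simp add: k_def field_simps)
    have gT: "g \<in> test_functions \<Omega>"
      unfolding test_functions_def using sg sub arg
      by (auto intro!: exI[of _ "cball x (2 * r)"] step_simps(1) less_imp_le simp: g_def h_def)
    have Lap_g: "\<bar>Lap g z\<bar> \<le> (4 * B + N * B) / r\<^sup>2 * indicator (cball x (2 * r)) z" for z
    proof -
      define t where "t = (norm (z - x))\<^sup>2"
      have L: "Lap g z = 4 * t * h2 t + 2 * N * h1 t"
        unfolding g_def[abs_def] t_def N_def by (rule Lap_radial[OF d1 d2])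
      show ?thesis
      proof (cases "z \<in> cball x (2 * r)")
        case False
        then show ?thesis unfolding L h1_def h2_def t_def using B(4,5)[OF arg[OF False]] by simp
      next
        case True
        have t: "0 \<le> t" "t \<le> 4 * r\<^sup>2"
        proof -
          have "(norm (z - x))\<^sup>2 \<le> (2 * r)\<^sup>2" using True by (intro power_mono) (auto simp: dist_norm norm_minus_commute)
          then show "t \<le> 4 * r\<^sup>2" by (simp add: t_def power_mult_distrib)
        qed (simp add: t_def)
        have "\<bar>4 * t * h2 t\<bar> \<le> (4 * (4 * r\<^sup>2)) * (k\<^sup>2 * B)"
          unfolding h2_def abs_mult using t B by (intro mult_mono) auto
        also have "\<dots> = 4 * B / r\<^sup>2" using r by (simp add: k_def power2_eq_square field_simps)
        finally have 1: "\<bar>4 * t * h2 t\<bar> \<le> 4 * B / r\<^sup>2" .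
        have "\<bar>2 * N * h1 t\<bar> \<le> (2 * N) * (k * B)"
          unfolding h1_def abs_mult using k N B by (intro mult_mono) auto
        also have "\<dots> = N * B / r\<^sup>2" using r by (simp add: k_def field_simps)
        finally have 2: "\<bar>2 * N * h1 t\<bar> \<le> N * B / r\<^sup>2" .
        show ?thesis unfolding L using True 1 2 by (simp add: add_divide_distrib)
      qed
    qed
    define I where "I = (LINT z|lborel. indicator (cball x (2 * r)) z * \<bar>f z\<bar>)"
    have iI: "integrable lborel (\<lambda>z. indicator (cball x (2 * r)) z * \<bar>f z\<bar>)"
      using integrable_f[OF compact_cball sub] integrable_abs[OF integrable_f[OF compact_cball sub]] by (simp add: abs_mult)
    have I0: "0 \<le> I" by (simp add: I_def)
    have "g z = 1" if "z \<in> ball x r" for z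
    proof -
      have "(norm (z - x))\<^sup>2 \<le> r\<^sup>2" using that by (intro power_mono) (auto simp: dist_norm norm_minus_commute)
      then have "(norm (z - x))\<^sup>2 \<le> 2 * r\<^sup>2" using zero_le_power2[of r] by linarith
      then have "k * (norm (z - x))\<^sup>2 \<le> 1" using r by (simp add: k_def field_simps)
      then show ?thesis unfolding g_def h_def by (intro step_simps(2)) simp
    qed
    then have ig: "indicator (ball x r) z \<le> g z" for z
      by (cases "z \<in> ball x r") (auto simp: g_def h_def step_simps)
    have bsub: "ball x r \<subseteq> cball x (2 * r)" using r by auto
    have finb: "emeasure \<mu> (ball x r) < \<infinity>"
      by (rule le_less_trans[OF emeasure_mono[OF bsub] \<mu>(2)[OF compact_cball sub]]) (simp add: \<mu>(1))
    have igT: "integrable \<mu> g"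
    proof (rule Bochner_Integration.integrable_bound[where f = "indicator (cball x (2 * r)) :: _ \<Rightarrow> real"])
      show "integrable \<mu> (indicator (cball x (2 * r)) :: _ \<Rightarrow> real)"
        using \<mu>(2)[OF compact_cball sub] by (intro integrable_real_indicator) (simp_all add: \<mu>(1))
      show "g \<in> borel_measurable \<mu>"
        using borel_measurable_continuous_onI[OF smooth_continuous_on[OF sg]] by (simp add: measurable_cong_sets[OF \<mu>(1) refl])
      show "AE z in \<mu>. norm (g z) \<le> norm (indicator (cball x (2 * r)) z :: real)"
      proof (rule AE_I2)
        fix z show "norm (g z) \<le> norm (indicator (cball x (2 * r)) z :: real)"
        proof (cases "z \<in> cball x (2 * r)")
          case True
          then show ?thesis by (simp add: g_def h_def step_simps)
        next
          case False
          then have "g z = 0" unfolding g_def h_def using arg[OF False] by (intro step_simps(1)) simp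
          then show ?thesis by simp
        qed
      qed
    qed
    have "measure \<mu> (ball x r) = (\<integral>z. indicator (ball x r) z \<partial>\<mu>)" by (simp add: \<mu>(1))
    also have "\<dots> \<le> (\<integral>z. g z \<partial>\<mu>)"
      by (rule integral_mono[OF _ igT ig]) (use finb in \<open>auto intro!: integrable_real_indicator simp: \<mu>(1)\<close>)
    also have "\<dots> = trace_const TYPE('n) * (LINT z|lborel. f z * Lap g z)"
      using \<mu>(3)[OF gT] by (simp add: trace_functional_def)
    also have "(LINT z|lborel. f z * Lap g z) \<le> (LINT z|lborel. (4 * B + N * B) / r\<^sup>2 * (indicator (cball x (2 * r)) z * \<bar>f z\<bar>))"
    proof (rule integral_mono)
      show "integrable lborel (\<lambda>z. f z * Lap g z)" by (rule integrable_f_Lap[OF gT])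
      show "integrable lborel (\<lambda>z. (4 * B + N * B) / r\<^sup>2 * (indicator (cball x (2 * r)) z * \<bar>f z\<bar>))" using iI by simp
      fix z
      have "f z * Lap g z \<le> \<bar>f z\<bar> * \<bar>Lap g z\<bar>" by (metis abs_ge_self abs_mult)
      also have "\<dots> \<le> \<bar>f z\<bar> * ((4 * B + N * B) / r\<^sup>2 * indicator (cball x (2 * r)) z)" by (rule mult_left_mono[OF Lap_g]) simp
      finally show "f z * Lap g z \<le> (4 * B + N * B) / r\<^sup>2 * (indicator (cball x (2 * r)) z * \<bar>f z\<bar>)" by (simp add: mult_ac)
    qed
    also have "(LINT z|lborel. (4 * B + N * B) / r\<^sup>2 * (indicator (cball x (2 * r)) z * \<bar>f z\<bar>)) = (4 * B + N * B) / r\<^sup>2 * I"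
      unfolding I_def by (rule integral_mult_right_zero)
    finally have "measure \<mu> (ball x r) \<le> trace_const TYPE('n) * ((4 * B + N * B) / r\<^sup>2 * I)" using tc by simp
    also have "\<dots> = trace_const TYPE('n) * (4 * B + N * B) * (I / r\<^sup>2)" by simp
    also have "\<dots> \<le> C * (I / r\<^sup>2)" unfolding C_def using I0 by (intro mult_right_mono) auto
    finally show "measure (trace_measure \<Omega> \<phi>) (ball x r) \<le> C / r\<^sup>2 * (LINT z|lborel. indicator (cball x (2 * r)) z * \<bar>f z\<bar>)"
      by (simp add: \<mu>_def I_def)
  qed
qed

text \<open>With \<mu> = r^-\<beta>, the normalised mass of the ball is bounded by multiples of
  r^(q-\<beta>) and r^(\<beta>(c-1)-2p). Both exponents can be made positive if and only if 2p/(c -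
  1) < q. As 2p + q = 2n and q m = 2 (n - m), this says c > n m / (n - m).\<close>

lemma lelong_zero:
  fixes x :: "complex ^ 'n"
  assumes c: "real (CARD('n) * m) / real (CARD('n) - m) < c"
    and U: "open U" "x \<in> U" "U \<subseteq> \<Omega>" and int: "set_integrable lborel U (\<lambda>z. \<bar>real_of_ereal (\<phi> z)\<bar> powr c)"
  shows "lelong_number m \<Omega> \<phi> x = 0"
proof -
  define n where "n = real CARD('n)"
  define q where "q = 2 * n - 2 * p"
  have q: "0 < q" using p_bounds by (simp add: q_def n_def)
  have mn: "0 < n - real m" "1 \<le> real m" "0 < n" using m by (auto simp: n_def)
  have nm: "real (CARD('n) - m) = n - real m" using m by (simp add: n_def of_nat_diff)
  have qm: "q * m = 2 * (n - real m)" using mn by (simp add: q_def p_def n_def field_simps)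
  have cq: "2 * n < q * c"
  proof -
    have "n * m < c * (n - real m)" using c mn unfolding nm by (simp add: n_def divide_less_eq)
    then have "2 * n * m < c * (q * m)" unfolding qm by (simp add: algebra_simps)
    then have "(2 * n) * m < (q * c) * m" by (simp add: mult_ac)
    then show ?thesis using mn by simp
  qed
  have c1: "1 < c"
  proof -
    have "q \<le> 2 * n" using p_bounds by (simp add: q_def)
    then have "q * 1 < q * c" using cq by simp
    then show ?thesis using q by (simp only: mult_less_cancel_left_pos)
  qed
  \<comment> \<open>The normalising exponent of the Lelong number is 2p - 2.\<close>
  have e: "2 * real CARD('n) / real m * (real m - 1) = 2 * p - 2"
    using mn by (simp add: p_def n_def[symmetric] field_simps)
  have "2 * p < q * (c - 1)"
    using cq unfolding right_diff_distrib by (simp add: q_def)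
  then have "2 * p / (c - 1) < q" using c1 by (simp add: divide_less_eq)
  then obtain \<beta> where \<beta>: "2 * p / (c - 1) < \<beta>" "\<beta> < q" using dense by blast
  have \<beta>c: "2 * p < \<beta> * (c - 1)" using \<beta>(1) c1 by (simp add: divide_less_eq)
  define A where "A = (LINT z|lborel. indicator U z * \<bar>f z\<bar> powr c)"
  have fU: "indicator U z *\<^sub>R \<bar>real_of_ereal (\<phi> z)\<bar> powr c = indicator U z * \<bar>f z\<bar> powr c" for z
    using U(3) by (cases "z \<in> U") (auto simp: f_def \<psi>_def)
  have iA: "integrable lborel (\<lambda>z. indicator U z * \<bar>f z\<bar> powr c)"
    using int unfolding set_integrable_def fU .
  obtain C where C: "0 < C" "\<And>r. 0 < r \<Longrightarrow> cball x (2 * r) \<subseteq> \<Omega> \<Longrightarrow>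
    measure (trace_measure \<Omega> \<phi>) (ball x r) \<le> C / r\<^sup>2 * (LINT z|lborel. indicator (cball x (2 * r)) z * \<bar>f z\<bar>)"
    using trace_ball_estimate by blast
  obtain \<epsilon> where \<epsilon>: "0 < \<epsilon>" "cball x \<epsilon> \<subseteq> U" using U open_contains_cball by blast
  define W where "W = measure lborel (cball (0 :: complex ^ 'n) 2)"
  have W: "0 \<le> W" by (simp add: W_def)
  have est: "measure (trace_measure \<Omega> \<phi>) (ball x r) / r powr (2 * p - 2) \<le>
      C * W * r powr (q - \<beta>) + C * A * r powr (\<beta> * (c - 1) - 2 * p)" if r: "0 < r" "r < \<epsilon> / 2" for r
  proof -
    define \<mu> where "\<mu> = r powr (- \<beta>)"
    have \<mu>: "0 < \<mu>" using r by (simp add: \<mu>_def)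
    have sU: "cball x (2 * r) \<subseteq> U" using \<epsilon>(2) r by (intro order.trans[OF _ \<epsilon>(2)] subset_cball) simp
    have s\<Omega>: "cball x (2 * r) \<subseteq> \<Omega>" using sU U by blast
    \<comment> \<open>Where |f| exceeds \<mu>, it equals |f|^(1-c) |f|^c, and the exponent 1 - c is
      negative.\<close>
    have young: "\<bar>f z\<bar> \<le> \<mu> + \<mu> powr (1 - c) * \<bar>f z\<bar> powr c" for z
    proof (cases "\<bar>f z\<bar> \<le> \<mu>")
      case True
      then show ?thesis by (simp add: add_increasing2)
    next
      case False
      then have "\<bar>f z\<bar> powr (1 - c) \<le> \<mu> powr (1 - c)" using \<mu> c1 by (intro powr_mono2') auto
      then have "\<bar>f z\<bar> powr (1 - c) * \<bar>f z\<bar> powr c \<le> \<mu> powr (1 - c) * \<bar>f z\<bar> powr c" by (rule mult_right_mono) simp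
      moreover have "\<bar>f z\<bar> powr (1 - c) * \<bar>f z\<bar> powr c = \<bar>f z\<bar>" using False \<mu> by (simp add: powr_add[symmetric])
      ultimately show ?thesis using \<mu> by simp
    qed
    have iB: "integrable lborel (indicator (cball x (2 * r)) :: complex ^ 'n \<Rightarrow> real)"
      using emeasure_compact_finite[OF compact_cball, of x "2 * r"] by (intro integrable_real_indicator) auto
    have "(LINT z|lborel. indicator (cball x (2 * r)) z * \<bar>f z\<bar>) \<le>
        (LINT z|lborel. \<mu> * indicator (cball x (2 * r)) z + \<mu> powr (1 - c) * (indicator U z * \<bar>f z\<bar> powr c))"
    proof (rule integral_mono)
      show "integrable lborel (\<lambda>z. indicator (cball x (2 * r)) z * \<bar>f z\<bar>)"
        using integrable_abs[OF integrable_f[OF compact_cball s\<Omega>]] by (simp add: abs_mult)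
      show "integrable lborel (\<lambda>z. \<mu> * indicator (cball x (2 * r)) z + \<mu> powr (1 - c) * (indicator U z * \<bar>f z\<bar> powr c))"
        using iB iA by simp
      fix z
      show "indicator (cball x (2 * r)) z * \<bar>f z\<bar> \<le> \<mu> * indicator (cball x (2 * r)) z + \<mu> powr (1 - c) * (indicator U z * \<bar>f z\<bar> powr c)"
        using young[of z] subsetD[OF sU, of z] by (cases "z \<in> cball x (2 * r)") auto
    qed
    also have "\<dots> = \<mu> * measure lborel (cball x (2 * r)) + \<mu> powr (1 - c) * A"
      using iB iA by (simp add: A_def)
    also have "measure lborel (cball x (2 * r)) = W * r powr (2 * n)"
      using r content_cball[of "2 * r" x] content_cball[of 2 "0 :: complex ^ 'n"] powr_realpow[OF r(1), of "2 * CARD('n)"]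
      by (simp add: W_def n_def DIM_cart power_mult_distrib mult.commute[of 2 "CARD('n)"] mult.commute[of 2 "real CARD('n)"])
    finally have I: "(LINT z|lborel. indicator (cball x (2 * r)) z * \<bar>f z\<bar>) \<le> \<mu> * (W * r powr (2 * n)) + \<mu> powr (1 - c) * A" .
    have "measure (trace_measure \<Omega> \<phi>) (ball x r) \<le> C / r\<^sup>2 * (\<mu> * (W * r powr (2 * n)) + \<mu> powr (1 - c) * A)"
      by (rule order.trans[OF C(2)[OF r(1) s\<Omega>]]) (use C(1) r in \<open>intro mult_left_mono I; simp\<close>)
    then have "measure (trace_measure \<Omega> \<phi>) (ball x r) / r powr (2 * p - 2) \<le>
        C / r\<^sup>2 * (\<mu> * (W * r powr (2 * n)) + \<mu> powr (1 - c) * A) / r powr (2 * p - 2)"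
      by (rule divide_right_mono) simp
    also have "\<dots> = C * W * (r powr (- 2) * r powr (- \<beta>) * r powr (2 * n) * r powr (- (2 * p - 2))) +
        C * A * (r powr (- 2) * r powr (- \<beta> * (1 - c)) * r powr (- (2 * p - 2)))"
    proof -
      have d: "1 / r\<^sup>2 = r powr (- 2)" "1 / r powr (2 * p - 2) = r powr (- (2 * p - 2))"
        using r by (simp_all only: powr_minus_divide powr_numeral of_nat_numeral)
      have d': "\<mu> powr (1 - c) = r powr (- \<beta> * (1 - c))" unfolding \<mu>_def by (rule powr_powr)
      have "C / r\<^sup>2 * (\<mu> * (W * r powr (2 * n)) + \<mu> powr (1 - c) * A) / r powr (2 * p - 2) =
          C * (1 / r\<^sup>2) * (\<mu> * (W * r powr (2 * n)) + \<mu> powr (1 - c) * A) * (1 / r powr (2 * p - 2))" by simp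
      then show ?thesis unfolding d d' by (simp only: \<mu>_def distrib_left distrib_right mult_ac)
    qed
    also have "r powr (- 2) * r powr (- \<beta>) * r powr (2 * n) * r powr (- (2 * p - 2)) = r powr (q - \<beta>)"
      by (simp add: powr_add[symmetric] q_def)
    also have "r powr (- 2) * r powr (- \<beta> * (1 - c)) * r powr (- (2 * p - 2)) = r powr (\<beta> * (c - 1) - 2 * p)"
      by (simp add: powr_add[symmetric] algebra_simps)
    finally show ?thesis .
  qed
  have z: "((\<lambda>r. r powr s) \<longlongrightarrow> 0) (at_right 0)" if "0 < s" for s :: real
  proof (rule tendsto_zero_powrI[where b = s])
    show "((\<lambda>r. r) \<longlongrightarrow> 0) (at_right 0)" by (rule tendsto_ident_at)
    show "\<forall>\<^sub>F r in at_right 0. 0 \<le> (r :: real)" unfolding eventually_at_right_field by (intro exI[of _ 1]) auto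
  qed (use that in auto)
  have "((\<lambda>r. measure (trace_measure \<Omega> \<phi>) (ball x r) / r powr (2 * p - 2)) \<longlongrightarrow> 0) (at_right 0)"
  proof (rule tendsto_sandwich[where f = "\<lambda>_. 0"])
    show "((\<lambda>r. C * W * r powr (q - \<beta>) + C * A * r powr (\<beta> * (c - 1) - 2 * p)) \<longlongrightarrow> 0) (at_right 0)"
    proof -
      have "((\<lambda>r. C * W * r powr (q - \<beta>) + C * A * r powr (\<beta> * (c - 1) - 2 * p)) \<longlongrightarrow> C * W * 0 + C * A * 0) (at_right 0)"
        by (intro tendsto_add tendsto_mult tendsto_const z) (use \<beta> \<beta>c in auto)
      then show ?thesis by simp
    qed
    show "\<forall>\<^sub>F r in at_right 0. measure (trace_measure \<Omega> \<phi>) (ball x r) / r powr (2 * p - 2) \<le>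
        C * W * r powr (q - \<beta>) + C * A * r powr (\<beta> * (c - 1) - 2 * p)"
      unfolding eventually_at_right_field using est \<epsilon>(1) by (intro exI[of _ "\<epsilon> / 2"]) auto
  qed simp_all
  then show ?thesis
    unfolding lelong_number_def e by (intro tendsto_Lim) (simp_all add: trivial_limit_at_right_real)
qed

lemma upper_bound_exponent:
  assumes pos: "0 < lelong_number m \<Omega> \<phi> x"
  shows "integrability_exponent \<Omega> \<phi> x \<le> ereal (real (CARD('n) * m) / real (CARD('n) - m))"
  unfolding integrability_exponent_def
proof (rule Sup_least)
  fix e assume "e \<in> {ereal c | c. c > 0 \<and> (\<exists>U. open U \<and> x \<in> U \<and> U \<subseteq> \<Omega> \<and>
        (AE z\<in>U in lborel. \<bar>\<phi> z\<bar> \<noteq> \<infinity>) \<and> set_integrable lborel U (\<lambda>z. \<bar>real_of_ereal (\<phi> z)\<bar> powr c))}"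
  then obtain c U where e: "e = ereal c" and U: "open U" "x \<in> U" "U \<subseteq> \<Omega>"
    "set_integrable lborel U (\<lambda>z. \<bar>real_of_ereal (\<phi> z)\<bar> powr c)" by blast
  have "\<not> real (CARD('n) * m) / real (CARD('n) - m) < c"
    using lelong_zero[OF _ U] pos by auto
  then show "e \<le> ereal (real (CARD('n) * m) / real (CARD('n) - m))" by (simp add: e)
qed

end

theorem theorem5:
  fixes m :: nat
    and \<Omega> :: "(complex ^ 'n) set"
    and \<phi> :: "complex ^ 'n \<Rightarrow> ereal"
    and x :: "complex ^ 'n"
  assumes "1 \<le> m" and "m < CARD('n)"
    and "open \<Omega>"
    and "m_subharmonic m \<Omega> \<phi>"
    and "x \<in> \<Omega>"
  shows "integrability_exponent \<Omega> \<phi> x \<ge> ereal (real CARD('n) / real (CARD('n) - m)) \<and>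
    (lelong_number m \<Omega> \<phi> x > 0 \<longrightarrow>
       integrability_exponent \<Omega> \<phi> x \<le> ereal (real (CARD('n) * m) / real (CARD('n) - m)))"
proof -
  interpret msh \<Omega> \<phi> m
    using assms(1-4) by unfold_locales (auto simp: m_subharmonic_def)
  show ?thesis using lower_bound_exponent[OF assms(5)] upper_bound_exponent[of x] by blast
qed

end
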